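(* For every $z\in\mathbb{C}$ there exists a probability measure $\nu_z$ on $\mathbb{R}_+=[0,\infty)$, depending only on $z$ and $K$, such that with probability one $\nu_{M-zI}$ converges weakly to $\nu_z$ as $n\to\infty$. Moreover, $\nu_z$ is characterized as follows: its symmetrization $\check\nu_z$ is the unique symmetric probability measure on $\mathbb{R}$ whose Cauchy–Stieltjes transform satisfies, for every $\eta\in\mathbb{C}_+$, $$S_{\check\nu_z}(\eta)=\mathbb{E}\left(\frac{S_{\check\nu_z}(\eta)+\eta}{|G-z|^2-(\eta+S_{\check\nu_z}(\eta))^2}\right),$$ where $G$ is a Gaussian random variable on $\mathbb{C}\cong\mathbb{R}^2$ with law $\mathcal{N}(0,K)$.
   Context: Setting. For each integer $n\ge 1$, $\mathbf{x}=\mathbf{x}(n)$ is a complex random variable whose law $\mathcal{L}(n)$ may depend on $n$, with mean $m=m(n)=\mathbb{E}\mathbf{x}$ and finite positive variance $\sigma^2=\sigma^2(n)=\mathbb{E}|\mathbf{x}-m|^2$. $X=(X_{ij})_{1\le i,j\le n}$ is the random matrix with entries i.i.d. copies of $\mathbf{x}(n)$; $D$ is the diagonal matrix with $D_{ii}=\sum_{k=1}^n X_{ik}$; $L=X-D$; and $M=M(n)=\dfrac{L+nmI}{\sigma\sqrt n}$. All random variables (for all $n$) are defined on a common probability space. Standing assumptions. (a) $n\sigma^2(n)\to\infty$ and $\sup_n\sigma^2(n)<\infty$. (b) For all $\varepsilon>0$, $\lim_{n\to\infty}\sigma(n)^{-2}\,\mathbb{E}\big[|\mathbf{x}-m(n)|^2\mathbf{1}_{\{|\mathbf{x}-m(n)|^2\ge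 \varepsilon n\sigma^2(n)\}}\big]=0$. (c) The $2\times2$ covariance matrix of $(\Re\mathbf{x},\Im\mathbf{x})$ divided by $\sigma(n)^2$ converges as $n\to\infty$ to a $2\times 2$ matrix $K$ (which then has unit trace). Notation. For an $n\times n$ matrix $A$ with singular values $s_1(A)\ge\dots\ge s_n(A)$, $\nu_A=\frac1n\sum_{k=1}^n\delta_{s_k(A)}$. $\mathbb{C}_+=\{z:\Im z>0\}$. For a probability measure $\nu$ on $\mathbb{R}$, $S_\nu(\eta)=\int\frac{1}{t-\eta}\,d\nu(t)$ for $\eta\in\mathbb{C}_+$, and $\check\nu(A)=\frac{\nu(A)+\nu(-A)}{2}$ for Borel $A\subset\mathbb{R}$. Weak convergence is against bounded continuous functions. *)

theory Defs
  imports
    "HOL-Probability.Probability"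
    "Jordan_Normal_Form.Schur_Decomposition"
    "Jordan_Normal_Form.Char_Poly"
begin

no_notation vec_index (infixl \<open>$\<close> 100)
no_notation scalar_prod (infix \<open>\<bullet>\<close> 70)

section \<open>Laws on the complex plane\<close>

definition law_mean :: "complex measure \<Rightarrow> complex" where
  "law_mean \<mu> = (\<integral>x. x \<partial>\<mu>)"

definition law_var :: "complex measure \<Rightarrow> real" where
  "law_var \<mu> = (\<integral>x. (cmod (x - law_mean \<mu>))\<^sup>2 \<partial>\<mu>)"

definition vec_of_complex :: "complex \<Rightarrow> real^2" where
  "vec_of_complex w = vector [Re w, Im w]"

definition complex_of_vec :: "real^2 \<Rightarrow> complex" where
  "complex_of_vec v = Complex (v $ 1) (v $ 2)"

definition law_cov :: "complex measure \<Rightarrow> real^2^2" where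
  "law_cov \<mu> = (\<chi> i j. \<integral>x. vec_of_complex (x - law_mean \<mu>) $ i *
                            vec_of_complex (x - law_mean \<mu>) $ j \<partial>\<mu>)"

text \<open>
  The centred Gaussian law with (possibly singular) covariance matrix \<open>K\<close> is the law of the image
  of a standard Gaussian vector under a matrix \<open>A\<close> with \<open>A A\<^sup>T = K\<close>. The choice of \<open>A\<close> is
  immaterial: see \<open>char_gaussian_law\<close> below.
\<close>
definition gaussian_law :: "real^2^2 \<Rightarrow> complex measure" where
  "gaussian_law K = (let A = (SOME A :: real^2^2. A ** transpose A = K) in
     distr (std_normal_distribution \<Otimes>\<^sub>M std_normal_distribution) borel
       (\<lambda>(u, v). complex_of_vec (A *v vector [u, v])))"

lemma psd_factor:
  fixes K :: "real^2^2"
  assumes sym: "transpose K = K" and psd: "\<And>t. 0 \<le> t \<bullet> (K *v t)"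
  shows "\<exists>A :: real^2^2. A ** transpose A = K"
proof -
  define a b c where abc: "a = K $ 1 $ 1" "b = K $ 1 $ 2" "c = K $ 2 $ 2"
  have k21: "K $ 2 $ 1 = b"
    using arg_cong[OF sym, of "\<lambda>B. B $ 1 $ 2"] by (simp add: abc transpose_def)
  have q: "0 \<le> a * x\<^sup>2 + 2 * b * x * y + c * y\<^sup>2" for x y
    using psd[of "vector [x, y]"] k21
    by (simp add: abc inner_vec_def matrix_vector_mult_def sum_2 power2_eq_square algebra_simps)
  have a0: "a \<ge> 0" and c0: "c \<ge> 0" using q[of 1 0] q[of 0 1] by auto
  define d where "d = (if a = 0 then c else c - b\<^sup>2 / a)"
  have b0: "b = 0" if "a = 0"
  proof (rule ccontr)
    assume "b \<noteq> 0"
    then have "2 * b * (- (c + 1) / (2 * b)) = - (c + 1)" by simp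
    then show False using q[of "- (c + 1) / (2 * b)" 1] that by simp
  qed
  have d0: "d \<ge> 0"
  proof (cases "a = 0")
    case False
    have "0 \<le> a * (- b / a)\<^sup>2 + 2 * b * (- b / a) * 1 + c * 1\<^sup>2" by (rule q)
    also have "\<dots> = c - b\<^sup>2 / a" using False by (simp add: field_simps power2_eq_square)
    finally show ?thesis by (simp add: d_def False)
  qed (simp add: d_def c0)
  define A :: "real^2^2" where
    "A = vector [vector [sqrt a, 0], vector [b / sqrt a, sqrt d]]"
  have e11: "sqrt a * sqrt a = a" and e22: "sqrt d * sqrt d = d" using a0 d0 by simp_all
  have e12: "sqrt a * (b / sqrt a) = b" using b0 by (cases "a = 0") auto
  have e3: "(b / sqrt a) * (b / sqrt a) + d = c"
    using a0 b0 by (cases "a = 0") (auto simp: d_def power2_eq_square)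
  have ent: "(A ** transpose A) $ i $ j = A $ i $ 1 * A $ j $ 1 + A $ i $ 2 * A $ j $ 2" for i j
    by (simp add: matrix_matrix_mult_def transpose_def sum_2)
  have A_entries: "A $ 1 $ 1 = sqrt a" "A $ 1 $ 2 = 0" "A $ 2 $ 1 = b / sqrt a" "A $ 2 $ 2 = sqrt d"
    by (simp_all add: A_def)
  have "(A ** transpose A) $ 1 $ 1 = K $ 1 $ 1"
    unfolding ent A_entries abc[symmetric] e11 by simp
  moreover have "(A ** transpose A) $ 1 $ 2 = K $ 1 $ 2"
    unfolding ent A_entries abc[symmetric] e12 by simp
  moreover have "(A ** transpose A) $ 2 $ 1 = K $ 2 $ 1"
    unfolding ent A_entries k21 mult.commute[of "b / sqrt a"] e12 by simp
  moreover have "(A ** transpose A) $ 2 $ 2 = K $ 2 $ 2"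
    unfolding ent A_entries abc[symmetric] e22 by (rule e3)
  ultimately have "A ** transpose A = K"
    by (simp only: Finite_Cartesian_Product.vec_eq_iff forall_2)
  then show ?thesis by blast
qed

lemma char_gaussian_law:
  fixes K :: "real^2^2"
  assumes sym: "transpose K = K" and psd: "\<And>t. 0 \<le> t \<bullet> (K *v t)"
  shows "(\<integral>w. iexp (t \<bullet> vec_of_complex w) \<partial>gaussian_law K) = exp (- (t \<bullet> (K *v t)) / 2)"
proof -
  define A :: "real^2^2" where "A = (SOME A. A ** transpose A = K)"
  have A: "A ** transpose A = K"
    unfolding A_def by (rule someI_ex) (rule psd_factor[OF assms])
  define s where "s = transpose A *v t"
  have eq: "t \<bullet> vec_of_complex (complex_of_vec (A *v vector [u, v])) = s $ 1 * u + s $ 2 * v" for u v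
    by (simp add: s_def inner_vec_def vec_of_complex_def complex_of_vec_def matrix_vector_mult_def
                  transpose_def sum_2 algebra_simps)
  have ss: "t \<bullet> (K *v t) = (s $ 1)\<^sup>2 + (s $ 2)\<^sup>2"
  proof -
    have "t \<bullet> (K *v t) = s \<bullet> s"
      unfolding s_def A[symmetric]
      by (simp add: matrix_vector_mul_assoc[symmetric] dot_lmul_matrix[symmetric])
    then show ?thesis by (simp add: inner_vec_def sum_2 power2_eq_square)
  qed
  interpret N: prob_space "std_normal_distribution"
    using prob_space_normal_density[of 1 0] by simp
  interpret NN: pair_prob_space "std_normal_distribution" "std_normal_distribution" ..
  have cv: "(\<lambda>x. complex_of_vec (A *v vector [fst x, snd x])) = 
       (\<lambda>x. Complex (A $ 1 $ 1 * fst x + A $ 1 $ 2 * snd x) (A $ 2 $ 1 * fst x + A $ 2 $ 2 * snd x))"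
    by (simp add: complex_of_vec_def matrix_vector_mult_def sum_2)
  have m1: "(\<lambda>(u, v). complex_of_vec (A *v vector [u, v])) \<in>
      borel_measurable (std_normal_distribution \<Otimes>\<^sub>M std_normal_distribution)"
    unfolding case_prod_beta' cv Complex_eq by measurable
  have m2: "(\<lambda>w. iexp (t \<bullet> vec_of_complex w)) \<in> borel_measurable borel"
    by (simp add: inner_vec_def vec_of_complex_def sum_2)
  have "(\<integral>w. iexp (t \<bullet> vec_of_complex w) \<partial>gaussian_law K) =
     (\<integral>x. iexp (s $ 1 * fst x) * iexp (s $ 2 * snd x)
        \<partial>(std_normal_distribution \<Otimes>\<^sub>M std_normal_distribution))"
    unfolding gaussian_law_def A_def[symmetric] Let_def
    by (subst integral_distr[OF m1 m2])
       (simp add: case_prod_beta' eq exp_add[symmetric] ring_distribs)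
  also have "\<dots> = (\<integral>u. \<integral>v. iexp (s $ 1 * u) * iexp (s $ 2 * v) \<partial>std_normal_distribution
        \<partial>std_normal_distribution)"
    by (subst NN.integral_fst'[symmetric])
       (auto intro!: NN.P.integrable_const_bound[where B = 1] simp: norm_mult)
  also have "\<dots> = char std_normal_distribution (s $ 1) * char std_normal_distribution (s $ 2)"
    by (simp add: char_def)
  also have "\<dots> = exp (- (t \<bullet> (K *v t)) / 2)"
    by (simp add: char_std_normal_distribution ss mult_exp_exp add_divide_distrib diff_divide_distrib
             flip: of_real_mult exp_of_real)
  finally show ?thesis .
qed


section \<open>Random Markov generators\<close>

text \<open>Row and column indices run over \<open>0, \<dots>, n - 1\<close>.\<close>

definition markov_generator :: "nat \<Rightarrow> (nat \<Rightarrow> nat \<Rightarrow> complex) \<Rightarrow> complex mat" where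
  "markov_generator n x =
     mat n n (\<lambda>(i, j). x i j) - mat_diag n (\<lambda>i. \<Sum>k<n. x i k)"

definition normalized_generator ::
  "complex measure \<Rightarrow> nat \<Rightarrow> (nat \<Rightarrow> nat \<Rightarrow> complex) \<Rightarrow> complex mat" where
  "normalized_generator \<mu> n x =
     complex_of_real (1 / (sqrt (law_var \<mu>) * sqrt (real n))) \<cdot>\<^sub>m
       (markov_generator n x + (of_nat n * law_mean \<mu>) \<cdot>\<^sub>m 1\<^sub>m n)"

text \<open>
  \<open>L n\<close> is the law of the entries of the \<open>n \<times> n\<close> matrix \<open>X n\<close>. All matrices live on \<open>P\<close>, with no
  assumption on the joint law of \<open>X n\<close> and \<open>X n'\<close> for \<open>n \<noteq> n'\<close>.
\<close>
locale random_generator = prob_space P for P :: "'a measure" +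
  fixes L :: "nat \<Rightarrow> complex measure"
    and X :: "nat \<Rightarrow> nat \<Rightarrow> nat \<Rightarrow> 'a \<Rightarrow> complex"
    and K :: "real^2^2"
  assumes indep: "\<And>n. n \<ge> 1 \<Longrightarrow> indep_vars (\<lambda>_. borel) (\<lambda>(i, j). X n i j) ({..<n} \<times> {..<n})"
    and law: "\<And>n i j. i < n \<Longrightarrow> j < n \<Longrightarrow> distr P borel (X n i j) = L n"
    and mean_finite: "\<And>n. n \<ge> 1 \<Longrightarrow> integrable (L n) (\<lambda>x. x)"
    and var_finite: "\<And>n. n \<ge> 1 \<Longrightarrow> integrable (L n) (\<lambda>x. (cmod (x - law_mean (L n)))\<^sup>2)"
    and var_pos: "\<And>n. n \<ge> 1 \<Longrightarrow> law_var (L n) > 0"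
    and n_var_at_top: "filterlim (\<lambda>n. real n * law_var (L n)) at_top sequentially"
    and var_bounded: "bdd_above ((\<lambda>n. law_var (L n)) ` {1..})"
    and lindeberg: "\<And>\<epsilon>. \<epsilon> > 0 \<Longrightarrow>
      (\<lambda>n. (\<integral>x. (cmod (x - law_mean (L n)))\<^sup>2 *
               indicator {x. (cmod (x - law_mean (L n)))\<^sup>2 \<ge> \<epsilon> * real n * law_var (L n)} x \<partial>L n)
            / law_var (L n)) \<longlonglongrightarrow> 0"
    and cov_limit: "(\<lambda>n. (1 / law_var (L n)) *\<^sub>R law_cov (L n)) \<longlonglongrightarrow> K"


section \<open>Singular values\<close>

text \<open>
  The roots of the characteristic polynomial of \<open>A\<^sup>* A\<close>, listed with multiplicity, are
  nonnegative reals; \<open>singular_values A\<close> lists their square roots in decreasing order.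
\<close>
definition singular_values :: "complex mat \<Rightarrow> real list" where
  "singular_values A =
     rev (sorted_list_of_multiset
       (image_mset (\<lambda>c. sqrt (Re c)) (proots (char_poly (mat_adjoint A * A)))))"

definition singular_law :: "complex mat \<Rightarrow> real measure" where
  "singular_law A =
     distr (uniform_count_measure {..<dim_row A}) borel (\<lambda>k. singular_values A ! k)"


section \<open>Probability measures on the real line\<close>

definition converges_weakly :: "(nat \<Rightarrow> real measure) \<Rightarrow> real measure \<Rightarrow> bool" where
  "converges_weakly \<mu> \<nu> \<longleftrightarrow>
     (\<forall>f :: real \<Rightarrow> real. continuous_on UNIV f \<and> bounded (range f) \<longrightarrow>
        (\<lambda>n. \<integral>t. f t \<partial>\<mu> n) \<longlonglongrightarrow> (\<integral>t. f t \<partial>\<nu>))"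

definition borel_prob :: "real measure \<Rightarrow> bool" where
  "borel_prob \<nu> \<longleftrightarrow> prob_space \<nu> \<and> sets \<nu> = sets borel"

definition symmetric_prob :: "real measure \<Rightarrow> bool" where
  "symmetric_prob \<nu> \<longleftrightarrow>
     borel_prob \<nu> \<and> (\<forall>A\<in>sets borel. emeasure \<nu> (uminus ` A) = emeasure \<nu> A)"

definition symmetrization :: "real measure \<Rightarrow> real measure" where
  "symmetrization \<nu> =
     measure_of UNIV (sets borel) (\<lambda>A. (emeasure \<nu> A + emeasure \<nu> (uminus ` A)) / 2)"

lemma uminus_image_borel: "uminus ` A \<in> sets borel" if "A \<in> sets borel" for A :: "real set"
proof -
  have "uminus ` A = uminus -` A \<inter> space borel" by (auto simp: image_iff) (metis minus_minus)
  moreover have "(uminus :: real \<Rightarrow> real) \<in> borel_measurable borel" by simp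
  ultimately show ?thesis using measurable_sets[of uminus borel borel A] that by simp
qed

lemma emeasure_symmetrization:
  assumes "sets \<nu> = sets borel" "A \<in> sets borel"
  shows "emeasure (symmetrization \<nu>) A = (emeasure \<nu> A + emeasure \<nu> (uminus ` A)) / 2"
proof (rule emeasure_measure_of[OF symmetrization_def])
  show "countably_additive (sets (symmetrization \<nu>))
          (\<lambda>A. (emeasure \<nu> A + emeasure \<nu> (uminus ` A)) / 2)"
  proof (rule countably_additiveI)
    fix B :: "nat \<Rightarrow> real set"
    assume "range B \<subseteq> sets (symmetrization \<nu>)" and disj: "disjoint_family B"
    moreover have "sets (symmetrization \<nu>) = sets borel"
      using sets.sigma_sets_eq[of "borel :: real measure"] by (simp add: symmetrization_def)
    ultimately have B: "B i \<in> sets borel" for i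
      by auto
    have disj': "disjoint_family (\<lambda>i. uminus ` B i)"
      using disj by (fastforce simp: disjoint_family_on_def)
    have "(\<Sum>i. emeasure \<nu> (B i)) = emeasure \<nu> (\<Union>i. B i)"
      by (rule suminf_emeasure) (use B disj assms in auto)
    moreover have "(\<Sum>i. emeasure \<nu> (uminus ` B i)) = emeasure \<nu> (uminus ` (\<Union>i. B i))"
      unfolding image_UN
      by (rule suminf_emeasure) (use B uminus_image_borel disj' assms in auto)
    ultimately show "(\<Sum>i. (emeasure \<nu> (B i) + emeasure \<nu> (uminus ` B i)) / 2) =
        (emeasure \<nu> (\<Union>i. B i) + emeasure \<nu> (uminus ` (\<Union>i. B i))) / 2"
      by (simp add: divide_ennreal_def suminf_add[symmetric])
  qed
qed (use assms in \<open>auto simp: positive_def symmetrization_def\<close>)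

definition stieltjes :: "real measure \<Rightarrow> complex \<Rightarrow> complex" where
  "stieltjes \<nu> \<eta> = (\<integral>t. 1 / (complex_of_real t - \<eta>) \<partial>\<nu>)"

definition stieltjes_equation :: "real^2^2 \<Rightarrow> complex \<Rightarrow> real measure \<Rightarrow> bool" where
  "stieltjes_equation K z \<nu> \<longleftrightarrow>
     (\<forall>\<eta>. Im \<eta> > 0 \<longrightarrow>
        stieltjes \<nu> \<eta> =
          (\<integral>g. (stieltjes \<nu> \<eta> + \<eta>) /
                (complex_of_real ((cmod (g - z))\<^sup>2) - (\<eta> + stieltjes \<nu> \<eta>)\<^sup>2) \<partial>gaussian_law K))"

end

theory Submission
  imports Defs "HOL-Real_Asymp.Real_Asymp"
begin

text \<open>
  Centring the entries changes the matrix by a rank one perturbation, and the normalized trace of the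
  resolvent of the hermitization of \<open>M - z\<close> is the Cauchy--Stieltjes transform of the symmetrized law
  of the singular values. Changing one row of the matrix is also a perturbation of rank one, so
  bounded differences give exponential concentration of this trace around its mean \<open>s\<close>. Removing the
  \<open>i\<close>-th row and column expresses the \<open>i\<close>-th diagonal block of the resolvent through quadratic forms,
  in the removed entries, of a resolvent independent of them. These concentrate, with two exceptions
  to the usual picture: the row sum \<open>D\<^sub>i\<^sub>i\<close> stays, and becomes the Gaussian variable \<open>G\<close> by a
  Lindeberg replacement that is uniform in the spectral parameter; and the diagonal entries of the
  other rows still depend on the removed column, which contributes a diagonal perturbation with small
  entries. Hence \<open>s\<close> satisfies the fixed point equation up to \<open>o(1)\<close>. The equation has at most one
  solution with nonnegative imaginary part for each \<open>\<eta>\<close>, and it forces tightness through its behaviour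
  at \<open>\<eta> = \<i> y\<close>, \<open>y \<rightarrow> \<infinity>\<close>, so the symmetrized laws converge weakly.
\<close>

section \<open>Resolvents of Hermitian matrices\<close>

text \<open>After scaling, an entry has variance 1/n, so a row sum is of order one and does not
  concentrate; it is the only randomness of row \<open>i\<close> that survives, which is why the
  limit contains \<open>G\<close>. The pseudo-variance of the entries enters only through
  \<open>G\<close>: the quadratic forms pair an entry with a conjugated entry of the same row or
  column, or a row entry with a column entry. Only second moments and the Lindeberg condition are
  available, so diagonal sums of squared moduli are truncated and errors are measured in mean. The
  comparison value \<open>s\<close> depends on n, hence the Gaussian replacement must be uniform in
  \<open>\<eta> + s\<close>; a lower bound on the imaginary part suffices for this. Rows, not
  columns, are the independent blocks for concentration, since changing a column would alter many
  diagonal entries. Matrices of different sizes have an arbitrary joint law: exponential tails and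
  Borel-Cantelli treat each \<open>\<eta>\<close>, and a countable dense set of
  \<open>\<eta>\<close> treats all at once. Resolvents are written through cofactors so that
  measurability in the entries can be read off.\<close>

definition hermitian_on :: "'i set \<Rightarrow> ('i \<Rightarrow> 'i \<Rightarrow> complex) \<Rightarrow> bool" where
  "hermitian_on V H \<longleftrightarrow> (\<forall>i\<in>V. \<forall>j\<in>V. H j i = cnj (H i j))"

text \<open>The two-sided inverse of \<open>H - \<eta>\<close>, entrywise on \<open>V\<close>;
  values of \<open>R\<close> off \<open>V\<close> are unconstrained. Being a relation, it lets a
  given resolvent be updated or transferred without forming matrix inverses.\<close>

definition resolvent_of ::
  "'i set \<Rightarrow> ('i \<Rightarrow> 'i \<Rightarrow> complex) \<Rightarrow> complex \<Rightarrow> ('i \<Rightarrow> 'i \<Rightarrow> complex) \<Rightarrow> bool" where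
  "resolvent_of V H \<eta> R \<longleftrightarrow> (\<forall>i\<in>V. \<forall>j\<in>V.
     (\<Sum>k\<in>V. H i k * R k j) = \<eta> * R i j + of_bool (i = j) \<and>
     (\<Sum>k\<in>V. R i k * H k j) = \<eta> * R i j + of_bool (i = j))"

lemma resolvent_of_left:
  "resolvent_of V H \<eta> R \<Longrightarrow> i \<in> V \<Longrightarrow> j \<in> V \<Longrightarrow>
     (\<Sum>k\<in>V. H i k * R k j) = \<eta> * R i j + of_bool (i = j)"
  unfolding resolvent_of_def by blast

lemma resolvent_of_right:
  "resolvent_of V H \<eta> R \<Longrightarrow> i \<in> V \<Longrightarrow> j \<in> V \<Longrightarrow>
     (\<Sum>k\<in>V. R i k * H k j) = \<eta> * R i j + of_bool (i = j)"
  unfolding resolvent_of_def by blast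

lemma resolvent_of_cong:
  assumes R: "resolvent_of V H \<eta> R" and eq: "\<And>i j. i \<in> V \<Longrightarrow> j \<in> V \<Longrightarrow> H i j = H' i j"
  shows "resolvent_of V H' \<eta> R"
proof -
  have "(\<Sum>k\<in>V. H' i k * R k j) = (\<Sum>k\<in>V. H i k * R k j)"
    "(\<Sum>k\<in>V. R i k * H' k j) = (\<Sum>k\<in>V. R i k * H k j)" if "i \<in> V" "j \<in> V" for i j
    by (rule sum.cong, simp, simp add: eq that)+
  then show ?thesis using R unfolding resolvent_of_def by simp
qed

lemma resolvent_of_transpose:
  assumes "resolvent_of V H \<eta> R"
  shows "resolvent_of V (\<lambda>i j. H j i) \<eta> (\<lambda>i j. R j i)"
  unfolding resolvent_of_def
proof (intro ballI conjI)
  fix i j assume ij: "i \<in> V" "j \<in> V"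
  have eq: "of_bool (j = i) = (of_bool (i = j) :: complex)"
    by (cases "i = j") auto
  have "(\<Sum>k\<in>V. H k i * R j k) = (\<Sum>k\<in>V. R j k * H k i)"
    by (rule sum.cong) (rule refl, rule mult.commute)
  then show "(\<Sum>k\<in>V. H k i * R j k) = \<eta> * R j i + of_bool (i = j)"
    unfolding resolvent_of_right[OF assms ij(2,1)] eq .
  have "(\<Sum>k\<in>V. R k i * H j k) = (\<Sum>k\<in>V. H j k * R k i)"
    by (rule sum.cong) (rule refl, rule mult.commute)
  then show "(\<Sum>k\<in>V. R k i * H j k) = \<eta> * R j i + of_bool (i = j)"
    unfolding resolvent_of_left[OF assms ij(2,1)] eq .
qed

lemma hermitian_on_transpose: "hermitian_on V H \<Longrightarrow> hermitian_on V (\<lambda>i j. H j i)"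
  unfolding hermitian_on_def by blast

lemma sum_swap_mult:
  fixes a :: "'a \<Rightarrow> complex"
  shows "(\<Sum>q\<in>V. a q * (\<Sum>r\<in>W. M q r * b r)) = (\<Sum>r\<in>W. (\<Sum>q\<in>V. a q * M q r) * b r)"
  unfolding sum_distrib_left sum_distrib_right by (subst sum.swap) (simp add: mult.assoc)

text \<open>This is \<open>R = R' - R' (H - H') R\<close>: expand \<open>R' H R\<close> through the
  left equation of \<open>R\<close> and \<open>R' H' R\<close> through the right equation of
  \<open>R'\<close>; the terms with \<open>\<eta>\<close> cancel.\<close>

lemma resolvent_identity:
  assumes fin: "finite V" and R: "resolvent_of V H \<eta> R" and R': "resolvent_of V H' \<eta> R'"
    and p: "p \<in> V" and i: "i \<in> V"
  shows "R p i = R' p i - (\<Sum>q\<in>V. R' p q * (\<Sum>r\<in>V. (H q r - H' q r) * R r i))"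
proof -
  have "(\<Sum>q\<in>V. R' p q * (\<Sum>r\<in>V. H q r * R r i)) = (\<Sum>q\<in>V. R' p q * (\<eta> * R q i + of_bool (q = i)))"
    by (intro sum.cong refl) (simp add: resolvent_of_left[OF R] i)
  also have "\<dots> = \<eta> * (\<Sum>q\<in>V. R' p q * R q i) + R' p i"
    using fin i by (simp add: ring_distribs sum.distrib sum_distrib_left mult.left_commute
      of_bool_def if_distrib[where f = "\<lambda>x. _ * x"] sum.delta cong: if_cong)
  finally have 1: "(\<Sum>q\<in>V. R' p q * (\<Sum>r\<in>V. H q r * R r i)) = \<eta> * (\<Sum>q\<in>V. R' p q * R q i) + R' p i" .
  have "(\<Sum>q\<in>V. R' p q * (\<Sum>r\<in>V. H' q r * R r i)) = (\<Sum>r\<in>V. (\<eta> * R' p r + of_bool (p = r)) * R r i)"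
    unfolding sum_swap_mult by (intro sum.cong refl) (simp add: resolvent_of_right[OF R'] p)
  also have "\<dots> = \<eta> * (\<Sum>q\<in>V. R' p q * R q i) + R p i"
    using fin p by (simp add: ring_distribs sum.distrib sum_distrib_left mult.assoc
      of_bool_def if_distrib[where f = "\<lambda>x. x * _"] sum.delta cong: if_cong)
  finally have 2: "(\<Sum>q\<in>V. R' p q * (\<Sum>r\<in>V. H' q r * R r i)) = \<eta> * (\<Sum>q\<in>V. R' p q * R q i) + R p i" .
  have "(\<Sum>q\<in>V. R' p q * (\<Sum>r\<in>V. (H q r - H' q r) * R r i)) = R' p i - R p i"
    unfolding left_diff_distrib sum_subtractf right_diff_distrib 1 2 by simp
  then show ?thesis by simp
qed

lemma hermitian_form_real:
  assumes "hermitian_on V H"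
  shows "Im (\<Sum>i\<in>V. cnj (x i) * (\<Sum>k\<in>V. H i k * x k)) = 0"
proof -
  let ?q = "\<Sum>i\<in>V. cnj (x i) * (\<Sum>k\<in>V. H i k * x k)"
  have "cnj ?q = (\<Sum>i\<in>V. \<Sum>k\<in>V. x i * cnj (H i k) * cnj (x k))"
    by (simp add: cnj_sum sum_distrib_left mult.assoc)
  also have "\<dots> = (\<Sum>i\<in>V. \<Sum>k\<in>V. x i * H k i * cnj (x k))"
    by (intro sum.cong refl) (metis assms hermitian_on_def)
  also have "\<dots> = (\<Sum>k\<in>V. \<Sum>i\<in>V. x i * H k i * cnj (x k))"
    by (rule sum.swap)
  also have "\<dots> = ?q"
    by (simp add: sum_distrib_left mult_ac)
  finally show ?thesis by (metis Reals_cnj_iff complex_is_Real_iff)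
qed

text \<open>\<open>x = R u\<close> solves \<open>H x = \<eta> x + u\<close>. Pairing with
  \<open>x\<close> and taking imaginary parts removes \<open>H\<close>, whose form is real. Both the
  norm bound (by Cauchy-Schwarz) and the Ward identity (\<open>u\<close> a unit vector) are
  consequences.\<close>

lemma resolvent_energy:
  fixes u :: "'i \<Rightarrow> complex"
  assumes fin: "finite V" and H: "hermitian_on V H" and R: "resolvent_of V H \<eta> R"
  defines "x \<equiv> \<lambda>k. \<Sum>q\<in>V. R k q * u q"
  shows "Im \<eta> * (\<Sum>k\<in>V. (cmod (x k))\<^sup>2) = Im (\<Sum>k\<in>V. x k * cnj (u k))"
proof -
  have Hx: "(\<Sum>k\<in>V. H i k * x k) = \<eta> * x i + u i" if "i \<in> V" for i
  proof -
    have "(\<Sum>k\<in>V. H i k * x k) = (\<Sum>q\<in>V. (\<eta> * R i q + of_bool (i = q)) * u q)"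
      unfolding x_def sum_swap_mult by (intro sum.cong refl) (simp add: resolvent_of_left[OF R] that)
    also have "\<dots> = \<eta> * x i + u i"
      using fin that by (simp add: x_def ring_distribs sum.distrib sum_distrib_left mult.assoc
        of_bool_def if_distrib[where f = "\<lambda>x. x * _"] sum.delta cong: if_cong)
    finally show ?thesis .
  qed
  have "(\<Sum>i\<in>V. cnj (x i) * (\<Sum>k\<in>V. H i k * x k)) = (\<Sum>i\<in>V. cnj (x i) * (\<eta> * x i + u i))"
    by (intro sum.cong refl) (simp add: Hx)
  also have "\<dots> = \<eta> * of_real (\<Sum>k\<in>V. (cmod (x k))\<^sup>2) + cnj (\<Sum>k\<in>V. x k * cnj (u k))"
    by (simp add: ring_distribs sum.distrib sum_distrib_left complex_norm_square flip: of_real_power) (simp add: mult_ac)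
  finally have "0 = Im (\<eta> * of_real (\<Sum>k\<in>V. (cmod (x k))\<^sup>2) + cnj (\<Sum>k\<in>V. x k * cnj (u k)))"
    using hermitian_form_real[OF H, of x] by (simp only:)
  moreover have "Im (\<eta> * of_real S + cnj X) = Im \<eta> * S - Im X" for S X by simp
  ultimately show ?thesis by (simp only:)
qed

lemma cmod_sum_mult_le:
  "cmod (\<Sum>i\<in>V. a i * b i) \<le> sqrt (\<Sum>i\<in>V. (cmod (a i))\<^sup>2) * sqrt (\<Sum>i\<in>V. (cmod (b i))\<^sup>2)"
proof -
  have "cmod (\<Sum>i\<in>V. a i * b i) \<le> (\<Sum>i\<in>V. \<bar>cmod (a i)\<bar> * \<bar>cmod (b i)\<bar>)"
    by (rule order_trans[OF norm_sum]) (simp add: norm_mult)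
  also have "\<dots> \<le> sqrt (\<Sum>i\<in>V. (cmod (a i))\<^sup>2) * sqrt (\<Sum>i\<in>V. (cmod (b i))\<^sup>2)"
    using L2_set_mult_ineq[of "\<lambda>i. cmod (a i)" "\<lambda>i. cmod (b i)" V] by (simp add: L2_set_def)
  finally show ?thesis .
qed

lemma resolvent_apply_bound:
  assumes fin: "finite V" and H: "hermitian_on V H" and R: "resolvent_of V H \<eta> R" and \<eta>: "Im \<eta> > 0"
  shows "sqrt (\<Sum>k\<in>V. (cmod (\<Sum>q\<in>V. R k q * u q))\<^sup>2) \<le> sqrt (\<Sum>k\<in>V. (cmod (u k))\<^sup>2) / Im \<eta>"
proof -
  define x where "x = (\<lambda>k. \<Sum>q\<in>V. R k q * u q)"
  define X where "X = sqrt (\<Sum>k\<in>V. (cmod (x k))\<^sup>2)"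
  have X0: "X \<ge> 0" by (simp add: X_def sum_nonneg)
  have "Im \<eta> * X\<^sup>2 = Im (\<Sum>k\<in>V. x k * cnj (u k))"
    using resolvent_energy[OF fin H R, of u] by (simp add: X_def x_def sum_nonneg)
  also have "\<dots> \<le> cmod (\<Sum>k\<in>V. x k * cnj (u k))" using abs_Im_le_cmod abs_le_iff by blast
  also have "\<dots> \<le> X * sqrt (\<Sum>k\<in>V. (cmod (u k))\<^sup>2)"
    using cmod_sum_mult_le[of x "\<lambda>k. cnj (u k)" V] by (simp add: X_def)
  finally have le: "X * (Im \<eta> * X) \<le> X * sqrt (\<Sum>k\<in>V. (cmod (u k))\<^sup>2)"
    by (simp add: power2_eq_square mult_ac)
  have "Im \<eta> * X \<le> sqrt (\<Sum>k\<in>V. (cmod (u k))\<^sup>2)"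
  proof (cases "X = 0")
    case False
    then show ?thesis using X0 le by (simp add: mult_le_cancel_left_pos)
  qed (simp add: sum_nonneg)
  then show ?thesis using \<eta> unfolding X_def x_def by (simp add: field_simps)
qed

lemma resolvent_ward:
  assumes fin: "finite V" and H: "hermitian_on V H" and R: "resolvent_of V H \<eta> R" and i: "i \<in> V"
  shows "Im \<eta> * (\<Sum>k\<in>V. (cmod (R k i))\<^sup>2) = Im (R i i)"
proof -
  have "(\<Sum>q\<in>V. R k q * of_bool (q = i)) = R k i" for k
    using fin i by (simp add: of_bool_def if_distrib[where f = "\<lambda>x. _ * x"] sum.delta cong: if_cong)
  moreover have "(\<Sum>k\<in>V. R k i * cnj (of_bool (k = i))) = R i i"
    using fin i by (simp add: of_bool_def if_distrib[where f = "\<lambda>x. _ * x"] if_distrib[where f = cnj]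
        sum.delta cong: if_cong)
  ultimately show ?thesis
    using resolvent_energy[OF fin H R, of "\<lambda>q. of_bool (q = i)"] by simp
qed

lemma resolvent_column_bound:
  assumes fin: "finite V" and H: "hermitian_on V H" and R: "resolvent_of V H \<eta> R"
    and \<eta>: "Im \<eta> > 0" and i: "i \<in> V"
  shows "(\<Sum>k\<in>V. (cmod (R k i))\<^sup>2) \<le> 1 / (Im \<eta>)\<^sup>2"
proof -
  have "(\<Sum>q\<in>V. R k q * of_bool (q = i)) = R k i" for k
    using fin i by (simp add: of_bool_def if_distrib[where f = "\<lambda>x. _ * x"] sum.delta cong: if_cong)
  moreover have "(\<Sum>k\<in>V. (cmod (of_bool (k = i)))\<^sup>2) = 1"
    using fin i by (simp add: of_bool_def if_distrib[where f = "\<lambda>x. x^2"] if_distrib[where f = cmod]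
        sum.delta cong: if_cong)
  ultimately have "sqrt (\<Sum>k\<in>V. (cmod (R k i))\<^sup>2) \<le> 1 / Im \<eta>"
    using resolvent_apply_bound[OF fin H R \<eta>, of "\<lambda>q. of_bool (q = i)"] by simp
  then have "(sqrt (\<Sum>k\<in>V. (cmod (R k i))\<^sup>2))\<^sup>2 \<le> (1 / Im \<eta>)\<^sup>2"
    by (intro power_mono) (auto simp: sum_nonneg)
  then show ?thesis by (simp add: sum_nonneg power_divide)
qed

lemma resolvent_row_bound:
  assumes fin: "finite V" and H: "hermitian_on V H" and R: "resolvent_of V H \<eta> R"
    and \<eta>: "Im \<eta> > 0" and i: "i \<in> V"
  shows "(\<Sum>k\<in>V. (cmod (R i k))\<^sup>2) \<le> 1 / (Im \<eta>)\<^sup>2"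
  using resolvent_column_bound[OF fin hermitian_on_transpose[OF H] resolvent_of_transpose[OF R] \<eta> i] .

lemma resolvent_entry_bound:
  assumes fin: "finite V" and H: "hermitian_on V H" and R: "resolvent_of V H \<eta> R"
    and \<eta>: "Im \<eta> > 0" and i: "i \<in> V" and j: "j \<in> V"
  shows "cmod (R i j) \<le> 1 / Im \<eta>"
proof -
  have "(cmod (R i j))\<^sup>2 \<le> (\<Sum>k\<in>V. (cmod (R k j))\<^sup>2)"
    by (rule member_le_sum[of i V "\<lambda>k. (cmod (R k j))\<^sup>2"]) (use fin i in auto)
  also have "\<dots> \<le> (1 / Im \<eta>)\<^sup>2"
    using resolvent_column_bound[OF fin H R \<eta> j] by (simp add: power_divide)
  finally show ?thesis by (rule power2_le_imp_le) (use \<eta> in simp)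
qed

text \<open>Sherman-Morrison, with \<open>x\<close> the form of \<open>R\<close> at \<open>u\<close>
  and denominator \<open>d = 1 + t x\<close>. The trace changes by \<open>t / d\<close> times a sum
  of modulus at most \<open>Im x / Im \<eta>\<close> (the energy identity for \<open>R u\<close> and
  for its transposed analogue), while \<open>|d| >= |t| Im x\<close>; hence a bound free of
  \<open>t\<close> and \<open>u\<close>.\<close>

lemma resolvent_of_rank_one:
  assumes fin: "finite V" and H: "hermitian_on V H" and R: "resolvent_of V H \<eta> R" and \<eta>: "Im \<eta> > 0"
  shows "\<exists>R'. resolvent_of V (\<lambda>i j. H i j + complex_of_real t * u i * cnj (u j)) \<eta> R' \<and>
     cmod ((\<Sum>i\<in>V. R' i i) - (\<Sum>i\<in>V. R i i)) \<le> 1 / Im \<eta>"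
proof -
  define a where "a = (\<lambda>k. \<Sum>q\<in>V. R k q * u q)"
  define b where "b = (\<lambda>k. \<Sum>q\<in>V. R q k * cnj (u q))"
  define x where "x = (\<Sum>k\<in>V. a k * cnj (u k))"
  have xb: "x = (\<Sum>k\<in>V. b k * u k)"
    unfolding x_def a_def b_def sum_distrib_right
    by (subst sum.swap) (simp add: mult_ac)
  have ea: "Im \<eta> * (\<Sum>k\<in>V. (cmod (a k))\<^sup>2) = Im x"
    unfolding a_def x_def by (rule resolvent_energy[OF fin H R])
  have eb: "Im \<eta> * (\<Sum>k\<in>V. (cmod (b k))\<^sup>2) = Im x"
    using resolvent_energy[OF fin hermitian_on_transpose[OF H] resolvent_of_transpose[OF R], of "\<lambda>k. cnj (u k)"]
    unfolding xb b_def by simp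
  have Imx: "Im x \<ge> 0" using ea \<eta> by (metis mult_nonneg_nonneg less_imp_le sum_nonneg zero_le_power2)
  define d where "d = 1 + t * x"
  \<comment> \<open>If \<open>Im x = 0\<close>, the energy identity forces \<open>R u = 0\<close>,
    so \<open>x = 0\<close> and \<open>d = 1\<close>; otherwise \<open>d\<close> has nonzero
    imaginary part unless \<open>t = 0\<close>.\<close>
  have a0: "a k = 0" if "Im x = 0" "k \<in> V" for k
  proof -
    have "(\<Sum>k\<in>V. (cmod (a k))\<^sup>2) = 0" using ea that \<eta> by simp
    then show ?thesis using fin that by (subst (asm) sum_nonneg_eq_0_iff) auto
  qed
  have d0: "d \<noteq> 0"
  proof
    assume "d = 0"
    then have "t * Im x = 0" by (auto simp: d_def complex_eq_iff)
    then have "t = 0 \<or> Im x = 0" by simp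
    moreover have "x = 0" if "Im x = 0" unfolding x_def using a0[OF that] by (intro sum.neutral) simp
    ultimately have "d = 1" unfolding d_def by auto
    then show False using \<open>d = 0\<close> by simp
  qed
  define \<tau> where "\<tau> = t / d"
  define R' where "R' = (\<lambda>i j. R i j - \<tau> * a i * b j)"
  have Ha: "(\<Sum>k\<in>V. H i k * a k) = \<eta> * a i + u i" if "i \<in> V" for i
  proof -
    have "(\<Sum>k\<in>V. H i k * a k) = (\<Sum>q\<in>V. (\<eta> * R i q + of_bool (i = q)) * u q)"
      unfolding a_def sum_swap_mult by (intro sum.cong refl) (simp add: resolvent_of_left[OF R] that)
    also have "\<dots> = \<eta> * a i + u i"
      using fin that by (simp add: a_def ring_distribs sum.distrib sum_distrib_left mult.assoc
        of_bool_def if_distrib[where f = "\<lambda>x. x * _"] sum.delta cong: if_cong)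
    finally show ?thesis .
  qed
  have bH: "(\<Sum>k\<in>V. b k * H k j) = \<eta> * b j + cnj (u j)" if "j \<in> V" for j
  proof -
    have "(\<Sum>k\<in>V. b k * H k j) = (\<Sum>q\<in>V. cnj (u q) * (\<Sum>k\<in>V. R q k * H k j))"
      unfolding sum_swap_mult b_def by (simp add: mult.commute)
    also have "\<dots> = (\<Sum>q\<in>V. cnj (u q) * (\<eta> * R q j + of_bool (q = j)))"
      by (intro sum.cong refl) (simp add: resolvent_of_right[OF R] that)
    also have "\<dots> = \<eta> * b j + cnj (u j)"
      using fin that by (simp add: b_def ring_distribs sum.distrib sum_distrib_left mult_ac
        of_bool_def if_distrib[where f = "\<lambda>x. _ * x"] sum.delta cong: if_cong)
    finally show ?thesis .
  qed
  have "d * \<tau> = t" using d0 by (simp add: \<tau>_def)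
  then have td: "t - \<tau> - t * \<tau> * x = 0" by (simp add: d_def algebra_simps)
  have bj: "(\<Sum>k\<in>V. R k j * cnj (u k)) = b j" and aj: "(\<Sum>k\<in>V. R j k * u k) = a j" for j
    by (simp_all add: a_def b_def)
  have "resolvent_of V (\<lambda>i j. H i j + t * u i * cnj (u j)) \<eta> R'"
    unfolding resolvent_of_def
  proof (intro ballI conjI)
    fix i j assume i: "i \<in> V" and j: "j \<in> V"
    have "(\<Sum>k\<in>V. (H i k + t * u i * cnj (u k)) * R' k j)
        = (\<Sum>k\<in>V. H i k * R k j) - \<tau> * b j * (\<Sum>k\<in>V. H i k * a k)
          + t * u i * (\<Sum>k\<in>V. R k j * cnj (u k)) - t * u i * \<tau> * b j * (\<Sum>k\<in>V. a k * cnj (u k))"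
      by (simp add: R'_def algebra_simps sum.distrib sum_subtractf sum_distrib_left)
    also have "\<dots> = \<eta> * R i j + of_bool (i = j) - \<tau> * b j * (\<eta> * a i + u i)
          + t * u i * b j - t * u i * \<tau> * b j * x"
      unfolding Ha[OF i] resolvent_of_left[OF R i j] bj x_def[symmetric] ..
    also have "\<dots> = \<eta> * R' i j + of_bool (i = j) + u i * b j * (t - \<tau> - t * \<tau> * x)"
      by (simp add: R'_def algebra_simps)
    finally show "(\<Sum>k\<in>V. (H i k + t * u i * cnj (u k)) * R' k j) = \<eta> * R' i j + of_bool (i = j)"
      unfolding td by simp
    have "(\<Sum>k\<in>V. R' i k * (H k j + t * u k * cnj (u j)))
        = (\<Sum>k\<in>V. R i k * H k j) - \<tau> * a i * (\<Sum>k\<in>V. b k * H k j)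
          + t * cnj (u j) * (\<Sum>k\<in>V. R i k * u k) - t * cnj (u j) * \<tau> * a i * (\<Sum>k\<in>V. b k * u k)"
      by (simp add: R'_def algebra_simps sum.distrib sum_subtractf sum_distrib_left)
    also have "\<dots> = \<eta> * R i j + of_bool (i = j) - \<tau> * a i * (\<eta> * b j + cnj (u j))
          + t * cnj (u j) * a i - t * cnj (u j) * \<tau> * a i * x"
      unfolding bH[OF j] resolvent_of_right[OF R i j] aj xb[symmetric] ..
    also have "\<dots> = \<eta> * R' i j + of_bool (i = j) + cnj (u j) * a i * (t - \<tau> - t * \<tau> * x)"
      by (simp add: R'_def algebra_simps)
    finally show "(\<Sum>k\<in>V. R' i k * (H k j + t * u k * cnj (u j))) = \<eta> * R' i j + of_bool (i = j)"
      unfolding td by simp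
  qed
  moreover have "cmod ((\<Sum>i\<in>V. R' i i) - (\<Sum>i\<in>V. R i i)) \<le> 1 / Im \<eta>"
  proof -
    have eq: "(\<Sum>i\<in>V. R' i i) - (\<Sum>i\<in>V. R i i) = - (t / d * (\<Sum>i\<in>V. a i * b i))"
      by (simp add: R'_def \<tau>_def sum_subtractf sum_distrib_left mult.assoc)
    show ?thesis
    proof (cases "t = 0 \<or> Im x = 0")
      case True
      then have "(\<Sum>i\<in>V. R' i i) - (\<Sum>i\<in>V. R i i) = 0" unfolding eq using a0 by auto
      then show ?thesis using \<eta> by simp
    next
      case False
      then have t: "\<bar>t\<bar> > 0" and x: "Im x > 0" using Imx by auto
      have "cmod (\<Sum>i\<in>V. a i * b i) \<le> sqrt (\<Sum>k\<in>V. (cmod (a k))\<^sup>2) * sqrt (\<Sum>k\<in>V. (cmod (b k))\<^sup>2)"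
        by (rule cmod_sum_mult_le)
      also have "(\<Sum>k\<in>V. (cmod (a k))\<^sup>2) = Im x / Im \<eta>" using ea \<eta> by (simp add: field_simps)
      also have "(\<Sum>k\<in>V. (cmod (b k))\<^sup>2) = Im x / Im \<eta>" using eb \<eta> by (simp add: field_simps)
      also have "sqrt (Im x / Im \<eta>) * sqrt (Im x / Im \<eta>) = Im x / Im \<eta>" using x \<eta> by simp
      finally have 1: "cmod (\<Sum>i\<in>V. a i * b i) \<le> Im x / Im \<eta>" .
      have 2: "\<bar>t\<bar> * Im x \<le> cmod d"
        using abs_Im_le_cmod[of d] x by (simp add: d_def abs_mult)
      have "cmod (t / d * (\<Sum>i\<in>V. a i * b i)) = \<bar>t\<bar> * cmod (\<Sum>i\<in>V. a i * b i) / cmod d"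
        by (simp add: norm_mult norm_divide)
      also have "\<dots> \<le> \<bar>t\<bar> * (Im x / Im \<eta>) / (\<bar>t\<bar> * Im x)"
        using 1 2 t x \<eta> by (intro frac_le mult_left_mono) auto
      also have "\<dots> = 1 / Im \<eta>" using t x by simp
      finally show ?thesis unfolding eq by simp
    qed
  qed
  ultimately show ?thesis by blast
qed

lemma resolvent_of_unique:
  assumes "finite V" "resolvent_of V H \<eta> R" "resolvent_of V H \<eta> R'" "i \<in> V" "j \<in> V"
  shows "R i j = R' i j"
  using resolvent_identity[OF assms] by simp

lemma hermitian_on_rank_one:
  assumes "hermitian_on V H"
  shows "hermitian_on V (\<lambda>i j. H i j + complex_of_real t * u i * cnj (u j))"
  unfolding hermitian_on_def
proof (intro ballI)
  fix i j assume "i \<in> V" "j \<in> V"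
  then have "H j i = cnj (H i j)" using assms unfolding hermitian_on_def by blast
  then show "H j i + complex_of_real t * u j * cnj (u i) = cnj (H i j + complex_of_real t * u i * cnj (u j))"
    by simp
qed

section \<open>Hermitization\<close>

text \<open>The block matrix with off-diagonal blocks \<open>A\<close> and \<open>A\<^sup>*\<close>; the flag \<open>True\<close> marks column indices of \<open>A\<close>.\<close>
definition hermitization :: "(nat \<Rightarrow> nat \<Rightarrow> complex) \<Rightarrow> nat \<times> bool \<Rightarrow> nat \<times> bool \<Rightarrow> complex" where
  "hermitization A p q = (if \<not> snd p \<and> snd q then A (fst p) (fst q)
     else if snd p \<and> \<not> snd q then cnj (A (fst q) (fst p)) else 0)"

abbreviation block_index :: "nat \<Rightarrow> (nat \<times> bool) set" where
  "block_index n \<equiv> {..<n} \<times> UNIV"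

lemma hermitian_hermitization: "hermitian_on V (hermitization A)"
  unfolding hermitian_on_def hermitization_def by auto

lemma sum_block_index:
  fixes f :: "nat \<times> bool \<Rightarrow> 'b :: comm_monoid_add"
  shows "(\<Sum>p\<in>block_index n. f p) = (\<Sum>k<n. f (k, False)) + (\<Sum>k<n. f (k, True))"
  by (simp add: sum.cartesian_product[symmetric, where g = "\<lambda>i b. f (i, b)", simplified] UNIV_bool sum.distrib)

lemma sum_hermitization_False:
  "(\<Sum>q\<in>block_index n. hermitization A (k, False) q * f q) = (\<Sum>j<n. A k j * f (j, True))"
  "(\<Sum>q\<in>block_index n. f q * hermitization A q (k, False)) = (\<Sum>j<n. f (j, True) * cnj (A k j))"
  by (simp_all add: sum_block_index hermitization_def)

lemma sum_hermitization_True: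
  "(\<Sum>q\<in>block_index n. hermitization A (k, True) q * f q) = (\<Sum>j<n. cnj (A j k) * f (j, False))"
  "(\<Sum>q\<in>block_index n. f q * hermitization A q (k, True)) = (\<Sum>j<n. f (j, False) * A j k)"
  by (simp_all add: sum_block_index hermitization_def)

text \<open>The hermitization of \<open>p q\<^sup>*\<close> is \<open>(u u\<^sup>* - v v\<^sup>*) / 2\<close> for \<open>u = (p, q)\<close> and \<open>v = (p, -q)\<close>.\<close>
lemma trace_resolvent_rank_one:
  assumes R: "resolvent_of (block_index n) (hermitization A) \<eta> R"
    and R': "resolvent_of (block_index n) (hermitization A') \<eta> R'"
    and A': "\<And>i j. i < n \<Longrightarrow> j < n \<Longrightarrow> A' i j = A i j + p i * cnj (q j)" and \<eta>: "Im \<eta> > 0"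
  shows "cmod ((\<Sum>i\<in>block_index n. R' i i) - (\<Sum>i\<in>block_index n. R i i)) \<le> 2 / Im \<eta>"
proof -
  let ?V = "block_index n"
  have fin: "finite ?V" by simp
  define u where "u = (\<lambda>x :: nat \<times> bool. if snd x then q (fst x) else p (fst x))"
  define v where "v = (\<lambda>x :: nat \<times> bool. if snd x then - q (fst x) else p (fst x))"
  let ?H1 = "\<lambda>i j. hermitization A i j + complex_of_real (1/2) * u i * cnj (u j)"
  obtain R1 where R1: "resolvent_of ?V ?H1 \<eta> R1"
    and t1: "cmod ((\<Sum>i\<in>?V. R1 i i) - (\<Sum>i\<in>?V. R i i)) \<le> 1 / Im \<eta>"
    using resolvent_of_rank_one[OF fin hermitian_hermitization R \<eta>, of "1/2" u] by auto
  obtain R2 where R2: "resolvent_of ?V (\<lambda>i j. ?H1 i j + complex_of_real (-1/2) * v i * cnj (v j)) \<eta> R2"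
    and t2: "cmod ((\<Sum>i\<in>?V. R2 i i) - (\<Sum>i\<in>?V. R1 i i)) \<le> 1 / Im \<eta>"
    using resolvent_of_rank_one[OF fin hermitian_on_rank_one[OF hermitian_hermitization] R1 \<eta>, of "-1/2" v]
    by auto
  have "?H1 i j + complex_of_real (-1/2) * v i * cnj (v j) = hermitization A' i j" if "i \<in> ?V" "j \<in> ?V" for i j
    using that A'[of "fst i" "fst j"] A'[of "fst j" "fst i"]
    by (cases "snd i"; cases "snd j") (auto simp: hermitization_def u_def v_def mem_Times_iff)
  then have "resolvent_of ?V (hermitization A') \<eta> R2"
    by (rule resolvent_of_cong[OF R2])
  then have "R2 i i = R' i i" if "i \<in> ?V" for i
    using resolvent_of_unique[OF fin _ R'] that by blast
  then have "(\<Sum>i\<in>?V. R' i i) = (\<Sum>i\<in>?V. R2 i i)" by simp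
  then show ?thesis
    using norm_triangle_mono[OF t2 t1] by simp
qed

text \<open>Both traces, multiplied by \<open>\<eta>\<close> and increased by \<open>n\<close>,
  equal the trace of \<open>A\<close> times an off-diagonal block: by the left equation for one
  diagonal block, by the right equation and a swap of sums for the other.\<close>

lemma trace_resolvent_blocks:
  assumes R: "resolvent_of (block_index n) (hermitization A) \<eta> R" and \<eta>: "\<eta> \<noteq> 0"
  shows "(\<Sum>k<n. R (k, True) (k, True)) = (\<Sum>k<n. R (k, False) (k, False))"
proof -
  have 1: "(\<Sum>j<n. A k j * R (j, True) (k, False)) = \<eta> * R (k, False) (k, False) + 1" if "k < n" for k
    using resolvent_of_left[OF R, of "(k, False)" "(k, False)"] that
    unfolding sum_hermitization_False by simp
  have 2: "(\<Sum>k<n. R (j, True) (k, False) * A k j) = \<eta> * R (j, True) (j, True) + 1" if "j < n" for j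
    using resolvent_of_right[OF R, of "(j, True)" "(j, True)"] that
    unfolding sum_hermitization_True by simp
  have "(\<Sum>k<n. \<eta> * R (k, False) (k, False) + 1) = (\<Sum>k<n. \<Sum>j<n. A k j * R (j, True) (k, False))"
    by (rule sum.cong[OF refl]) (simp only: 1 lessThan_iff)
  also have "\<dots> = (\<Sum>j<n. \<Sum>k<n. R (j, True) (k, False) * A k j)"
    unfolding mult.commute[of "A _ _"] by (rule sum.swap)
  also have "\<dots> = (\<Sum>j<n. \<eta> * R (j, True) (j, True) + 1)"
    by (rule sum.cong[OF refl]) (simp only: 2 lessThan_iff)
  finally have "\<eta> * (\<Sum>k<n. R (k, False) (k, False)) = \<eta> * (\<Sum>k<n. R (k, True) (k, True))"
    unfolding sum.distrib sum_distrib_left by simp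
  then show ?thesis using \<eta> by simp
qed

section \<open>Stieltjes transforms\<close>

lemma norm_integral_le:
  fixes f :: "'a \<Rightarrow> 'b :: {banach, second_countable_topology}"
  assumes "integrable M f" "integrable M g" "\<And>x. x \<in> space M \<Longrightarrow> norm (f x) \<le> g x"
  shows "norm (\<integral>x. f x \<partial>M) \<le> (\<integral>x. g x \<partial>M)"
  using integral_norm_bound[of M f] integral_mono[OF integrable_norm[OF assms(1)] assms(2,3)]
  by (rule order_trans)

lemma cmod_inverse_diff_le:
  assumes "Im w > 0"
  shows "cmod (1 / (complex_of_real t - w)) \<le> 1 / Im w"
proof -
  have "Im w \<le> cmod (complex_of_real t - w)"
    using abs_Im_le_cmod[of "complex_of_real t - w"] assms by simp
  then show ?thesis using assms by (simp add: norm_divide frac_le)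
qed

lemma Im_inverse_diff:
  "Im (1 / (complex_of_real t - w)) = Im w / (cmod (complex_of_real t - w))\<^sup>2"
  by (simp add: Im_divide cmod_power2)

lemma (in real_distribution) integrable_inverse_diff:
  assumes "Im w > 0"
  shows "integrable M (\<lambda>t. 1 / (complex_of_real t - w))"
  by (rule integrable_const_bound[where B = "1 / Im w"]) (use assms cmod_inverse_diff_le in auto)

lemma (in real_distribution) Im_stieltjes:
  assumes "Im w > 0"
  shows "Im (stieltjes M w) = (\<integral>t. Im w / (cmod (complex_of_real t - w))\<^sup>2 \<partial>M)"
  unfolding stieltjes_def Im_inverse_diff[symmetric]
  using integral_Im[OF integrable_inverse_diff[OF assms]] by simp

lemma (in real_distribution) Im_stieltjes_nonneg:
  assumes "Im w > 0"
  shows "Im (stieltjes M w) \<ge> 0"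
  unfolding Im_stieltjes[OF assms] by (intro integral_nonneg_AE) (use assms in auto)

lemma (in real_distribution) cmod_stieltjes_le:
  assumes "Im w > 0"
  shows "cmod (stieltjes M w) \<le> 1 / Im w"
proof -
  have "cmod (stieltjes M w) \<le> (\<integral>t. 1 / Im w \<partial>M)"
    unfolding stieltjes_def
    by (rule norm_integral_le) (use integrable_inverse_diff assms cmod_inverse_diff_le in auto)
  then show ?thesis using prob_space by simp
qed

text \<open>The Cauchy density turns the Stieltjes transform along a horizontal line into the
  characteristic function.\<close>
lemma (in real_distribution) stieltjes_fourier:
  fixes y t :: real
  assumes y: "y > 0"
  shows "(\<integral>x. iexp (t * x) * Im (stieltjes M (Complex x y)) \<partial>lborel) =
    char M t * (\<integral>x. iexp (t * x) * complex_of_real (y / (x\<^sup>2 + y\<^sup>2)) \<partial>lborel)"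
proof -
  interpret P: pair_sigma_finite lborel M ..
  define p where "p = (\<lambda>x::real. y / (x\<^sup>2 + y\<^sup>2))"
  have p0: "p x \<ge> 0" for x using y by (simp add: p_def)
  have pm[measurable]: "p \<in> borel_measurable borel" unfolding p_def by measurable
  have int1: "integrable lborel (\<lambda>x::real. inverse (1 + x\<^sup>2))"
    using integrable_inverse_1_plus_square by (simp add: set_integrable_def einterval_def)
  have "integrable lborel (\<lambda>x. (1/y) * inverse (1 + (0 + (1/y) * x)\<^sup>2))"
    by (intro integrable_mult_right lborel_integrable_real_affine[OF int1]) (use y in simp)
  moreover have "(1/y) * inverse (1 + (0 + (1/y) * x)\<^sup>2) = p x" for x
    using y by (simp add: p_def field_simps power2_eq_square)
  ultimately have intp: "integrable lborel p" by simp
  have "integrable lborel (\<lambda>x. p (- s + 1 * x))" for s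
    by (rule lborel_integrable_real_affine[OF intp]) simp
  then have intps: "integrable lborel (\<lambda>x. p (x - s))" for s by simp
  have shift: "(\<integral>x. p (x - s) \<partial>lborel) = (\<integral>x. p x \<partial>lborel)" for s
    using lborel_integral_real_affine[of 1 p "- s"] by simp
  have cp: "Im (stieltjes M (Complex x y)) = (\<integral>s. p (x - s) \<partial>M)" for x
  proof -
    have "(cmod (complex_of_real s - Complex x y))\<^sup>2 = (x - s)\<^sup>2 + y\<^sup>2" for s
      by (simp add: cmod_power2 power2_commute)
    then show ?thesis using Im_stieltjes[of "Complex x y"] y by (simp add: p_def)
  qed
  \<comment> \<open>Fubini needs joint integrability; it holds since all translates of the Cauchy
    density have the same finite mass and \<open>M\<close> is a probability measure.\<close>
  have intp2: "integrable (lborel \<Otimes>\<^sub>M M) (\<lambda>(x, s). iexp (t * x) * complex_of_real (p (x - s)))"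
  proof -
    have m[measurable]: "(\<lambda>z. iexp (t * fst z) * complex_of_real (p (fst z - snd z))) \<in> borel_measurable (lborel \<Otimes>\<^sub>M M)"
      by measurable
    have "(\<integral>\<^sup>+z. ennreal (norm (iexp (t * fst z) * complex_of_real (p (fst z - snd z)))) \<partial>(lborel \<Otimes>\<^sub>M M))
       = (\<integral>\<^sup>+z. ennreal (p (fst z - snd z)) \<partial>(lborel \<Otimes>\<^sub>M M))"
      by (intro nn_integral_cong) (simp add: norm_mult p0)
    also have "\<dots> = (\<integral>\<^sup>+s. \<integral>\<^sup>+x. ennreal (p (x - s)) \<partial>lborel \<partial>M)"
      by (subst P.nn_integral_snd[symmetric]) simp_all
    also have "\<dots> = (\<integral>\<^sup>+s. ennreal (\<integral>x. p x \<partial>lborel) \<partial>M)"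
      by (intro nn_integral_cong) (simp add: nn_integral_eq_integral[OF intps] p0 shift)
    also have "\<dots> < \<infinity>" using emeasure_space_1 by simp
    finally have "integrable (lborel \<Otimes>\<^sub>M M) (\<lambda>z. iexp (t * fst z) * complex_of_real (p (fst z - snd z)))"
      by (intro integrableI_bounded m)
    then show ?thesis by (simp add: case_prod_beta')
  qed
  have "(\<integral>x. iexp (t * x) * Im (stieltjes M (Complex x y)) \<partial>lborel) =
    (\<integral>x. (\<integral>s. iexp (t * x) * complex_of_real (p (x - s)) \<partial>M) \<partial>lborel)"
    unfolding cp by (simp only: integral_mult_right_zero integral_complex_of_real)
  also have "\<dots> = (\<integral>s. (\<integral>x. iexp (t * x) * complex_of_real (p (x - s)) \<partial>lborel) \<partial>M)"
    by (rule P.Fubini_integral[symmetric, OF intp2])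
  also have "\<dots> = (\<integral>s. iexp (t * s) * (\<integral>x. iexp (t * x) * complex_of_real (p x) \<partial>lborel) \<partial>M)"
  proof (rule Bochner_Integration.integral_cong[OF refl])
    fix s
    have "(\<integral>x. iexp (t * x) * complex_of_real (p (x - s)) \<partial>lborel) =
      (\<integral>x. iexp (t * (s + x)) * complex_of_real (p x) \<partial>lborel)"
      using lborel_integral_real_affine[of 1 "\<lambda>x. iexp (t * x) * complex_of_real (p (x - s))" s] by simp
    also have "\<dots> = (\<integral>x. iexp (t * s) * (iexp (t * x) * complex_of_real (p x)) \<partial>lborel)"
      by (intro Bochner_Integration.integral_cong refl) (simp add: exp_add[symmetric] ring_distribs)
    finally show "(\<integral>x. iexp (t * x) * complex_of_real (p (x - s)) \<partial>lborel) =
        iexp (t * s) * (\<integral>x. iexp (t * x) * complex_of_real (p x) \<partial>lborel)"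
      by simp
  qed
  also have "\<dots> = char M t * (\<integral>x. iexp (t * x) * complex_of_real (p x) \<partial>lborel)"
    by (simp add: char_def)
  finally show ?thesis by (simp add: p_def)
qed

text \<open>The integral is the Fourier transform of the Cauchy density at scale \<open>y\<close>.
  Its closed form is avoided: after rescaling \<open>x\<close> by \<open>y = 1 / (k + 1)\<close>,
  dominated convergence gives the limit \<open>pi\<close>, so it is nonzero for some small
  \<open>y\<close>.\<close>

lemma cauchy_density_fourier_nonzero:
  fixes t :: real
  shows "\<exists>y>0. (\<integral>x. iexp (t * x) * complex_of_real (y / (x\<^sup>2 + y\<^sup>2)) \<partial>lborel) \<noteq> 0"
proof -
  have int1: "integrable lborel (\<lambda>x::real. inverse (1 + x\<^sup>2))"
    using integrable_inverse_1_plus_square by (simp add: set_integrable_def einterval_def)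
  have cauchy_mass: "(\<integral>x. inverse (1 + x\<^sup>2) \<partial>(lborel :: real measure)) = pi"
    using LBINT_inverse_1_plus_square
    by (simp add: interval_lebesgue_integral_def set_lebesgue_integral_def einterval_def)
  define c where "c = (\<lambda>k::nat. \<integral>x. iexp (t * (inverse (Suc k) * x)) * complex_of_real (inverse (1 + x\<^sup>2)) \<partial>lborel)"
  have ceq: "(\<integral>x. iexp (t * x) * complex_of_real (inverse (Suc k) / (x\<^sup>2 + (inverse (Suc k))\<^sup>2)) \<partial>lborel) = c k" for k
  proof -
    define y :: real where "y = inverse (Suc k)"
    have y: "y > 0" by (simp add: y_def)
    have "(\<integral>x. iexp (t * x) * complex_of_real (y / (x\<^sup>2 + y\<^sup>2)) \<partial>lborel) =
      \<bar>y\<bar> *\<^sub>R (\<integral>x. iexp (t * (0 + y * x)) * complex_of_real (y / ((0 + y * x)\<^sup>2 + y\<^sup>2)) \<partial>lborel)"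
      by (rule lborel_integral_real_affine) (use y in simp)
    also have "\<dots> = (\<integral>x. y *\<^sub>R (iexp (t * (0 + y * x)) * complex_of_real (y / ((0 + y * x)\<^sup>2 + y\<^sup>2))) \<partial>lborel)"
      using y by simp
    also have "\<dots> = (\<integral>x. iexp (t * (y * x)) * complex_of_real (inverse (1 + x\<^sup>2)) \<partial>lborel)"
    proof (rule Bochner_Integration.integral_cong[OF refl])
      fix x :: real
      have "y\<^sup>2 * x\<^sup>2 + y\<^sup>2 \<noteq> 0" "1 + x\<^sup>2 \<noteq> 0" using y by (auto simp: add_nonneg_eq_0_iff)
      then have "y * (y / ((0 + y * x)\<^sup>2 + y\<^sup>2)) = inverse (1 + x\<^sup>2)"
        by (simp add: field_simps power2_eq_square)
      then show "y *\<^sub>R (iexp (t * (0 + y * x)) * complex_of_real (y / ((0 + y * x)\<^sup>2 + y\<^sup>2))) =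
        iexp (t * (y * x)) * complex_of_real (inverse (1 + x\<^sup>2))"
        unfolding scaleR_conv_of_real by (metis (no_types, opaque_lifting) add_0 mult.left_commute of_real_mult)
    qed
    finally show ?thesis unfolding c_def y_def .
  qed
  have "c \<longlonglongrightarrow> (\<integral>x. 1 * complex_of_real (inverse (1 + x\<^sup>2)) \<partial>lborel)"
    unfolding c_def
  proof (rule integral_dominated_convergence[where w = "\<lambda>x. inverse (1 + x\<^sup>2)"])
    show "AE x in lborel. (\<lambda>k. iexp (t * (inverse (Suc k) * x)) * complex_of_real (inverse (1 + x\<^sup>2)))
      \<longlonglongrightarrow> 1 * complex_of_real (inverse (1 + x\<^sup>2))"
    proof (rule AE_I2, rule tendsto_mult[OF _ tendsto_const])
      fix x :: real
      have "(\<lambda>k. iexp (t * (inverse (Suc k) * x))) \<longlonglongrightarrow> iexp (t * (0 * x))"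
        by (intro tendsto_intros LIMSEQ_inverse_real_of_nat)
      then show "(\<lambda>k. iexp (t * (inverse (Suc k) * x))) \<longlonglongrightarrow> 1" by simp
    qed
  qed (auto simp: int1 norm_mult simp del: of_real_inverse of_real_add of_real_power)
  also have "(\<integral>x. 1 * complex_of_real (inverse (1 + x\<^sup>2)) \<partial>lborel) = complex_of_real pi"
    by (simp only: mult_1 integral_complex_of_real cauchy_mass)
  finally have "\<forall>\<^sub>F k in sequentially. c k \<noteq> 0"
    by (rule tendsto_imp_eventually_ne) simp
  then obtain k where "c k \<noteq> 0" by (auto simp: eventually_sequentially)
  then show ?thesis using ceq[of k] by (intro exI[of _ "inverse (Suc k)"]) simp
qed

text \<open>For each frequency \<open>t\<close> a height \<open>y\<close> is picked at which the
  Cauchy factor does not vanish; cancelling it recovers the characteristic function.\<close>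

theorem stieltjes_unique:
  assumes M: "real_distribution M" and N: "real_distribution N"
    and eq: "\<And>w. Im w > 0 \<Longrightarrow> stieltjes M w = stieltjes N w"
  shows "M = N"
proof (rule Levy_uniqueness[OF M N], rule ext)
  fix t
  obtain y where y: "y > 0" and nz: "(\<integral>x. iexp (t * x) * complex_of_real (y / (x\<^sup>2 + y\<^sup>2)) \<partial>lborel) \<noteq> 0"
    using cauchy_density_fourier_nonzero[of t] by blast
  have "stieltjes M (Complex x y) = stieltjes N (Complex x y)" for x using eq y by simp
  then show "char M t = char N t"
    using real_distribution.stieltjes_fourier[OF M y, of t] real_distribution.stieltjes_fourier[OF N y, of t] nz
    by simp
qed

section \<open>The fixed point equation\<close>

text \<open>The integrand of the fixed point equation, with \<open>w = \<eta> + s\<close> and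
  \<open>r = |G - z|\<close>. It is the Stieltjes transform at \<open>w\<close> of the law with mass
  1/2 at each of \<open>r\<close> and \<open>- r\<close>.\<close>

definition pastur_kernel :: "complex \<Rightarrow> real \<Rightarrow> complex" where
  "pastur_kernel w r = w / (complex_of_real (r\<^sup>2) - w\<^sup>2)"

lemma of_real_diff_nonzero: "Im w > 0 \<Longrightarrow> complex_of_real t - w \<noteq> 0" "Im w > 0 \<Longrightarrow> complex_of_real t + w \<noteq> 0"
  by (auto simp: complex_eq_iff)

lemma square_diff_factor: "complex_of_real (r\<^sup>2) - w\<^sup>2 = (complex_of_real r - w) * (complex_of_real r + w)"
  by (simp add: power2_eq_square algebra_simps)

lemma square_diff_nonzero: "Im w > 0 \<Longrightarrow> complex_of_real (r\<^sup>2) - w\<^sup>2 \<noteq> 0"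
  unfolding square_diff_factor using of_real_diff_nonzero by simp

lemma pastur_kernel_split:
  assumes "Im w > 0"
  shows "pastur_kernel w r = (1 / (complex_of_real r - w) + 1 / (complex_of_real (- r) - w)) / 2"
proof -
  have nz: "complex_of_real r - w \<noteq> 0" "complex_of_real (- r) - w \<noteq> 0" "complex_of_real r + w \<noteq> 0"
    using of_real_diff_nonzero[OF assms] by blast+
  have "1 / (complex_of_real (- r) - w) = - (1 / (complex_of_real r + w))"
    using nz by (simp add: field_simps)
  then have "(1 / (complex_of_real r - w) + 1 / (complex_of_real (- r) - w)) / 2
    = (1 / (complex_of_real r - w) - 1 / (complex_of_real r + w)) / 2" by simp
  also have "1 / (complex_of_real r - w) - 1 / (complex_of_real r + w)
      = 2 * w / ((complex_of_real r - w) * (complex_of_real r + w))"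
    using nz(1,3) by (simp add: diff_frac_eq)
  finally show ?thesis unfolding pastur_kernel_def square_diff_factor by simp
qed

lemma cmod_pastur_kernel_le:
  assumes "Im w > 0"
  shows "cmod (pastur_kernel w r) \<le> 1 / Im w"
proof -
  have "cmod (pastur_kernel w r) \<le> (1 / Im w + 1 / Im w) / 2"
    unfolding pastur_kernel_split[OF assms] norm_divide
    using norm_triangle_mono[OF cmod_inverse_diff_le[OF assms, of r] cmod_inverse_diff_le[OF assms, of "- r"]]
    by simp
  then show ?thesis by simp
qed

text \<open>The mean of \<open>1 / |t - w|^2\<close> under the same two-point law: the imaginary
  part of the kernel divided by \<open>Im w\<close>, and a local Lipschitz constant in
  \<open>w\<close>.\<close>

definition pastur_weight :: "complex \<Rightarrow> real \<Rightarrow> real" where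
  "pastur_weight w r = (1 / (cmod (complex_of_real r - w))\<^sup>2 + 1 / (cmod (complex_of_real (- r) - w))\<^sup>2) / 2"

lemma Im_pastur_kernel:
  assumes "Im w > 0"
  shows "Im (pastur_kernel w r) = Im w * pastur_weight w r"
proof -
  have "Im (z / 2) = Im z / 2" for z by (simp add: Im_divide_numeral)
  then show ?thesis
    unfolding pastur_kernel_split[OF assms] pastur_weight_def
    by (simp only: plus_complex.sel Im_inverse_diff) (simp add: field_simps)
qed

text \<open>Each difference of two reciprocals is \<open>w - w'\<close> times a product; bounding
  the product by the mean of the squares keeps the weights at the two points, which the uniqueness
  argument compares with 1. A bound by imaginary parts alone would not give a contraction.\<close>

lemma pastur_kernel_diff:
  assumes w: "Im w > 0" and w': "Im w' > 0"
  shows "cmod (pastur_kernel w r - pastur_kernel w' r) \<le>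
    cmod (w - w') * ((pastur_weight w r + pastur_weight w' r) / 2)"
proof -
  have *: "cmod (1 / (complex_of_real t - w) - 1 / (complex_of_real t - w')) \<le> cmod (w - w') *
      ((1 / (cmod (complex_of_real t - w))\<^sup>2 + 1 / (cmod (complex_of_real t - w'))\<^sup>2) / 2)" for t
  proof -
    define a b where "a = complex_of_real t - w" and "b = complex_of_real t - w'"
    have nz: "a \<noteq> 0" "b \<noteq> 0"
      using of_real_diff_nonzero w w' by (auto simp: a_def b_def)
    have "1 / a - 1 / b = (w - w') * ((1 / a) * (1 / b))"
      using nz by (simp add: field_simps) (simp add: a_def b_def)
    then have "cmod (1 / a - 1 / b) = cmod (w - w') * ((1 / cmod a) * (1 / cmod b))"
      by (simp add: norm_mult norm_divide)
    also have "(1 / cmod a) * (1 / cmod b) \<le> ((1 / cmod a)\<^sup>2 + (1 / cmod b)\<^sup>2) / 2"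
      using sum_squares_bound[of "1 / cmod a" "1 / cmod b"] by simp
    finally show ?thesis unfolding a_def b_def by (simp add: power_divide mult_left_mono)
  qed
  have "pastur_kernel w r - pastur_kernel w' r =
    ((1 / (complex_of_real r - w) - 1 / (complex_of_real r - w')) +
     (1 / (complex_of_real (- r) - w) - 1 / (complex_of_real (- r) - w'))) / 2"
    unfolding pastur_kernel_split[OF w] pastur_kernel_split[OF w'] by (simp add: field_simps)
  then have "cmod (pastur_kernel w r - pastur_kernel w' r) \<le>
    (cmod (1 / (complex_of_real r - w) - 1 / (complex_of_real r - w')) +
     cmod (1 / (complex_of_real (- r) - w) - 1 / (complex_of_real (- r) - w'))) / 2"
    by (simp only: norm_divide) (simp add: norm_triangle_ineq del: of_real_minus)
  also have "\<dots> \<le> cmod (w - w') * ((pastur_weight w r + pastur_weight w' r) / 2)"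
    using *[of r] *[of "- r"] unfolding pastur_weight_def by argo
  finally show ?thesis .
qed

lemma pastur_weight_le:
  assumes "Im w > 0"
  shows "pastur_weight w r \<le> 1 / (Im w)\<^sup>2"
proof -
  have "1 / (cmod (complex_of_real t - w))\<^sup>2 \<le> 1 / (Im w)\<^sup>2" for t
    using power_mono[OF cmod_inverse_diff_le[OF assms, of t], of 2] by (simp add: norm_divide power_divide)
  from this[of r] this[of "- r"] show ?thesis by (simp add: pastur_weight_def del: of_real_minus)
qed

lemma pastur_weight_nonneg: "pastur_weight w r \<ge> 0"
  by (simp add: pastur_weight_def)

lemma borel_measurable_pastur[measurable]:
  "pastur_kernel w \<in> borel_measurable borel" "pastur_weight w \<in> borel_measurable borel"
  unfolding pastur_kernel_def pastur_weight_def by measurable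

lemma (in prob_space) integrable_pastur:
  assumes r: "r \<in> borel_measurable M" and w: "Im w > 0"
  shows "integrable M (\<lambda>g. pastur_kernel w (r g))" "integrable M (\<lambda>g. pastur_weight w (r g))"
proof -
  show "integrable M (\<lambda>g. pastur_kernel w (r g))"
    using cmod_pastur_kernel_le[OF w] r by (intro integrable_const_bound[where B = "1 / Im w"]) auto
  show "integrable M (\<lambda>g. pastur_weight w (r g))"
    using pastur_weight_le[OF w] pastur_weight_nonneg r
    by (intro integrable_const_bound[where B = "1 / (Im w)\<^sup>2"]) auto
qed

lemma (in prob_space) pastur_lipschitz:
  assumes r: "r \<in> borel_measurable M" and w: "Im w \<ge> v" and w': "Im w' \<ge> v" and v: "v > 0"
  shows "cmod ((\<integral>g. pastur_kernel w (r g) \<partial>M) - (\<integral>g. pastur_kernel w' (r g) \<partial>M)) \<le> cmod (w - w') / v\<^sup>2"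
proof -
  have w0: "Im w > 0" "Im w' > 0" using assms by auto
  have "cmod ((\<integral>g. pastur_kernel w (r g) \<partial>M) - (\<integral>g. pastur_kernel w' (r g) \<partial>M))
     = cmod (\<integral>g. pastur_kernel w (r g) - pastur_kernel w' (r g) \<partial>M)"
    by (subst Bochner_Integration.integral_diff) (use integrable_pastur[OF r] w0 in auto)
  also have "\<dots> \<le> (\<integral>g. cmod (w - w') / v\<^sup>2 \<partial>M)"
  proof (rule norm_integral_le)
    fix g
    have "1 / (Im w)\<^sup>2 \<le> 1 / v\<^sup>2" "1 / (Im w')\<^sup>2 \<le> 1 / v\<^sup>2"
      using w w' v by (auto intro!: frac_le power_mono)
    then have "pastur_weight w (r g) \<le> 1 / v\<^sup>2" "pastur_weight w' (r g) \<le> 1 / v\<^sup>2"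
      using pastur_weight_le[OF w0(1), of "r g"] pastur_weight_le[OF w0(2), of "r g"] by linarith+
    then have "cmod (w - w') * ((pastur_weight w (r g) + pastur_weight w' (r g)) / 2) \<le> cmod (w - w') * (1 / v\<^sup>2)"
      by (intro mult_left_mono) auto
    then show "cmod (pastur_kernel w (r g) - pastur_kernel w' (r g)) \<le> cmod (w - w') / v\<^sup>2"
      using order_trans[OF pastur_kernel_diff[OF w0, of "r g"]] by simp
  qed (use integrable_pastur[OF r] w0 in auto)
  finally show ?thesis by (simp add: prob_space)
qed

text \<open>If both points solve the equation then, by the formula for the imaginary part, the Lipschitz
  constant between them is the average of two numbers below one.\<close>
lemma (in prob_space) pastur_fixed_point_unique:
  assumes r: "r \<in> borel_measurable M" and \<eta>: "Im \<eta> > 0"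
    and s: "Im s \<ge> 0" "s = (\<integral>g. pastur_kernel (\<eta> + s) (r g) \<partial>M)"
    and s': "Im s' \<ge> 0" "s' = (\<integral>g. pastur_kernel (\<eta> + s') (r g) \<partial>M)"
  shows "s = s'"
proof (rule ccontr)
  assume ne: "s \<noteq> s'"
  have lt: "(\<integral>g. pastur_weight (\<eta> + u) (r g) \<partial>M) < 1"
    if u: "Im u \<ge> 0" "u = (\<integral>g. pastur_kernel (\<eta> + u) (r g) \<partial>M)" for u
  proof -
    have w: "Im (\<eta> + u) > 0" using u \<eta> by simp
    have "Im u = Im (\<integral>g. pastur_kernel (\<eta> + u) (r g) \<partial>M)" using u(2) by simp
    also have "\<dots> = (\<integral>g. Im (pastur_kernel (\<eta> + u) (r g)) \<partial>M)"
      by (rule integral_Im[symmetric]) (rule integrable_pastur[OF r w])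
    also have "\<dots> = (Im \<eta> + Im u) * (\<integral>g. pastur_weight (\<eta> + u) (r g) \<partial>M)"
      by (simp add: Im_pastur_kernel[OF w])
    finally have *: "Im u = (Im \<eta> + Im u) * (\<integral>g. pastur_weight (\<eta> + u) (r g) \<partial>M)" .
    show ?thesis
    proof (rule ccontr)
      assume "\<not> ?thesis"
      then have "(Im \<eta> + Im u) * 1 \<le> (Im \<eta> + Im u) * (\<integral>g. pastur_weight (\<eta> + u) (r g) \<partial>M)"
        using \<eta> u(1) by (intro mult_left_mono) auto
      then show False using * \<eta> by simp
    qed
  qed
  have w: "Im (\<eta> + s) > 0" "Im (\<eta> + s') > 0" using s s' \<eta> by auto
  note int = integrable_pastur[OF r w(1)] integrable_pastur[OF r w(2)]
  have "cmod (s - s') = cmod (\<integral>g. pastur_kernel (\<eta> + s) (r g) - pastur_kernel (\<eta> + s') (r g) \<partial>M)"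
    by (subst Bochner_Integration.integral_diff) (use int s(2) s'(2) in auto)
  also have "\<dots> \<le> (\<integral>g. cmod (s - s') * ((pastur_weight (\<eta> + s) (r g) + pastur_weight (\<eta> + s') (r g)) / 2) \<partial>M)"
  proof (rule norm_integral_le)
    show "cmod (pastur_kernel (\<eta> + s) (r g) - pastur_kernel (\<eta> + s') (r g)) \<le>
        cmod (s - s') * ((pastur_weight (\<eta> + s) (r g) + pastur_weight (\<eta> + s') (r g)) / 2)" for g
      using pastur_kernel_diff[OF w, of "r g"] by simp
  qed (use int in auto)
  also have "\<dots> = cmod (s - s') *
     (((\<integral>g. pastur_weight (\<eta> + s) (r g) \<partial>M) + (\<integral>g. pastur_weight (\<eta> + s') (r g) \<partial>M)) / 2)"
    using int by simp
  also have "\<dots> < cmod (s - s') * 1"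
    using lt[OF s] lt[OF s'] ne by (intro mult_strict_left_mono) auto
  finally show False by simp
qed


lemma (in real_distribution) stieltjes_lipschitz:
  assumes w: "Im w \<ge> v" and w': "Im w' \<ge> v" and v: "v > 0"
  shows "cmod (stieltjes M w - stieltjes M w') \<le> cmod (w - w') / v\<^sup>2"
proof -
  have w0: "Im w > 0" "Im w' > 0" using assms by auto
  note int = integrable_inverse_diff[OF w0(1)] integrable_inverse_diff[OF w0(2)]
  have "cmod (stieltjes M w - stieltjes M w') =
      cmod (\<integral>t. 1 / (complex_of_real t - w) - 1 / (complex_of_real t - w') \<partial>M)"
    unfolding stieltjes_def by (subst Bochner_Integration.integral_diff) (use int in auto)
  also have "\<dots> \<le> (\<integral>t. cmod (w - w') / v\<^sup>2 \<partial>M)"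
  proof (rule norm_integral_le)
    fix t
    have nz: "complex_of_real t - w \<noteq> 0" "complex_of_real t - w' \<noteq> 0"
      using of_real_diff_nonzero w0 by auto
    have b: "cmod (1 / (complex_of_real t - w)) \<le> 1 / v" "cmod (1 / (complex_of_real t - w')) \<le> 1 / v"
      using cmod_inverse_diff_le[OF w0(1), of t] cmod_inverse_diff_le[OF w0(2), of t] w w' v
      by (auto elim!: order_trans intro!: frac_le)
    have "1 / (complex_of_real t - w) - 1 / (complex_of_real t - w') =
        (w - w') * ((1 / (complex_of_real t - w)) * (1 / (complex_of_real t - w')))"
      using nz by (simp add: diff_frac_eq)
    then have "cmod (1 / (complex_of_real t - w) - 1 / (complex_of_real t - w')) =
        cmod (w - w') * (cmod (1 / (complex_of_real t - w)) * cmod (1 / (complex_of_real t - w')))"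
      by (simp only: norm_mult)
    also have "\<dots> \<le> cmod (w - w') * (1 / v * (1 / v))"
      using b v by (intro mult_left_mono mult_mono) auto
    finally show "cmod (1 / (complex_of_real t - w) - 1 / (complex_of_real t - w')) \<le> cmod (w - w') / v\<^sup>2"
      by (simp add: power2_eq_square)
  qed (use int in auto)
  finally show ?thesis using prob_space by simp
qed

text \<open>The real part of \<open>1 + \<i> y S(\<i> y)\<close> is the integral of
  \<open>t^2 / (t^2 + y^2)\<close>, and this integrand is at least 1/2 where
  \<open>|t| >= y\<close>.\<close>

lemma (in real_distribution) tail_le_stieltjes:
  assumes y: "y > 0"
  shows "measure M {t. y \<le> \<bar>t\<bar>} \<le> 2 * cmod (1 + \<i> * y * stieltjes M (\<i> * y))"
proof -
  have "Im (\<i> * complex_of_real y) > 0" using y by simp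
  note int0 = integrable_inverse_diff[OF this]
  define h where "h = (\<lambda>t. 1 / (complex_of_real t - \<i> * y))"
  define f where "f = (\<lambda>t::real. t\<^sup>2 / (t\<^sup>2 + y\<^sup>2))"
  have int: "integrable M (\<lambda>t. 1 + \<i> * y * h t)"
    using int0 unfolding h_def[symmetric] by simp
  have "(\<integral>t. 1 + \<i> * y * h t \<partial>M) = 1 + \<i> * y * (\<integral>t. h t \<partial>M)"
    using int0 prob_space unfolding h_def[symmetric] by simp
  then have eq: "1 + \<i> * y * stieltjes M (\<i> * y) = (\<integral>t. 1 + \<i> * y * h t \<partial>M)"
    by (simp add: stieltjes_def h_def)
  have D: "t\<^sup>2 + y\<^sup>2 > 0" for t :: real using y by (simp add: add_nonneg_pos)
  have Re_eq: "Re (1 + \<i> * y * h t) = f t" for t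
  proof -
    have "Re (1 + \<i> * y * h t) = 1 - y * (y / (t\<^sup>2 + y\<^sup>2))"
      by (simp add: h_def Im_divide Re_divide)
    also have "\<dots> = (t\<^sup>2 + y\<^sup>2) / (t\<^sup>2 + y\<^sup>2) - y\<^sup>2 / (t\<^sup>2 + y\<^sup>2)"
      unfolding divide_self[OF less_imp_neq[OF D[of t], symmetric]] by (simp add: power2_eq_square)
    also have "\<dots> = f t" unfolding f_def diff_divide_distrib[symmetric] by simp
    finally show ?thesis .
  qed
  have f0: "0 \<le> f t" "f t \<le> 1" for t using D[of t] by (auto simp: f_def divide_simps)
  have le: "indicator {t. y \<le> \<bar>t\<bar>} t \<le> 2 * f t" for t
  proof (cases "y \<le> \<bar>t\<bar>")
    case True
    then have "y\<^sup>2 \<le> t\<^sup>2" using y by (metis abs_le_square_iff abs_of_pos)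
    then show ?thesis using True D[of t] by (simp add: f_def field_simps)
  qed (simp add: f0)
  have int2: "integrable M f"
    using f0 by (intro integrable_const_bound[where B = 1]) (auto simp: f_def[abs_def])
  have "measure M {t. y \<le> \<bar>t\<bar>} = (\<integral>t. indicator {t. y \<le> \<bar>t\<bar>} t \<partial>M)"
    by simp
  also have "\<dots> \<le> (\<integral>t. 2 * f t \<partial>M)"
    using int2 le by (intro integral_mono) (auto intro!: integrable_real_indicator simp: emeasure_eq_measure)
  also have "\<dots> = 2 * (\<integral>t. f t \<partial>M)" by simp
  also have "(\<integral>t. f t \<partial>M) = Re (1 + \<i> * y * stieltjes M (\<i> * y))"
    unfolding eq integral_Re[OF int, symmetric] by (simp only: Re_eq)
  also have "\<dots> \<le> cmod (1 + \<i> * y * stieltjes M (\<i> * y))" by (rule complex_Re_le_cmod)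
  finally show ?thesis by simp
qed

lemma (in real_distribution) tail_small:
  assumes "\<epsilon> > 0"
  shows "\<exists>k::nat. measure M {t. real k \<le> \<bar>t\<bar>} < \<epsilon>"
proof -
  have "(\<lambda>k. measure M {t. real k \<le> \<bar>t\<bar>}) \<longlonglongrightarrow> measure M (\<Inter>k. {t. real k \<le> \<bar>t\<bar>})"
    by (rule finite_Lim_measure_decseq) (auto simp: decseq_def)
  also have "(\<Inter>k. {t. real k \<le> \<bar>t\<bar>}) = {}"
  proof -
    have "\<exists>k. x \<notin> {t. real k \<le> \<bar>t\<bar>}" for x
      using reals_Archimedean2[of "\<bar>x\<bar>"] by (simp add: not_le)
    then show ?thesis by blast
  qed
  finally have "(\<lambda>k. measure M {t. real k \<le> \<bar>t\<bar>}) \<longlonglongrightarrow> 0" by simp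
  then have "\<forall>\<^sub>F k in sequentially. measure M {t. real k \<le> \<bar>t\<bar>} < \<epsilon>"
    using assms by (rule order_tendstoD)
  then show ?thesis by (auto simp: eventually_sequentially)
qed

text \<open>With \<open>w = \<i> y + s\<close>, the left side is the modulus of the mean of
  \<open>r^2 / (r^2 - w^2)\<close>. Since \<open>|s| <= 1 / y\<close>, one has
  \<open>(Re s)^2 <= 1\<close> and \<open>Im w >= y\<close>, so the denominator has modulus at least
  \<open>r^2 + y^2 - 1\<close>. The bound involves only the law of \<open>r\<close>, hence is
  uniform over all admissible \<open>s\<close>.\<close>

lemma (in prob_space) pastur_at_infinity:
  assumes r: "r \<in> borel_measurable M" and y: "y \<ge> 2" and s: "cmod s \<le> 1 / y" "Im s \<ge> 0"
  shows "cmod (1 + (\<i> * y + s) * (\<integral>g. pastur_kernel (\<i> * y + s) (r g) \<partial>M))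
    \<le> (\<integral>g. (r g)\<^sup>2 / ((r g)\<^sup>2 + y\<^sup>2 - 1) \<partial>M)"
proof -
  define w where "w = \<i> * y + s"
  have w: "Im w > 0" using y s by (simp add: w_def)
  have y1: "y\<^sup>2 \<ge> 4" using power_mono[of 2 y 2] y by simp
  define F where "F g = (r g)\<^sup>2 / ((r g)\<^sup>2 + y\<^sup>2 - 1)" for g
  note int = integrable_pastur(1)[OF r w]
  have b0: "0 \<le> (r g)\<^sup>2 / ((r g)\<^sup>2 + y\<^sup>2 - 1)" "(r g)\<^sup>2 / ((r g)\<^sup>2 + y\<^sup>2 - 1) \<le> 1" for g
  proof -
    have "(r g)\<^sup>2 + y\<^sup>2 - 1 > 0" using y1 zero_le_power2[of "r g"] by linarith
    then show "0 \<le> (r g)\<^sup>2 / ((r g)\<^sup>2 + y\<^sup>2 - 1)" "(r g)\<^sup>2 / ((r g)\<^sup>2 + y\<^sup>2 - 1) \<le> 1"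
      using y1 by (auto simp: divide_simps)
  qed
  have "1 + w * (\<integral>g. pastur_kernel w (r g) \<partial>M) = (\<integral>g. 1 + w * pastur_kernel w (r g) \<partial>M)"
    by (subst Bochner_Integration.integral_add) (use int prob_space in auto)
  also have "cmod \<dots> \<le> (\<integral>g. (r g)\<^sup>2 / ((r g)\<^sup>2 + y\<^sup>2 - 1) \<partial>M)"
  proof (rule norm_integral_le)
    show "integrable M (\<lambda>g. (r g)\<^sup>2 / ((r g)\<^sup>2 + y\<^sup>2 - 1))"
      unfolding F_def[symmetric]
    proof (rule integrable_const_bound[where B = 1])
      show "F \<in> borel_measurable M" unfolding F_def using r by measurable
      show "AE g in M. norm (F g) \<le> 1" using b0[folded F_def] by simp
    qed
    fix g
    have "1 + w * pastur_kernel w (r g) = complex_of_real ((r g)\<^sup>2) / (complex_of_real ((r g)\<^sup>2) - w\<^sup>2)"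
      using square_diff_nonzero[OF w, of "r g"]
      by (simp add: pastur_kernel_def field_simps power2_eq_square)
    then have eq: "cmod (1 + w * pastur_kernel w (r g)) = (r g)\<^sup>2 / cmod (complex_of_real ((r g)\<^sup>2) - w\<^sup>2)"
      by (simp add: norm_divide norm_power)
    have "1 / y \<le> 1" using y by simp
    then have "\<bar>Re s\<bar> \<le> 1" using abs_Re_le_cmod[of s] s(1) by linarith
    then have "(Re s)\<^sup>2 \<le> 1" by (simp add: abs_square_le_1)
    moreover have "y\<^sup>2 \<le> (y + Im s)\<^sup>2" using s y by (intro power_mono) auto
    ultimately have "(r g)\<^sup>2 + y\<^sup>2 - 1 \<le> Re (complex_of_real ((r g)\<^sup>2) - w\<^sup>2)"
      by (simp add: w_def Re_power2)
    also have "\<dots> \<le> cmod (complex_of_real ((r g)\<^sup>2) - w\<^sup>2)" by (rule complex_Re_le_cmod)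
    finally show "cmod (1 + w * pastur_kernel w (r g)) \<le> (r g)\<^sup>2 / ((r g)\<^sup>2 + y\<^sup>2 - 1)"
      unfolding eq using y1 zero_le_power2[of "r g"] by (intro frac_le) linarith+
  qed (use int in auto)
  finally show ?thesis unfolding w_def .
qed

lemma (in prob_space) pastur_at_infinity_tendsto:
  assumes [measurable]: "r \<in> borel_measurable M"
  shows "(\<lambda>k. \<integral>g. (r g)\<^sup>2 / ((r g)\<^sup>2 + (real (k + 2))\<^sup>2 - 1) \<partial>M) \<longlonglongrightarrow> 0"
proof -
  have "(\<lambda>k. \<integral>g. (r g)\<^sup>2 / ((r g)\<^sup>2 + (real (k + 2))\<^sup>2 - 1) \<partial>M) \<longlonglongrightarrow> (\<integral>g. 0 \<partial>M)"
  proof (rule integral_dominated_convergence[where w = "\<lambda>_. 1"])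
    show "AE g in M. (\<lambda>k. (r g)\<^sup>2 / ((r g)\<^sup>2 + (real (k + 2))\<^sup>2 - 1)) \<longlonglongrightarrow> 0"
    proof (rule AE_I2)
      fix g
      have "filterlim (\<lambda>k. c + (real (k + 2))\<^sup>2 - 1) at_top sequentially" for c :: real by real_asymp
      then show "(\<lambda>k. (r g)\<^sup>2 / ((r g)\<^sup>2 + (real (k + 2))\<^sup>2 - 1)) \<longlonglongrightarrow> 0"
        by (intro real_tendsto_divide_at_top[OF tendsto_const])
    qed
    fix k :: nat
    have 4: "(real (k + 2))\<^sup>2 \<ge> 4" using power_mono[of 2 "real (k + 2)" 2] by simp
    show "AE g in M. norm ((r g)\<^sup>2 / ((r g)\<^sup>2 + (real (k + 2))\<^sup>2 - 1)) \<le> 1"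
    proof (rule AE_I2)
      fix g
      have "(r g)\<^sup>2 + (real (k + 2))\<^sup>2 - 1 > 0" "(r g)\<^sup>2 \<le> (r g)\<^sup>2 + (real (k + 2))\<^sup>2 - 1"
        using 4 zero_le_power2[of "r g"] by linarith+
      then show "norm ((r g)\<^sup>2 / ((r g)\<^sup>2 + (real (k + 2))\<^sup>2 - 1)) \<le> 1"
        by (simp add: divide_simps)
    qed
  qed auto
  then show ?thesis by simp
qed

text \<open>Countable, so that almost sure statements for each \<open>\<eta>\<close> hold for all of
  them simultaneously; it contains \<open>\<i> k\<close> for positive integers \<open>k\<close>,
  which the tightness argument uses.\<close>

definition rational_upper :: "complex set" where
  "rational_upper = {w. Im w > 0 \<and> Re w \<in> \<rat> \<and> Im w \<in> \<rat>}"

lemma countable_rational_upper: "countable rational_upper"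
proof -
  have "rational_upper \<subseteq> (\<lambda>(a, b). Complex a b) ` (\<rat> \<times> \<rat>)"
  proof
    fix w assume "w \<in> rational_upper"
    then have "(Re w, Im w) \<in> \<rat> \<times> \<rat>" by (simp add: rational_upper_def)
    then have "(\<lambda>(a, b). Complex a b) (Re w, Im w) \<in> (\<lambda>(a, b). Complex a b) ` (\<rat> \<times> \<rat>)" by (rule imageI)
    then show "w \<in> (\<lambda>(a, b). Complex a b) ` (\<rat> \<times> \<rat>)" by simp
  qed
  then show ?thesis
    by (rule countable_subset) (intro countable_image countable_SIGMA countable_rat)
qed

text \<open>The approximants keep imaginary part at least \<open>Im w\<close>, so Lipschitz bounds
  with constant \<open>1 / (Im w)^2\<close> apply along the whole sequence.\<close>

lemma rational_upper_dense:
  assumes "Im w > 0"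
  shows "\<exists>u. (\<forall>k. u k \<in> rational_upper \<and> Im (u k) \<ge> Im w) \<and> u \<longlonglongrightarrow> w"
proof -
  define q where "q x k = (SOME q. q \<in> \<rat> \<and> x < q \<and> q < x + inverse (Suc k))" for x :: real and k :: nat
  have ex: "\<exists>q. q \<in> \<rat> \<and> x < q \<and> q < x + inverse (Suc k)" for x :: real and k
    using Rats_dense_in_real[of x "x + inverse (Suc k)"] by (auto simp del: of_nat_Suc)
  have q: "q x k \<in> \<rat>" "x < q x k" "q x k < x + inverse (Suc k)" for x :: real and k :: nat
    unfolding q_def using someI_ex[OF ex[of x k]] by blast+
  have lim: "(\<lambda>k. q x k) \<longlonglongrightarrow> x" for x
  proof (rule tendsto_sandwich[of "\<lambda>_. x" _ _ "\<lambda>k. x + inverse (Suc k)"])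
    show "(\<lambda>k. x + inverse (Suc k)) \<longlonglongrightarrow> x"
      using tendsto_add[OF tendsto_const LIMSEQ_inverse_real_of_nat] by simp
  qed (use q in \<open>auto intro!: always_eventually less_imp_le\<close>)
  have "(\<lambda>k. Complex (q (Re w) k) (q (Im w) k)) \<longlonglongrightarrow> Complex (Re w) (Im w)"
    by (intro tendsto_Complex lim)
  moreover have "Complex (q (Re w) k) (q (Im w) k) \<in> rational_upper" "Im (Complex (q (Re w) k) (q (Im w) k)) \<ge> Im w" for k
    using q assms less_trans[OF assms q(2)] by (auto simp: rational_upper_def intro: less_imp_le)
  ultimately show ?thesis by (intro exI[of _ "\<lambda>k. Complex (q (Re w) k) (q (Im w) k)"]) simp
qed

text \<open>Mass cannot escape: a point \<open>s\<close> with \<open>s = \<Phi> (\<i> y + s)\<close> satisfies \<open>\<i> y s \<rightarrow> -1\<close> as \<open>y \<rightarrow> \<infinity>\<close>.\<close>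
lemma (in prob_space) tight_of_approx_pastur:
  assumes r: "r \<in> borel_measurable M"
    and \<mu>: "\<And>n. real_distribution (\<mu> n)"
    and conv: "\<And>\<eta>. \<eta> \<in> rational_upper \<Longrightarrow>
      (\<lambda>n. stieltjes (\<mu> n) \<eta> - (\<integral>g. pastur_kernel (\<eta> + stieltjes (\<mu> n) \<eta>) (r g) \<partial>M)) \<longlonglongrightarrow> 0"
  shows "tight \<mu>"
  unfolding tight_def
proof (intro conjI allI impI)
  show "real_distribution (\<mu> n)" for n by (rule \<mu>)
  fix \<epsilon> :: real assume \<epsilon>: "\<epsilon> > 0"
  have "(\<lambda>k. (\<integral>g. (r g)\<^sup>2 / ((r g)\<^sup>2 + (real (k + 2))\<^sup>2 - 1) \<partial>M) + 1 / (real (k + 2))\<^sup>2) \<longlonglongrightarrow> 0 + 0"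
    by (rule tendsto_add[OF pastur_at_infinity_tendsto[OF r]]) real_asymp
  then have "\<forall>\<^sub>F k in sequentially. (\<integral>g. (r g)\<^sup>2 / ((r g)\<^sup>2 + (real (k + 2))\<^sup>2 - 1) \<partial>M) + 1 / (real (k + 2))\<^sup>2 < \<epsilon> / 4"
    by (rule order_tendstoD) (use \<epsilon> in simp)
  then obtain k where k: "(\<integral>g. (r g)\<^sup>2 / ((r g)\<^sup>2 + (real (k + 2))\<^sup>2 - 1) \<partial>M) + 1 / (real (k + 2))\<^sup>2 < \<epsilon> / 4"
    by (auto simp: eventually_sequentially)
  \<comment> \<open>An integer height keeps \<open>\<i> y\<close> in \<open>rational_upper\<close>;
    the shift by 2 gives \<open>y >= 2\<close>.\<close>
  define y where "y = real (k + 2)"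
  have y: "y \<ge> 2" by (simp add: y_def)
  define \<eta> where "\<eta> = \<i> * complex_of_real y"
  have "\<eta> \<in> rational_upper" using y by (simp add: rational_upper_def \<eta>_def y_def)
  have Im\<eta>: "Im \<eta> = y" by (simp add: \<eta>_def)
  define S where "S = (\<lambda>n. stieltjes (\<mu> n) \<eta>)"
  define F where "F = (\<lambda>n. \<integral>g. pastur_kernel (\<eta> + S n) (r g) \<partial>M)"
  have S: "cmod (S n) \<le> 1 / y" "Im (S n) \<ge> 0" for n
    using real_distribution.cmod_stieltjes_le[OF \<mu>, of \<eta> n] real_distribution.Im_stieltjes_nonneg[OF \<mu>, of \<eta> n] y
    by (simp_all add: S_def Im\<eta>)
  have "(\<lambda>n. (y + 1) * cmod (S n - F n)) \<longlonglongrightarrow> (y + 1) * cmod 0"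
    unfolding S_def F_def by (intro tendsto_intros conv \<open>\<eta> \<in> rational_upper\<close>)
  then have "\<forall>\<^sub>F n in sequentially. (y + 1) * cmod (S n - F n) < \<epsilon> / 4"
    by (rule order_tendstoD) (use \<epsilon> in simp)
  then obtain N where N: "\<And>n. n \<ge> N \<Longrightarrow> (y + 1) * cmod (S n - F n) < \<epsilon> / 4"
    by (auto simp: eventually_sequentially)
  have big: "measure (\<mu> n) {t. y \<le> \<bar>t\<bar>} < \<epsilon>" if n: "n \<ge> N" for n
  proof -
    \<comment> \<open>Write \<open>S\<close> as \<open>F + (S - F)\<close>: the main term is
      controlled by the law of \<open>r\<close> at height \<open>y\<close>, the second by the
      hypothesis \<open>conv\<close>, and the last by \<open>|S|^2 <= 1 / y^2\<close>.\<close>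
    have "1 + \<eta> * S n = (1 + (\<eta> + S n) * F n) + (\<eta> + S n) * (S n - F n) - S n * S n"
      by (simp add: algebra_simps)
    moreover have "cmod (x + x' - x'') \<le> cmod x + cmod x' + cmod x''" for x x' x'' :: complex
      using norm_triangle_ineq4[of "x + x'" x''] norm_triangle_ineq[of x x'] by linarith
    ultimately have "cmod (1 + \<eta> * S n) \<le> cmod (1 + (\<eta> + S n) * F n) + cmod ((\<eta> + S n) * (S n - F n)) + cmod (S n * S n)"
      by metis
    also have "cmod (1 + (\<eta> + S n) * F n) \<le> (\<integral>g. (r g)\<^sup>2 / ((r g)\<^sup>2 + y\<^sup>2 - 1) \<partial>M)"
      unfolding F_def \<eta>_def by (rule pastur_at_infinity[OF r y S])
    also have "cmod ((\<eta> + S n) * (S n - F n)) \<le> (y + 1) * cmod (S n - F n)"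
    proof -
      have "cmod (\<eta> + S n) \<le> y + 1 / y"
        using norm_triangle_ineq[of \<eta> "S n"] S(1)[of n] y by (simp add: \<eta>_def norm_mult)
      also have "\<dots> \<le> y + 1" using y by simp
      finally show ?thesis by (simp add: norm_mult mult_right_mono)
    qed
    also have "cmod (S n * S n) \<le> 1 / y\<^sup>2"
      using mult_mono[OF S(1) S(1)] y by (simp add: norm_mult power2_eq_square)
    finally have "cmod (1 + \<eta> * S n) < \<epsilon> / 2" using k N[OF n] by (simp add: y_def)
    then show ?thesis
      using real_distribution.tail_le_stieltjes[OF \<mu>, of y n] y by (simp add: \<eta>_def S_def)
  qed
  \<comment> \<open>The estimate \<open>big\<close> covers \<open>n >= N\<close>; the finitely many
    remaining laws are tight one by one.\<close>
  have "\<forall>n. \<exists>k::nat. measure (\<mu> n) {t. real k \<le> \<bar>t\<bar>} < \<epsilon>"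
    using real_distribution.tail_small[OF \<mu> \<epsilon>] by blast
  from choice[OF this] obtain b :: "nat \<Rightarrow> nat" where b: "measure (\<mu> n) {t. real (b n) \<le> \<bar>t\<bar>} < \<epsilon>" for n
    by blast
  define a where "a = y + (\<Sum>n<N. real (b n))"
  have a: "a > 0" "y \<le> a" using y by (auto simp: a_def intro!: add_pos_nonneg sum_nonneg)
  have ba: "real (b n) \<le> a" if "n < N" for n
    using member_le_sum[of n "{..<N}" "\<lambda>n. real (b n)"] that y by (simp add: a_def)
  have "measure (\<mu> n) {- (a + 1)<..a + 1} > 1 - \<epsilon>" for n
  proof -
    interpret \<mu>: real_distribution "\<mu> n" by (rule \<mu>)
    have "measure (\<mu> n) {t. a \<le> \<bar>t\<bar>} < \<epsilon>"
    proof (cases "n < N")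
      case True
      have "measure (\<mu> n) {t. a \<le> \<bar>t\<bar>} \<le> measure (\<mu> n) {t. real (b n) \<le> \<bar>t\<bar>}"
        using ba[OF True] by (intro \<mu>.finite_measure_mono) auto
      then show ?thesis using b[of n] by linarith
    next
      case False
      have "measure (\<mu> n) {t. a \<le> \<bar>t\<bar>} \<le> measure (\<mu> n) {t. y \<le> \<bar>t\<bar>}"
        using a by (intro \<mu>.finite_measure_mono) auto
      then show ?thesis using big[of n] False by linarith
    qed
    moreover have "measure (\<mu> n) (space (\<mu> n) - {- (a + 1)<..a + 1}) \<le> measure (\<mu> n) {t. a \<le> \<bar>t\<bar>}"
      by (intro \<mu>.finite_measure_mono) auto
    moreover have "measure (\<mu> n) (space (\<mu> n) - {- (a + 1)<..a + 1}) = 1 - measure (\<mu> n) {- (a + 1)<..a + 1}"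
      by (rule \<mu>.prob_compl) simp
    ultimately show ?thesis by linarith
  qed
  then show "\<exists>a b. a < b \<and> (\<forall>n. 1 - \<epsilon> < measure (\<mu> n) {a<..b})"
    using a by (intro exI[of _ "- (a + 1)"] exI[of _ "a + 1"]) auto
qed

lemma weak_conv_stieltjes:
  assumes \<mu>: "\<And>n. real_distribution (\<mu> n)" and \<nu>: "real_distribution \<nu>" and w: "weak_conv_m \<mu> \<nu>"
    and \<eta>: "Im \<eta> > 0"
  shows "(\<lambda>n. stieltjes (\<mu> n) \<eta>) \<longlonglongrightarrow> stieltjes \<nu> \<eta>"
  unfolding stieltjes_def
proof (rule weak_conv_imp_integral_bdd_continuous_conv[OF \<mu> \<nu> w])
  show "isCont (\<lambda>t. 1 / (complex_of_real t - \<eta>)) t" for t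
    using of_real_diff_nonzero(1)[OF \<eta>, of t] by (intro continuous_intros) auto
  show "cmod (1 / (complex_of_real t - \<eta>)) \<le> 1 / Im \<eta>" for t
    by (rule cmod_inverse_diff_le[OF \<eta>])
qed

text \<open>Tightness provides subsequential limits, each of which solves the exact equation;
  uniqueness of the solution at every \<open>\<eta>\<close> makes them all equal, so the whole
  sequence converges.\<close>

theorem (in prob_space) approx_pastur_weak_limit:
  assumes r: "r \<in> borel_measurable M"
    and \<mu>: "\<And>n. real_distribution (\<mu> n)"
    and conv: "\<And>\<eta>. \<eta> \<in> rational_upper \<Longrightarrow>
      (\<lambda>n. stieltjes (\<mu> n) \<eta> - (\<integral>g. pastur_kernel (\<eta> + stieltjes (\<mu> n) \<eta>) (r g) \<partial>M)) \<longlonglongrightarrow> 0"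
  shows "\<exists>\<nu>. real_distribution \<nu> \<and> weak_conv_m \<mu> \<nu> \<and>
    (\<forall>\<eta>. Im \<eta> > 0 \<longrightarrow> stieltjes \<nu> \<eta> = (\<integral>g. pastur_kernel (\<eta> + stieltjes \<nu> \<eta>) (r g) \<partial>M))"
proof -
  define \<Phi> where "\<Phi> = (\<lambda>w. \<integral>g. pastur_kernel w (r g) \<partial>M)"
  note tight = tight_of_approx_pastur[OF r \<mu> conv]
  have eq: "stieltjes \<nu> \<eta> = \<Phi> (\<eta> + stieltjes \<nu> \<eta>)"
    if s: "strict_mono s" and \<nu>: "real_distribution \<nu>" and w: "weak_conv_m (\<mu> \<circ> s) \<nu>" and \<eta>: "Im \<eta> > 0"
    for s :: "nat \<Rightarrow> nat" and \<nu> \<eta>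
  proof -
    interpret \<nu>: real_distribution \<nu> by (rule \<nu>)
    have rat: "stieltjes \<nu> u - \<Phi> (u + stieltjes \<nu> u) = 0" if u: "u \<in> rational_upper" for u
    proof -
      have u0: "Im u > 0" using u by (simp add: rational_upper_def)
      define S where "S = (\<lambda>n. stieltjes (\<mu> (s n)) u)"
      have lim: "S \<longlonglongrightarrow> stieltjes \<nu> u"
        using weak_conv_stieltjes[OF _ \<nu> w u0] \<mu> by (simp add: S_def)
      have Im: "Im (u + S n) \<ge> Im u" "Im (u + stieltjes \<nu> u) \<ge> Im u" for n
        using real_distribution.Im_stieltjes_nonneg[OF \<mu> u0, of "s n"] \<nu>.Im_stieltjes_nonneg[OF u0]
        by (auto simp: S_def)
      have "(\<lambda>n. \<Phi> (u + S n)) \<longlonglongrightarrow> \<Phi> (u + stieltjes \<nu> u)"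
      proof (rule metric_tendsto_imp_tendsto)
        show "(\<lambda>n. S n / (Im u)\<^sup>2) \<longlonglongrightarrow> stieltjes \<nu> u / (Im u)\<^sup>2"
          using lim u0 by (intro tendsto_intros) auto
        have "dist (\<Phi> (u + S n)) (\<Phi> (u + stieltjes \<nu> u)) \<le> dist (S n / (Im u)\<^sup>2) (stieltjes \<nu> u / (Im u)\<^sup>2)" for n
          using pastur_lipschitz[OF r Im u0, of n]
          by (simp add: \<Phi>_def dist_norm diff_divide_distrib[symmetric] norm_divide norm_power)
        then show "\<forall>\<^sub>F n in sequentially. dist (\<Phi> (u + S n)) (\<Phi> (u + stieltjes \<nu> u))
            \<le> dist (S n / (Im u)\<^sup>2) (stieltjes \<nu> u / (Im u)\<^sup>2)" by simp
      qed
      with lim have "(\<lambda>n. S n - \<Phi> (u + S n)) \<longlonglongrightarrow> stieltjes \<nu> u - \<Phi> (u + stieltjes \<nu> u)"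
        by (intro tendsto_diff)
      moreover have "(\<lambda>n. S n - \<Phi> (u + S n)) \<longlonglongrightarrow> 0"
        using LIMSEQ_subseq_LIMSEQ[OF conv[OF u] s] by (simp add: S_def \<Phi>_def o_def)
      ultimately show ?thesis by (rule LIMSEQ_unique)
    qed
    \<comment> \<open>So far the equation holds at rational points only; both sides are Lipschitz
      above height \<open>Im \<eta>\<close>, so it extends to every \<open>\<eta>\<close>.\<close>
    obtain u where u: "\<And>k. u k \<in> rational_upper" "\<And>k. Im (u k) \<ge> Im \<eta>" "u \<longlonglongrightarrow> \<eta>"
      using rational_upper_dense[OF \<eta>] by blast
    have u0: "Im (u k) > 0" for k using u(2)[of k] \<eta> by linarith
    have l1: "(\<lambda>k. stieltjes \<nu> (u k)) \<longlonglongrightarrow> stieltjes \<nu> \<eta>"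
    proof (rule metric_tendsto_imp_tendsto)
      show "(\<lambda>k. u k / (Im \<eta>)\<^sup>2) \<longlonglongrightarrow> \<eta> / (Im \<eta>)\<^sup>2" using u(3) \<eta> by (intro tendsto_intros) auto
      show "\<forall>\<^sub>F k in sequentially. dist (stieltjes \<nu> (u k)) (stieltjes \<nu> \<eta>) \<le> dist (u k / (Im \<eta>)\<^sup>2) (\<eta> / (Im \<eta>)\<^sup>2)"
        using \<nu>.stieltjes_lipschitz[OF u(2) order_refl \<eta>]
        by (simp add: dist_norm diff_divide_distrib[symmetric] norm_divide norm_power)
    qed
    have l2: "(\<lambda>k. \<Phi> (u k + stieltjes \<nu> (u k))) \<longlonglongrightarrow> \<Phi> (\<eta> + stieltjes \<nu> \<eta>)"
    proof (rule metric_tendsto_imp_tendsto)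
      show "(\<lambda>k. (u k + stieltjes \<nu> (u k)) / (Im \<eta>)\<^sup>2) \<longlonglongrightarrow> (\<eta> + stieltjes \<nu> \<eta>) / (Im \<eta>)\<^sup>2"
        using u(3) l1 \<eta> by (intro tendsto_intros) auto
      have Im: "Im (u k + stieltjes \<nu> (u k)) \<ge> Im \<eta>" "Im (\<eta> + stieltjes \<nu> \<eta>) \<ge> Im \<eta>" for k
        using \<nu>.Im_stieltjes_nonneg[OF u0, of k] \<nu>.Im_stieltjes_nonneg[OF \<eta>] u(2)[of k] by auto
      have "dist (\<Phi> (u k + stieltjes \<nu> (u k))) (\<Phi> (\<eta> + stieltjes \<nu> \<eta>)) \<le>
          dist ((u k + stieltjes \<nu> (u k)) / (Im \<eta>)\<^sup>2) ((\<eta> + stieltjes \<nu> \<eta>) / (Im \<eta>)\<^sup>2)" for k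
        using pastur_lipschitz[OF r Im(1)[of k] Im(2) \<eta>]
        by (simp add: \<Phi>_def dist_norm diff_divide_distrib[symmetric] norm_divide norm_power)
      then show "\<forall>\<^sub>F k in sequentially. dist (\<Phi> (u k + stieltjes \<nu> (u k))) (\<Phi> (\<eta> + stieltjes \<nu> \<eta>)) \<le>
          dist ((u k + stieltjes \<nu> (u k)) / (Im \<eta>)\<^sup>2) ((\<eta> + stieltjes \<nu> \<eta>) / (Im \<eta>)\<^sup>2)" by simp
    qed
    have "(\<lambda>k. stieltjes \<nu> (u k)) \<longlonglongrightarrow> \<Phi> (\<eta> + stieltjes \<nu> \<eta>)"
      using l2 rat[OF u(1)] by simp
    with l1 show ?thesis by (rule LIMSEQ_unique)
  qed
  have uniq: "\<nu> = \<nu>'"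
    if s: "strict_mono s" "real_distribution \<nu>" "weak_conv_m (\<mu> \<circ> s) \<nu>"
      and s': "strict_mono s'" "real_distribution \<nu>'" "weak_conv_m (\<mu> \<circ> s') \<nu>'" for s s' :: "nat \<Rightarrow> nat" and \<nu> \<nu>'
  proof (rule stieltjes_unique[OF s(2) s'(2)])
    fix \<eta> assume \<eta>: "Im \<eta> > 0"
    show "stieltjes \<nu> \<eta> = stieltjes \<nu>' \<eta>"
      using pastur_fixed_point_unique[OF r \<eta> real_distribution.Im_stieltjes_nonneg[OF s(2) \<eta>] _
          real_distribution.Im_stieltjes_nonneg[OF s'(2) \<eta>]] eq[OF s \<eta>] eq[OF s' \<eta>]
      unfolding \<Phi>_def by simp
  qed
  obtain q \<nu> where q: "strict_mono (q :: nat \<Rightarrow> nat)" "real_distribution \<nu>" "weak_conv_m (\<mu> \<circ> q) \<nu>"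
    using tight_imp_convergent_subsubsequence[OF tight strict_mono_id] by (auto simp: o_def id_def)
  have "weak_conv_m \<mu> \<nu>"
  proof (rule tight_subseq_weak_converge[OF \<mu> q(2) tight])
    fix s \<nu>' assume "strict_mono s" "real_distribution \<nu>'" "weak_conv_m (\<mu> \<circ> s) \<nu>'"
    then show "weak_conv_m (\<mu> \<circ> s) \<nu>" using uniq[OF q, of s \<nu>'] by simp
  qed
  then show ?thesis using q(2) eq[OF q] unfolding \<Phi>_def by blast
qed

section \<open>The resolvent as a rational function of the entries\<close>

definition shifted_gram :: "nat \<Rightarrow> (nat \<Rightarrow> nat \<Rightarrow> complex) \<Rightarrow> complex \<Rightarrow> complex Matrix.mat" where
  "shifted_gram n A \<zeta> = Matrix.mat n n (\<lambda>(i, j). (if i = j then \<zeta> else 0) - (\<Sum>k<n. cnj (A k i) * A k j))"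

text \<open>The inverse of \<open>B - \<zeta>\<close>, with \<open>B\<close> the Gram matrix of
  \<open>A\<close>, by Cramer's rule; the minus sign is there because \<open>shifted_gram\<close> is
  \<open>\<zeta> - B\<close>. Being a quotient of polynomials in the entries and their conjugates,
  it is visibly measurable in them.\<close>

definition gram_resolvent :: "nat \<Rightarrow> (nat \<Rightarrow> nat \<Rightarrow> complex) \<Rightarrow> complex \<Rightarrow> nat \<Rightarrow> nat \<Rightarrow> complex" where
  "gram_resolvent n A \<zeta> i j = - (cofactor (shifted_gram n A \<zeta>) j i / Determinant.det (shifted_gram n A \<zeta>))"

text \<open>Block inversion of the hermitization: with \<open>N\<close> the inverse of
  \<open>A\<^sup>* A - \<eta>\<^sup>2\<close>, the blocks are \<open>\<eta> N\<close>,
  \<open>N A\<^sup>*\<close>, \<open>A N\<close> and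
  \<open>(1 / \<eta>) (A N A\<^sup>* - 1)\<close>.\<close>

definition block_resolvent ::
  "nat \<Rightarrow> (nat \<Rightarrow> nat \<Rightarrow> complex) \<Rightarrow> complex \<Rightarrow> nat \<times> bool \<Rightarrow> nat \<times> bool \<Rightarrow> complex" where
  "block_resolvent n A \<eta> p q = (let N = gram_resolvent n A (\<eta>\<^sup>2); i = fst p; j = fst q in
     if snd p then (if snd q then \<eta> * N i j else (\<Sum>k<n. N i k * cnj (A j k)))
     else if snd q then (\<Sum>k<n. A i k * N k j)
     else (1 / \<eta>) * ((\<Sum>k<n. A i k * (\<Sum>l<n. N k l * cnj (A j l))) - of_bool (i = j)))"

lemma square_not_nonneg_real:
  assumes "Im \<eta> > 0" "r \<ge> 0"
  shows "\<eta>\<^sup>2 \<noteq> complex_of_real r"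
  using square_diff_nonzero[OF assms(1), of "sqrt r"] assms(2) by auto

lemma gram_form:
  "(\<Sum>i<n. cnj (v i) * (\<Sum>j<n. (\<Sum>k<n. cnj (A k i) * A k j) * v j)) =
    complex_of_real (\<Sum>k<n. (cmod (\<Sum>j<n. A k j * v j))\<^sup>2)"
proof -
  have "(\<Sum>i<n. cnj (v i) * (\<Sum>j<n. (\<Sum>k<n. cnj (A k i) * A k j) * v j)) =
    (\<Sum>i<n. cnj (v i) * (\<Sum>k<n. cnj (A k i) * (\<Sum>j<n. A k j * v j)))"
    unfolding sum_swap_mult ..
  also have "\<dots> = (\<Sum>k<n. (\<Sum>i<n. cnj (v i) * cnj (A k i)) * (\<Sum>j<n. A k j * v j))"
    unfolding sum_swap_mult ..
  also have "\<dots> = (\<Sum>k<n. complex_of_real ((cmod (\<Sum>j<n. A k j * v j))\<^sup>2))"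
    unfolding complex_norm_square by (intro sum.cong refl) (simp add: cnj_sum mult.commute)
  finally show ?thesis by simp
qed

lemma mult_mat_vec_sum:
  "i < dim_row M \<Longrightarrow> dim_vec v = dim_col M \<Longrightarrow>
     vec_index (M *\<^sub>v v) i = (\<Sum>j<dim_col M. M $$ (i, j) * vec_index v j)"
  by (simp add: mult_mat_vec_def Matrix.scalar_prod_def atLeast0LessThan Matrix.row_def)

lemma eq_of_real_quotient:
  "complex_of_real a = z * complex_of_real b \<Longrightarrow> b > 0 \<Longrightarrow> z = complex_of_real (a / b)"
  by (simp add: field_simps)

text \<open>A kernel vector \<open>x\<close> would give \<open>\<eta>^2 = |A x|^2 / |x|^2\<close>, a
  nonnegative real, which is impossible for \<open>Im \<eta> > 0\<close>.\<close>

lemma det_shifted_gram: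
  assumes \<eta>: "Im \<eta> > 0"
  shows "Determinant.det (shifted_gram n A (\<eta>\<^sup>2)) \<noteq> 0"
proof
  let ?D = "shifted_gram n A (\<eta>\<^sup>2)"
  have D: "?D \<in> carrier_mat n n" by (simp add: shifted_gram_def)
  assume "Determinant.det ?D = 0"
  then obtain v where v: "v \<in> carrier_vec n" "v \<noteq> 0\<^sub>v n" "?D *\<^sub>v v = 0\<^sub>v n"
    using det_0_iff_vec_prod_zero[OF D] by blast
  define x where "x j = vec_index v j" for j
  have "(\<Sum>j<n. (\<Sum>k<n. cnj (A k i) * A k j) * x j) = \<eta>\<^sup>2 * x i" if i: "i < n" for i
  proof -
    have "0 = vec_index (?D *\<^sub>v v) i" using v(3) i by simp
    also have "\<dots> = (\<Sum>j<n. ((if i = j then \<eta>\<^sup>2 else 0) - (\<Sum>k<n. cnj (A k i) * A k j)) * x j)"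
      using i v(1) D by (subst mult_mat_vec_sum) (auto simp: shifted_gram_def x_def)
    also have "\<dots> = (\<Sum>j<n. (if i = j then \<eta>\<^sup>2 else 0) * x j) - (\<Sum>j<n. (\<Sum>k<n. cnj (A k i) * A k j) * x j)"
      by (simp only: left_diff_distrib sum_subtractf)
    also have "(\<Sum>j<n. (if i = j then \<eta>\<^sup>2 else 0) * x j) = \<eta>\<^sup>2 * x i"
      using i by (simp add: if_distrib[where f = "\<lambda>a. a * _"] sum.delta cong: if_cong)
    finally show ?thesis by simp
  qed
  then have "(\<Sum>i<n. cnj (x i) * (\<Sum>j<n. (\<Sum>k<n. cnj (A k i) * A k j) * x j)) = (\<Sum>i<n. cnj (x i) * (\<eta>\<^sup>2 * x i))"
    by (intro sum.cong refl) simp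
  also have "\<dots> = \<eta>\<^sup>2 * complex_of_real (\<Sum>i<n. (cmod (x i))\<^sup>2)"
    unfolding of_real_sum complex_norm_square sum_distrib_left by (intro sum.cong refl) (simp add: mult_ac)
  finally have eq: "complex_of_real (\<Sum>k<n. (cmod (\<Sum>j<n. A k j * x j))\<^sup>2) = \<eta>\<^sup>2 * complex_of_real (\<Sum>i<n. (cmod (x i))\<^sup>2)"
    unfolding gram_form .
  obtain i where i: "i < n" "x i \<noteq> 0"
    using v(1,2) unfolding x_def by (metis carrier_vecD eq_vecI index_zero_vec(1,2))
  then have pos: "(\<Sum>i<n. (cmod (x i))\<^sup>2) > 0"
    by (intro sum_pos2[of _ i]) auto
  then have "\<eta>\<^sup>2 = complex_of_real ((\<Sum>k<n. (cmod (\<Sum>j<n. A k j * x j))\<^sup>2) / (\<Sum>i<n. (cmod (x i))\<^sup>2))"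
    by (rule eq_of_real_quotient[OF eq])
  moreover have "(\<Sum>k<n. (cmod (\<Sum>j<n. A k j * x j))\<^sup>2) / (\<Sum>i<n. (cmod (x i))\<^sup>2) \<ge> 0"
    by (intro divide_nonneg_nonneg sum_nonneg zero_le_power2)
  ultimately show False using square_not_nonneg_real[OF \<eta>] by blast
qed

lemma gram_resolvent_inverse:
  assumes \<eta>: "Im \<eta> > 0" and i: "i < n" and j: "j < n"
  shows "(\<Sum>l<n. (\<Sum>k<n. cnj (A k i) * A k l) * gram_resolvent n A (\<eta>\<^sup>2) l j) =
      \<eta>\<^sup>2 * gram_resolvent n A (\<eta>\<^sup>2) i j + of_bool (i = j)"
    "(\<Sum>l<n. gram_resolvent n A (\<eta>\<^sup>2) i l * (\<Sum>k<n. cnj (A k l) * A k j)) =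
      \<eta>\<^sup>2 * gram_resolvent n A (\<eta>\<^sup>2) i j + of_bool (i = j)"
proof -
  let ?D = "shifted_gram n A (\<eta>\<^sup>2)"
  define d where "d = Determinant.det ?D"
  have d: "d \<noteq> 0" unfolding d_def by (rule det_shifted_gram[OF \<eta>])
  define G where "G i j = (\<Sum>k<n. cnj (A k i) * A k j)" for i j
  define N where "N i j = gram_resolvent n A (\<eta>\<^sup>2) i j" for i j
  have D: "?D \<in> carrier_mat n n" by (simp add: shifted_gram_def)
  have adj: "adj_mat ?D $$ (a, b) = - d * N a b" if "a < n" "b < n" for a b
    using that d D by (simp add: adj_mat_def N_def gram_resolvent_def d_def)
  have ent: "?D $$ (a, b) = (if a = b then \<eta>\<^sup>2 else 0) - G a b" if "a < n" "b < n" for a b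
    using that by (simp add: shifted_gram_def G_def)
  have prod: "(X * Y) $$ (a, b) = (\<Sum>l<n. X $$ (a, l) * Y $$ (l, b))"
    if "X \<in> carrier_mat n n" "Y \<in> carrier_mat n n" "a < n" "b < n" for X Y :: "complex Matrix.mat" and a b
    using that by (simp add: times_mat_def Matrix.scalar_prod_def atLeast0LessThan Matrix.row_def Matrix.col_def)
  have "d * of_bool (i = j) = (?D * adj_mat ?D) $$ (i, j)"
    unfolding adj_mat(2)[OF D] d_def using i j by simp
  also have "\<dots> = (\<Sum>l<n. ((if i = l then \<eta>\<^sup>2 else 0) - G i l) * (- d * N l j))"
    unfolding prod[OF D adj_mat(1)[OF D] i j] using i j by (intro sum.cong refl) (simp add: ent adj)
  also have "\<dots> = d * (\<Sum>l<n. G i l * N l j) - d * (\<Sum>l<n. (if i = l then \<eta>\<^sup>2 else 0) * N l j)"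
    by (simp add: sum_distrib_left sum_subtractf[symmetric] algebra_simps)
  also have "(\<Sum>l<n. (if i = l then \<eta>\<^sup>2 else 0) * N l j) = \<eta>\<^sup>2 * N i j"
    using i by (simp add: if_distrib[where f = "\<lambda>a. a * _"] sum.delta cong: if_cong)
  finally have "d * (\<Sum>l<n. G i l * N l j) = d * (\<eta>\<^sup>2 * N i j + of_bool (i = j))"
    by (simp add: algebra_simps)
  then show "(\<Sum>l<n. (\<Sum>k<n. cnj (A k i) * A k l) * gram_resolvent n A (\<eta>\<^sup>2) l j) =
      \<eta>\<^sup>2 * gram_resolvent n A (\<eta>\<^sup>2) i j + of_bool (i = j)"
    using d by (simp add: G_def N_def)
  have "d * of_bool (i = j) = (adj_mat ?D * ?D) $$ (i, j)"
    unfolding adj_mat(3)[OF D] d_def using i j by simp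
  also have "\<dots> = (\<Sum>l<n. (- d * N i l) * ((if l = j then \<eta>\<^sup>2 else 0) - G l j))"
    unfolding prod[OF adj_mat(1)[OF D] D i j] using i j by (intro sum.cong refl) (simp add: ent adj)
  also have "\<dots> = d * (\<Sum>l<n. N i l * G l j) - d * (\<Sum>l<n. N i l * (if l = j then \<eta>\<^sup>2 else 0))"
    by (simp add: sum_distrib_left sum_subtractf[symmetric] algebra_simps)
  also have "(\<Sum>l<n. N i l * (if l = j then \<eta>\<^sup>2 else 0)) = N i j * \<eta>\<^sup>2"
    using j by (simp add: if_distrib[where f = "\<lambda>a. _ * a"] sum.delta cong: if_cong)
  finally have "d * (\<Sum>l<n. N i l * G l j) = d * (\<eta>\<^sup>2 * N i j + of_bool (i = j))"
    by (simp add: algebra_simps)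
  then show "(\<Sum>l<n. gram_resolvent n A (\<eta>\<^sup>2) i l * (\<Sum>k<n. cnj (A k l) * A k j)) =
      \<eta>\<^sup>2 * gram_resolvent n A (\<eta>\<^sup>2) i j + of_bool (i = j)"
    using d by (simp add: G_def N_def)
qed

lemma sum_of_bool_mult:
  fixes f :: "nat \<Rightarrow> complex"
  assumes "i < n"
  shows "(\<Sum>k<n. of_bool (i = k) * f k) = f i" "(\<Sum>k<n. f k * of_bool (k = i)) = f i"
    "(\<Sum>k<n. f k * of_bool (i = k)) = f i" "(\<Sum>k<n. of_bool (k = i) * f k) = f i"
  using assms by (simp_all add: of_bool_def if_distrib[where f = "\<lambda>a. a * _"] if_distrib[where f = "\<lambda>a. _ * a"]
      sum.delta cong: if_cong)

lemma sum_scaled_diff: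
  fixes a x y :: "'a \<Rightarrow> complex"
  shows "(\<Sum>k\<in>V. a k * (c * (x k - y k))) = c * ((\<Sum>k\<in>V. a k * x k) - (\<Sum>k\<in>V. a k * y k))"
    "(\<Sum>k\<in>V. (c * (x k - y k)) * a k) = c * ((\<Sum>k\<in>V. x k * a k) - (\<Sum>k\<in>V. y k * a k))"
  by (simp_all add: sum_distrib_left sum_subtractf[symmetric] algebra_simps)

lemma resolvent_of_block_resolvent:
  assumes \<eta>: "Im \<eta> > 0"
  shows "resolvent_of (block_index n) (hermitization A) \<eta> (block_resolvent n A \<eta>)"
proof -
  define N where "N = gram_resolvent n A (\<eta>\<^sup>2)"
  define R where "R = block_resolvent n A \<eta>"
  have \<eta>0: "\<eta> \<noteq> 0" using \<eta> by auto
  have RTT: "R (i, True) (j, True) = \<eta> * N i j" for i j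
    by (simp add: R_def N_def block_resolvent_def Let_def)
  have RTF: "R (i, True) (j, False) = (\<Sum>k<n. N i k * cnj (A j k))" for i j
    by (simp add: R_def N_def block_resolvent_def Let_def)
  have RFT: "R (i, False) (j, True) = (\<Sum>k<n. A i k * N k j)" for i j
    by (simp add: R_def N_def block_resolvent_def Let_def)
  have RFF: "R (i, False) (j, False) = (1 / \<eta>) * ((\<Sum>k<n. A i k * (\<Sum>l<n. N k l * cnj (A j l))) - of_bool (i = j))" for i j
    by (simp add: R_def N_def block_resolvent_def Let_def)
  note inv = gram_resolvent_inverse[OF \<eta>, where n = n and A = A, folded N_def]
  \<comment> \<open>\<open>A\<^sup>* A N = \<eta>\<^sup>2 N + 1\<close> and its mirror image: the
    inputs for those of the eight block equations that do not follow from the block formulas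
    alone.\<close>
  have L1: "(\<Sum>k<n. cnj (A k i) * (\<Sum>l<n. A k l * N l j)) = \<eta>\<^sup>2 * N i j + of_bool (i = j)" if "i < n" "j < n" for i j
    unfolding sum_swap_mult by (rule inv(1)[OF that])
  have L2: "(\<Sum>k<n. (\<Sum>l<n. N i l * cnj (A k l)) * A k j) = \<eta>\<^sup>2 * N i j + of_bool (i = j)" if "i < n" "j < n" for i j
    unfolding sum_swap_mult[symmetric] by (rule inv(2)[OF that])
  show ?thesis
    unfolding resolvent_of_def R_def[symmetric]
  proof (intro ballI)
    fix p q assume p: "p \<in> block_index n" and q: "q \<in> block_index n"
    obtain i b where pi: "p = (i, b)" by (rule prod.exhaust)
    obtain j c where qj: "q = (j, c)" by (rule prod.exhaust)
    note pq = pi qj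
    have i: "i < n" and j: "j < n" using p q unfolding pq by simp_all
    have FF: "(\<Sum>k<n. A i k * R (k, True) (j, False)) = \<eta> * R (i, False) (j, False) + of_bool (i = j)"
      "(\<Sum>k<n. R (i, False) (k, True) * cnj (A j k)) = \<eta> * R (i, False) (j, False) + of_bool (i = j)"
      unfolding RTF RFF RFT sum_swap_mult using \<eta>0 by simp_all
    have FT: "(\<Sum>k<n. A i k * R (k, True) (j, True)) = \<eta> * R (i, False) (j, True)"
      unfolding RTT RFT sum_distrib_left by (simp add: mult.left_commute)
    have FT': "(\<Sum>k<n. R (i, False) (k, False) * A k j) = \<eta> * R (i, False) (j, True)"
    proof -
      have "(\<Sum>k<n. R (i, False) (k, False) * A k j) =
         (1 / \<eta>) * ((\<Sum>k<n. (\<Sum>m<n. A i m * (\<Sum>l<n. N m l * cnj (A k l))) * A k j) - (\<Sum>k<n. of_bool (i = k) * A k j))"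
        unfolding RFF by (rule sum_scaled_diff)
      also have "(\<Sum>k<n. (\<Sum>m<n. A i m * (\<Sum>l<n. N m l * cnj (A k l))) * A k j) =
          (\<Sum>m<n. A i m * (\<Sum>k<n. (\<Sum>l<n. N m l * cnj (A k l)) * A k j))"
        unfolding sum_swap_mult ..
      also have "\<dots> = (\<Sum>m<n. A i m * (\<eta>\<^sup>2 * N m j + of_bool (m = j)))"
        using j by (intro sum.cong refl) (simp only: L2 lessThan_iff)
      also have "\<dots> = \<eta>\<^sup>2 * (\<Sum>m<n. A i m * N m j) + A i j"
        using j by (simp add: ring_distribs sum.distrib sum_of_bool_mult sum_distrib_left mult.left_commute)
      finally show ?thesis using i \<eta>0
        by (simp add: sum_of_bool_mult RFT power2_eq_square)
    qed
    have TF: "(\<Sum>k<n. cnj (A k i) * R (k, False) (j, False)) = \<eta> * R (i, True) (j, False)"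
    proof -
      have "(\<Sum>k<n. cnj (A k i) * R (k, False) (j, False)) =
         (1 / \<eta>) * ((\<Sum>k<n. cnj (A k i) * (\<Sum>m<n. A k m * (\<Sum>l<n. N m l * cnj (A j l)))) - (\<Sum>k<n. cnj (A k i) * of_bool (k = j)))"
        unfolding RFF by (rule sum_scaled_diff)
      also have "(\<Sum>k<n. cnj (A k i) * (\<Sum>m<n. A k m * (\<Sum>l<n. N m l * cnj (A j l)))) =
          (\<Sum>l<n. (\<Sum>k<n. cnj (A k i) * (\<Sum>m<n. A k m * N m l)) * cnj (A j l))"
        unfolding sum_swap_mult ..
      also have "\<dots> = (\<Sum>l<n. (\<eta>\<^sup>2 * N i l + of_bool (i = l)) * cnj (A j l))"
        using i by (intro sum.cong refl) (simp only: L1 lessThan_iff)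
      also have "\<dots> = \<eta>\<^sup>2 * (\<Sum>l<n. N i l * cnj (A j l)) + cnj (A j i)"
        using i by (simp add: ring_distribs sum.distrib sum_of_bool_mult sum_distrib_left mult.assoc)
      finally show ?thesis using j \<eta>0
        by (simp add: sum_of_bool_mult RTF power2_eq_square)
    qed
    have TF': "(\<Sum>k<n. R (i, True) (k, True) * cnj (A j k)) = \<eta> * R (i, True) (j, False)"
      unfolding RTT RTF sum_distrib_left by (simp add: mult.assoc)
    have TT: "(\<Sum>k<n. cnj (A k i) * R (k, False) (j, True)) = \<eta> * R (i, True) (j, True) + of_bool (i = j)"
      "(\<Sum>k<n. R (i, True) (k, False) * A k j) = \<eta> * R (i, True) (j, True) + of_bool (i = j)"
      unfolding RFT RTF RTT L1[OF i j] L2[OF i j] by (simp_all add: power2_eq_square)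
    show "(\<Sum>k\<in>block_index n. hermitization A p k * R k q) = \<eta> * R p q + of_bool (p = q) \<and>
      (\<Sum>k\<in>block_index n. R p k * hermitization A k q) = \<eta> * R p q + of_bool (p = q)"
    proof (cases b)
      case b: True
      show ?thesis
      proof (cases c)
        case c: True
        show ?thesis unfolding pi qj eqTrueI[OF b] eqTrueI[OF c] sum_hermitization_True TT by simp
      next
        case c: False
        then have cF: "c = False" by simp
        show ?thesis
          unfolding pi qj eqTrueI[OF b] cF sum_hermitization_True sum_hermitization_False TF TF' by simp
      qed
    next
      case b: False
      then have bF: "b = False" by simp
      show ?thesis
      proof (cases c)
        case c: True
        show ?thesis
          unfolding pi qj bF eqTrueI[OF c] sum_hermitization_True sum_hermitization_False FT FT' by simp
      next
        case c: False
        then have cF: "c = False" by simp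
        show ?thesis unfolding pi qj bF cF sum_hermitization_False FF by simp
      qed
    qed
  qed
qed

section \<open>Measurability of the resolvent in the matrix entries\<close>

lemma borel_measurable_det:
  fixes M :: "'a \<Rightarrow> complex Matrix.mat"
  assumes "\<And>\<omega>. M \<omega> \<in> carrier_mat n n" "\<And>i j. i < n \<Longrightarrow> j < n \<Longrightarrow> (\<lambda>\<omega>. M \<omega> $$ (i, j)) \<in> borel_measurable P"
  shows "(\<lambda>\<omega>. Determinant.det (M \<omega>)) \<in> borel_measurable P"
  unfolding det_def'[OF assms(1)]
proof (intro borel_measurable_sum borel_measurable_times borel_measurable_const borel_measurable_prod)
  fix p i assume "p \<in> {p. p permutes {0..<n}}" "i \<in> {0..<n}"
  then have "i < n" "p i < n" using permutes_in_image[of p "{0..<n}" i] by auto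
  then show "(\<lambda>\<omega>. M \<omega> $$ (i, p i)) \<in> borel_measurable P" by (rule assms(2))
qed

lemma borel_measurable_cnj:
  fixes f :: "'a \<Rightarrow> complex"
  assumes "f \<in> borel_measurable P"
  shows "(\<lambda>x. cnj (f x)) \<in> borel_measurable P"
  by (rule borel_measurable_continuous_on[OF _ assms]) (intro continuous_intros)

lemma borel_measurable_block_resolvent:
  assumes A: "\<And>i j. i < n \<Longrightarrow> j < n \<Longrightarrow> (\<lambda>\<omega>. A \<omega> i j) \<in> borel_measurable P"
    and p: "p \<in> block_index n" and q: "q \<in> block_index n"
  shows "(\<lambda>\<omega>. block_resolvent n (A \<omega>) \<eta> p q) \<in> borel_measurable P"
proof -
  let ?D = "\<lambda>\<omega>. shifted_gram n (A \<omega>) (\<eta>\<^sup>2)"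
  have Dc: "?D \<omega> \<in> carrier_mat n n" for \<omega> by (simp add: shifted_gram_def)
  have Dm: "(\<lambda>\<omega>. ?D \<omega> $$ (i, j)) \<in> borel_measurable P" if "i < n" "j < n" for i j
  proof -
    have "?D \<omega> $$ (i, j) = (if i = j then \<eta>\<^sup>2 else 0) - (\<Sum>k<n. cnj (A \<omega> k i) * A \<omega> k j)" for \<omega>
      using that by (simp add: shifted_gram_def)
    then show ?thesis
      by (simp only:) (intro borel_measurable_diff borel_measurable_const borel_measurable_sum borel_measurable_times
          borel_measurable_cnj A, use that in auto)
  qed
  have det: "(\<lambda>\<omega>. Determinant.det (?D \<omega>)) \<in> borel_measurable P"
    by (rule borel_measurable_det[OF Dc Dm])
  have cof: "(\<lambda>\<omega>. cofactor (?D \<omega>) j i) \<in> borel_measurable P" if ij: "i < n" "j < n" for i j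
    unfolding cofactor_def
  proof (intro borel_measurable_times borel_measurable_const borel_measurable_det[where n = "n - 1"])
    show "mat_delete (?D \<omega>) j i \<in> carrier_mat (n - 1) (n - 1)" for \<omega>
      by (rule mat_delete_carrier[OF Dc])
    fix a b assume ab: "a < n - 1" "b < n - 1"
    have "mat_delete (?D \<omega>) j i $$ (a, b) = ?D \<omega> $$ (if a < j then a else Suc a, if b < i then b else Suc b)" for \<omega>
      using ab Dc[of \<omega>] unfolding mat_delete_def by auto
    moreover have "(if a < j then a else Suc a) < n" "(if b < i then b else Suc b) < n" using ab by auto
    ultimately show "(\<lambda>\<omega>. mat_delete (?D \<omega>) j i $$ (a, b)) \<in> borel_measurable P"
      using Dm by (simp only:)
  qed
  have N: "(\<lambda>\<omega>. gram_resolvent n (A \<omega>) (\<eta>\<^sup>2) i j) \<in> borel_measurable P" if "i < n" "j < n" for i j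
    unfolding gram_resolvent_def
    by (intro borel_measurable_uminus borel_measurable_divide cof det that)
  obtain i b where pe: "p = (i, b)" and i: "i < n" using p by auto
  obtain j c where qe: "q = (j, c)" and j: "j < n" using q by auto
  have 1: "(\<lambda>\<omega>. \<eta> * gram_resolvent n (A \<omega>) (\<eta>\<^sup>2) i j) \<in> borel_measurable P"
    by (intro borel_measurable_times borel_measurable_const N i j)
  have 2: "(\<lambda>\<omega>. \<Sum>k<n. gram_resolvent n (A \<omega>) (\<eta>\<^sup>2) i k * cnj (A \<omega> j k)) \<in> borel_measurable P"
    if "i < n" for i
    by (intro borel_measurable_sum borel_measurable_times borel_measurable_cnj A N) (use that j in auto)
  have 3: "(\<lambda>\<omega>. \<Sum>k<n. A \<omega> i k * gram_resolvent n (A \<omega>) (\<eta>\<^sup>2) k j) \<in> borel_measurable P"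
    by (intro borel_measurable_sum borel_measurable_times A N) (use i j in auto)
  have 4: "(\<lambda>\<omega>. (1 / \<eta>) * ((\<Sum>k<n. A \<omega> i k * (\<Sum>l<n. gram_resolvent n (A \<omega>) (\<eta>\<^sup>2) k l * cnj (A \<omega> j l))) - of_bool (i = j)))
      \<in> borel_measurable P"
    by (intro borel_measurable_times borel_measurable_diff borel_measurable_const borel_measurable_sum A 2) (use i in auto)
  show ?thesis
    unfolding pe qe block_resolvent_def Let_def fst_conv snd_conv using 1 2[OF i] 3 4
    by (cases b; cases c) (simp_all only: if_True if_False simp_thms)
qed

section \<open>Singular values as characteristic roots, and the trace of the resolvent\<close>

lemma log_derivative_factors:
  fixes x :: complex
  assumes "\<And>a. a \<in> set as \<Longrightarrow> x \<noteq> a"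
  shows "poly (pderiv (\<Prod>a\<leftarrow>as. [:- a, 1:])) x = (\<Sum>a\<leftarrow>as. 1 / (x - a)) * poly (\<Prod>a\<leftarrow>as. [:- a, 1:]) x"
  using assms
proof (induction as)
  case (Cons a as)
  define Q where "Q = (\<Prod>a\<leftarrow>as. [:- a, 1:])"
  define s where "s = (\<Sum>a\<leftarrow>as. 1 / (x - a))"
  have nz: "x - a \<noteq> 0" using Cons.prems[of a] by simp
  have 1: "poly [:- a, 1:] x = x - a" "poly (pderiv [:- a, 1:]) x = 1" by (simp_all add: pderiv_pCons)
  have IH: "poly (pderiv Q) x = s * poly Q x" unfolding Q_def s_def using Cons by simp
  have "poly (pderiv ([:- a, 1:] * Q)) x = (x - a) * (s * poly Q x) + poly Q x"
    unfolding pderiv_mult poly_add poly_mult 1 IH by simp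
  also have "\<dots> = (1 / (x - a) + s) * poly ([:- a, 1:] * Q) x"
    unfolding poly_mult 1 using nz by (simp add: field_simps)
  finally show ?case by (simp only: list.map prod_list.Cons sum_list.Cons Q_def s_def)
qed simp

lemma proots_factors:
  "proots (\<Prod>a\<leftarrow>as. [:- a, 1:] :: complex poly) = mset as"
proof (induction as)
  case (Cons a as)
  have nz: "(\<Prod>a\<leftarrow>as. [:- a, 1:] :: complex poly) \<noteq> 0" by (auto simp: prod_list_zero_iff)
  have "proots ([:- a, 1:] * (\<Prod>a\<leftarrow>as. [:- a, 1:] :: complex poly)) = proots [:- a, 1:] + mset as"
    by (subst proots_mult) (use nz Cons.IH in auto)
  then show ?case by (simp only: list.map prod_list.Cons proots_linear_factor) simp
qed simp

lemma gram_carrier: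
  assumes "B \<in> carrier_mat n n"
  shows "mat_adjoint B * B \<in> carrier_mat n n"
proof -
  have "mat_adjoint B \<in> carrier_mat n n" using assms unfolding carrier_mat_def mat_adjoint_def by simp
  then show ?thesis using assms by (rule mult_carrier_mat)
qed

lemma mat_adjoint_gram:
  assumes B: "B \<in> carrier_mat n n" and ij: "i < n" "j < n"
  shows "(mat_adjoint B * B) $$ (i, j) = (\<Sum>k<n. cnj (B $$ (k, i)) * B $$ (k, j))"
  using assms
  by (simp add: mat_adjoint_def times_mat_def Matrix.scalar_prod_def atLeast0LessThan mat_of_rows_def conjugate_vec_def)

text \<open>An eigenvalue \<open>a\<close> with eigenvector \<open>x\<close> is the Rayleigh
  quotient \<open>|B x|^2 / |x|^2\<close>.\<close>

lemma char_poly_gram_roots: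
  assumes B: "B \<in> carrier_mat n n" and a: "poly (char_poly (mat_adjoint B * B)) a = 0"
  shows "Im a = 0" "Re a \<ge> 0"
proof -
  let ?G = "mat_adjoint B * B"
  define A where "A i j = B $$ (i, j)" for i j
  have G: "?G \<in> carrier_mat n n" by (rule gram_carrier[OF B])
  obtain v where v: "v \<in> carrier_vec n" "v \<noteq> 0\<^sub>v n" "?G *\<^sub>v v = a \<cdot>\<^sub>v v"
    using a G unfolding eigenvalue_root_char_poly[OF G, symmetric] eigenvalue_def eigenvector_def by auto
  define x where "x j = vec_index v j" for j
  have "(\<Sum>j<n. (\<Sum>k<n. cnj (A k i) * A k j) * x j) = a * x i" if i: "i < n" for i
  proof -
    have "a * x i = vec_index (?G *\<^sub>v v) i" using v i by (simp add: x_def)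
    also have "\<dots> = (\<Sum>j<n. ?G $$ (i, j) * x j)"
      using i v(1) G by (subst mult_mat_vec_sum) (auto simp: x_def)
    also have "\<dots> = (\<Sum>j<n. (\<Sum>k<n. cnj (A k i) * A k j) * x j)"
      using i by (intro sum.cong refl) (simp add: mat_adjoint_gram[OF B] A_def)
    finally show ?thesis by simp
  qed
  then have "(\<Sum>i<n. cnj (x i) * (\<Sum>j<n. (\<Sum>k<n. cnj (A k i) * A k j) * x j)) = (\<Sum>i<n. cnj (x i) * (a * x i))"
    by (intro sum.cong refl) simp
  also have "\<dots> = a * complex_of_real (\<Sum>i<n. (cmod (x i))\<^sup>2)"
    unfolding of_real_sum complex_norm_square sum_distrib_left by (intro sum.cong refl) (simp add: mult_ac)
  finally have eq: "complex_of_real (\<Sum>k<n. (cmod (\<Sum>j<n. A k j * x j))\<^sup>2) = a * complex_of_real (\<Sum>i<n. (cmod (x i))\<^sup>2)"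
    unfolding gram_form .
  obtain i where i: "i < n" "x i \<noteq> 0"
    using v(1,2) unfolding x_def by (metis carrier_vecD eq_vecI index_zero_vec(1,2))
  then have pos: "(\<Sum>i<n. (cmod (x i))\<^sup>2) > 0"
    by (intro sum_pos2[of _ i]) auto
  then have a: "a = complex_of_real ((\<Sum>k<n. (cmod (\<Sum>j<n. A k j * x j))\<^sup>2) / (\<Sum>i<n. (cmod (x i))\<^sup>2))"
    by (rule eq_of_real_quotient[OF eq])
  show "Im a = 0" unfolding a by (rule Im_complex_of_real)
  show "Re a \<ge> 0" unfolding a Re_complex_of_real by (intro divide_nonneg_nonneg sum_nonneg zero_le_power2)
qed

text \<open>Root multiplicities are carried by a list in no particular order; only multisets are
  compared, so the sorting of the singular values never matters.\<close>

lemma char_poly_gram_factors: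
  assumes B: "B \<in> carrier_mat n n"
  obtains as where "char_poly (mat_adjoint B * B) = (\<Prod>a\<leftarrow>as. [:- a, 1:])" "length as = n"
    "\<And>a. a \<in> set as \<Longrightarrow> Im a = 0 \<and> Re a \<ge> 0"
    "mset (singular_values B) = mset (map (\<lambda>a. sqrt (Re a)) as)"
proof -
  from char_poly_factorized[OF gram_carrier[OF B]] obtain as where
    as: "char_poly (mat_adjoint B * B) = (\<Prod>a\<leftarrow>as. [:- a, 1:])" "length as = n" by blast
  have "Im a = 0 \<and> Re a \<ge> 0" if "a \<in> set as" for a
    using char_poly_gram_roots[OF B, of a] that unfolding as(1) by (auto simp: poly_prod_list prod_list_zero_iff)
  moreover have "mset (singular_values B) = mset (map (\<lambda>a. sqrt (Re a)) as)"
    unfolding singular_values_def as(1) proots_factors by simp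
  ultimately show ?thesis using as that by blast
qed

lemma length_singular_values:
  assumes B: "B \<in> carrier_mat n n"
  shows "length (singular_values B) = n"
  using char_poly_gram_factors[OF B] by (metis length_map size_mset)

lemma singular_values_nonneg:
  assumes B: "B \<in> carrier_mat n n" and s: "s \<in> set (singular_values B)"
  shows "s \<ge> 0"
proof -
  obtain as where as: "\<And>a. a \<in> set as \<Longrightarrow> Im a = 0 \<and> Re a \<ge> 0"
    "mset (singular_values B) = mset (map (\<lambda>a. sqrt (Re a)) as)"
    by (rule char_poly_gram_factors[OF B]) (rule that)
  have "s \<in> (\<lambda>a. sqrt (Re a)) ` set as" using s mset_eq_setD[OF as(2)] by simp
  then show ?thesis using as(1) by auto
qed

lemma trace_gram_resolvent:
  assumes B: "B \<in> carrier_mat n n" and \<eta>: "Im \<eta> > 0"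
  shows "\<eta> * (\<Sum>j<n. gram_resolvent n (\<lambda>i j. B $$ (i, j)) (\<eta>\<^sup>2) j j) =
    (\<Sum>k<n. pastur_kernel \<eta> (singular_values B ! k))"
proof -
  let ?G = "mat_adjoint B * B"
  let ?D = "shifted_gram n (\<lambda>i j. B $$ (i, j)) (\<eta>\<^sup>2)"
  obtain as where as: "char_poly ?G = (\<Prod>a\<leftarrow>as. [:- a, 1:])" "length as = n"
    "\<And>a. a \<in> set as \<Longrightarrow> Im a = 0 \<and> Re a \<ge> 0"
    "mset (singular_values B) = mset (map (\<lambda>a. sqrt (Re a)) as)"
    by (rule char_poly_gram_factors[OF B]) (rule that)
  have G: "?G \<in> carrier_mat n n" by (rule gram_carrier[OF B])
  have cm: "char_matrix M e $$ (a, b) = M $$ (a, b) + - e * of_bool (a = b)"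
    if "M \<in> carrier_mat m m" "a < m" "b < m" for M :: "complex Matrix.mat" and m e a b
    using that unfolding char_matrix_def by simp
  have md: "mat_delete M i i $$ (a, b) = M $$ (if a < i then a else Suc a, if b < i then b else Suc b)"
    if "M \<in> carrier_mat n n" "a < n - 1" "b < n - 1" for M :: "complex Matrix.mat" and i a b
    using that unfolding mat_delete_def by simp
  have real: "a = complex_of_real ((sqrt (Re a))\<^sup>2)" if "a \<in> set as" for a
    using as(3)[OF that] by (simp add: complex_eq_iff)
  have ne: "\<eta>\<^sup>2 \<noteq> a" if "a \<in> set as" for a
    using square_not_nonneg_real[OF \<eta>, of "(sqrt (Re a))\<^sup>2"] real[OF that] by simp
  have Dg: "?D = - char_matrix ?G (\<eta>\<^sup>2)"
  proof (rule eq_matI)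
    fix i j assume "i < dim_row (- char_matrix ?G (\<eta>\<^sup>2))" "j < dim_col (- char_matrix ?G (\<eta>\<^sup>2))"
    then have ij: "i < n" "j < n" using char_matrix_closed[OF G, of "\<eta>\<^sup>2"] by auto
    have "char_matrix ?G (\<eta>\<^sup>2) $$ (i, j) = ?G $$ (i, j) + - \<eta>\<^sup>2 * of_bool (i = j)"
      by (rule cm[OF G ij])
    then show "?D $$ (i, j) = (- char_matrix ?G (\<eta>\<^sup>2)) $$ (i, j)"
      using ij char_matrix_closed[OF G, of "\<eta>\<^sup>2"] mat_adjoint_gram[OF B ij] by (simp add: shifted_gram_def)
  qed (use char_matrix_closed[OF G, of "\<eta>\<^sup>2"] in \<open>auto simp: shifted_gram_def\<close>)
  have p: "poly (char_poly ?G) (\<eta>\<^sup>2) = Determinant.det ?D"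
    unfolding Dg by (rule char_poly_matrix[OF G])
  have minor: "poly (char_poly (mat_delete ?G i i)) (\<eta>\<^sup>2) = cofactor ?D i i" if i: "i < n" for i
  proof -
    have M: "mat_delete ?G i i \<in> carrier_mat (n - 1) (n - 1)" by (rule mat_delete_carrier[OF G])
    have "mat_delete ?D i i = - char_matrix (mat_delete ?G i i) (\<eta>\<^sup>2)"
    proof (rule eq_matI)
      fix a b assume "a < dim_row (- char_matrix (mat_delete ?G i i) (\<eta>\<^sup>2))"
        "b < dim_col (- char_matrix (mat_delete ?G i i) (\<eta>\<^sup>2))"
      then have ab: "a < n - 1" "b < n - 1" using char_matrix_closed[OF M, of "\<eta>\<^sup>2"] by auto
      let ?a = "if a < i then a else Suc a" and ?b = "if b < i then b else Suc b"
      have ab': "?a < n" "?b < n" "?a = ?b \<longleftrightarrow> a = b" using ab by auto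
      have dG: "mat_delete ?G i i $$ (a, b) = ?G $$ (?a, ?b)" by (rule md[OF G ab])
      have dD: "mat_delete ?D i i $$ (a, b) = ?D $$ (?a, ?b)"
        by (rule md[OF _ ab]) (simp add: shifted_gram_def)
      have "char_matrix (mat_delete ?G i i) (\<eta>\<^sup>2) $$ (a, b) = ?G $$ (?a, ?b) + - \<eta>\<^sup>2 * of_bool (a = b)"
        unfolding cm[OF M ab] dG ..
      moreover have "?D $$ (?a, ?b) = \<eta>\<^sup>2 * of_bool (a = b) - ?G $$ (?a, ?b)"
        unfolding mat_adjoint_gram[OF B ab'(1,2)] using ab' by (simp add: shifted_gram_def)
      ultimately show "mat_delete ?D i i $$ (a, b) = (- char_matrix (mat_delete ?G i i) (\<eta>\<^sup>2)) $$ (a, b)"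
        using ab char_matrix_closed[OF M, of "\<eta>\<^sup>2"] dD by simp
    qed (use char_matrix_closed[OF M, of "\<eta>\<^sup>2"] in \<open>auto simp: shifted_gram_def\<close>)
    then show ?thesis unfolding cofactor_def char_poly_matrix[OF M] by simp
  qed
  have "(\<Sum>i<n. cofactor ?D i i) = poly (pderiv (char_poly ?G)) (\<eta>\<^sup>2)"
    unfolding pderiv_char_poly[OF G] poly_sum by (intro sum.cong refl) (simp only: minor lessThan_iff)
  also have "\<dots> = (\<Sum>a\<leftarrow>as. 1 / (\<eta>\<^sup>2 - a)) * Determinant.det ?D"
    unfolding p[symmetric] unfolding as(1) by (rule log_derivative_factors) (use ne in auto)
  finally have "(\<Sum>j<n. gram_resolvent n (\<lambda>i j. B $$ (i, j)) (\<eta>\<^sup>2) j j) = - (\<Sum>a\<leftarrow>as. 1 / (\<eta>\<^sup>2 - a))"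
    using det_shifted_gram[OF \<eta>, of n "\<lambda>i j. B $$ (i, j)"]
    by (simp add: gram_resolvent_def sum_negf sum_divide_distrib[symmetric])
  also have "\<eta> * \<dots> = (\<Sum>a\<leftarrow>as. pastur_kernel \<eta> (sqrt (Re a)))"
  proof -
    have "\<eta> * (- (1 / (\<eta>\<^sup>2 - a))) = pastur_kernel \<eta> (sqrt (Re a))" if "a \<in> set as" for a
    proof -
      have "complex_of_real ((sqrt (Re a))\<^sup>2) = a" using real[OF that] by simp
      then have "pastur_kernel \<eta> (sqrt (Re a)) = \<eta> / (- (\<eta>\<^sup>2 - a))" by (simp add: pastur_kernel_def)
      then show ?thesis by (simp only: divide_minus_right) simp
    qed
    then have "map (\<lambda>a. \<eta> * (- (1 / (\<eta>\<^sup>2 - a)))) as = map (\<lambda>a. pastur_kernel \<eta> (sqrt (Re a))) as"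
      by simp
    moreover have "\<eta> * (- (\<Sum>a\<leftarrow>as. 1 / (\<eta>\<^sup>2 - a))) = (\<Sum>a\<leftarrow>as. \<eta> * (- (1 / (\<eta>\<^sup>2 - a))))"
      by (induction as) (simp_all add: algebra_simps)
    ultimately show ?thesis by (simp only:)
  qed
  also have "\<dots> = sum_mset (image_mset (pastur_kernel \<eta>) (mset (map (\<lambda>a. sqrt (Re a)) as)))"
    by (simp add: sum_mset_sum_list[symmetric] image_mset.compositionality o_def)
  also have "\<dots> = sum_list (map (pastur_kernel \<eta>) (singular_values B))"
    unfolding as(4)[symmetric] by (simp add: sum_mset_sum_list[symmetric])
  also have "\<dots> = (\<Sum>k<n. pastur_kernel \<eta> (singular_values B ! k))"
    by (simp add: sum_list_sum_nth length_singular_values[OF B] atLeast0LessThan)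
  finally show ?thesis .
qed

lemma trace_block_resolvent:
  assumes B: "B \<in> carrier_mat n n" and \<eta>: "Im \<eta> > 0"
  shows "(\<Sum>p\<in>block_index n. block_resolvent n (\<lambda>i j. B $$ (i, j)) \<eta> p p) =
    2 * (\<Sum>k<n. pastur_kernel \<eta> (singular_values B ! k))"
proof -
  have "\<eta> \<noteq> 0" using \<eta> by auto
  from trace_resolvent_blocks[OF resolvent_of_block_resolvent[OF \<eta>, of n "\<lambda>i j. B $$ (i, j)"] this]
  have "(\<Sum>p\<in>block_index n. block_resolvent n (\<lambda>i j. B $$ (i, j)) \<eta> p p) =
     2 * (\<Sum>k<n. block_resolvent n (\<lambda>i j. B $$ (i, j)) \<eta> (k, True) (k, True))"
    unfolding sum_block_index by simp
  also have "(\<Sum>k<n. block_resolvent n (\<lambda>i j. B $$ (i, j)) \<eta> (k, True) (k, True)) =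
     \<eta> * (\<Sum>j<n. gram_resolvent n (\<lambda>i j. B $$ (i, j)) (\<eta>\<^sup>2) j j)"
    by (simp add: block_resolvent_def Let_def sum_distrib_left)
  finally show ?thesis unfolding trace_gram_resolvent[OF B \<eta>] .
qed

section \<open>Bounded differences\<close>

lemma (in prob_space) exp_nn_integral_le:
  assumes f: "f \<in> borel_measurable M" and b: "\<And>x. x \<in> space M \<Longrightarrow> f x \<in> {a..b}" and l: "l > 0"
  shows "(\<integral>\<^sup>+x. ennreal (exp (l * (f x - (\<integral>x. f x \<partial>M)))) \<partial>M) \<le> ennreal (exp (l\<^sup>2 * (b - a)\<^sup>2 / 8))"
proof -
  interpret interval_bounded_random_variable M f a b
    by unfold_locales (use f b in \<open>auto intro!: AE_I2\<close>)
  show ?thesis using Hoeffdings_lemma_nn_integral[OF l] by simp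
qed

lemma (in prob_space) norm_expectation_le:
  fixes f :: "'a \<Rightarrow> 'b :: {banach, second_countable_topology}"
  assumes "integrable M f" "\<And>x. x \<in> space M \<Longrightarrow> norm (f x) \<le> c"
  shows "norm (\<integral>x. f x \<partial>M) \<le> c"
proof -
  have "norm (\<integral>x. f x \<partial>M) \<le> (\<integral>x. norm (f x) \<partial>M)" by (rule integral_norm_bound)
  also have "\<dots> \<le> (\<integral>x. c \<partial>M)" by (rule integral_mono) (use assms in auto)
  finally show ?thesis by (simp add: prob_space)
qed

lemma merge_space_PiM:
  assumes "x \<in> space (PiM I M)" "y \<in> space (PiM J M)"
  shows "merge I J (x, y) \<in> space (PiM (I \<union> J) M)"
  using assms by (auto simp: space_PiM PiE_def Pi_def extensional_def merge_def)

text \<open>Induction over the blocks \<open>{t} \<times> J\<close>. With the other blocks fixed,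
  \<open>F\<close> varies by at most \<open>c\<close> in block \<open>t\<close>, which Hoeffding's
  lemma handles; the average \<open>G\<close> over block \<open>t\<close> has the same mean as
  \<open>F\<close> and inherits the remaining difference bounds.\<close>

lemma bounded_differences_mgf:
  fixes N :: "'a measure" and T :: "'r set" and J :: "'c set"
  assumes N: "prob_space N" and T: "finite T" and J: "finite J" and l: "l > 0" and c: "c \<ge> 0"
  shows "F \<in> borel_measurable (PiM (T \<times> J) (\<lambda>_. N)) \<Longrightarrow>
    (\<And>x. x \<in> space (PiM (T \<times> J) (\<lambda>_. N)) \<Longrightarrow> \<bar>F x\<bar> \<le> B) \<Longrightarrow>
    (\<And>t x y. t \<in> T \<Longrightarrow> x \<in> space (PiM (T \<times> J) (\<lambda>_. N)) \<Longrightarrow> y \<in> space (PiM (T \<times> J) (\<lambda>_. N)) \<Longrightarrow>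
       (\<And>p. p \<in> T \<times> J \<Longrightarrow> fst p \<noteq> t \<Longrightarrow> x p = y p) \<Longrightarrow> \<bar>F x - F y\<bar> \<le> c) \<Longrightarrow>
    (\<integral>\<^sup>+x. ennreal (exp (l * (F x - (\<integral>x. F x \<partial>PiM (T \<times> J) (\<lambda>_. N))))) \<partial>PiM (T \<times> J) (\<lambda>_. N))
      \<le> ennreal (exp (real (card T) * (l\<^sup>2 * c\<^sup>2 / 2)))"
  using T
proof (induction T arbitrary: F rule: finite_induct)
  case empty
  interpret E: prob_space "PiM ({} :: ('r \<times> 'c) set) (\<lambda>_. N)" by (rule prob_space_PiM) (rule N)
  have "F x = F (\<lambda>_. undefined)" if "x \<in> space (PiM ({} :: ('r \<times> 'c) set) (\<lambda>_. N))" for x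
    using that by (simp add: space_PiM)
  then have "(\<integral>x. F x \<partial>PiM ({} :: ('r \<times> 'c) set) (\<lambda>_. N)) =
      (\<integral>x. F (\<lambda>_. undefined) \<partial>PiM ({} :: ('r \<times> 'c) set) (\<lambda>_. N))"
    by (rule Bochner_Integration.integral_cong[OF refl])
  then have 1: "(\<integral>x. F x \<partial>PiM ({} :: ('r \<times> 'c) set) (\<lambda>_. N)) = F (\<lambda>_. undefined)"
    using E.prob_space by simp
  have "(\<integral>\<^sup>+x. ennreal (exp (l * (F x - F (\<lambda>_. undefined)))) \<partial>PiM ({} :: ('r \<times> 'c) set) (\<lambda>_. N)) =
     (\<integral>\<^sup>+x. 1 \<partial>PiM ({} :: ('r \<times> 'c) set) (\<lambda>_. N))"
    by (intro nn_integral_cong) (simp add: space_PiM)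
  then show ?case using 1 by (simp add: E.emeasure_space_1)
next
  case (insert t T)
  define I1 where "I1 = T \<times> J"
  define I2 where "I2 = {t} \<times> J"
  have un: "insert t T \<times> J = I1 \<union> I2" by (auto simp: I1_def I2_def)
  have dis: "I1 \<inter> I2 = {}" using insert.hyps by (auto simp: I1_def I2_def)
  have fin: "finite I1" "finite I2" using insert.hyps J by (auto simp: I1_def I2_def)
  interpret product_prob_space "\<lambda>_::'r \<times> 'c. N" I1
    using N by (simp add: product_prob_space_def product_sigma_finite_def product_prob_space_axioms_def
        prob_space_imp_sigma_finite)
  interpret A: prob_space "PiM I1 (\<lambda>_. N)" by (rule prob_space_PiM) (rule N)
  interpret B: prob_space "PiM I2 (\<lambda>_. N)" by (rule prob_space_PiM) (rule N)
  interpret AB: prob_space "PiM (I1 \<union> I2) (\<lambda>_. N)" by (rule prob_space_PiM) (rule N)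
  note F = insert.prems[unfolded un]
  have [measurable]: "F \<in> borel_measurable (PiM (I1 \<union> I2) (\<lambda>_. N))" by (rule F(1))
  have intF: "integrable (PiM (I1 \<union> I2) (\<lambda>_. N)) F"
    by (rule AB.integrable_const_bound[where B = B]) (auto simp: F(2))
  define G where "G x = (\<integral>y. F (merge I1 I2 (x, y)) \<partial>PiM I2 (\<lambda>_. N))" for x
  have mm: "(\<lambda>z. F (merge I1 I2 z)) \<in> borel_measurable (PiM I1 (\<lambda>_. N) \<Otimes>\<^sub>M PiM I2 (\<lambda>_. N))"
    by measurable
  then have Gm[measurable]: "G \<in> borel_measurable (PiM I1 (\<lambda>_. N))"
    unfolding G_def[abs_def] by (intro B.borel_measurable_lebesgue_integral) (simp add: case_prod_beta')
  have sm: "(\<lambda>y. F (merge I1 I2 (x, y))) \<in> borel_measurable (PiM I2 (\<lambda>_. N))" if "x \<in> space (PiM I1 (\<lambda>_. N))" for x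
    by (rule measurable_Pair2[OF mm that])
  have bm: "\<bar>F (merge I1 I2 (x, y))\<bar> \<le> B"
    if "x \<in> space (PiM I1 (\<lambda>_. N))" "y \<in> space (PiM I2 (\<lambda>_. N))" for x y
    by (rule F(2)[OF merge_space_PiM[OF that]])
  have si: "integrable (PiM I2 (\<lambda>_. N)) (\<lambda>y. F (merge I1 I2 (x, y)))" if "x \<in> space (PiM I1 (\<lambda>_. N))" for x
    by (rule B.integrable_const_bound[where B = B]) (auto simp: bm that sm)
  have EG: "(\<integral>x. G x \<partial>PiM I1 (\<lambda>_. N)) = (\<integral>x. F x \<partial>PiM (I1 \<union> I2) (\<lambda>_. N))"
    unfolding G_def by (rule product_integral_fold[OF dis fin intF, symmetric])
  define EF where "EF = (\<integral>x. F x \<partial>PiM (I1 \<union> I2) (\<lambda>_. N))"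
  have IH: "(\<integral>\<^sup>+x. ennreal (exp (l * (G x - (\<integral>x. G x \<partial>PiM I1 (\<lambda>_. N))))) \<partial>PiM I1 (\<lambda>_. N)) \<le>
     ennreal (exp (real (card T) * (l\<^sup>2 * c\<^sup>2 / 2)))"
    unfolding I1_def
  proof (rule insert.IH)
    show "G \<in> borel_measurable (PiM (T \<times> J) (\<lambda>_. N))" using Gm by (simp add: I1_def)
    show "\<bar>G x\<bar> \<le> B" if "x \<in> space (PiM (T \<times> J) (\<lambda>_. N))" for x
    proof -
      have x: "x \<in> space (PiM I1 (\<lambda>_. N))" using that by (simp add: I1_def)
      show ?thesis
        unfolding G_def real_norm_def[symmetric]
        by (rule B.norm_expectation_le[OF si[OF x]]) (simp add: bm[OF x])
    qed
    show "\<bar>G x - G y\<bar> \<le> c" if t': "t' \<in> T" and x: "x \<in> space (PiM (T \<times> J) (\<lambda>_. N))"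
      and y: "y \<in> space (PiM (T \<times> J) (\<lambda>_. N))"
      and eq: "\<And>p. p \<in> T \<times> J \<Longrightarrow> fst p \<noteq> t' \<Longrightarrow> x p = y p" for t' x y
    proof -
      have x: "x \<in> space (PiM I1 (\<lambda>_. N))" and y: "y \<in> space (PiM I1 (\<lambda>_. N))"
        using x y by (simp_all add: I1_def)
      have d: "\<bar>F (merge I1 I2 (x, w)) - F (merge I1 I2 (y, w))\<bar> \<le> c" if w: "w \<in> space (PiM I2 (\<lambda>_. N))" for w
      proof (rule F(3)[OF _ merge_space_PiM[OF x w] merge_space_PiM[OF y w]])
        show "t' \<in> insert t T" using t' by simp
        show "merge I1 I2 (x, w) p = merge I1 I2 (y, w) p" if "p \<in> I1 \<union> I2" "fst p \<noteq> t'" for p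
          using eq[of p] that by (cases "p \<in> I1") (auto simp: merge_def I1_def)
      qed
      have "\<bar>G x - G y\<bar> = \<bar>\<integral>w. F (merge I1 I2 (x, w)) - F (merge I1 I2 (y, w)) \<partial>PiM I2 (\<lambda>_. N)\<bar>"
        unfolding G_def by (subst Bochner_Integration.integral_diff) (use si[OF x] si[OF y] in auto)
      also have "\<dots> \<le> c"
        unfolding real_norm_def[symmetric]
        by (rule B.norm_expectation_le) (use si[OF x] si[OF y] d in auto)
      finally show ?thesis .
    qed
  qed
  have "(\<integral>\<^sup>+x. ennreal (exp (l * (F x - EF))) \<partial>PiM (I1 \<union> I2) (\<lambda>_. N)) =
    (\<integral>\<^sup>+x. (\<integral>\<^sup>+y. ennreal (exp (l * (F (merge I1 I2 (x, y)) - EF))) \<partial>PiM I2 (\<lambda>_. N)) \<partial>PiM I1 (\<lambda>_. N))"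
    by (rule product_nn_integral_fold[OF dis fin]) measurable
  also have "\<dots> \<le> (\<integral>\<^sup>+x. ennreal (exp (l * (G x - EF))) * ennreal (exp (l\<^sup>2 * c\<^sup>2 / 2)) \<partial>PiM I1 (\<lambda>_. N))"
  proof (rule nn_integral_mono)
    fix x assume x: "x \<in> space (PiM I1 (\<lambda>_. N))"
    \<comment> \<open>Values within \<open>c\<close> of a reference value lie in an interval of
      length \<open>2 c\<close>, whence the exponent
      \<open>l^2 (2 c)^2 / 8 = l^2 c^2 / 2\<close>.\<close>
    obtain y0 where y0: "y0 \<in> space (PiM I2 (\<lambda>_. N))" using B.not_empty by blast
    have rng: "F (merge I1 I2 (x, y)) \<in> {F (merge I1 I2 (x, y0)) - c .. F (merge I1 I2 (x, y0)) + c}"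
      if y: "y \<in> space (PiM I2 (\<lambda>_. N))" for y
    proof -
      have "\<bar>F (merge I1 I2 (x, y)) - F (merge I1 I2 (x, y0))\<bar> \<le> c"
        by (rule F(3)[OF insertI1 merge_space_PiM[OF x y] merge_space_PiM[OF x y0]])
           (auto simp: merge_def I1_def I2_def)
      then show ?thesis by (simp add: abs_le_iff)
    qed
    have "(\<integral>\<^sup>+y. ennreal (exp (l * (F (merge I1 I2 (x, y)) - EF))) \<partial>PiM I2 (\<lambda>_. N)) =
      (\<integral>\<^sup>+y. ennreal (exp (l * (G x - EF))) * ennreal (exp (l * (F (merge I1 I2 (x, y)) - G x))) \<partial>PiM I2 (\<lambda>_. N))"
      by (intro nn_integral_cong) (simp add: ennreal_mult[symmetric] exp_add[symmetric] algebra_simps)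
    also have "\<dots> = ennreal (exp (l * (G x - EF))) *
        (\<integral>\<^sup>+y. ennreal (exp (l * (F (merge I1 I2 (x, y)) - G x))) \<partial>PiM I2 (\<lambda>_. N))"
      by (rule nn_integral_cmult) (use sm[OF x] in measurable)
    also have "(\<integral>\<^sup>+y. ennreal (exp (l * (F (merge I1 I2 (x, y)) - G x))) \<partial>PiM I2 (\<lambda>_. N)) \<le>
       ennreal (exp (l\<^sup>2 * ((F (merge I1 I2 (x, y0)) + c) - (F (merge I1 I2 (x, y0)) - c))\<^sup>2 / 8))"
      unfolding G_def by (rule B.exp_nn_integral_le[OF sm[OF x] rng l])
    also have "(F (merge I1 I2 (x, y0)) + c) - (F (merge I1 I2 (x, y0)) - c) = 2 * c" by simp
    also have "l\<^sup>2 * (2 * c)\<^sup>2 / 8 = l\<^sup>2 * c\<^sup>2 / 2" by (simp add: power_mult_distrib)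
    finally show "(\<integral>\<^sup>+y. ennreal (exp (l * (F (merge I1 I2 (x, y)) - EF))) \<partial>PiM I2 (\<lambda>_. N)) \<le>
      ennreal (exp (l * (G x - EF))) * ennreal (exp (l\<^sup>2 * c\<^sup>2 / 2))"
      by (simp add: mult_left_mono)
  qed
  also have "\<dots> = (\<integral>\<^sup>+x. ennreal (exp (l * (G x - EF))) \<partial>PiM I1 (\<lambda>_. N)) * ennreal (exp (l\<^sup>2 * c\<^sup>2 / 2))"
    by (rule nn_integral_multc) measurable
  also have "(\<integral>\<^sup>+x. ennreal (exp (l * (G x - EF))) \<partial>PiM I1 (\<lambda>_. N)) \<le>
     ennreal (exp (real (card T) * (l\<^sup>2 * c\<^sup>2 / 2)))"
    using IH by (simp add: EF_def EG)
  finally have "(\<integral>\<^sup>+x. ennreal (exp (l * (F x - EF))) \<partial>PiM (I1 \<union> I2) (\<lambda>_. N)) \<le>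
    ennreal (exp (real (card T) * (l\<^sup>2 * c\<^sup>2 / 2))) * ennreal (exp (l\<^sup>2 * c\<^sup>2 / 2))"
    by (simp add: mult_right_mono)
  also have "\<dots> = ennreal (exp (real (card (insert t T)) * (l\<^sup>2 * c\<^sup>2 / 2)))"
    using insert.hyps by (simp add: ennreal_mult[symmetric] exp_add[symmetric] algebra_simps)
  finally show ?case unfolding un EF_def .
qed

lemma bounded_differences_upper_tail:
  fixes N :: "'a measure" and T :: "'r set" and J :: "'c set"
  assumes N: "prob_space N" and T: "finite T" "T \<noteq> {}" and J: "finite J" and c: "c > 0" and a: "a > 0"
    and F: "F \<in> borel_measurable (PiM (T \<times> J) (\<lambda>_. N))"
    and B: "\<And>x. x \<in> space (PiM (T \<times> J) (\<lambda>_. N)) \<Longrightarrow> \<bar>F x\<bar> \<le> B"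
    and d: "\<And>t x y. t \<in> T \<Longrightarrow> x \<in> space (PiM (T \<times> J) (\<lambda>_. N)) \<Longrightarrow> y \<in> space (PiM (T \<times> J) (\<lambda>_. N)) \<Longrightarrow>
       (\<And>p. p \<in> T \<times> J \<Longrightarrow> fst p \<noteq> t \<Longrightarrow> x p = y p) \<Longrightarrow> \<bar>F x - F y\<bar> \<le> c"
  shows "measure (PiM (T \<times> J) (\<lambda>_. N)) {x \<in> space (PiM (T \<times> J) (\<lambda>_. N)).
      F x - (\<integral>x. F x \<partial>PiM (T \<times> J) (\<lambda>_. N)) \<ge> a} \<le> exp (- (a\<^sup>2 / (2 * real (card T) * c\<^sup>2)))"
proof -
  let ?P = "PiM (T \<times> J) (\<lambda>_. N)"
  interpret P: prob_space ?P by (rule prob_space_PiM) (rule N)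
  define n where "n = real (card T)"
  have n: "n > 0" using T by (simp add: n_def card_gt_0_iff)
  \<comment> \<open>The minimizer of \<open>- l a + n l^2 c^2 / 2\<close>, the exponent in
    Chernoff's bound.\<close>
  define l where "l = a / (n * c\<^sup>2)"
  have l: "l > 0" using a n c by (simp add: l_def)
  define f where "f x = F x - (\<integral>x. F x \<partial>?P)" for x
  have [measurable]: "f \<in> borel_measurable ?P" unfolding f_def using F by measurable
  have "emeasure ?P {x\<in>space ?P. f x \<ge> a} \<le>
      ennreal (exp (- l * a)) * nn_integral ?P (\<lambda>x. ennreal (exp (l * f x)) * indicator (space ?P) x)"
    by (rule Chernoff_ineq_nn_integral_ge[OF l]) measurable
  also have "nn_integral ?P (\<lambda>x. ennreal (exp (l * f x)) * indicator (space ?P) x) = (\<integral>\<^sup>+x. ennreal (exp (l * f x)) \<partial>?P)"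
    by (intro nn_integral_cong) simp
  also have "\<dots> \<le> ennreal (exp (n * (l\<^sup>2 * c\<^sup>2 / 2)))"
    unfolding f_def n_def by (rule bounded_differences_mgf[OF N T(1) J l less_imp_le[OF c] F B d])
  also have "ennreal (exp (- l * a)) * ennreal (exp (n * (l\<^sup>2 * c\<^sup>2 / 2))) = ennreal (exp (- (a\<^sup>2 / (2 * n * c\<^sup>2))))"
  proof -
    have "- l * a + n * (l\<^sup>2 * c\<^sup>2 / 2) = - (a\<^sup>2 / (2 * n * c\<^sup>2))"
      using n c by (simp add: l_def field_simps power2_eq_square)
    then show ?thesis by (simp add: ennreal_mult[symmetric] exp_add[symmetric])
  qed
  finally have "emeasure ?P {x\<in>space ?P. f x \<ge> a} \<le> ennreal (exp (- (a\<^sup>2 / (2 * n * c\<^sup>2))))"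
    by (simp add: mult_left_mono)
  then show ?thesis unfolding f_def n_def P.emeasure_eq_measure by simp
qed

theorem bounded_differences_inequality:
  fixes N :: "'a measure" and T :: "'r set" and J :: "'c set" and F :: "('r \<times> 'c \<Rightarrow> 'a) \<Rightarrow> real"
  assumes N: "prob_space N" and T: "finite T" "T \<noteq> {}" and J: "finite J" and c: "c > 0" and a: "a > 0"
    and F: "F \<in> borel_measurable (PiM (T \<times> J) (\<lambda>_. N))"
    and B: "\<And>x. x \<in> space (PiM (T \<times> J) (\<lambda>_. N)) \<Longrightarrow> \<bar>F x\<bar> \<le> B"
    and d: "\<And>t x y. t \<in> T \<Longrightarrow> x \<in> space (PiM (T \<times> J) (\<lambda>_. N)) \<Longrightarrow> y \<in> space (PiM (T \<times> J) (\<lambda>_. N)) \<Longrightarrow>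
       (\<And>p. p \<in> T \<times> J \<Longrightarrow> fst p \<noteq> t \<Longrightarrow> x p = y p) \<Longrightarrow> \<bar>F x - F y\<bar> \<le> c"
  shows "measure (PiM (T \<times> J) (\<lambda>_. N)) {x \<in> space (PiM (T \<times> J) (\<lambda>_. N)).
      \<bar>F x - (\<integral>x. F x \<partial>PiM (T \<times> J) (\<lambda>_. N))\<bar> \<ge> a} \<le> 2 * exp (- (a\<^sup>2 / (2 * real (card T) * c\<^sup>2)))"
proof -
  let ?P = "PiM (T \<times> J) (\<lambda>_. N)"
  interpret P: prob_space ?P by (rule prob_space_PiM) (rule N)
  let ?E = "\<integral>x. F x \<partial>?P"
  have "measure ?P {x \<in> space ?P. F x - ?E \<ge> a} \<le> exp (- (a\<^sup>2 / (2 * real (card T) * c\<^sup>2)))"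
    by (rule bounded_differences_upper_tail[OF N T J c a F B d])
  moreover have "measure ?P {x \<in> space ?P. - F x - (\<integral>x. - F x \<partial>?P) \<ge> a} \<le> exp (- (a\<^sup>2 / (2 * real (card T) * c\<^sup>2)))"
  proof (rule bounded_differences_upper_tail[OF N T J c a])
    show "\<bar>- F x - - F y\<bar> \<le> c" if "t \<in> T" "x \<in> space ?P" "y \<in> space ?P"
      "\<And>p. p \<in> T \<times> J \<Longrightarrow> fst p \<noteq> t \<Longrightarrow> x p = y p" for t x y
      using d[OF that] by simp
  qed (use F B in auto)
  moreover have "measure ?P {x \<in> space ?P. \<bar>F x - ?E\<bar> \<ge> a} \<le>
      measure ?P ({x \<in> space ?P. F x - ?E \<ge> a} \<union> {x \<in> space ?P. - F x - (\<integral>x. - F x \<partial>?P) \<ge> a})"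
    using F by (intro P.finite_measure_mono) auto
  moreover have "\<dots> \<le> measure ?P {x \<in> space ?P. F x - ?E \<ge> a} + measure ?P {x \<in> space ?P. - F x - (\<integral>x. - F x \<partial>?P) \<ge> a}"
    using F by (intro measure_subadditive) (auto simp: P.emeasure_eq_measure)
  ultimately show ?thesis by linarith
qed

section \<open>Quadratic forms in independent entries\<close>

lemma (in prob_space) nn_integral_norm_le_sqrt:
  fixes Z :: "'a \<Rightarrow> complex"
  assumes Z: "Z \<in> borel_measurable M" and int: "integrable M (\<lambda>x. (cmod (Z x))\<^sup>2)"
    and le: "(\<integral>x. (cmod (Z x))\<^sup>2 \<partial>M) \<le> C\<^sup>2" and C: "C \<ge> 0"
  shows "(\<integral>\<^sup>+x. ennreal (cmod (Z x)) \<partial>M) \<le> ennreal C"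
proof -
  have i1: "integrable M (\<lambda>x. cmod (Z x))"
    by (rule square_integrable_imp_integrable) (use Z int in auto)
  have "0 \<le> variance (\<lambda>x. cmod (Z x))" by (rule variance_positive)
  then have "(\<integral>x. cmod (Z x) \<partial>M)\<^sup>2 \<le> (\<integral>x. (cmod (Z x))\<^sup>2 \<partial>M)"
    by (subst (asm) variance_eq[OF i1 int]) simp
  then have "(\<integral>x. cmod (Z x) \<partial>M)\<^sup>2 \<le> C\<^sup>2" using le by simp
  then have "(\<integral>x. cmod (Z x) \<partial>M) \<le> C" by (rule power2_le_imp_le) (rule C)
  then show ?thesis by (simp add: nn_integral_eq_integral[OF i1] ennreal_leI)
qed

text \<open>Expands the square into covariances, nearly all of which vanish in the applications
  because the factors are independent and centred.\<close>

lemma square_norm_sum_integral: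
  fixes W :: "'d \<Rightarrow> 'a \<Rightarrow> complex"
  assumes int: "\<And>d e. d \<in> D \<Longrightarrow> e \<in> D \<Longrightarrow> integrable M (\<lambda>x. W d x * cnj (W e x))"
  shows "integrable M (\<lambda>x. (cmod (\<Sum>d\<in>D. W d x))\<^sup>2)"
    "(\<integral>x. (cmod (\<Sum>d\<in>D. W d x))\<^sup>2 \<partial>M) \<le> (\<Sum>d\<in>D. \<Sum>e\<in>D. cmod (\<integral>x. W d x * cnj (W e x) \<partial>M))"
proof -
  have eq: "complex_of_real ((cmod (\<Sum>d\<in>D. W d x))\<^sup>2) = (\<Sum>d\<in>D. \<Sum>e\<in>D. W d x * cnj (W e x))" for x
    unfolding complex_norm_square cnj_sum sum_product ..
  have i: "integrable M (\<lambda>x. \<Sum>d\<in>D. \<Sum>e\<in>D. W d x * cnj (W e x))"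
    by (intro Bochner_Integration.integrable_sum int)
  have "integrable M (\<lambda>x. Re (complex_of_real ((cmod (\<Sum>d\<in>D. W d x))\<^sup>2)))"
    unfolding eq by (rule integrable_Re[OF i])
  then show "integrable M (\<lambda>x. (cmod (\<Sum>d\<in>D. W d x))\<^sup>2)" by simp
  have "complex_of_real (\<integral>x. (cmod (\<Sum>d\<in>D. W d x))\<^sup>2 \<partial>M) = (\<integral>x. (\<Sum>d\<in>D. \<Sum>e\<in>D. W d x * cnj (W e x)) \<partial>M)"
    unfolding eq[symmetric] by (rule integral_complex_of_real[symmetric])
  also have "\<dots> = (\<Sum>d\<in>D. \<Sum>e\<in>D. (\<integral>x. W d x * cnj (W e x) \<partial>M))"
    by (simp add: Bochner_Integration.integral_sum Bochner_Integration.integrable_sum int)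
  finally have "cmod (complex_of_real (\<integral>x. (cmod (\<Sum>d\<in>D. W d x))\<^sup>2 \<partial>M))
      = cmod (\<Sum>d\<in>D. \<Sum>e\<in>D. (\<integral>x. W d x * cnj (W e x) \<partial>M))"
    by (rule arg_cong)
  also have "\<dots> \<le> (\<Sum>d\<in>D. \<Sum>e\<in>D. cmod (\<integral>x. W d x * cnj (W e x) \<partial>M))"
    by (rule order_trans[OF norm_sum]) (rule sum_mono, rule norm_sum)
  finally have "cmod (complex_of_real (\<integral>x. (cmod (\<Sum>d\<in>D. W d x))\<^sup>2 \<partial>M))
      \<le> (\<Sum>d\<in>D. \<Sum>e\<in>D. cmod (\<integral>x. W d x * cnj (W e x) \<partial>M))" .
  then show "(\<integral>x. (cmod (\<Sum>d\<in>D. W d x))\<^sup>2 \<partial>M) \<le> (\<Sum>d\<in>D. \<Sum>e\<in>D. cmod (\<integral>x. W d x * cnj (W e x) \<partial>M))"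
    unfolding norm_of_real by (rule order_trans[OF abs_ge_self])
qed

locale entry_law = prob_space N for N :: "complex measure" +
  fixes \<tau> :: real
  assumes sets_N: "sets N = sets borel"
    and mean_zero: "(\<integral>x. x \<partial>N) = 0"
    and square_integrable: "integrable N (\<lambda>x. (cmod x)\<^sup>2)"
    and second_moment: "(\<integral>x. (cmod x)\<^sup>2 \<partial>N) = \<tau>"
begin

lemma measurable_N[measurable_cong]: "sets N = sets borel" by (rule sets_N)

lemma tau_nonneg: "\<tau> \<ge> 0"
  unfolding second_moment[symmetric] by (rule integral_nonneg_AE) simp

lemma product_prob: "product_prob_space (\<lambda>_. N)"
  by (simp add: product_prob_space_def product_sigma_finite_def product_prob_space_axioms_def
      prob_space_imp_sigma_finite prob_space_axioms)

lemma prob_space_product: "prob_space (PiM U (\<lambda>_. N))"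
  by (rule prob_space_PiM) (rule prob_space_axioms)

lemma integral_product:
  fixes h :: "'u \<Rightarrow> complex \<Rightarrow> 'b :: {real_normed_field, banach, second_countable_topology}"
  assumes "finite U" "\<And>u. u \<in> U \<Longrightarrow> integrable N (h u)"
  shows "(\<integral>\<omega>. (\<Prod>u\<in>U. h u (\<omega> u)) \<partial>PiM U (\<lambda>_. N)) = (\<Prod>u\<in>U. integral\<^sup>L N (h u))"
    "integrable (PiM U (\<lambda>_. N)) (\<lambda>\<omega>. \<Prod>u\<in>U. h u (\<omega> u))"
proof -
  interpret product_prob_space "\<lambda>_. N" U by (rule product_prob)
  show "(\<integral>\<omega>. (\<Prod>u\<in>U. h u (\<omega> u)) \<partial>PiM U (\<lambda>_. N)) = (\<Prod>u\<in>U. integral\<^sup>L N (h u))"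
    by (rule product_integral_prod) (use assms in auto)
  show "integrable (PiM U (\<lambda>_. N)) (\<lambda>\<omega>. \<Prod>u\<in>U. h u (\<omega> u))"
    by (rule product_integrable_prod) (use assms in auto)
qed

lemma integral_one_factor:
  fixes h :: "complex \<Rightarrow> 'b :: {real_normed_field, banach, second_countable_topology}"
  assumes U: "finite U" "u \<in> U" and h: "integrable N h"
  shows "(\<integral>\<omega>. h (\<omega> u) \<partial>PiM U (\<lambda>_. N)) = integral\<^sup>L N h" "integrable (PiM U (\<lambda>_. N)) (\<lambda>\<omega>. h (\<omega> u))"
proof -
  define H where "H k = (if k = u then h else (\<lambda>_. 1))" for k
  have i: "integrable N (H k)" for k using h by (simp add: H_def)
  have p: "(\<Prod>k\<in>U. H k (\<omega> k)) = h (\<omega> u)" for \<omega>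
    using U by (simp add: H_def if_distribR prod.delta cong: if_cong)
  have "(\<Prod>k\<in>U. integral\<^sup>L N (H k)) = integral\<^sup>L N h"
    using U by (simp add: H_def if_distrib[where f = "integral\<^sup>L N"] prob_space prod.delta cong: if_cong)
  then show "(\<integral>\<omega>. h (\<omega> u) \<partial>PiM U (\<lambda>_. N)) = integral\<^sup>L N h" "integrable (PiM U (\<lambda>_. N)) (\<lambda>\<omega>. h (\<omega> u))"
    using integral_product[where h = H, OF U(1) i] unfolding p by simp_all
qed

lemma integral_two_factors:
  fixes h h' :: "complex \<Rightarrow> 'b :: {real_normed_field, banach, second_countable_topology}"
  assumes U: "finite U" "u \<in> U" "v \<in> U" "u \<noteq> v" and h: "integrable N h" "integrable N h'"
  shows "(\<integral>\<omega>. h (\<omega> u) * h' (\<omega> v) \<partial>PiM U (\<lambda>_. N)) = integral\<^sup>L N h * integral\<^sup>L N h'"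
    "integrable (PiM U (\<lambda>_. N)) (\<lambda>\<omega>. h (\<omega> u) * h' (\<omega> v))"
proof -
  define H where "H k = (if k = u then h else if k = v then h' else (\<lambda>_. 1))" for k
  have i: "integrable N (H k)" for k using h by (simp add: H_def)
  have sp: "(\<Prod>k\<in>U. g k) = g u * g v" if "\<And>k. k \<noteq> u \<Longrightarrow> k \<noteq> v \<Longrightarrow> g k = 1" for g :: "_ \<Rightarrow> 'b"
  proof -
    have "(\<Prod>k\<in>U. g k) = (\<Prod>k\<in>{u, v}. g k)"
      by (rule prod.mono_neutral_right) (use U that in auto)
    then show ?thesis using U(4) by simp
  qed
  have p: "(\<Prod>k\<in>U. H k (\<omega> k)) = h (\<omega> u) * h' (\<omega> v)" for \<omega>
    using U(4) by (subst sp) (auto simp: H_def)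
  have "(\<Prod>k\<in>U. integral\<^sup>L N (H k)) = integral\<^sup>L N h * integral\<^sup>L N h'"
    using U(4) by (subst sp) (auto simp: H_def prob_space)
  then show "(\<integral>\<omega>. h (\<omega> u) * h' (\<omega> v) \<partial>PiM U (\<lambda>_. N)) = integral\<^sup>L N h * integral\<^sup>L N h'"
    "integrable (PiM U (\<lambda>_. N)) (\<lambda>\<omega>. h (\<omega> u) * h' (\<omega> v))"
    using integral_product[where h = H, OF U(1) i] unfolding p by simp_all
qed

end

lemma le_one_plus_square: "(a :: real) \<le> 1 + a\<^sup>2"
proof -
  have "1 + a\<^sup>2 - a = (a - 1/2)\<^sup>2 + 3/4" by (simp add: power2_eq_square algebra_simps)
  moreover have "(a - 1/2)\<^sup>2 \<ge> 0" by simp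
  ultimately show ?thesis by linarith
qed

text \<open>\<open>f\<close> and \<open>g\<close> stand for the identity or conjugation; their four
  combinations are the four quadratic forms of the cavity argument.\<close>

locale entry_pair = entry_law +
  fixes f g :: "complex \<Rightarrow> complex"
  assumes f_measurable[measurable]: "f \<in> borel_measurable borel" and g_measurable[measurable]: "g \<in> borel_measurable borel"
    and norm_f: "\<And>x. cmod (f x) = cmod x" and norm_g: "\<And>x. cmod (g x) = cmod x"
    and mean_f: "(\<integral>x. f x \<partial>N) = 0" and mean_g: "(\<integral>x. g x \<partial>N) = 0"
begin

text \<open>The factor at coordinate \<open>k\<close> of a product of four coordinate functions, so
  that independence turns the integral into a product over \<open>k\<close> even where coordinates
  of \<open>d\<close> and \<open>e\<close> coincide.\<close>

definition four_factor :: "'u \<times> 'u \<Rightarrow> 'u \<times> 'u \<Rightarrow> 'u \<Rightarrow> complex \<Rightarrow> complex" where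
  "four_factor d e k x = (if k = fst d then f x else 1) * (if k = snd d then g x else 1) *
     ((if k = fst e then cnj (f x) else 1) * (if k = snd e then cnj (g x) else 1))"

text \<open>As \<open>d\<close> and \<open>e\<close> each have distinct components, a coordinate
  carries at most one factor from \<open>d\<close> and one from \<open>e\<close>: the degree is at
  most two, and second moments suffice.\<close>

lemma integrable_four_factor:
  assumes "fst d \<noteq> snd d" "fst e \<noteq> snd e"
  shows "integrable N (four_factor d e k)"
proof (rule Bochner_Integration.integrable_bound)
  show "integrable N (\<lambda>x. 1 + (cmod x)\<^sup>2)" using square_integrable by simp
  have cn: "(\<lambda>x. cnj (F x)) \<in> borel_measurable borel" if "F \<in> borel_measurable borel" for F :: "complex \<Rightarrow> complex"
    by (rule borel_measurable_continuous_on[OF _ that]) (intro continuous_intros)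
  have A: "(\<lambda>x. if c then F x else 1) \<in> borel_measurable borel" if "F \<in> borel_measurable borel"
    for c and F :: "complex \<Rightarrow> complex"
    using that by (cases c) simp_all
  have "four_factor d e k \<in> borel_measurable borel"
    unfolding four_factor_def by (intro borel_measurable_times A cn f_measurable g_measurable)
  then show "four_factor d e k \<in> borel_measurable N" by (simp add: measurable_cong_sets[OF sets_N refl])
  have "cmod (four_factor d e k x) \<le> 1 + (cmod x)\<^sup>2" for x
    using assms le_one_plus_square[of "cmod x"]
    by (auto simp: four_factor_def norm_mult norm_f norm_g power2_eq_square)
  then show "AE x in N. norm (four_factor d e k x) \<le> norm (1 + (cmod x)\<^sup>2)" by simp
qed

lemma prod_four_factor:
  assumes "finite U" "d \<in> U \<times> U" "e \<in> U \<times> U"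
  shows "(\<Prod>k\<in>U. four_factor d e k (\<omega> k)) =
    f (\<omega> (fst d)) * g (\<omega> (snd d)) * cnj (f (\<omega> (fst e)) * g (\<omega> (snd e)))"
  using assms by (auto simp: four_factor_def prod.distrib prod.delta)

text \<open>If \<open>e\<close> is neither \<open>d\<close> nor its swap, some coordinate of
  \<open>d\<close> carries a single centred factor and the integral vanishes. In the two other cases
  the integrand has modulus equal to a product of two squared entries.\<close>

lemma integral_four_factor:
  assumes U: "finite U" "d \<in> U \<times> U" "e \<in> U \<times> U" and ne: "fst d \<noteq> snd d" "fst e \<noteq> snd e"
  shows "cmod (\<integral>\<omega>. f (\<omega> (fst d)) * g (\<omega> (snd d)) * cnj (f (\<omega> (fst e)) * g (\<omega> (snd e))) \<partial>PiM U (\<lambda>_. N))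
     \<le> (if e = d \<or> e = (snd d, fst d) then \<tau>\<^sup>2 else 0)"
    "integrable (PiM U (\<lambda>_. N)) (\<lambda>\<omega>. f (\<omega> (fst d)) * g (\<omega> (snd d)) * cnj (f (\<omega> (fst e)) * g (\<omega> (snd e))))"
proof -
  note P = integral_product[where h = "four_factor d e", OF U(1) integrable_four_factor[OF ne],
      unfolded prod_four_factor[OF U]]
  show "integrable (PiM U (\<lambda>_. N)) (\<lambda>\<omega>. f (\<omega> (fst d)) * g (\<omega> (snd d)) * cnj (f (\<omega> (fst e)) * g (\<omega> (snd e))))"
    by (rule P(2))
  have uv: "fst d \<in> U" "snd d \<in> U" using U by auto
  show "cmod (\<integral>\<omega>. f (\<omega> (fst d)) * g (\<omega> (snd d)) * cnj (f (\<omega> (fst e)) * g (\<omega> (snd e))) \<partial>PiM U (\<lambda>_. N))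
     \<le> (if e = d \<or> e = (snd d, fst d) then \<tau>\<^sup>2 else 0)"
  proof (cases "e = d \<or> e = (snd d, fst d)")
    case True
    have n: "cmod (f (\<omega> (fst d)) * g (\<omega> (snd d)) * cnj (f (\<omega> (fst e)) * g (\<omega> (snd e)))) =
        (cmod (\<omega> (fst d)))\<^sup>2 * (cmod (\<omega> (snd d)))\<^sup>2" for \<omega>
      using True by (auto simp: norm_mult norm_f norm_g power2_eq_square)
    have "cmod (\<integral>\<omega>. f (\<omega> (fst d)) * g (\<omega> (snd d)) * cnj (f (\<omega> (fst e)) * g (\<omega> (snd e))) \<partial>PiM U (\<lambda>_. N))
      \<le> (\<integral>\<omega>. (cmod (\<omega> (fst d)))\<^sup>2 * (cmod (\<omega> (snd d)))\<^sup>2 \<partial>PiM U (\<lambda>_. N))"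
      unfolding n[symmetric] by (rule integral_norm_bound)
    also have "\<dots> = \<tau> * \<tau>"
      using integral_two_factors(1)[OF U(1) uv ne(1) square_integrable square_integrable]
      by (simp add: second_moment)
    finally show ?thesis using True by (simp add: power2_eq_square)
  next
    case False
    have "\<exists>k\<in>U. integral\<^sup>L N (four_factor d e k) = 0"
    proof (cases "fst d = fst e \<or> fst d = snd e")
      case True
      then have "snd d \<noteq> fst e" "snd d \<noteq> snd e" using False ne True by (cases d; cases e; auto)+
      then have "four_factor d e (snd d) = g"
        using ne unfolding four_factor_def by (intro ext) simp
      then show ?thesis using uv mean_g by (intro bexI[of _ "snd d"]) auto
    next
      case False
      then have "four_factor d e (fst d) = f"
        using ne unfolding four_factor_def by (intro ext) simp
      then show ?thesis using uv mean_f by (intro bexI[of _ "fst d"]) auto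
    qed
    then have "(\<Prod>k\<in>U. integral\<^sup>L N (four_factor d e k)) = 0" using U(1) by simp
    then show ?thesis using P(1) False by simp
  qed
qed

text \<open>Orthogonality leaves, for each pair \<open>d\<close>, its own square and its product
  with the swapped pair. The latter is at most a mean of two squares, so the second moment is at
  most twice the squared Frobenius norm times \<open>\<tau>^2\<close>.\<close>

lemma quadratic_form_off_diagonal:
  assumes U: "finite U" and b: "(\<Sum>u\<in>U. \<Sum>v\<in>U. (cmod (B u v))\<^sup>2) \<le> b"
  shows "(\<integral>\<^sup>+\<omega>. ennreal (cmod (\<Sum>u\<in>U. \<Sum>v\<in>U. if u = v then 0 else B u v * f (\<omega> u) * g (\<omega> v))) \<partial>PiM U (\<lambda>_. N))
    \<le> ennreal (sqrt (2 * b) * \<tau>)"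
proof -
  interpret P: prob_space "PiM U (\<lambda>_. N)" by (rule prob_space_product)
  have b0: "0 \<le> b" by (rule order_trans[OF _ b]) (simp add: sum_nonneg)
  define D where "D = {d \<in> U \<times> U. fst d \<noteq> snd d}"
  have D: "finite D" using U by (simp add: D_def)
  define C where "C d = B (fst d) (snd d)" for d
  define W where "W d \<omega> = C d * (f (\<omega> (fst d)) * g (\<omega> (snd d)))" for d \<omega>
  have Z: "(\<Sum>u\<in>U. \<Sum>v\<in>U. if u = v then 0 else B u v * f (\<omega> u) * g (\<omega> v)) = (\<Sum>d\<in>D. W d \<omega>)" for \<omega>
  proof -
    have "(\<Sum>u\<in>U. \<Sum>v\<in>U. if u = v then 0 else B u v * f (\<omega> u) * g (\<omega> v)) =
      (\<Sum>d\<in>U \<times> U. if fst d \<noteq> snd d then W d \<omega> else 0)"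
      unfolding sum.cartesian_product by (intro sum.cong) (auto simp: W_def C_def)
    also have "\<dots> = (\<Sum>d\<in>D. W d \<omega>)" unfolding D_def by (rule sum.inter_filter[symmetric]) (use U in simp)
    finally show ?thesis .
  qed
  have WW: "W d \<omega> * cnj (W e \<omega>) = (C d * cnj (C e)) *
      (f (\<omega> (fst d)) * g (\<omega> (snd d)) * cnj (f (\<omega> (fst e)) * g (\<omega> (snd e))))" for d e \<omega>
    by (simp add: W_def)
  have int: "integrable (PiM U (\<lambda>_. N)) (\<lambda>\<omega>. W d \<omega> * cnj (W e \<omega>))" if "d \<in> D" "e \<in> D" for d e
    unfolding WW by (intro integrable_mult_right integral_four_factor(2)) (use that U in \<open>auto simp: D_def\<close>)
  have cov: "cmod (\<integral>\<omega>. W d \<omega> * cnj (W e \<omega>) \<partial>PiM U (\<lambda>_. N)) \<le>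
      (if e = d then cmod (C d) * cmod (C d) * \<tau>\<^sup>2 else 0) +
      (if e = (snd d, fst d) then cmod (C d) * cmod (C (snd d, fst d)) * \<tau>\<^sup>2 else 0)"
    if "d \<in> D" "e \<in> D" for d e
  proof -
    have "cmod (\<integral>\<omega>. W d \<omega> * cnj (W e \<omega>) \<partial>PiM U (\<lambda>_. N)) \<le> cmod (C d) * cmod (C e) *
        (if e = d \<or> e = (snd d, fst d) then \<tau>\<^sup>2 else 0)"
      unfolding WW integral_mult_right_zero norm_mult complex_mod_cnj
      by (intro mult_left_mono integral_four_factor(1) mult_nonneg_nonneg norm_ge_zero)
         (use that U in \<open>auto simp: D_def\<close>)
    also have "\<dots> \<le> (if e = d then cmod (C d) * cmod (C d) * \<tau>\<^sup>2 else 0) +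
      (if e = (snd d, fst d) then cmod (C d) * cmod (C (snd d, fst d)) * \<tau>\<^sup>2 else 0)"
      by auto
    finally show ?thesis .
  qed
  have swapD: "(snd d, fst d) \<in> D" if "d \<in> D" for d using that by (auto simp: D_def)
  note sq = square_norm_sum_integral[where D = D and W = W, OF int]
  have "(\<integral>\<omega>. (cmod (\<Sum>d\<in>D. W d \<omega>))\<^sup>2 \<partial>PiM U (\<lambda>_. N)) \<le>
      (\<Sum>d\<in>D. \<Sum>e\<in>D. cmod (\<integral>\<omega>. W d \<omega> * cnj (W e \<omega>) \<partial>PiM U (\<lambda>_. N)))"
    by (rule sq(2))
  also have "\<dots> \<le> (\<Sum>d\<in>D. \<Sum>e\<in>D. (if e = d then cmod (C d) * cmod (C d) * \<tau>\<^sup>2 else 0) +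
      (if e = (snd d, fst d) then cmod (C d) * cmod (C (snd d, fst d)) * \<tau>\<^sup>2 else 0))"
    by (intro sum_mono cov)
  also have "\<dots> = (\<Sum>d\<in>D. cmod (C d) * cmod (C d) * \<tau>\<^sup>2 + cmod (C d) * cmod (C (snd d, fst d)) * \<tau>\<^sup>2)"
    using swapD D by (intro sum.cong refl) (simp add: sum.distrib sum.delta)
  also have "\<dots> \<le> (\<Sum>d\<in>D. \<tau>\<^sup>2 * ((cmod (C d))\<^sup>2 + ((cmod (C d))\<^sup>2 + (cmod (C (snd d, fst d)))\<^sup>2) / 2))"
  proof (rule sum_mono)
    fix d
    have "cmod (C d) * cmod (C (snd d, fst d)) \<le> ((cmod (C d))\<^sup>2 + (cmod (C (snd d, fst d)))\<^sup>2) / 2"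
      using sum_squares_bound[of "cmod (C d)" "cmod (C (snd d, fst d))"] by simp
    then have "\<tau>\<^sup>2 * (cmod (C d) * cmod (C d) + cmod (C d) * cmod (C (snd d, fst d))) \<le>
        \<tau>\<^sup>2 * ((cmod (C d))\<^sup>2 + ((cmod (C d))\<^sup>2 + (cmod (C (snd d, fst d)))\<^sup>2) / 2)"
      by (intro mult_left_mono) (auto simp: power2_eq_square)
    then show "cmod (C d) * cmod (C d) * \<tau>\<^sup>2 + cmod (C d) * cmod (C (snd d, fst d)) * \<tau>\<^sup>2 \<le>
        \<tau>\<^sup>2 * ((cmod (C d))\<^sup>2 + ((cmod (C d))\<^sup>2 + (cmod (C (snd d, fst d)))\<^sup>2) / 2)"
      by (simp add: algebra_simps)
  qed
  also have "\<dots> = \<tau>\<^sup>2 * ((\<Sum>d\<in>D. (cmod (C d))\<^sup>2) + ((\<Sum>d\<in>D. (cmod (C d))\<^sup>2) + (\<Sum>d\<in>D. (cmod (C (snd d, fst d)))\<^sup>2)) / 2)"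
    by (simp only: sum_distrib_left[symmetric] sum.distrib sum_divide_distrib[symmetric])
  also have "(\<Sum>d\<in>D. (cmod (C (snd d, fst d)))\<^sup>2) = (\<Sum>d\<in>D. (cmod (C d))\<^sup>2)"
    by (rule sum.reindex_bij_witness[of _ "\<lambda>d. (snd d, fst d)" "\<lambda>d. (snd d, fst d)"]) (auto simp: D_def)
  also have "\<tau>\<^sup>2 * ((\<Sum>d\<in>D. (cmod (C d))\<^sup>2) + ((\<Sum>d\<in>D. (cmod (C d))\<^sup>2) + (\<Sum>d\<in>D. (cmod (C d))\<^sup>2)) / 2) =
      2 * (\<Sum>d\<in>D. (cmod (C d))\<^sup>2) * \<tau>\<^sup>2" by simp
  also have "\<dots> \<le> 2 * b * \<tau>\<^sup>2"
  proof -
    have "(\<Sum>d\<in>D. (cmod (C d))\<^sup>2) \<le> (\<Sum>d\<in>U \<times> U. (cmod (C d))\<^sup>2)"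
      by (rule sum_mono2) (use U in \<open>auto simp: D_def\<close>)
    also have "\<dots> = (\<Sum>u\<in>U. \<Sum>v\<in>U. (cmod (B u v))\<^sup>2)"
      unfolding sum.cartesian_product by (simp add: C_def case_prod_beta')
    also have "\<dots> \<le> b" by (rule b)
    finally show ?thesis by (intro mult_right_mono) auto
  qed
  also have "\<dots> = (sqrt (2 * b) * \<tau>)\<^sup>2"
    using b0 by (simp add: power_mult_distrib)
  finally have le: "(\<integral>\<omega>. (cmod (\<Sum>d\<in>D. W d \<omega>))\<^sup>2 \<partial>PiM U (\<lambda>_. N)) \<le> (sqrt (2 * b) * \<tau>)\<^sup>2" .
  have Wm: "W d \<in> borel_measurable (PiM U (\<lambda>_. N))" if "d \<in> D" for d
  proof -
    have [measurable]: "(\<lambda>\<omega>. \<omega> (fst d)) \<in> PiM U (\<lambda>_. N) \<rightarrow>\<^sub>M borel" "(\<lambda>\<omega>. \<omega> (snd d)) \<in> PiM U (\<lambda>_. N) \<rightarrow>\<^sub>M borel"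
      using that measurable_component_singleton[of _ U "\<lambda>_. N"]
      by (auto simp: D_def measurable_cong_sets[OF refl sets_N])
    show ?thesis unfolding W_def[abs_def] by measurable
  qed
  show ?thesis unfolding Z
    by (rule P.nn_integral_norm_le_sqrt[OF _ sq(1) le])
       (use Wm tau_nonneg b0 in \<open>auto intro!: borel_measurable_sum mult_nonneg_nonneg\<close>)
qed

end

context entry_law
begin

lemma measurable_coordinate: "u \<in> U \<Longrightarrow> (\<lambda>\<omega>. \<omega> u) \<in> PiM U (\<lambda>_. N) \<rightarrow>\<^sub>M borel"
  using measurable_component_singleton[of u U "\<lambda>_. N"] by (simp add: measurable_cong_sets[OF refl sets_N])

definition tail_moment :: "real \<Rightarrow> real" where
  "tail_moment \<epsilon> = (\<integral>x. (cmod x)\<^sup>2 * indicator {x. cmod x > \<epsilon>} x \<partial>N)"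

lemma integrable_tail: "integrable N (\<lambda>x. (cmod x)\<^sup>2 * indicator {x. cmod x > \<epsilon>} x)"
  by (rule Bochner_Integration.integrable_bound[OF square_integrable]) (auto simp: indicator_def)

lemma integrable_body: "integrable N (\<lambda>x. (cmod x)\<^sup>2 * indicator {x. cmod x \<le> \<epsilon>} x)"
  by (rule Bochner_Integration.integrable_bound[OF square_integrable]) (auto simp: indicator_def)

lemma tail_moment_nonneg: "tail_moment \<epsilon> \<ge> 0"
  unfolding tail_moment_def by (rule integral_nonneg_AE) simp

text \<open>Fourth moments may be infinite, so \<open>|x|^2\<close> is cut where \<open>|x|\<close>
  exceeds \<open>\<epsilon>\<close>. The bounded part has variance at most
  \<open>\<epsilon>^2 \<tau>\<close> and is treated in mean square; the tail is estimated in mean,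
  its centring accounting for the factor 2.\<close>

lemma quadratic_form_diagonal:
  assumes U: "finite U" and b: "\<And>u. u \<in> U \<Longrightarrow> cmod (b u) \<le> \<beta>" and \<beta>: "\<beta> \<ge> 0" and \<epsilon>: "\<epsilon> \<ge> 0"
  shows "(\<integral>\<^sup>+\<omega>. ennreal (cmod (\<Sum>u\<in>U. b u * complex_of_real ((cmod (\<omega> u))\<^sup>2 - \<tau>))) \<partial>PiM U (\<lambda>_. N))
    \<le> ennreal (\<beta> * (\<epsilon> * sqrt (card U * \<tau>) + 2 * card U * tail_moment \<epsilon>))"
proof -
  interpret P: prob_space "PiM U (\<lambda>_. N)" by (rule prob_space_product)
  define \<xi> where "\<xi> x = (cmod x)\<^sup>2 * indicator {x. cmod x \<le> \<epsilon>} x" for x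
  define \<rho> where "\<rho> x = (cmod x)\<^sup>2 * indicator {x. cmod x > \<epsilon>} x" for x
  define m where "m = (\<integral>x. \<xi> x \<partial>N)"
  have i\<xi>: "integrable N \<xi>" and i\<rho>: "integrable N \<rho>"
    unfolding \<xi>_def[abs_def] \<rho>_def[abs_def] by (rule integrable_body, rule integrable_tail)
  have split: "(cmod x)\<^sup>2 = \<xi> x + \<rho> x" for x by (auto simp: \<xi>_def \<rho>_def indicator_def)
  have tm: "tail_moment \<epsilon> = integral\<^sup>L N \<rho>" unfolding tail_moment_def \<rho>_def[abs_def] ..
  have \<tau>: "\<tau> = m + tail_moment \<epsilon>"
    unfolding tm m_def Bochner_Integration.integral_add[OF i\<xi> i\<rho>, symmetric]
    using second_moment by (simp only: split)
  have m0: "m \<ge> 0" unfolding m_def by (rule integral_nonneg_AE) (simp add: \<xi>_def)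
  have m\<tau>: "m \<le> \<tau>" using \<tau> tail_moment_nonneg by simp
  define \<zeta> where "\<zeta> x = complex_of_real (\<xi> x - m)" for x
  have \<xi>b: "0 \<le> \<xi> x" "\<xi> x \<le> \<epsilon>\<^sup>2" for x using \<epsilon> by (auto simp: \<xi>_def indicator_def power_mono)
  have i\<zeta>: "integrable N \<zeta>" "integral\<^sup>L N \<zeta> = 0"
    unfolding \<zeta>_def[abs_def] using i\<xi> by (simp_all add: m_def prob_space flip: integral_complex_of_real of_real_diff)
  have i\<xi>2: "integrable N (\<lambda>x. (\<xi> x)\<^sup>2)"
  proof (rule integrable_const_bound[where B = "(\<epsilon>\<^sup>2)\<^sup>2"])
    show "AE x in N. norm ((\<xi> x)\<^sup>2) \<le> (\<epsilon>\<^sup>2)\<^sup>2"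
      using power_mono[OF \<xi>b(2) \<xi>b(1), where n = 2] by (intro AE_I2) simp
  qed (use i\<xi> in simp)
  have i\<zeta>2: "integrable N (\<lambda>x. \<zeta> x * cnj (\<zeta> x))"
  proof -
    have "integrable N (\<lambda>x. complex_of_real ((\<xi> x)\<^sup>2 - 2 * \<xi> x * m + m\<^sup>2))"
      using i\<xi>2 i\<xi> by (intro integrable_of_real) simp
    then show ?thesis by (simp add: \<zeta>_def power2_eq_square algebra_simps)
  qed
  have v\<zeta>: "cmod (\<integral>x. \<zeta> x * cnj (\<zeta> x) \<partial>N) \<le> \<epsilon>\<^sup>2 * \<tau>"
  proof -
    have "(\<integral>x. \<zeta> x * cnj (\<zeta> x) \<partial>N) = complex_of_real (\<integral>x. (\<xi> x - m)\<^sup>2 \<partial>N)"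
      unfolding integral_complex_of_real[symmetric] by (simp add: \<zeta>_def power2_eq_square)
    then have "cmod (\<integral>x. \<zeta> x * cnj (\<zeta> x) \<partial>N) = \<bar>\<integral>x. (\<xi> x - m)\<^sup>2 \<partial>N\<bar>"
      by (simp only: norm_of_real)
    moreover have "(\<integral>x. (\<xi> x - m)\<^sup>2 \<partial>N) = (\<integral>x. (\<xi> x)\<^sup>2 \<partial>N) - m\<^sup>2"
      unfolding m_def by (rule variance_eq[OF i\<xi> i\<xi>2])
    moreover have "(\<integral>x. (\<xi> x - m)\<^sup>2 \<partial>N) \<ge> 0" by (rule integral_nonneg_AE) simp
    moreover have "(\<integral>x. (\<xi> x)\<^sup>2 \<partial>N) \<le> (\<integral>x. \<epsilon>\<^sup>2 * \<xi> x \<partial>N)"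
      using i\<xi>2 i\<xi> \<xi>b by (intro integral_mono) (auto simp: power2_eq_square intro: mult_right_mono)
    moreover have "(\<integral>x. \<epsilon>\<^sup>2 * \<xi> x \<partial>N) \<le> \<epsilon>\<^sup>2 * \<tau>" using m\<tau> by (simp add: m_def mult_left_mono)
    ultimately show ?thesis using zero_le_power2[of m] by linarith
  qed
  define W where "W u \<omega> = b u * \<zeta> (\<omega> u)" for u \<omega>
  have WW: "W u \<omega> * cnj (W v \<omega>) = (b u * cnj (b v)) * (\<zeta> (\<omega> u) * cnj (\<zeta> (\<omega> v)))" for u v \<omega>
    by (simp add: W_def)
  have i\<zeta>c: "integrable N (\<lambda>x. cnj (\<zeta> x))" "(\<integral>x. cnj (\<zeta> x) \<partial>N) = 0"
  proof -
    have "cnj (\<zeta> x) = \<zeta> x" for x by (simp add: \<zeta>_def)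
    then show "integrable N (\<lambda>x. cnj (\<zeta> x))" "(\<integral>x. cnj (\<zeta> x) \<partial>N) = 0"
      using i\<zeta> by simp_all
  qed
  have int: "integrable (PiM U (\<lambda>_. N)) (\<lambda>\<omega>. W u \<omega> * cnj (W v \<omega>))" if "u \<in> U" "v \<in> U" for u v
    unfolding WW
    using integral_one_factor(2)[OF U that(1) i\<zeta>2] integral_two_factors(2)[OF U that _ i\<zeta>(1) i\<zeta>c(1)]
    by (cases "u = v") (auto intro!: integrable_mult_right)
  have cov: "cmod (\<integral>\<omega>. W u \<omega> * cnj (W v \<omega>) \<partial>PiM U (\<lambda>_. N)) \<le> (if v = u then \<beta>\<^sup>2 * (\<epsilon>\<^sup>2 * \<tau>) else 0)"
    if uv: "u \<in> U" "v \<in> U" for u v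
  proof (cases "u = v")
    case True
    have "cmod (b u) * cmod (b u) \<le> \<beta>\<^sup>2"
      using mult_mono[OF b[OF uv(1)] b[OF uv(1)] \<beta>] by (simp add: power2_eq_square)
    then show ?thesis
      using True v\<zeta> integral_one_factor(1)[OF U uv(1) i\<zeta>2] unfolding WW
      by (auto simp: norm_mult intro!: mult_mono)
  next
    case False
    then show ?thesis
      using integral_two_factors(1)[OF U uv False i\<zeta>(1) i\<zeta>c(1)] i\<zeta>(2) unfolding WW by simp
  qed
  note sq = square_norm_sum_integral[where D = U and W = W, OF int]
  have "(\<integral>\<omega>. (cmod (\<Sum>u\<in>U. W u \<omega>))\<^sup>2 \<partial>PiM U (\<lambda>_. N)) \<le>
      (\<Sum>u\<in>U. \<Sum>v\<in>U. if v = u then \<beta>\<^sup>2 * (\<epsilon>\<^sup>2 * \<tau>) else 0)"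
    by (rule order_trans[OF sq(2)], assumption, assumption) (intro sum_mono cov)
  also have "\<dots> = (\<beta> * (\<epsilon> * sqrt (card U * \<tau>)))\<^sup>2"
    using U tau_nonneg by (simp add: sum.delta power_mult_distrib)
  finally have le: "(\<integral>\<omega>. (cmod (\<Sum>u\<in>U. W u \<omega>))\<^sup>2 \<partial>PiM U (\<lambda>_. N)) \<le> (\<beta> * (\<epsilon> * sqrt (card U * \<tau>)))\<^sup>2" .
  have \<zeta>m[measurable]: "\<zeta> \<in> borel_measurable borel"
    unfolding \<zeta>_def[abs_def] \<xi>_def[abs_def] by measurable
  have Wm: "W u \<in> borel_measurable (PiM U (\<lambda>_. N))" if "u \<in> U" for u
    unfolding W_def[abs_def] using measurable_coordinate[OF that] by measurable
  have 1: "(\<integral>\<^sup>+\<omega>. ennreal (cmod (\<Sum>u\<in>U. W u \<omega>)) \<partial>PiM U (\<lambda>_. N)) \<le> ennreal (\<beta> * (\<epsilon> * sqrt (card U * \<tau>)))"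
    by (rule P.nn_integral_norm_le_sqrt[OF _ sq(1) le])
       (use Wm \<beta> \<epsilon> tau_nonneg in \<open>auto intro!: borel_measurable_sum mult_nonneg_nonneg\<close>)
  define V where "V \<omega> = (\<Sum>u\<in>U. b u * complex_of_real (\<rho> (\<omega> u) - tail_moment \<epsilon>))" for \<omega>
  have Vint: "integrable (PiM U (\<lambda>_. N)) (\<lambda>\<omega>. \<beta> * (\<Sum>u\<in>U. \<rho> (\<omega> u) + tail_moment \<epsilon>))"
    using integral_one_factor(2)[OF U _ i\<rho>] P.prob_space
    by (intro integrable_mult_right Bochner_Integration.integrable_sum Bochner_Integration.integrable_add) auto
  have \<rho>0: "\<rho> x \<ge> 0" for x by (simp add: \<rho>_def)
  have "cmod (V \<omega>) \<le> \<beta> * (\<Sum>u\<in>U. \<rho> (\<omega> u) + tail_moment \<epsilon>)" for \<omega>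
    unfolding V_def sum_distrib_left
  proof (rule order_trans[OF norm_sum], rule sum_mono)
    fix u assume u: "u \<in> U"
    have "\<bar>\<rho> (\<omega> u) - tail_moment \<epsilon>\<bar> \<le> \<rho> (\<omega> u) + tail_moment \<epsilon>"
      using \<rho>0[of "\<omega> u"] tail_moment_nonneg[of \<epsilon>] by linarith
    then show "cmod (b u * complex_of_real (\<rho> (\<omega> u) - tail_moment \<epsilon>)) \<le> \<beta> * (\<rho> (\<omega> u) + tail_moment \<epsilon>)"
      using b[OF u] \<beta> unfolding norm_mult norm_of_real by (intro mult_mono) auto
  qed
  then have "(\<integral>\<^sup>+\<omega>. ennreal (cmod (V \<omega>)) \<partial>PiM U (\<lambda>_. N)) \<le>
     (\<integral>\<^sup>+\<omega>. ennreal (\<beta> * (\<Sum>u\<in>U. \<rho> (\<omega> u) + tail_moment \<epsilon>)) \<partial>PiM U (\<lambda>_. N))"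
    by (intro nn_integral_mono ennreal_leI)
  also have "\<dots> = ennreal (\<integral>\<omega>. \<beta> * (\<Sum>u\<in>U. \<rho> (\<omega> u) + tail_moment \<epsilon>) \<partial>PiM U (\<lambda>_. N))"
    by (rule nn_integral_eq_integral[OF Vint])
       (use \<beta> \<rho>0 tail_moment_nonneg in \<open>auto intro!: AE_I2 mult_nonneg_nonneg sum_nonneg add_nonneg_nonneg\<close>)
  also have "(\<integral>\<omega>. \<beta> * (\<Sum>u\<in>U. \<rho> (\<omega> u) + tail_moment \<epsilon>) \<partial>PiM U (\<lambda>_. N)) = \<beta> * (2 * card U * tail_moment \<epsilon>)"
  proof -
    have i: "integrable (PiM U (\<lambda>_. N)) (\<lambda>\<omega>. \<rho> (\<omega> u) + tail_moment \<epsilon>)"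
      "(\<integral>\<omega>. \<rho> (\<omega> u) + tail_moment \<epsilon> \<partial>PiM U (\<lambda>_. N)) = 2 * tail_moment \<epsilon>" if "u \<in> U" for u
      using integral_one_factor[OF U that i\<rho>] P.prob_space by (simp_all add: tm)
    have "(\<integral>\<omega>. (\<Sum>u\<in>U. \<rho> (\<omega> u) + tail_moment \<epsilon>) \<partial>PiM U (\<lambda>_. N)) =
        (\<Sum>u\<in>U. \<integral>\<omega>. \<rho> (\<omega> u) + tail_moment \<epsilon> \<partial>PiM U (\<lambda>_. N))"
      by (rule Bochner_Integration.integral_sum) (rule i)
    also have "\<dots> = (\<Sum>u\<in>U. 2 * tail_moment \<epsilon>)" by (rule sum.cong) (simp_all only: i)
    finally show ?thesis by simp
  qed
  finally have 2: "(\<integral>\<^sup>+\<omega>. ennreal (cmod (V \<omega>)) \<partial>PiM U (\<lambda>_. N)) \<le> ennreal (\<beta> * (2 * card U * tail_moment \<epsilon>))" .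
  have Vm: "V \<in> borel_measurable (PiM U (\<lambda>_. N))"
  proof -
    have \<rho>m: "\<rho> \<in> borel_measurable borel" unfolding \<rho>_def[abs_def] by measurable
    then have "(\<lambda>x. complex_of_real (\<rho> x - tail_moment \<epsilon>)) \<in> borel_measurable borel" by measurable
    then have "(\<lambda>\<omega>. complex_of_real (\<rho> (\<omega> u) - tail_moment \<epsilon>)) \<in> borel_measurable (PiM U (\<lambda>_. N))" if "u \<in> U" for u
      by (rule measurable_compose[OF measurable_coordinate[OF that]])
    then show ?thesis
      unfolding V_def[abs_def] by (intro borel_measurable_sum borel_measurable_times borel_measurable_const)
  qed
  have "(\<Sum>u\<in>U. b u * complex_of_real ((cmod (\<omega> u))\<^sup>2 - \<tau>)) = (\<Sum>u\<in>U. W u \<omega>) + V \<omega>" for \<omega>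
    unfolding V_def W_def \<zeta>_def split \<tau> sum.distrib[symmetric] by (intro sum.cong refl) (simp add: algebra_simps)
  then have "(\<integral>\<^sup>+\<omega>. ennreal (cmod (\<Sum>u\<in>U. b u * complex_of_real ((cmod (\<omega> u))\<^sup>2 - \<tau>))) \<partial>PiM U (\<lambda>_. N)) \<le>
    (\<integral>\<^sup>+\<omega>. ennreal (cmod (\<Sum>u\<in>U. W u \<omega>)) + ennreal (cmod (V \<omega>)) \<partial>PiM U (\<lambda>_. N))"
    by (intro nn_integral_mono) (simp add: norm_triangle_ineq flip: ennreal_plus)
  also have "\<dots> = (\<integral>\<^sup>+\<omega>. ennreal (cmod (\<Sum>u\<in>U. W u \<omega>)) \<partial>PiM U (\<lambda>_. N)) + (\<integral>\<^sup>+\<omega>. ennreal (cmod (V \<omega>)) \<partial>PiM U (\<lambda>_. N))"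
    by (rule nn_integral_add) (use Wm Vm in measurable)
  also have "\<dots> \<le> ennreal (\<beta> * (\<epsilon> * sqrt (card U * \<tau>))) + ennreal (\<beta> * (2 * card U * tail_moment \<epsilon>))"
    by (rule add_mono[OF 1 2])
  also have "\<dots> = ennreal (\<beta> * (\<epsilon> * sqrt (card U * \<tau>) + 2 * card U * tail_moment \<epsilon>))"
    using \<beta> \<epsilon> tau_nonneg tail_moment_nonneg by (simp add: algebra_simps flip: ennreal_plus)
  finally show ?thesis .
qed

end

section \<open>A central limit theorem by replacement\<close>

definition complex_law :: "complex measure \<Rightarrow> bool" where
  "complex_law \<mu> \<longleftrightarrow> prob_space \<mu> \<and> sets \<mu> = sets borel"

definition bounded_borel :: "(complex \<Rightarrow> complex) \<Rightarrow> bool" where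
  "bounded_borel f \<longleftrightarrow> f \<in> borel_measurable borel \<and> (\<exists>B. \<forall>x. cmod (f x) \<le> B)"

text \<open>Convolution as an operator on bounded functions: one independent increment is added.
  Iterates describe sums of independent identically distributed variables, and Lindeberg replacement
  becomes algebra with commuting contractions.\<close>

definition smear :: "complex measure \<Rightarrow> (complex \<Rightarrow> complex) \<Rightarrow> complex \<Rightarrow> complex" where
  "smear \<mu> f g = (\<integral>h. f (g + h) \<partial>\<mu>)"

lemma complex_law_measurable:
  fixes f :: "complex \<Rightarrow> complex"
  shows "complex_law \<mu> \<Longrightarrow> f \<in> borel_measurable borel \<Longrightarrow> f \<in> borel_measurable \<mu>"
  unfolding complex_law_def using measurable_cong_sets[of \<mu> borel "borel :: complex measure" borel] by simp

lemma smear_integrable: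
  assumes \<mu>: "complex_law \<mu>" and f: "bounded_borel f"
  shows "integrable \<mu> (\<lambda>h. f (g + h))"
proof -
  interpret prob_space \<mu> using \<mu> by (simp add: complex_law_def)
  obtain B where B: "\<And>x. cmod (f x) \<le> B" using f by (auto simp: bounded_borel_def)
  have [measurable]: "f \<in> borel_measurable borel" using f by (simp add: bounded_borel_def)
  have "(\<lambda>h. f (g + h)) \<in> borel_measurable \<mu>"
    by (rule complex_law_measurable[OF \<mu>]) measurable
  then show ?thesis using B by (intro integrable_const_bound[where B = B]) auto
qed

lemma cmod_smear_le:
  assumes \<mu>: "complex_law \<mu>" and f: "bounded_borel f" and B: "\<And>x. cmod (f x) \<le> B"
  shows "cmod (smear \<mu> f g) \<le> B"
proof -
  interpret prob_space \<mu> using \<mu> by (simp add: complex_law_def)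
  show ?thesis unfolding smear_def by (rule norm_expectation_le[OF smear_integrable[OF \<mu> f] B])
qed

lemma bounded_borel_smear:
  assumes \<mu>: "complex_law \<mu>" and f: "bounded_borel f"
  shows "bounded_borel (smear \<mu> f)"
proof -
  interpret prob_space \<mu> using \<mu> by (simp add: complex_law_def)
  have [measurable_cong]: "sets \<mu> = sets borel" using \<mu> by (simp add: complex_law_def)
  have [measurable]: "f \<in> borel_measurable borel" using f by (simp add: bounded_borel_def)
  have "(\<lambda>(g, h). f (g + h)) \<in> borel_measurable (borel \<Otimes>\<^sub>M \<mu>)" by measurable
  then have "smear \<mu> f \<in> borel_measurable borel"
    unfolding smear_def[abs_def] by (rule borel_measurable_lebesgue_integral)
  moreover obtain B where "\<And>x. cmod (f x) \<le> B" using f by (auto simp: bounded_borel_def)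
  then have "cmod (smear \<mu> f x) \<le> B" for x by (intro cmod_smear_le[OF \<mu> f])
  ultimately show ?thesis by (auto simp: bounded_borel_def)
qed

lemma bounded_borel_diff:
  assumes "bounded_borel f" "bounded_borel g"
  shows "bounded_borel (\<lambda>x. f x - g x)"
proof -
  obtain B C where "\<And>x. cmod (f x) \<le> B" "\<And>x. cmod (g x) \<le> C" using assms by (auto simp: bounded_borel_def)
  then have "cmod (f x - g x) \<le> B + C" for x by (intro order_trans[OF norm_triangle_ineq4] add_mono)
  then show ?thesis using assms unfolding bounded_borel_def by (intro conjI borel_measurable_diff exI[of _ "B + C"]) auto
qed

lemma smear_diff:
  assumes "complex_law \<mu>" "bounded_borel f" "bounded_borel f'"
  shows "smear \<mu> (\<lambda>x. f x - f' x) g = smear \<mu> f g - smear \<mu> f' g"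
  unfolding smear_def by (rule Bochner_Integration.integral_diff) (intro smear_integrable assms)+

lemma smear_commute:
  assumes \<mu>: "complex_law \<mu>" and \<nu>: "complex_law \<nu>" and f: "bounded_borel f"
  shows "smear \<mu> (smear \<nu> f) = smear \<nu> (smear \<mu> f)"
proof
  fix g
  interpret M: prob_space \<mu> using \<mu> by (simp add: complex_law_def)
  interpret N: prob_space \<nu> using \<nu> by (simp add: complex_law_def)
  interpret P: pair_prob_space \<mu> \<nu> ..
  have [measurable_cong]: "sets \<mu> = sets borel" "sets \<nu> = sets borel" using \<mu> \<nu> by (simp_all add: complex_law_def)
  have [measurable]: "f \<in> borel_measurable borel" using f by (simp add: bounded_borel_def)
  obtain B where B: "\<And>x. cmod (f x) \<le> B" using f by (auto simp: bounded_borel_def)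
  have "integrable (\<mu> \<Otimes>\<^sub>M \<nu>) (\<lambda>(h, h'). f (g + h + h'))"
    by (rule P.integrable_const_bound[where B = B]) (auto simp: B)
  from P.Fubini_integral[OF this]
  have "(\<integral>h'. (\<integral>h. f (g + h + h') \<partial>\<mu>) \<partial>\<nu>) = (\<integral>h. (\<integral>h'. f (g + h + h') \<partial>\<nu>) \<partial>\<mu>)" by simp
  then show "smear \<mu> (smear \<nu> f) g = smear \<nu> (smear \<mu> f) g"
    unfolding smear_def by (simp add: ac_simps)
qed

lemma bounded_borel_smear_pow:
  assumes "complex_law \<mu>" "bounded_borel f"
  shows "bounded_borel ((smear \<mu> ^^ n) f)"
  by (induction n) (simp_all add: assms bounded_borel_smear)

text \<open>Telescoping with commuting contractions for the supremum norm: one replacement costs at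
  most \<open>\<beta>\<close>, wherever it occurs in the product.\<close>

lemma smear_pow_diff:
  assumes \<mu>: "complex_law \<mu>" and \<nu>: "complex_law \<nu>" and f: "bounded_borel f"
    and \<beta>: "\<And>g. cmod (smear \<mu> f g - smear \<nu> f g) \<le> \<beta>"
  shows "cmod ((smear \<mu> ^^ n) f g - (smear \<nu> ^^ n) f g) \<le> real n * \<beta>"
  using f \<beta>
proof (induction n arbitrary: f g)
  case (Suc n)
  have pow: "cmod ((smear \<mu> ^^ n) f' g) \<le> \<beta>"
    if f': "bounded_borel f'" "\<And>x. cmod (f' x) \<le> \<beta>" for f' g n
    using that
  proof (induction n arbitrary: g)
    case (Suc n)
    then show ?case by (simp add: cmod_smear_le[OF \<mu> bounded_borel_smear_pow[OF \<mu>]])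
  qed simp
  have powdiff: "(smear \<mu> ^^ n) (\<lambda>x. f1 x - f2 x) = (\<lambda>g. (smear \<mu> ^^ n) f1 g - (smear \<mu> ^^ n) f2 g)"
    if "bounded_borel f1" "bounded_borel f2" for f1 f2 n
    using that
  proof (induction n)
    case (Suc n)
    show ?case
      by (rule ext) (simp add: Suc.IH[OF Suc.prems] smear_diff[OF \<mu>] bounded_borel_smear_pow[OF \<mu>] Suc.prems)
  qed simp
  note bm = bounded_borel_smear[OF \<mu> Suc.prems(1)] and bn = bounded_borel_smear[OF \<nu> Suc.prems(1)]
  have 1: "cmod ((smear \<mu> ^^ n) (smear \<mu> f) g - (smear \<mu> ^^ n) (smear \<nu> f) g) \<le> \<beta>"
    using pow[OF bounded_borel_diff[OF bm bn] Suc.prems(2), of n g] unfolding powdiff[OF bm bn] .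
  have 2: "cmod ((smear \<mu> ^^ n) (smear \<nu> f) g - (smear \<nu> ^^ n) (smear \<nu> f) g) \<le> real n * \<beta>"
  proof (rule Suc.IH[OF bn])
    fix g'
    \<comment> \<open>The one-step bound is inherited by \<open>smear \<nu> f\<close>: by
      commutation the difference of the two operators can be applied to \<open>f\<close>
      first.\<close>
    have "smear \<mu> (smear \<nu> f) g' - smear \<nu> (smear \<nu> f) g' = smear \<nu> (\<lambda>x. smear \<mu> f x - smear \<nu> f x) g'"
      by (simp add: smear_diff[OF \<nu> bm bn] smear_commute[OF \<mu> \<nu> Suc.prems(1)])
    then show "cmod (smear \<mu> (smear \<nu> f) g' - smear \<nu> (smear \<nu> f) g') \<le> \<beta>"
      using cmod_smear_le[OF \<nu> bounded_borel_diff[OF bm bn] Suc.prems(2)] by simp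
  qed
  have "cmod ((smear \<mu> ^^ Suc n) f g - (smear \<nu> ^^ Suc n) f g) \<le> \<beta> + real n * \<beta>"
    using norm_triangle_mono[OF 1 2] by (simp add: funpow_Suc_right del: funpow.simps)
  then show ?case by (simp add: algebra_simps)
qed simp

text \<open>\<open>J\<close> selects the coordinates that are summed, later one row of the matrix;
  each selected coordinate contributes one convolution and the others integrate to 1.\<close>

lemma integral_sum_coordinates:
  fixes U :: "'u set"
  assumes \<mu>: "complex_law \<mu>" and U: "finite U" and f: "bounded_borel f"
  shows "(\<integral>\<omega>. f (z + (\<Sum>k\<in>U \<inter> J. \<omega> k)) \<partial>PiM U (\<lambda>_. \<mu>)) = (smear \<mu> ^^ card (U \<inter> J)) f z"
  using U f
proof (induction U arbitrary: f rule: finite_induct)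
  case empty
  interpret prob_space "PiM ({} :: 'u set) (\<lambda>_. \<mu>)" by (rule prob_space_PiM) (use \<mu> in \<open>simp add: complex_law_def\<close>)
  show ?case using prob_space by simp
next
  case (insert i U)
  interpret M: prob_space \<mu> using \<mu> by (simp add: complex_law_def)
  interpret product_prob_space "\<lambda>_. \<mu>" U
    by (simp add: product_prob_space_def product_sigma_finite_def product_prob_space_axioms_def
        prob_space_imp_sigma_finite M.prob_space_axioms)
  interpret I: prob_space "PiM (insert i U) (\<lambda>_. \<mu>)" by (rule prob_space_PiM) (rule M.prob_space_axioms)
  have setsm: "sets \<mu> = sets borel" using \<mu> by (simp add: complex_law_def)
  have fm: "f \<in> borel_measurable borel" using insert.prems by (simp add: bounded_borel_def)
  obtain B where B: "\<And>x. cmod (f x) \<le> B" using insert.prems by (auto simp: bounded_borel_def)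
  have cm: "(\<lambda>\<omega>. \<omega> k) \<in> borel_measurable (PiM (insert i U) (\<lambda>_. \<mu>))" if "k \<in> insert i U" for k
    using measurable_component_singleton[OF that, of "\<lambda>_. \<mu>"] by (simp add: measurable_cong_sets[OF refl setsm])
  have "(\<lambda>\<omega>. z + (\<Sum>k\<in>insert i U \<inter> J. \<omega> k)) \<in> borel_measurable (PiM (insert i U) (\<lambda>_. \<mu>))"
    by (intro borel_measurable_add borel_measurable_const borel_measurable_sum cm) auto
  then have m: "(\<lambda>\<omega>. f (z + (\<Sum>k\<in>insert i U \<inter> J. \<omega> k))) \<in> borel_measurable (PiM (insert i U) (\<lambda>_. \<mu>))"
    by (rule measurable_compose[OF _ fm])
  have int: "integrable (PiM (insert i U) (\<lambda>_. \<mu>)) (\<lambda>\<omega>. f (z + (\<Sum>k\<in>insert i U \<inter> J. \<omega> k)))"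
    by (rule I.integrable_const_bound[where B = B]) (use B m in auto)
  have eq: "(\<integral>\<omega>. f (z + (\<Sum>k\<in>insert i U \<inter> J. \<omega> k)) \<partial>PiM (insert i U) (\<lambda>_. \<mu>)) =
     (\<integral>\<omega>. (\<integral>h. f (z + (\<Sum>k\<in>insert i U \<inter> J. fun_upd \<omega> i h k)) \<partial>\<mu>) \<partial>PiM U (\<lambda>_. \<mu>))"
    by (rule product_integral_insert[OF insert.hyps int])
  show ?case
  proof (cases "i \<in> J")
    case True
    have e: "z + (\<Sum>k\<in>insert i U \<inter> J. fun_upd \<omega> i h k) = (z + (\<Sum>k\<in>U \<inter> J. \<omega> k)) + h" for \<omega> h
    proof -
      have 1: "(\<Sum>k\<in>insert i U \<inter> J. fun_upd \<omega> i h k) = h + (\<Sum>k\<in>U \<inter> J. fun_upd \<omega> i h k)"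
        using True insert.hyps by (simp add: Int_insert_left)
      have 2: "(\<Sum>k\<in>U \<inter> J. fun_upd \<omega> i h k) = (\<Sum>k\<in>U \<inter> J. \<omega> k)"
        using insert.hyps by (intro sum.cong) auto
      show ?thesis unfolding 1 2 by (simp only: ac_simps)
    qed
    have "(\<integral>\<omega>. f (z + (\<Sum>k\<in>insert i U \<inter> J. \<omega> k)) \<partial>PiM (insert i U) (\<lambda>_. \<mu>)) =
      (\<integral>\<omega>. smear \<mu> f (z + (\<Sum>k\<in>U \<inter> J. \<omega> k)) \<partial>PiM U (\<lambda>_. \<mu>))"
      unfolding eq e smear_def ..
    also have "\<dots> = (smear \<mu> ^^ card (U \<inter> J)) (smear \<mu> f) z"
      by (rule insert.IH[OF bounded_borel_smear[OF \<mu> insert.prems]])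
    also have "\<dots> = (smear \<mu> ^^ card (insert i U \<inter> J)) f z"
      using True insert.hyps by (simp add: Int_insert_left funpow_swap1)
    finally show ?thesis .
  next
    case False
    have e: "(\<Sum>k\<in>insert i U \<inter> J. fun_upd \<omega> i h k) = (\<Sum>k\<in>U \<inter> J. \<omega> k)" for \<omega> h
      using False insert.hyps by (intro sum.cong) auto
    have "(\<integral>\<omega>. f (z + (\<Sum>k\<in>insert i U \<inter> J. \<omega> k)) \<partial>PiM (insert i U) (\<lambda>_. \<mu>)) =
      (\<integral>\<omega>. f (z + (\<Sum>k\<in>U \<inter> J. \<omega> k)) \<partial>PiM U (\<lambda>_. \<mu>))"
      unfolding eq e by (simp add: M.prob_space)
    also have "\<dots> = (smear \<mu> ^^ card (U \<inter> J)) f z" by (rule insert.IH[OF insert.prems])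
    finally show ?thesis using False by (simp add: Int_insert_left)
  qed
qed

section \<open>Gaussian increments as convolution operators\<close>

abbreviation SN :: "real measure" where "SN \<equiv> std_normal_distribution"

definition directional_normal :: "complex \<Rightarrow> complex measure" where
  "directional_normal a = distr SN borel (\<lambda>x. complex_of_real x * a)"

text \<open>The centred Gaussian whose covariance has a factor with columns \<open>a\<close> and
  \<open>b\<close>; singular covariances are included.\<close>

definition planar_normal :: "complex \<Rightarrow> complex \<Rightarrow> complex measure" where
  "planar_normal a b = distr (SN \<Otimes>\<^sub>M SN) borel (\<lambda>p. complex_of_real (fst p) * a + complex_of_real (snd p) * b)"

lemma prob_space_SN: "prob_space SN"
  using prob_space_normal_density[of 1 0] by simp

lemma complex_law_normal: "complex_law (directional_normal a)" "complex_law (planar_normal a b)"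
proof -
  interpret prob_space SN by (rule prob_space_SN)
  interpret P: pair_prob_space SN SN ..
  show "complex_law (directional_normal a)"
    unfolding complex_law_def directional_normal_def by (auto intro!: prob_space_distr)
  show "complex_law (planar_normal a b)"
    unfolding complex_law_def planar_normal_def by (auto intro!: P.prob_space_distr)
qed

lemma smear_directional:
  assumes "bounded_borel f"
  shows "smear (directional_normal a) f g = (\<integral>x. f (g + complex_of_real x * a) \<partial>SN)"
proof -
  have [measurable]: "f \<in> borel_measurable borel" using assms by (simp add: bounded_borel_def)
  show ?thesis unfolding smear_def directional_normal_def by (subst integral_distr) auto
qed

lemma smear_planar:
  assumes f: "bounded_borel f"
  shows "smear (planar_normal a b) f = smear (directional_normal a) (smear (directional_normal b) f)"
proof
  fix g
  interpret prob_space SN by (rule prob_space_SN)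
  interpret P: pair_prob_space SN SN ..
  have [measurable]: "f \<in> borel_measurable borel" using assms by (simp add: bounded_borel_def)
  obtain B where B: "\<And>x. cmod (f x) \<le> B" using f by (auto simp: bounded_borel_def)
  have int: "integrable (SN \<Otimes>\<^sub>M SN) (\<lambda>p. f (g + (complex_of_real (fst p) * a + complex_of_real (snd p) * b)))"
    by (rule P.integrable_const_bound[where B = B]) (auto simp: B)
  have "smear (planar_normal a b) f g =
      (\<integral>p. f (g + (complex_of_real (fst p) * a + complex_of_real (snd p) * b)) \<partial>(SN \<Otimes>\<^sub>M SN))"
    unfolding smear_def planar_normal_def by (subst integral_distr) auto
  also have "\<dots> = (\<integral>x. \<integral>y. f (g + (complex_of_real x * a + complex_of_real y * b)) \<partial>SN \<partial>SN)"
    using P.integral_fst'[OF int] by simp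
  also have "\<dots> = smear (directional_normal a) (smear (directional_normal b) f) g"
    unfolding smear_directional[OF bounded_borel_smear[OF complex_law_normal(1) f]] smear_directional[OF f]
    by (simp only: add.assoc)
  finally show "smear (planar_normal a b) f g = smear (directional_normal a) (smear (directional_normal b) f) g" .
qed

lemma normal_stable:
  "distr (SN \<Otimes>\<^sub>M SN) borel (\<lambda>p. s * fst p + t * snd p) = distr SN borel (\<lambda>x. sqrt (s\<^sup>2 + t\<^sup>2) * x)"
proof (rule Levy_uniqueness)
  interpret prob_space SN by (rule prob_space_SN)
  interpret P: pair_prob_space SN SN ..
  show "real_distribution (distr (SN \<Otimes>\<^sub>M SN) borel (\<lambda>p. s * fst p + t * snd p))"
    by (rule P.real_distribution_distr) measurable
  show "real_distribution (distr SN borel (\<lambda>x. sqrt (s\<^sup>2 + t\<^sup>2) * x))"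
    by (rule real_distribution_distr) measurable
  show "char (distr (SN \<Otimes>\<^sub>M SN) borel (\<lambda>p. s * fst p + t * snd p)) = char (distr SN borel (\<lambda>x. sqrt (s\<^sup>2 + t\<^sup>2) * x))"
  proof
    fix r
    have int: "integrable (SN \<Otimes>\<^sub>M SN) (\<lambda>p. iexp ((r * s) * fst p) * iexp ((r * t) * snd p))"
      by (rule P.integrable_const_bound[where B = 1]) (auto simp: norm_mult)
    have "char (distr (SN \<Otimes>\<^sub>M SN) borel (\<lambda>p. s * fst p + t * snd p)) r =
        (\<integral>p. iexp (r * (s * fst p + t * snd p)) \<partial>(SN \<Otimes>\<^sub>M SN))"
      unfolding char_def by (subst integral_distr) auto
    also have "\<dots> = (\<integral>p. iexp ((r * s) * fst p) * iexp ((r * t) * snd p) \<partial>(SN \<Otimes>\<^sub>M SN))"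
      by (simp add: exp_add[symmetric] algebra_simps)
    also have "\<dots> = (\<integral>x. \<integral>y. iexp ((r * s) * x) * iexp ((r * t) * y) \<partial>SN \<partial>SN)"
      using P.integral_fst'[OF int] by simp
    also have "\<dots> = char SN (r * s) * char SN (r * t)" by (simp add: char_def)
    also have "\<dots> = complex_of_real (exp (- ((r * s)\<^sup>2 + (r * t)\<^sup>2) / 2))"
      unfolding char_std_normal_distribution of_real_mult[symmetric] exp_add[symmetric] by (simp add: field_simps)
    also have "(r * s)\<^sup>2 + (r * t)\<^sup>2 = (r * sqrt (s\<^sup>2 + t\<^sup>2))\<^sup>2"
      by (simp add: power_mult_distrib distrib_left)
    also have "complex_of_real (exp (- (r * sqrt (s\<^sup>2 + t\<^sup>2))\<^sup>2 / 2)) = char SN (r * sqrt (s\<^sup>2 + t\<^sup>2))"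
      by (simp add: char_std_normal_distribution)
    also have "\<dots> = char (distr SN borel (\<lambda>x. sqrt (s\<^sup>2 + t\<^sup>2) * x)) r"
      unfolding char_def by (subst integral_distr) (auto simp: mult.assoc)
    finally show "char (distr (SN \<Otimes>\<^sub>M SN) borel (\<lambda>p. s * fst p + t * snd p)) r =
      char (distr SN borel (\<lambda>x. sqrt (s\<^sup>2 + t\<^sup>2) * x)) r" .
  qed
qed

lemma smear_directional_stable:
  assumes f: "bounded_borel f"
  shows "smear (directional_normal (complex_of_real s * a)) (smear (directional_normal (complex_of_real t * a)) f) =
    smear (directional_normal (complex_of_real (sqrt (s\<^sup>2 + t\<^sup>2)) * a)) f"
proof
  fix g
  have [measurable]: "f \<in> borel_measurable borel" using assms by (simp add: bounded_borel_def)
  define F where "F x = f (g + complex_of_real x * a)" for x :: real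
  have [measurable]: "F \<in> borel_measurable borel" unfolding F_def[abs_def] by measurable
  have "smear (directional_normal (complex_of_real s * a)) (smear (directional_normal (complex_of_real t * a)) f) g =
    smear (planar_normal (complex_of_real s * a) (complex_of_real t * a)) f g"
    unfolding smear_planar[OF f] ..
  also have "\<dots> = (\<integral>p. F (s * fst p + t * snd p) \<partial>(SN \<Otimes>\<^sub>M SN))"
    unfolding smear_def planar_normal_def by (subst integral_distr) (auto simp: F_def algebra_simps)
  also have "\<dots> = (\<integral>x. F x \<partial>distr (SN \<Otimes>\<^sub>M SN) borel (\<lambda>p. s * fst p + t * snd p))"
    by (subst integral_distr) auto
  also have "\<dots> = (\<integral>x. F (sqrt (s\<^sup>2 + t\<^sup>2) * x) \<partial>SN)"
    unfolding normal_stable by (subst integral_distr) auto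
  also have "\<dots> = smear (directional_normal (complex_of_real (sqrt (s\<^sup>2 + t\<^sup>2)) * a)) f g"
    unfolding smear_directional[OF f] F_def by (simp add: mult_ac)
  finally show "smear (directional_normal (complex_of_real s * a)) (smear (directional_normal (complex_of_real t * a)) f) g =
    smear (directional_normal (complex_of_real (sqrt (s\<^sup>2 + t\<^sup>2)) * a)) f g" .
qed

lemma smear_directional_zero:
  assumes "bounded_borel f"
  shows "smear (directional_normal 0) f = f"
  using assms prob_space.prob_space[OF prob_space_SN] by (simp add: fun_eq_iff smear_directional)

text \<open>The planar Gaussian splits into two commuting directional ones, and within a direction
  variances add. The square root of the variance yields \<open>|s|\<close>; the auxiliary fact
  \<open>sym\<close> restores the sign.\<close>

lemma smear_planar_pow:
  assumes f: "bounded_borel f"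
  shows "(smear (planar_normal (complex_of_real s * a) (complex_of_real s * b)) ^^ n) f =
    smear (planar_normal (complex_of_real (s * sqrt n) * a) (complex_of_real (s * sqrt n) * b)) f"
proof (induction n)
  case 0
  show ?case by (simp add: smear_planar[OF f] smear_directional_zero[OF f])
next
  case (Suc n)
  let ?D = "\<lambda>s a. smear (directional_normal (complex_of_real s * a))"
  note b = bounded_borel_smear[OF complex_law_normal(1)]
  have sq: "sqrt (s\<^sup>2 + (s * sqrt n)\<^sup>2) = \<bar>s\<bar> * sqrt (Suc n)"
  proof -
    have "s\<^sup>2 + (s * sqrt n)\<^sup>2 = s\<^sup>2 * Suc n" by (simp add: power_mult_distrib algebra_simps)
    then show ?thesis by (simp add: real_sqrt_mult)
  qed
  have sym: "?D (\<bar>s\<bar> * t) a f' = ?D (s * t) a f'" if f': "bounded_borel f'" for t a f'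
  proof (cases "s \<ge> 0")
    case False
    have "?D (\<bar>s\<bar> * t) a f' = ?D (\<bar>s\<bar> * t) a (?D 0 a f')"
      by (simp add: smear_directional_zero[OF f'])
    also have "\<dots> = ?D (sqrt ((\<bar>s\<bar> * t)\<^sup>2 + 0\<^sup>2)) a f'" by (rule smear_directional_stable[OF f'])
    also have "(\<bar>s\<bar> * t)\<^sup>2 + 0\<^sup>2 = (s * t)\<^sup>2 + 0\<^sup>2" by (simp add: power_mult_distrib)
    also have "?D (sqrt ((s * t)\<^sup>2 + 0\<^sup>2)) a f' = ?D (s * t) a (?D 0 a f')" by (rule smear_directional_stable[OF f', symmetric])
    also have "\<dots> = ?D (s * t) a f'" by (simp add: smear_directional_zero[OF f'])
    finally show ?thesis .
  qed simp
  have "(smear (planar_normal (complex_of_real s * a) (complex_of_real s * b)) ^^ Suc n) f =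
    ?D s a (?D s b (?D (s * sqrt n) a (?D (s * sqrt n) b f)))"
    by (simp add: Suc smear_planar f b)
  also have "\<dots> = ?D s a (?D (s * sqrt n) a (?D s b (?D (s * sqrt n) b f)))"
    by (subst smear_commute[OF complex_law_normal(1) complex_law_normal(1)]) (auto intro: b f)
  also have "\<dots> = ?D (\<bar>s\<bar> * sqrt (Suc n)) a (?D (\<bar>s\<bar> * sqrt (Suc n)) b f)"
    by (subst (1 2) smear_directional_stable) (auto intro: b f simp only: sq)
  also have "\<dots> = ?D (s * sqrt (Suc n)) a (?D (s * sqrt (Suc n)) b f)"
    by (subst sym[OF f], subst sym[OF b[OF f]]) simp
  finally show ?case unfolding smear_planar[OF f] .
qed

subsection \<open>Second order expansion of the kernel\<close>

text \<open>The second order Taylor polynomial in \<open>h\<close> of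
  \<open>w / (|g + h|^2 - w^2)\<close> without its constant term: \<open>|g + h|^2\<close> exceeds
  \<open>|g|^2\<close> by \<open>2 a + |h|^2\<close>, and the cubic and quartic parts of the square
  of this increment are dropped.\<close>

definition taylor_term :: "complex \<Rightarrow> complex \<Rightarrow> complex \<Rightarrow> complex" where
  "taylor_term w g h = (let Q = complex_of_real ((cmod g)\<^sup>2) - w\<^sup>2; a = Re g * Re h + Im g * Im h in
     - (w / Q\<^sup>2) * complex_of_real (2 * a + (cmod h)\<^sup>2) + (4 * w / Q ^ 3) * complex_of_real (a\<^sup>2))"

text \<open>The first summand serves increments with \<open>|h| <= 1\<close>, the second those with
  \<open>|h| > 1\<close>.\<close>

definition taylor_const :: "real \<Rightarrow> real" where
  "taylor_const v = 1 / v * (4 / v ^ 3 + 1 / v ^ 4 + (2 / v + 1 / v\<^sup>2) ^ 3) +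
     (2 / v + 1 / v * (2 / v + 1 / v\<^sup>2) + 4 / v ^ 3)"

text \<open>With \<open>t = (P - Q) / Q\<close>, the remainder of the geometric expansion of
  \<open>1 / (1 + t)\<close> after the quadratic term.\<close>

lemma third_order_identity:
  fixes P Q :: complex
  assumes "P \<noteq> 0" "Q \<noteq> 0"
  shows "1 / P - 1 / Q + (P - Q) / Q\<^sup>2 - (P - Q)\<^sup>2 / Q ^ 3 = - ((P - Q) ^ 3 / (Q ^ 3 * P))"
proof -
  define x y t where "x = 1 / P" and "y = 1 / Q" and "t = (P - Q) / Q"
  have y: "y = x * (1 + t)" using assms by (simp add: x_def y_def t_def field_simps)
  have "1 / P - 1 / Q + (P - Q) / Q\<^sup>2 - (P - Q)\<^sup>2 / Q ^ 3 = x - y + t * y - t\<^sup>2 * y"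
    by (simp add: x_def y_def t_def power2_eq_square power3_eq_cube)
  also have "\<dots> = - (t ^ 3 * x)"
    unfolding y by (simp add: algebra_simps power2_eq_square power3_eq_cube)
  also have "\<dots> = - ((P - Q) ^ 3 / (Q ^ 3 * P))"
    by (simp add: x_def t_def power_divide)
  finally show ?thesis .
qed

text \<open>Partial fractions: \<open>w / Q\<close> and \<open>|g| / Q\<close> are half the
  difference and half the sum of \<open>1 / (r - w)\<close> and \<open>1 / (r + w)\<close> with
  \<open>r = |g|\<close>, each of modulus at most \<open>1 / v\<close>. The bounds do not involve
  the size of \<open>g\<close> or \<open>w\<close>, which makes the replacement step
  uniform.\<close>

lemma kernel_ratio_bounds:
  fixes g w :: complex and v :: real
  assumes w: "Im w \<ge> v" and v: "v > 0"
  defines "Q \<equiv> complex_of_real ((cmod g)\<^sup>2) - w\<^sup>2"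
  shows "Q \<noteq> 0" "cmod w / cmod Q \<le> 1 / v" "cmod g / cmod Q \<le> 1 / v" "1 / cmod Q \<le> 1 / v\<^sup>2"
proof -
  have w0: "Im w > 0" using assms by simp
  define r where "r = cmod g"
  show nz: "Q \<noteq> 0" unfolding Q_def by (rule square_diff_nonzero[OF w0])
  have Qf: "Q = (complex_of_real r - w) * (complex_of_real r + w)"
    unfolding Q_def r_def square_diff_factor ..
  have 1: "1 / Im w \<le> 1 / v" using w v by (simp add: frac_le)
  have b: "cmod (1 / (complex_of_real r - w)) \<le> 1 / v" "cmod (1 / (complex_of_real r + w)) \<le> 1 / v"
  proof -
    show "cmod (1 / (complex_of_real r - w)) \<le> 1 / v" using cmod_inverse_diff_le[OF w0, of r] 1 by linarith
    have "cmod (1 / (complex_of_real (- r) - w)) = cmod (1 / (complex_of_real r + w))"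
    proof -
      have "complex_of_real (- r) - w = - (complex_of_real r + w)" by simp
      then show ?thesis by (simp only: norm_divide norm_minus_cancel)
    qed
    then show "cmod (1 / (complex_of_real r + w)) \<le> 1 / v" using cmod_inverse_diff_le[OF w0, of "- r"] 1 by linarith
  qed
  show "1 / cmod Q \<le> 1 / v\<^sup>2"
    using mult_mono[OF b] v by (simp add: Qf norm_mult norm_divide power2_eq_square)
  have "cmod w / cmod Q = cmod (pastur_kernel w r)"
    by (simp add: pastur_kernel_def Q_def r_def norm_divide)
  then show "cmod w / cmod Q \<le> 1 / v" using cmod_pastur_kernel_le[OF w0, of r] 1 by linarith
  have nz': "complex_of_real r - w \<noteq> 0" "complex_of_real r + w \<noteq> 0" using nz Qf by auto
  have rQ: "complex_of_real r / Q = (1 / (complex_of_real r - w) + 1 / (complex_of_real r + w)) / 2"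
    unfolding Qf using nz' by (simp add: add_frac_eq)
  have "cmod (complex_of_real r / Q) \<le> (1 / v + 1 / v) / 2"
    unfolding rQ norm_divide[of _ 2] using norm_triangle_mono[OF b] by simp
  then show "cmod g / cmod Q \<le> 1 / v" by (simp add: norm_divide r_def)
qed

text \<open>Increments up to \<open>\<epsilon>\<close> have a cubic remainder, in which one factor
  \<open>|h|\<close> becomes \<open>\<epsilon>\<close>; larger ones are charged \<open>|h|^2\<close>
  and fall under the Lindeberg tail.\<close>

lemma kernel_taylor:
  assumes w: "Im w \<ge> v" and v: "v > 0" and \<epsilon>: "0 < \<epsilon>" "\<epsilon> \<le> 1"
  shows "cmod (pastur_kernel w (cmod (g + h)) - pastur_kernel w (cmod g) - taylor_term w g h)
    \<le> taylor_const v * (\<epsilon> * (cmod h)\<^sup>2 + (cmod h)\<^sup>2 * indicator {x. cmod x > \<epsilon>} h)"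
proof -
  define Q where "Q = complex_of_real ((cmod g)\<^sup>2) - w\<^sup>2"
  define P where "P = complex_of_real ((cmod (g + h))\<^sup>2) - w\<^sup>2"
  note q = kernel_ratio_bounds[OF w v, of g, folded Q_def]
  note p = kernel_ratio_bounds[OF w v, of "g + h", folded P_def]
  define a where "a = Re g * Re h + Im g * Im h"
  define H where "H = cmod h"
  define d where "d = 2 * a + H\<^sup>2"
  define G where "G = cmod g / cmod Q"
  define I where "I = 1 / cmod Q"
  define W where "W = cmod w / cmod Q"
  define W' where "W' = cmod w / cmod P"
  define c where "c = 2 / v + 1 / v\<^sup>2"
  have c0: "c \<ge> 0" using v by (simp add: c_def)
  have H0: "H \<ge> 0" by (simp add: H_def)
  have G: "0 \<le> G" "G \<le> 1 / v" and I: "0 \<le> I" "I \<le> 1 / v\<^sup>2" and W: "0 \<le> W" "W \<le> 1 / v" and W': "0 \<le> W'" "W' \<le> 1 / v"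
    using q p by (auto simp: G_def I_def W_def W'_def)
  have PQ: "P = Q + complex_of_real d"
    unfolding P_def Q_def d_def a_def H_def cmod_power2 by (simp add: power2_sum algebra_simps power2_eq_square)
  have a_le: "\<bar>a\<bar> \<le> cmod g * H"
  proof -
    have "a = Re (cnj g * h)" by (simp add: a_def)
    then show ?thesis using abs_Re_le_cmod[of "cnj g * h"] by (simp add: norm_mult H_def)
  qed
  have aq: "\<bar>a\<bar> / cmod Q \<le> G * H"
    using divide_right_mono[OF a_le, of "cmod Q"] by (simp add: G_def)
  have dq: "\<bar>d\<bar> / cmod Q \<le> 2 * (G * H) + H\<^sup>2 * I"
  proof -
    have "\<bar>d\<bar> \<le> 2 * \<bar>a\<bar> + H\<^sup>2" unfolding d_def using zero_le_power2[of H] by linarith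
    then have "\<bar>d\<bar> / cmod Q \<le> (2 * \<bar>a\<bar> + H\<^sup>2) / cmod Q" by (rule divide_right_mono) simp
    then show ?thesis using aq by (simp add: add_divide_distrib I_def)
  qed
  have T: "taylor_term w g h = - (w / Q\<^sup>2) * d + (4 * w / Q ^ 3) * (a\<^sup>2)"
    by (simp add: taylor_term_def Let_def Q_def d_def a_def H_def)
  have F: "pastur_kernel w (cmod (g + h)) = w / P" "pastur_kernel w (cmod g) = w / Q"
    by (simp_all add: pastur_kernel_def P_def Q_def)
  let ?E = "pastur_kernel w (cmod (g + h)) - pastur_kernel w (cmod g) - taylor_term w g h"
  have small: "cmod ?E \<le> (1 / v * (4 / v ^ 3 + 1 / v ^ 4 + c ^ 3)) * H ^ 3" if H1: "H \<le> 1"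
  proof -
    have "?E = w * (1 / P - 1 / Q + (P - Q) / Q\<^sup>2 - (P - Q)\<^sup>2 / Q ^ 3) + w * (complex_of_real (d\<^sup>2 - 4 * a\<^sup>2) / Q ^ 3)"
      unfolding T F by (simp add: PQ algebra_simps diff_divide_distrib)
    also have "\<dots> = - ((w / P) * (complex_of_real d / Q) ^ 3) + (w / Q) * (complex_of_real (d\<^sup>2 - 4 * a\<^sup>2) / Q\<^sup>2)"
    proof -
      have "P - Q = complex_of_real d" by (simp add: PQ)
      then show ?thesis
        unfolding third_order_identity[OF p(1) q(1)]
        by (simp add: power_divide power2_eq_square power3_eq_cube mult_ac del: of_real_diff)
    qed
    finally have "cmod ?E \<le> W' * (\<bar>d\<bar> / cmod Q) ^ 3 + W * (\<bar>d\<^sup>2 - 4 * a\<^sup>2\<bar> / (cmod Q)\<^sup>2)"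
      by (simp only:) (rule order_trans[OF norm_triangle_ineq], simp add: norm_mult norm_divide norm_power W'_def W_def
          del: of_real_diff of_real_mult of_real_power)
    also have "\<dots> \<le> 1 / v * (c ^ 3 * H ^ 3) + 1 / v * ((4 / v ^ 3 + 1 / v ^ 4) * H ^ 3)"
    proof (intro add_mono mult_mono)
      have "\<bar>d\<bar> / cmod Q \<le> 2 * (1 / v * H) + H * H * (1 / v\<^sup>2)"
        using dq G I H0 mult_right_mono[OF G(2) H0] mult_left_mono[OF I(2), of "H * H"] by (simp add: power2_eq_square)
      also have "\<dots> \<le> 2 * (1 / v * H) + 1 * H * (1 / v\<^sup>2)"
        using H1 H0 v by (intro add_left_mono mult_right_mono) auto
      also have "\<dots> = c * H" by (simp add: c_def algebra_simps)
      finally have "(\<bar>d\<bar> / cmod Q) ^ 3 \<le> (c * H) ^ 3" by (intro power_mono) auto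
      then show "(\<bar>d\<bar> / cmod Q) ^ 3 \<le> c ^ 3 * H ^ 3" by (simp add: power_mult_distrib)
      \<comment> \<open>The square of the full increment differs from the retained
        \<open>4 a^2\<close> by terms of third and fourth order in \<open>h\<close>.\<close>
      have "d\<^sup>2 - 4 * a\<^sup>2 = H\<^sup>2 * (4 * a + H\<^sup>2)" by (simp add: d_def power2_eq_square algebra_simps)
      then have "\<bar>d\<^sup>2 - 4 * a\<^sup>2\<bar> = H\<^sup>2 * \<bar>4 * a + H\<^sup>2\<bar>" by (simp add: abs_mult)
      also have "\<dots> \<le> H\<^sup>2 * (4 * (cmod g * H) + H\<^sup>2)"
        using a_le zero_le_power2[of H] by (intro mult_left_mono) linarith+
      finally have "\<bar>d\<^sup>2 - 4 * a\<^sup>2\<bar> / (cmod Q)\<^sup>2 \<le> (H\<^sup>2 * (4 * (cmod g * H) + H\<^sup>2)) / (cmod Q)\<^sup>2"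
        by (rule divide_right_mono) simp
      also have "\<dots> = H ^ 3 * (4 * (G * I)) + H ^ 3 * (H * (I * I))"
        by (simp add: G_def I_def power2_eq_square power3_eq_cube add_divide_distrib distrib_left mult_ac)
      also have "\<dots> \<le> H ^ 3 * (4 * (1 / v * (1 / v\<^sup>2))) + H ^ 3 * (1 * (1 / v\<^sup>2 * (1 / v\<^sup>2)))"
        using G I H0 H1 v by (intro add_mono mult_left_mono mult_mono) auto
      also have "\<dots> = (4 / v ^ 3 + 1 / v ^ 4) * H ^ 3"
        by (simp add: algebra_simps power2_eq_square power3_eq_cube power4_eq_xxxx)
      finally show "\<bar>d\<^sup>2 - 4 * a\<^sup>2\<bar> / (cmod Q)\<^sup>2 \<le> (4 / v ^ 3 + 1 / v ^ 4) * H ^ 3" .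
    qed (use W W' v in auto)
    also have "\<dots> = (1 / v * (4 / v ^ 3 + 1 / v ^ 4 + c ^ 3)) * H ^ 3" by (simp add: algebra_simps)
    finally show ?thesis .
  qed
  have big: "cmod ?E \<le> (2 / v + 1 / v * c + 4 / v ^ 3) * H\<^sup>2" if H1: "1 < H"
  proof -
    have "?E = w / P - w / Q + ((w / Q) * (complex_of_real d / Q) - 4 * (w / Q) * (complex_of_real a / Q)\<^sup>2)"
      unfolding T F by (simp add: power2_eq_square power3_eq_cube)
    also have "cmod \<dots> \<le> (cmod (w / P) + cmod (w / Q)) + (cmod ((w / Q) * (complex_of_real d / Q)) + cmod (4 * (w / Q) * (complex_of_real a / Q)\<^sup>2))"
      by (rule order_trans[OF norm_triangle_ineq]) (intro add_mono norm_triangle_ineq4)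
    also have "\<dots> = (W' + W) + (W * (\<bar>d\<bar> / cmod Q) + 4 * W * (\<bar>a\<bar> / cmod Q)\<^sup>2)"
      by (simp add: norm_mult norm_divide norm_power W_def W'_def)
    also have "\<dots> \<le> (1 / v + 1 / v) * H\<^sup>2 + (1 / v * (c * H\<^sup>2) + 4 * (1 / v) * (1 / v * H)\<^sup>2)"
    proof (intro add_mono mult_mono power_mono)
      have "W' + W \<le> (1 / v + 1 / v) * 1" using W W' by simp
      also have "\<dots> \<le> (1 / v + 1 / v) * H\<^sup>2"
        using H1 v by (intro mult_left_mono) (auto intro!: one_le_power less_imp_le)
      finally show "W' + W \<le> (1 / v + 1 / v) * H\<^sup>2" .
      have HH: "H \<le> H\<^sup>2" using H1 by (simp add: power2_eq_square)
      have "\<bar>d\<bar> / cmod Q \<le> 2 * (1 / v * H) + H\<^sup>2 * (1 / v\<^sup>2)"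
        using dq mult_right_mono[OF G(2) H0] mult_left_mono[OF I(2), of "H\<^sup>2"] by simp
      also have "\<dots> \<le> 2 * (1 / v * H\<^sup>2) + H\<^sup>2 * (1 / v\<^sup>2)"
        using mult_left_mono[OF HH, of "1 / v"] v by simp
      also have "\<dots> = c * H\<^sup>2" by (simp add: c_def algebra_simps)
      finally show "\<bar>d\<bar> / cmod Q \<le> c * H\<^sup>2" .
      show "\<bar>a\<bar> / cmod Q \<le> 1 / v * H" using aq mult_right_mono[OF G(2) H0] by simp
    qed (use W W' v c0 in auto)
    also have "\<dots> = (2 / v + 1 / v * c + 4 / v ^ 3) * H\<^sup>2"
      by (simp add: algebra_simps power2_eq_square power3_eq_cube)
    finally show ?thesis .
  qed
  define C1 where "C1 = 1 / v * (4 / v ^ 3 + 1 / v ^ 4 + c ^ 3)"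
  define C2 where "C2 = 2 / v + 1 / v * c + 4 / v ^ 3"
  have C: "C1 \<ge> 0" "C2 \<ge> 0" "taylor_const v = C1 + C2"
    using v c0 by (simp_all add: C1_def C2_def taylor_const_def c_def)
  have "cmod ?E \<le> (C1 + C2) * (\<epsilon> * H\<^sup>2 + H\<^sup>2 * indicator {x. cmod x > \<epsilon>} h)"
  proof (cases "H \<le> \<epsilon>")
    case True
    then have H1: "H \<le> 1" using \<epsilon> by simp
    have "cmod ?E \<le> C1 * H ^ 3" using small[OF H1] by (simp add: C1_def)
    also have "\<dots> = C1 * (H * H\<^sup>2)" by (simp add: power2_eq_square power3_eq_cube)
    also have "\<dots> \<le> (C1 + C2) * (\<epsilon> * H\<^sup>2)"
      using True C H0 \<epsilon> by (intro mult_mono mult_right_mono) auto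
    finally show ?thesis using True by (simp add: H_def)
  next
    case False
    have "cmod ?E \<le> (C1 + C2) * H\<^sup>2"
    proof (cases "H \<le> 1")
      case True
      have "cmod ?E \<le> C1 * H ^ 3" using small[OF True] by (simp add: C1_def)
      also have "\<dots> = C1 * (H * H\<^sup>2)" by (simp add: power2_eq_square power3_eq_cube)
      also have "\<dots> \<le> (C1 + C2) * (1 * H\<^sup>2)"
        using True C H0 by (intro mult_mono mult_right_mono) auto
      finally show ?thesis by simp
    next
      case False
      then have "cmod ?E \<le> C2 * H\<^sup>2" using big by (simp add: C2_def)
      also have "\<dots> \<le> (C1 + C2) * H\<^sup>2" using C by (intro mult_right_mono) auto
      finally show ?thesis .
    qed
    also have "\<dots> \<le> (C1 + C2) * (\<epsilon> * H\<^sup>2 + H\<^sup>2)" using C \<epsilon> by (intro mult_left_mono) auto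
    finally show ?thesis using False by (simp add: H_def)
  qed
  then show ?thesis unfolding C(3) H_def .
qed

section \<open>Second moments and the one-step comparison of two laws\<close>

definition second_moments :: "complex measure \<Rightarrow> real \<times> real \<times> real" where
  "second_moments N = ((\<integral>x. (Re x)\<^sup>2 \<partial>N), (\<integral>x. Re x * Im x \<partial>N), (\<integral>x. (Im x)\<^sup>2 \<partial>N))"

abbreviation "mom11 N \<equiv> fst (second_moments N)"
abbreviation "mom12 N \<equiv> fst (snd (second_moments N))"
abbreviation "mom22 N \<equiv> snd (snd (second_moments N))"

lemma bounded_borel_kernel:
  assumes "Im w > 0"
  shows "bounded_borel (\<lambda>g. pastur_kernel w (cmod g))"
  unfolding bounded_borel_def
proof (intro conjI exI[of _ "1 / Im w"] allI)
  show "(\<lambda>g :: complex. pastur_kernel w (cmod g)) \<in> borel_measurable borel" by measurable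
qed (rule cmod_pastur_kernel_le[OF assms])

context entry_law
begin

lemma complex_law: "complex_law N"
  unfolding complex_law_def using sets_N prob_space_axioms by simp

lemma integrable_moments:
  "integrable N (\<lambda>x. x)" "integrable N Re" "integrable N Im"
  "integrable N (\<lambda>x. (Re x)\<^sup>2)" "integrable N (\<lambda>x. Re x * Im x)" "integrable N (\<lambda>x. (Im x)\<^sup>2)"
proof -
  have b: "integrable N f" if "f \<in> borel_measurable borel" "\<And>x. norm (f x) \<le> 1 + (cmod x)\<^sup>2"
    for f :: "complex \<Rightarrow> 'b :: {banach, second_countable_topology}"
  proof (rule Bochner_Integration.integrable_bound)
    show "integrable N (\<lambda>x. 1 + (cmod x)\<^sup>2)" using square_integrable by simp
    show "f \<in> borel_measurable N" using that(1) by (simp add: measurable_cong_sets[OF sets_N refl])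
    show "AE x in N. norm (f x) \<le> norm (1 + (cmod x)\<^sup>2)" using that(2) by simp
  qed
  have c: "cmod x \<le> 1 + (cmod x)\<^sup>2" for x by (rule le_one_plus_square)
  have sq: "(cmod x)\<^sup>2 = (Re x)\<^sup>2 + (Im x)\<^sup>2" for x by (rule cmod_power2)
  have p: "\<bar>Re x * Im x\<bar> \<le> (Re x)\<^sup>2 + (Im x)\<^sup>2" for x
    using sum_squares_bound[of "\<bar>Re x\<bar>" "\<bar>Im x\<bar>"] mult_nonneg_nonneg[of "\<bar>Re x\<bar>" "\<bar>Im x\<bar>"]
    unfolding abs_mult power2_abs by linarith
  show "integrable N (\<lambda>x. x)" by (rule b) (use c in auto)
  then show "integrable N Re" "integrable N Im" by (rule integrable_Re, rule integrable_Im)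
  show "integrable N (\<lambda>x. (Re x)\<^sup>2)" by (rule b) (auto simp: sq)
  show "integrable N (\<lambda>x. (Im x)\<^sup>2)" by (rule b) (auto simp: sq)
  show "integrable N (\<lambda>x. Re x * Im x)" by (rule b) (use p in \<open>auto simp: sq intro: add_increasing\<close>)
qed

lemma mean_Re_Im: "(\<integral>x. Re x \<partial>N) = 0" "(\<integral>x. Im x \<partial>N) = 0"
  using integral_Re[OF integrable_moments(1)] integral_Im[OF integrable_moments(1)] mean_zero by simp_all

text \<open>The mean of the Taylor term: its part linear in the increment vanishes by centring, so
  only second moments remain.\<close>

definition taylor_mean :: "complex \<Rightarrow> complex \<Rightarrow> complex" where
  "taylor_mean w g = (let Q = complex_of_real ((cmod g)\<^sup>2) - w\<^sup>2 in
     - (w / Q\<^sup>2) * complex_of_real (mom11 N + mom22 N) +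
     (4 * w / Q ^ 3) * complex_of_real ((Re g)\<^sup>2 * mom11 N + 2 * (Re g * Im g) * mom12 N + (Im g)\<^sup>2 * mom22 N))"

lemma taylor_term_integral:
  "integrable N (taylor_term w g)" "(\<integral>h. taylor_term w g h \<partial>N) = taylor_mean w g"
proof -
  define Q where "Q = complex_of_real ((cmod g)\<^sup>2) - w\<^sup>2"
  define p where "p h = 2 * (Re g * Re h + Im g * Im h) + ((Re h)\<^sup>2 + (Im h)\<^sup>2)" for h
  define q where "q h = (Re g)\<^sup>2 * (Re h)\<^sup>2 + 2 * (Re g * Im g) * (Re h * Im h) + (Im g)\<^sup>2 * (Im h)\<^sup>2" for h
  have T: "taylor_term w g = (\<lambda>h. - (w / Q\<^sup>2) * complex_of_real (p h) + (4 * w / Q ^ 3) * complex_of_real (q h))"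
  proof
    fix h
    have "2 * (Re g * Re h + Im g * Im h) + (cmod h)\<^sup>2 = p h" unfolding p_def cmod_power2 ..
    moreover have "(Re g * Re h + Im g * Im h)\<^sup>2 = q h"
      by (simp add: q_def power2_sum power_mult_distrib)
    ultimately show "taylor_term w g h = - (w / Q\<^sup>2) * complex_of_real (p h) + (4 * w / Q ^ 3) * complex_of_real (q h)"
      unfolding taylor_term_def Let_def Q_def[symmetric] by (simp only:)
  qed
  have ip: "integrable N p" "integral\<^sup>L N p = mom11 N + mom22 N"
    unfolding p_def[abs_def] using integrable_moments mean_Re_Im by (simp_all add: second_moments_def)
  have iq: "integrable N q" "integral\<^sup>L N q = (Re g)\<^sup>2 * mom11 N + 2 * (Re g * Im g) * mom12 N + (Im g)\<^sup>2 * mom22 N"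
    unfolding q_def[abs_def] using integrable_moments by (simp_all add: second_moments_def)
  have i: "integrable N (\<lambda>h. - (w / Q\<^sup>2) * complex_of_real (p h))" "integrable N (\<lambda>h. (4 * w / Q ^ 3) * complex_of_real (q h))"
    by (intro integrable_mult_right integrable_of_real ip iq)+
  show "integrable N (taylor_term w g)" unfolding T by (rule Bochner_Integration.integrable_add[OF i])
  show "(\<integral>h. taylor_term w g h \<partial>N) = taylor_mean w g"
    unfolding T Bochner_Integration.integral_add[OF i] integral_mult_right_zero integral_complex_of_real ip iq
    by (simp add: taylor_mean_def Let_def Q_def)
qed

lemma smear_kernel_taylor:
  assumes w: "Im w \<ge> v" and v: "v > 0" and \<epsilon>: "0 < \<epsilon>" "\<epsilon> \<le> 1"
  shows "cmod (smear N (\<lambda>g. pastur_kernel w (cmod g)) g - pastur_kernel w (cmod g) - taylor_mean w g)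
    \<le> taylor_const v * (\<epsilon> * \<tau> + tail_moment \<epsilon>)"
proof -
  have w0: "Im w > 0" using w v by simp
  note iF = smear_integrable[OF complex_law bounded_borel_kernel[OF w0], of g]
  have i: "integrable N (\<lambda>h. pastur_kernel w (cmod (g + h)) - pastur_kernel w (cmod g) - taylor_term w g h)"
    by (intro Bochner_Integration.integrable_diff iF taylor_term_integral) simp
  have "smear N (\<lambda>g. pastur_kernel w (cmod g)) g - pastur_kernel w (cmod g) - taylor_mean w g =
    (\<integral>h. pastur_kernel w (cmod (g + h)) - pastur_kernel w (cmod g) - taylor_term w g h \<partial>N)"
    using iF taylor_term_integral[of w g] prob_space by (simp add: smear_def)
  also have "cmod \<dots> \<le> (\<integral>h. taylor_const v * (\<epsilon> * (cmod h)\<^sup>2 + (cmod h)\<^sup>2 * indicator {x. cmod x > \<epsilon>} h) \<partial>N)"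
    by (rule norm_integral_le[OF i])
       (use kernel_taylor[OF w v \<epsilon>] square_integrable integrable_tail in \<open>auto intro!: integrable_mult_right Bochner_Integration.integrable_add\<close>)
  also have "\<dots> = taylor_const v * (\<epsilon> * \<tau> + tail_moment \<epsilon>)"
    using square_integrable integrable_tail[of \<epsilon>] by (simp add: second_moment tail_moment_def)
  finally show ?thesis .
qed

end

text \<open>The constant is 5 = 1 + 4: the first Taylor coefficient gives \<open>1 / v^3\<close>,
  the second \<open>4 / v^3\<close> once \<open>|g| / |Q| <= 1 / v\<close> has absorbed the factor
  \<open>|g|^2\<close>.\<close>

lemma taylor_mean_diff:
  assumes N: "entry_law N \<tau>" and M: "entry_law M \<tau>'" and w: "Im w \<ge> v" and v: "v > 0"
  shows "cmod (entry_law.taylor_mean N w g - entry_law.taylor_mean M w g) \<le>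
    5 / v ^ 3 * (\<bar>mom11 N - mom11 M\<bar> + 2 * \<bar>mom12 N - mom12 M\<bar> + \<bar>mom22 N - mom22 M\<bar>)"
proof -
  interpret N: entry_law N \<tau> by (rule N)
  interpret M: entry_law M \<tau>' by (rule M)
  define Q where "Q = complex_of_real ((cmod g)\<^sup>2) - w\<^sup>2"
  note q = kernel_ratio_bounds[OF w v, of g, folded Q_def]
  define x y t where "x = mom11 N - mom11 M" and "y = mom12 N - mom12 M" and "t = mom22 N - mom22 M"
  define D where "D = \<bar>x\<bar> + 2 * \<bar>y\<bar> + \<bar>t\<bar>"
  define r where "r = cmod g"
  have eq: "N.taylor_mean w g - M.taylor_mean w g = - (w / Q\<^sup>2) * complex_of_real (x + t) +
     (4 * w / Q ^ 3) * complex_of_real ((Re g)\<^sup>2 * x + 2 * (Re g * Im g) * y + (Im g)\<^sup>2 * t)"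
  proof -
    have gen: "A * complex_of_real p + B * complex_of_real q - (A * complex_of_real p' + B * complex_of_real q') =
      A * complex_of_real (p - p') + B * complex_of_real (q - q')" for A B p q p' q'
      by (simp add: algebra_simps)
    show ?thesis
      unfolding N.taylor_mean_def M.taylor_mean_def Let_def Q_def[symmetric] gen
      by (simp add: x_def y_def t_def algebra_simps del: of_real_add of_real_diff of_real_mult)
  qed
  have Re2: "(Re g)\<^sup>2 \<le> r\<^sup>2" "(Im g)\<^sup>2 \<le> r\<^sup>2" "\<bar>Re g * Im g\<bar> \<le> r\<^sup>2"
  proof -
    show "(Re g)\<^sup>2 \<le> r\<^sup>2" "(Im g)\<^sup>2 \<le> r\<^sup>2" by (simp_all add: r_def cmod_power2)
    show "\<bar>Re g * Im g\<bar> \<le> r\<^sup>2"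
      unfolding abs_mult power2_eq_square r_def by (intro mult_mono abs_Re_le_cmod abs_Im_le_cmod) auto
  qed
  have "\<bar>(Re g)\<^sup>2 * x + 2 * (Re g * Im g) * y + (Im g)\<^sup>2 * t\<bar> \<le> \<bar>(Re g)\<^sup>2 * x\<bar> + \<bar>2 * (Re g * Im g) * y\<bar> + \<bar>(Im g)\<^sup>2 * t\<bar>"
    by linarith
  also have "\<dots> \<le> r\<^sup>2 * \<bar>x\<bar> + 2 * r\<^sup>2 * \<bar>y\<bar> + r\<^sup>2 * \<bar>t\<bar>"
    unfolding abs_mult[of "(Re g)\<^sup>2"] abs_mult[of "(Im g)\<^sup>2"] abs_mult[of "2 * (Re g * Im g)"] abs_mult[of 2 "Re g * Im g"]
    using Re2 by (intro add_mono mult_mono) auto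
  also have "\<dots> = r\<^sup>2 * D" by (simp add: D_def algebra_simps)
  finally have 1: "\<bar>(Re g)\<^sup>2 * x + 2 * (Re g * Im g) * y + (Im g)\<^sup>2 * t\<bar> \<le> r\<^sup>2 * D" .
  have 2: "\<bar>x + t\<bar> \<le> D" unfolding D_def by linarith
  have D0: "D \<ge> 0" by (simp add: D_def)
  have "cmod (N.taylor_mean w g - M.taylor_mean w g) \<le>
      cmod (- (w / Q\<^sup>2) * complex_of_real (x + t)) + cmod ((4 * w / Q ^ 3) * complex_of_real ((Re g)\<^sup>2 * x + 2 * (Re g * Im g) * y + (Im g)\<^sup>2 * t))"
    unfolding eq by (rule norm_triangle_ineq)
  also have "\<dots> = (cmod w / cmod Q) * (1 / cmod Q) * \<bar>x + t\<bar> +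
      (4 * (cmod w / cmod Q) * (1 / cmod Q)\<^sup>2) * \<bar>(Re g)\<^sup>2 * x + 2 * (Re g * Im g) * y + (Im g)\<^sup>2 * t\<bar>"
    unfolding norm_mult norm_of_real norm_minus_cancel norm_divide norm_power
    by (simp add: power2_eq_square power3_eq_cube)
  also have "\<dots> \<le> (cmod w / cmod Q) * (1 / cmod Q) * D + (4 * (cmod w / cmod Q) * (1 / cmod Q)\<^sup>2) * (r\<^sup>2 * D)"
    using 1 2 by (intro add_mono mult_left_mono) auto
  also have "\<dots> = ((cmod w / cmod Q) * (1 / cmod Q) + 4 * (cmod w / cmod Q) * (cmod g / cmod Q)\<^sup>2) * D"
    by (simp add: r_def algebra_simps power_divide)
  also have "\<dots> \<le> (1 / v * (1 / v\<^sup>2) + 4 * (1 / v) * (1 / v)\<^sup>2) * D"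
    using q v D0 by (intro mult_right_mono add_mono mult_mono power_mono) auto
  also have "\<dots> = 5 / v ^ 3 * D" by (simp add: power2_eq_square power3_eq_cube)
  finally show ?thesis unfolding D_def x_def y_def t_def .
qed

lemma smear_kernel_diff:
  assumes N: "entry_law N \<tau>" and M: "entry_law M \<tau>'" and w: "Im w \<ge> v" and v: "v > 0" and \<epsilon>: "0 < \<epsilon>" "\<epsilon> \<le> 1"
  shows "cmod (smear N (\<lambda>g. pastur_kernel w (cmod g)) g - smear M (\<lambda>g. pastur_kernel w (cmod g)) g) \<le>
    taylor_const v * (\<epsilon> * \<tau> + entry_law.tail_moment N \<epsilon>) + taylor_const v * (\<epsilon> * \<tau>' + entry_law.tail_moment M \<epsilon>) +
    5 / v ^ 3 * (\<bar>mom11 N - mom11 M\<bar> + 2 * \<bar>mom12 N - mom12 M\<bar> + \<bar>mom22 N - mom22 M\<bar>)"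
proof -
  have tri: "cmod (a - b) \<le> cmod (a - f - x) + cmod (b - f - y) + cmod (x - y)" for a b f x y :: complex
  proof -
    have "a - b = (a - f - x) - (b - f - y) + (x - y)" by simp
    then have "cmod (a - b) \<le> cmod ((a - f - x) - (b - f - y)) + cmod (x - y)" by (metis norm_triangle_ineq)
    then show ?thesis using norm_triangle_ineq4[of "a - f - x" "b - f - y"] by linarith
  qed
  show ?thesis
    by (rule order_trans[OF tri[where f = "pastur_kernel w (cmod g)" and x = "entry_law.taylor_mean N w g"
          and y = "entry_law.taylor_mean M w g"]]) (intro add_mono entry_law.smear_kernel_taylor[OF N w v \<epsilon>]
        entry_law.smear_kernel_taylor[OF M w v \<epsilon>] taylor_mean_diff[OF N M w v])
qed

lemma SN_moments:
  "integrable SN (\<lambda>x. x)" "integrable SN (\<lambda>x. x\<^sup>2)" "(\<integral>x. x \<partial>SN) = 0" "(\<integral>x. x\<^sup>2 \<partial>SN) = 1"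
  using integrable_std_normal_distribution_moment[of 1] integrable_std_normal_distribution_moment[of 2]
    integral_std_normal_distribution_moment_odd[of 1] std_normal_distribution_even_moments(1)[of 1] by simp_all

lemma SN_pair_moments:
  fixes f g :: "real \<Rightarrow> real"
  assumes f: "integrable SN f" and g: "integrable SN g"
  shows "integrable (SN \<Otimes>\<^sub>M SN) (\<lambda>p. f (fst p) * g (snd p))"
    "(\<integral>p. f (fst p) * g (snd p) \<partial>(SN \<Otimes>\<^sub>M SN)) = (\<integral>x. f x \<partial>SN) * (\<integral>x. g x \<partial>SN)"
proof -
  interpret prob_space SN by (rule prob_space_SN)
  interpret P: pair_prob_space SN SN ..
  have fm[measurable]: "f \<in> borel_measurable borel" and gm[measurable]: "g \<in> borel_measurable borel"
    using borel_measurable_integrable[OF f] borel_measurable_integrable[OF g] by simp_all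
  show int: "integrable (SN \<Otimes>\<^sub>M SN) (\<lambda>p. f (fst p) * g (snd p))"
  proof (rule P.Fubini_integrable)
    show "integrable SN (\<lambda>x. \<integral>y. norm (f (fst (x, y)) * g (snd (x, y))) \<partial>SN)"
      using f g by (simp add: abs_mult)
    show "AE x in SN. integrable SN (\<lambda>y. f (fst (x, y)) * g (snd (x, y)))" using g by simp
  qed simp
  show "(\<integral>p. f (fst p) * g (snd p) \<partial>(SN \<Otimes>\<^sub>M SN)) = (\<integral>x. f x \<partial>SN) * (\<integral>x. g x \<partial>SN)"
    using P.integral_fst'[OF int] by simp
qed

lemma planar_normal_integral:
  fixes f :: "complex \<Rightarrow> real"
  assumes [measurable]: "f \<in> borel_measurable borel"
  shows "(\<integral>x. f x \<partial>planar_normal a b) =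
      (\<integral>p. f (complex_of_real (fst p) * a + complex_of_real (snd p) * b) \<partial>(SN \<Otimes>\<^sub>M SN))"
    "integrable (planar_normal a b) f \<longleftrightarrow>
      integrable (SN \<Otimes>\<^sub>M SN) (\<lambda>p. f (complex_of_real (fst p) * a + complex_of_real (snd p) * b))"
  unfolding planar_normal_def by (subst integral_distr integrable_distr_eq; simp)+

lemma planar_normal_quadratic:
  fixes \<alpha> \<beta> \<gamma> :: real
  shows "integrable (SN \<Otimes>\<^sub>M SN) (\<lambda>p. \<alpha> * (fst p)\<^sup>2 + \<beta> * (fst p * snd p) + \<gamma> * (snd p)\<^sup>2)"
    "(\<integral>p. \<alpha> * (fst p)\<^sup>2 + \<beta> * (fst p * snd p) + \<gamma> * (snd p)\<^sup>2 \<partial>(SN \<Otimes>\<^sub>M SN)) = \<alpha> + \<gamma>"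
    "integrable (SN \<Otimes>\<^sub>M SN) (\<lambda>p. \<alpha> * fst p + \<gamma> * snd p)"
    "(\<integral>p. \<alpha> * fst p + \<gamma> * snd p \<partial>(SN \<Otimes>\<^sub>M SN)) = 0"
proof -
  interpret prob_space SN by (rule prob_space_SN)
  have one: "integrable SN (\<lambda>_. 1 :: real)" "(\<integral>x. 1 \<partial>SN) = (1 :: real)" using prob_space by simp_all
  note m = SN_pair_moments[OF SN_moments(2) one(1)] SN_pair_moments[OF SN_moments(1) SN_moments(1)]
    SN_pair_moments[OF one(1) SN_moments(2)] SN_pair_moments[OF SN_moments(1) one(1)] SN_pair_moments[OF one(1) SN_moments(1)]
  have i: "integrable (SN \<Otimes>\<^sub>M SN) (\<lambda>p. (fst p)\<^sup>2)" "integrable (SN \<Otimes>\<^sub>M SN) (\<lambda>p. fst p * snd p)"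
    "integrable (SN \<Otimes>\<^sub>M SN) (\<lambda>p. (snd p)\<^sup>2)" "integrable (SN \<Otimes>\<^sub>M SN) (\<lambda>p. fst p :: real)" "integrable (SN \<Otimes>\<^sub>M SN) (\<lambda>p. snd p :: real)"
    using m by simp_all
  have v: "(\<integral>p. (fst p)\<^sup>2 \<partial>(SN \<Otimes>\<^sub>M SN)) = 1" "(\<integral>p. fst p * snd p \<partial>(SN \<Otimes>\<^sub>M SN)) = 0"
    "(\<integral>p. (snd p)\<^sup>2 \<partial>(SN \<Otimes>\<^sub>M SN)) = 1" "(\<integral>p. fst p \<partial>(SN \<Otimes>\<^sub>M SN)) = 0" "(\<integral>p. snd p \<partial>(SN \<Otimes>\<^sub>M SN)) = 0"
    using m one(2) SN_moments(3,4) by simp_all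
  show "integrable (SN \<Otimes>\<^sub>M SN) (\<lambda>p. \<alpha> * (fst p)\<^sup>2 + \<beta> * (fst p * snd p) + \<gamma> * (snd p)\<^sup>2)"
    "integrable (SN \<Otimes>\<^sub>M SN) (\<lambda>p. \<alpha> * fst p + \<gamma> * snd p)"
    by (intro Bochner_Integration.integrable_add integrable_mult_right i)+
  show "(\<integral>p. \<alpha> * (fst p)\<^sup>2 + \<beta> * (fst p * snd p) + \<gamma> * (snd p)\<^sup>2 \<partial>(SN \<Otimes>\<^sub>M SN)) = \<alpha> + \<gamma>"
    using i v by simp
  show "(\<integral>p. \<alpha> * fst p + \<gamma> * snd p \<partial>(SN \<Otimes>\<^sub>M SN)) = 0" using i v by simp
qed

lemma planar_normal_moments:
  "integrable (planar_normal a b) (\<lambda>x. (cmod x)\<^sup>2)"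
  "(\<integral>x. (cmod x)\<^sup>2 \<partial>planar_normal a b) = (cmod a)\<^sup>2 + (cmod b)\<^sup>2"
  "(\<integral>x. x \<partial>planar_normal a b) = 0"
  "second_moments (planar_normal a b) = ((Re a)\<^sup>2 + (Re b)\<^sup>2, Re a * Im a + Re b * Im b, (Im a)\<^sup>2 + (Im b)\<^sup>2)"
proof -
  define X where "X p = complex_of_real (fst p) * a + complex_of_real (snd p) * b" for p :: "real \<times> real"
  have 1: "(cmod (X p))\<^sup>2 = (cmod a)\<^sup>2 * (fst p)\<^sup>2 + (2 * (Re a * Re b + Im a * Im b)) * (fst p * snd p) + (cmod b)\<^sup>2 * (snd p)\<^sup>2" for p
    unfolding cmod_power2 by (simp add: X_def power2_eq_square algebra_simps)
  have 2: "(Re (X p))\<^sup>2 = (Re a)\<^sup>2 * (fst p)\<^sup>2 + (2 * (Re a * Re b)) * (fst p * snd p) + (Re b)\<^sup>2 * (snd p)\<^sup>2" for p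
    by (simp add: X_def power2_eq_square algebra_simps)
  have 3: "(Im (X p))\<^sup>2 = (Im a)\<^sup>2 * (fst p)\<^sup>2 + (2 * (Im a * Im b)) * (fst p * snd p) + (Im b)\<^sup>2 * (snd p)\<^sup>2" for p
    by (simp add: X_def power2_eq_square algebra_simps)
  have 4: "Re (X p) * Im (X p) = (Re a * Im a) * (fst p)\<^sup>2 + (Re a * Im b + Im a * Re b) * (fst p * snd p) + (Re b * Im b) * (snd p)\<^sup>2" for p
    by (simp add: X_def power2_eq_square algebra_simps)
  have 5: "Re (X p) = Re a * fst p + Re b * snd p" "Im (X p) = Im a * fst p + Im b * snd p" for p
    by (simp_all add: X_def)
  note pi = planar_normal_integral[of _ a b, folded X_def]
  show i: "integrable (planar_normal a b) (\<lambda>x. (cmod x)\<^sup>2)"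
    by (subst pi(2)) (simp_all only: 1 planar_normal_quadratic, measurable)
  show "(\<integral>x. (cmod x)\<^sup>2 \<partial>planar_normal a b) = (cmod a)\<^sup>2 + (cmod b)\<^sup>2"
    by (subst pi(1)) (simp_all only: 1 planar_normal_quadratic, measurable)
  have "(\<integral>x. (Re x)\<^sup>2 \<partial>planar_normal a b) = (Re a)\<^sup>2 + (Re b)\<^sup>2"
    by (subst pi(1)) (simp_all only: 2 planar_normal_quadratic, measurable)
  moreover have "(\<integral>x. (Im x)\<^sup>2 \<partial>planar_normal a b) = (Im a)\<^sup>2 + (Im b)\<^sup>2"
    by (subst pi(1)) (simp_all only: 3 planar_normal_quadratic, measurable)
  moreover have "(\<integral>x. Re x * Im x \<partial>planar_normal a b) = Re a * Im a + Re b * Im b"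
    by (subst pi(1)) (simp_all only: 4 planar_normal_quadratic, measurable)
  ultimately show "second_moments (planar_normal a b) = ((Re a)\<^sup>2 + (Re b)\<^sup>2, Re a * Im a + Re b * Im b, (Im a)\<^sup>2 + (Im b)\<^sup>2)"
    by (simp add: second_moments_def)
  have iR: "integrable (planar_normal a b) Re" "integrable (planar_normal a b) Im"
    by (subst pi(2), measurable, simp only: 5 planar_normal_quadratic)+
  have vR: "(\<integral>x. Re x \<partial>planar_normal a b) = 0" "(\<integral>x. Im x \<partial>planar_normal a b) = 0"
    by (subst pi(1), measurable, simp only: 5 planar_normal_quadratic)+
  have "integrable (planar_normal a b) (\<lambda>x. complex_of_real (Re x) + \<i> * complex_of_real (Im x))"
    by (intro Bochner_Integration.integrable_add integrable_mult_right integrable_of_real iR)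
  then have ix: "integrable (planar_normal a b) (\<lambda>x. x)" by (simp add: complex_eq[symmetric])
  show "(\<integral>x. x \<partial>planar_normal a b) = 0"
    using integral_Re[OF ix] integral_Im[OF ix] vR by (simp add: complex_eq_iff)
qed

lemma entry_law_planar_normal: "entry_law (planar_normal a b) ((cmod a)\<^sup>2 + (cmod b)\<^sup>2)"
proof -
  interpret prob_space "planar_normal a b" using complex_law_normal(2) by (simp add: complex_law_def)
  show ?thesis
    using complex_law_normal(2)[of a b] planar_normal_moments[of a b]
    by unfold_locales (simp_all add: complex_law_def)
qed

text \<open>Rescaling turns the tail at \<open>\<epsilon>\<close> into the tail of one fixed
  Gaussian at \<open>\<epsilon> sqrt n\<close>, which vanishes by dominated convergence.\<close>

lemma planar_normal_tail:
  assumes \<epsilon>: "\<epsilon> > 0"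
  shows "(\<lambda>n. real n * entry_law.tail_moment (planar_normal (complex_of_real (1 / sqrt n) * a) (complex_of_real (1 / sqrt n) * b)) \<epsilon>)
    \<longlonglongrightarrow> 0"
proof -
  define X where "X p = complex_of_real (fst p) * a + complex_of_real (snd p) * b" for p :: "real \<times> real"
  have Xm[measurable]: "X \<in> borel_measurable (SN \<Otimes>\<^sub>M SN)" unfolding X_def[abs_def] by measurable
  have iX: "integrable (SN \<Otimes>\<^sub>M SN) (\<lambda>p. (cmod (X p))\<^sup>2)"
    using planar_normal_moments(1)[of a b] planar_normal_integral(2)[of "\<lambda>x. (cmod x)\<^sup>2" a b] by (simp add: X_def)
  have tail: "real n * entry_law.tail_moment (planar_normal (complex_of_real (1 / sqrt n) * a) (complex_of_real (1 / sqrt n) * b)) \<epsilon>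
     = (\<integral>p. (cmod (X p))\<^sup>2 * indicator {x. cmod x > \<epsilon> * sqrt n} (X p) \<partial>(SN \<Otimes>\<^sub>M SN))" if n: "n > 0" for n :: nat
  proof -
    let ?s = "1 / sqrt (real n)"
    have c: "cmod (complex_of_real ?s * x) = ?s * cmod x" for x by (simp add: norm_mult norm_divide)
    have lin: "complex_of_real (fst p) * (complex_of_real ?s * a) + complex_of_real (snd p) * (complex_of_real ?s * b)
       = complex_of_real ?s * X p" for p by (simp add: X_def algebra_simps)
    have "entry_law.tail_moment (planar_normal (complex_of_real ?s * a) (complex_of_real ?s * b)) \<epsilon> =
      (\<integral>p. (cmod (complex_of_real ?s * X p))\<^sup>2 * indicator {x. cmod x > \<epsilon>} (complex_of_real ?s * X p) \<partial>(SN \<Otimes>\<^sub>M SN))"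
      unfolding entry_law.tail_moment_def[OF entry_law_planar_normal]
      by (subst planar_normal_integral(1)) (simp_all only: lin, measurable)
    also have "\<dots> = (\<integral>p. (1 / real n) * ((cmod (X p))\<^sup>2 * indicator {x. cmod x > \<epsilon> * sqrt n} (X p)) \<partial>(SN \<Otimes>\<^sub>M SN))"
      unfolding c using n
      by (intro Bochner_Integration.integral_cong refl) (simp add: indicator_def norm_divide power_divide pos_less_divide_eq)
    finally show ?thesis using n by simp
  qed
  have "(\<lambda>n. \<integral>p. (cmod (X p))\<^sup>2 * indicator {x. cmod x > \<epsilon> * sqrt (real n)} (X p) \<partial>(SN \<Otimes>\<^sub>M SN)) \<longlonglongrightarrow> (\<integral>p. 0 \<partial>(SN \<Otimes>\<^sub>M SN))"
  proof (rule integral_dominated_convergence[where w = "\<lambda>p. (cmod (X p))\<^sup>2"])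
    show "AE p in SN \<Otimes>\<^sub>M SN. (\<lambda>n. (cmod (X p))\<^sup>2 * indicator {x. cmod x > \<epsilon> * sqrt (real n)} (X p)) \<longlonglongrightarrow> 0"
    proof (rule AE_I2)
      fix p
      have "filterlim (\<lambda>n. \<epsilon> * sqrt (real n)) at_top sequentially"
        using \<epsilon> by real_asymp
      then have "\<forall>\<^sub>F n in sequentially. \<epsilon> * sqrt (real n) \<ge> cmod (X p)"
        by (simp add: filterlim_at_top)
      then have "\<forall>\<^sub>F n in sequentially. (cmod (X p))\<^sup>2 * indicator {x. cmod x > \<epsilon> * sqrt (real n)} (X p) = 0"
        by eventually_elim simp
      then show "(\<lambda>n. (cmod (X p))\<^sup>2 * indicator {x. cmod x > \<epsilon> * sqrt (real n)} (X p)) \<longlonglongrightarrow> 0"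
        by (rule tendsto_eventually)
    qed
    show "AE p in SN \<Otimes>\<^sub>M SN. norm ((cmod (X p))\<^sup>2 * indicator {x. cmod x > \<epsilon> * sqrt (real n)} (X p)) \<le> (cmod (X p))\<^sup>2" for n
      by (rule AE_I2) (simp add: indicator_def)
  qed (use iX in simp_all)
  then have "(\<lambda>n. \<integral>p. (cmod (X p))\<^sup>2 * indicator {x. cmod x > \<epsilon> * sqrt (real n)} (X p) \<partial>(SN \<Otimes>\<^sub>M SN)) \<longlonglongrightarrow> 0" by simp
  moreover have "\<forall>\<^sub>F n in sequentially. (\<integral>p. (cmod (X p))\<^sup>2 * indicator {x. cmod x > \<epsilon> * sqrt (real n)} (X p) \<partial>(SN \<Otimes>\<^sub>M SN)) =
     real n * entry_law.tail_moment (planar_normal (complex_of_real (1 / sqrt n) * a) (complex_of_real (1 / sqrt n) * b)) \<epsilon>"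
    using eventually_gt_at_top[of 0] by eventually_elim (rule tail[symmetric])
  ultimately show ?thesis by (rule Lim_transform_eventually)
qed

text \<open>Uniformity in \<open>w\<close> is essential, because the application takes
  \<open>w = \<eta> + s\<close> with \<open>s\<close> depending on \<open>n\<close>. Replacing
  \<open>n\<close> increments costs \<open>n\<close> times the one-step bound: a part proportional
  to \<open>\<epsilon>\<close>, plus tails and moment differences that tend to 0.\<close>

theorem replacement_clt:
  assumes N: "\<And>n. n \<ge> 1 \<Longrightarrow> entry_law (N n) (1 / real n)"
    and tail: "\<And>\<epsilon>. \<epsilon> > 0 \<Longrightarrow> (\<lambda>n. real n * entry_law.tail_moment (N n) \<epsilon>) \<longlonglongrightarrow> 0"
    and m11: "(\<lambda>n. real n * mom11 (N n)) \<longlonglongrightarrow> (Re a)\<^sup>2 + (Re b)\<^sup>2"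
    and m12: "(\<lambda>n. real n * mom12 (N n)) \<longlonglongrightarrow> Re a * Im a + Re b * Im b"
    and m22: "(\<lambda>n. real n * mom22 (N n)) \<longlonglongrightarrow> (Im a)\<^sup>2 + (Im b)\<^sup>2"
    and v: "v > 0" and \<delta>: "\<delta> > 0"
  shows "\<forall>\<^sub>F n in sequentially. \<forall>w z. Im w \<ge> v \<longrightarrow>
    cmod ((smear (N n) ^^ n) (\<lambda>g. pastur_kernel w (cmod g)) z - (\<integral>g. pastur_kernel w (cmod (g - z)) \<partial>planar_normal a b)) \<le> \<delta>"
proof -
  define s where "s n = 1 / sqrt (real n)" for n
  \<comment> \<open>The signs match the target: increments are added to \<open>z\<close>, while the
    limit contains \<open>g - z\<close>, which has the modulus of \<open>z - g\<close>.\<close>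
  define G where "G n = planar_normal (complex_of_real (s n) * - a) (complex_of_real (s n) * - b)" for n
  define \<sigma> where "\<sigma> = (cmod a)\<^sup>2 + (cmod b)\<^sup>2"
  define C where "C = taylor_const v"
  have C0: "C \<ge> 0" using v by (simp add: C_def taylor_const_def)
  have \<sigma>0: "\<sigma> \<ge> 0" by (simp add: \<sigma>_def)
  \<comment> \<open>Chosen so that \<open>C \<epsilon> (1 + \<sigma>) <= \<delta> / 2\<close>;
    writing \<open>C + 1\<close> keeps the denominator positive.\<close>
  define \<epsilon> where "\<epsilon> = min 1 (\<delta> / (2 * ((C + 1) * (1 + \<sigma>))))"
  have \<epsilon>: "0 < \<epsilon>" "\<epsilon> \<le> 1" using \<delta> C0 \<sigma>0 by (auto simp: \<epsilon>_def intro!: divide_pos_pos mult_pos_pos)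
  have C\<epsilon>: "C * (\<epsilon> * (1 + \<sigma>)) \<le> \<delta> / 2"
  proof -
    have "C * (\<epsilon> * (1 + \<sigma>)) \<le> (C + 1) * (\<epsilon> * (1 + \<sigma>))" using \<epsilon> \<sigma>0 by (intro mult_right_mono) auto
    also have "\<dots> = \<epsilon> * ((C + 1) * (1 + \<sigma>))" by simp
    also have "\<dots> \<le> (\<delta> / (2 * ((C + 1) * (1 + \<sigma>)))) * ((C + 1) * (1 + \<sigma>))"
      using C0 \<sigma>0 by (intro mult_right_mono) (auto simp: \<epsilon>_def)
    also have "\<dots> = \<delta> / 2"
    proof -
      have "(C + 1) * (1 + \<sigma>) > 0" using C0 \<sigma>0 by (intro mult_pos_pos) auto
      moreover have "\<delta> / (2 * P) * P = \<delta> / 2" if "P > 0" for P :: real using that by simp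
      ultimately show ?thesis by blast
    qed
    finally show ?thesis .
  qed
  have sn: "real n * (s n)\<^sup>2 = 1" if "n \<ge> 1" for n using that by (simp add: s_def power_divide)
  have G: "entry_law (G n) (\<sigma> / real n)" if n: "n \<ge> 1" for n
  proof -
    have "(cmod (complex_of_real (s n) * - a))\<^sup>2 + (cmod (complex_of_real (s n) * - b))\<^sup>2 = \<sigma> / real n"
      using n by (simp add: norm_mult norm_divide power_mult_distrib \<sigma>_def s_def power_divide add_divide_distrib)
    then show ?thesis using entry_law_planar_normal[of "complex_of_real (s n) * - a" "complex_of_real (s n) * - b"]
      unfolding G_def by simp
  qed
  have mG: "real n * mom11 (G n) = (Re a)\<^sup>2 + (Re b)\<^sup>2" "real n * mom12 (G n) = Re a * Im a + Re b * Im b"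
    "real n * mom22 (G n) = (Im a)\<^sup>2 + (Im b)\<^sup>2" if n: "n \<ge> 1" for n
  proof -
    have "real n * mom11 (G n) = (real n * (s n)\<^sup>2) * ((Re a)\<^sup>2 + (Re b)\<^sup>2)"
      "real n * mom12 (G n) = (real n * (s n)\<^sup>2) * (Re a * Im a + Re b * Im b)"
      "real n * mom22 (G n) = (real n * (s n)\<^sup>2) * ((Im a)\<^sup>2 + (Im b)\<^sup>2)"
      unfolding G_def planar_normal_moments(4) by (simp_all add: power_mult_distrib algebra_simps power2_eq_square)
    then show "real n * mom11 (G n) = (Re a)\<^sup>2 + (Re b)\<^sup>2" "real n * mom12 (G n) = Re a * Im a + Re b * Im b"
      "real n * mom22 (G n) = (Im a)\<^sup>2 + (Im b)\<^sup>2" unfolding sn[OF n] by simp_all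
  qed
  define E where "E n = C * (real n * entry_law.tail_moment (N n) \<epsilon>) + C * (real n * entry_law.tail_moment (G n) \<epsilon>) +
    5 / v ^ 3 * (\<bar>real n * mom11 (N n) - ((Re a)\<^sup>2 + (Re b)\<^sup>2)\<bar> + 2 * \<bar>real n * mom12 (N n) - (Re a * Im a + Re b * Im b)\<bar>
      + \<bar>real n * mom22 (N n) - ((Im a)\<^sup>2 + (Im b)\<^sup>2)\<bar>)" for n
  have tG: "(\<lambda>n. real n * entry_law.tail_moment (G n) \<epsilon>) \<longlonglongrightarrow> 0"
    unfolding G_def s_def by (rule planar_normal_tail[OF \<epsilon>(1)])
  have "E \<longlonglongrightarrow> C * 0 + C * 0 + 5 / v ^ 3 * (\<bar>((Re a)\<^sup>2 + (Re b)\<^sup>2) - ((Re a)\<^sup>2 + (Re b)\<^sup>2)\<bar> +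
      2 * \<bar>(Re a * Im a + Re b * Im b) - (Re a * Im a + Re b * Im b)\<bar> + \<bar>((Im a)\<^sup>2 + (Im b)\<^sup>2) - ((Im a)\<^sup>2 + (Im b)\<^sup>2)\<bar>)"
    unfolding E_def by (intro tendsto_intros tail[OF \<epsilon>(1)] tG m11 m12 m22)
  then have "E \<longlonglongrightarrow> 0" by simp
  then have "\<forall>\<^sub>F n in sequentially. E n < \<delta> / 2" by (rule order_tendstoD) (use \<delta> in simp)
  then show ?thesis
    using eventually_ge_at_top[of 1]
  proof eventually_elim
    fix n :: nat assume En: "E n < \<delta> / 2" and n: "n \<ge> 1"
    show "\<forall>w z. Im w \<ge> v \<longrightarrow>
      cmod ((smear (N n) ^^ n) (\<lambda>g. pastur_kernel w (cmod g)) z - (\<integral>g. pastur_kernel w (cmod (g - z)) \<partial>planar_normal a b)) \<le> \<delta>"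
    proof (intro allI impI)
      fix w z assume w: "Im w \<ge> v"
      have w0: "Im w > 0" using w v by simp
      let ?F = "\<lambda>g. pastur_kernel w (cmod g)"
      note F = bounded_borel_kernel[OF w0]
      note cN = entry_law.complex_law[OF N[OF n]] and cG = entry_law.complex_law[OF G[OF n]]
      define \<beta> where "\<beta> = C * (\<epsilon> * (1 / real n) + entry_law.tail_moment (N n) \<epsilon>) + C * (\<epsilon> * (\<sigma> / real n) + entry_law.tail_moment (G n) \<epsilon>) +
        5 / v ^ 3 * (\<bar>mom11 (N n) - mom11 (G n)\<bar> + 2 * \<bar>mom12 (N n) - mom12 (G n)\<bar> + \<bar>mom22 (N n) - mom22 (G n)\<bar>)"
      have "cmod ((smear (N n) ^^ n) ?F z - (smear (G n) ^^ n) ?F z) \<le> real n * \<beta>"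
        unfolding \<beta>_def C_def
        by (rule smear_pow_diff[OF cN cG F smear_kernel_diff[OF N[OF n] G[OF n] w v \<epsilon>]])
      also have "real n * \<beta> = C * (\<epsilon> * (1 + \<sigma>)) + E n"
      proof -
        have ab: "real n * \<bar>x - y\<bar> = \<bar>real n * x - real n * y\<bar>" for x y
          by (simp add: right_diff_distrib[symmetric] abs_mult)
        have "real n * \<beta> = C * (\<epsilon> * (1 + \<sigma>)) + (C * (real n * entry_law.tail_moment (N n) \<epsilon>) + C * (real n * entry_law.tail_moment (G n) \<epsilon>) +
          5 / v ^ 3 * (real n * \<bar>mom11 (N n) - mom11 (G n)\<bar> + 2 * (real n * \<bar>mom12 (N n) - mom12 (G n)\<bar>) + real n * \<bar>mom22 (N n) - mom22 (G n)\<bar>))"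
          using n by (simp add: \<beta>_def algebra_simps)
        then show ?thesis unfolding E_def ab mG[OF n] .
      qed
      also have "\<dots> \<le> \<delta>" using C\<epsilon> En by simp
      also have "(smear (G n) ^^ n) ?F z = (\<integral>g. pastur_kernel w (cmod (g - z)) \<partial>planar_normal a b)"
      proof -
        have "s n * sqrt n = 1" using n by (simp add: s_def)
        then have "(smear (G n) ^^ n) ?F z = smear (planar_normal (- a) (- b)) ?F z"
          unfolding G_def smear_planar_pow[OF F] by simp
        also have "\<dots> = (\<integral>p. ?F (z + (complex_of_real (fst p) * - a + complex_of_real (snd p) * - b)) \<partial>(SN \<Otimes>\<^sub>M SN))"
          unfolding smear_def planar_normal_def using F by (subst integral_distr) (auto simp: bounded_borel_def)
        also have "\<dots> = (\<integral>p. pastur_kernel w (cmod (complex_of_real (fst p) * a + complex_of_real (snd p) * b - z)) \<partial>(SN \<Otimes>\<^sub>M SN))"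
        proof -
          have "cmod (z + (x * - a + y * - b)) = cmod (x * a + y * b - z)" for x y
          proof -
            have "z + (x * - a + y * - b) = - (x * a + y * b - z)" by simp
            then show ?thesis by (simp only: norm_minus_cancel)
          qed
          then show ?thesis by (simp only:)
        qed
        also have "\<dots> = (\<integral>g. pastur_kernel w (cmod (g - z)) \<partial>planar_normal a b)"
          unfolding planar_normal_def by (subst integral_distr) auto
        finally show ?thesis .
      qed
      finally show "cmod ((smear (N n) ^^ n) ?F z - (\<integral>g. pastur_kernel w (cmod (g - z)) \<partial>planar_normal a b)) \<le> \<delta>" .
    qed
  qed
qed

text \<open>\<open>a\<close> and \<open>b\<close> are the columns of the chosen factor of
  \<open>K\<close>, read as complex numbers.\<close>

lemma gaussian_law_planar:
  fixes K :: "real^2^2"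
  assumes sym: "transpose K = K" and psd: "\<And>t. 0 \<le> t \<bullet> (K *v t)"
  obtains a b where "gaussian_law K = planar_normal a b" "K $ 1 $ 1 = (Re a)\<^sup>2 + (Re b)\<^sup>2"
    "K $ 1 $ 2 = Re a * Im a + Re b * Im b" "K $ 2 $ 2 = (Im a)\<^sup>2 + (Im b)\<^sup>2"
proof -
  define A :: "real^2^2" where "A = (SOME A. A ** transpose A = K)"
  have A: "A ** transpose A = K"
    unfolding A_def by (rule someI_ex) (rule psd_factor[OF assms])
  define a where "a = Complex (A $ 1 $ 1) (A $ 2 $ 1)"
  define b where "b = Complex (A $ 1 $ 2) (A $ 2 $ 2)"
  have "(\<lambda>(u, v). complex_of_vec (A *v vector [u, v])) = (\<lambda>p. complex_of_real (fst p) * a + complex_of_real (snd p) * b)"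
    by (rule ext) (simp add: case_prod_beta' complex_of_vec_def matrix_vector_mult_def sum_2 a_def b_def complex_eq_iff algebra_simps)
  then have "gaussian_law K = planar_normal a b"
    unfolding gaussian_law_def A_def[symmetric] Let_def planar_normal_def by simp
  moreover have "(A ** transpose A) $ i $ j = A $ i $ 1 * A $ j $ 1 + A $ i $ 2 * A $ j $ 2" for i j
    by (simp add: matrix_matrix_mult_def transpose_def sum_2)
  ultimately show ?thesis
    by (intro that[of a b]) (simp_all add: A[symmetric] a_def b_def power2_eq_square)
qed

section \<open>Removing one row and one column\<close>

text \<open>\<open>w\<close> stands for the centred and scaled entries, so this is
  \<open>M - z\<close> up to the constant matrix that centring removes.\<close>

definition markov_matrix :: "nat \<Rightarrow> complex \<Rightarrow> (nat \<Rightarrow> nat \<Rightarrow> complex) \<Rightarrow> nat \<Rightarrow> nat \<Rightarrow> complex" where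
  "markov_matrix n z w i j = w i j - (if i = j then (\<Sum>k<n. w i k) + z else 0)"

text \<open>Besides zeroing row and column \<open>i\<close>, the entries of column \<open>i\<close>
  are dropped from the other row sums, so that nothing depends on row or column \<open>i\<close>.
  The size stays \<open>n\<close>, which avoids reindexing.\<close>

definition cavity_matrix :: "nat \<Rightarrow> complex \<Rightarrow> nat \<Rightarrow> (nat \<Rightarrow> nat \<Rightarrow> complex) \<Rightarrow> nat \<Rightarrow> nat \<Rightarrow> complex" where
  "cavity_matrix n z i w k j = (if k = i \<or> j = i then 0
     else w k j - (if k = j then (\<Sum>l\<in>{..<n} - {i}. w k l) + z else 0))"

lemma sum_two_indices:
  fixes f :: "nat \<Rightarrow> complex"
  assumes "i < n" "l < n" "l \<noteq> i" "\<And>m. m < n \<Longrightarrow> m \<noteq> i \<Longrightarrow> m \<noteq> l \<Longrightarrow> f m = 0"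
  shows "(\<Sum>m<n. f m) = f i + f l"
proof -
  have "(\<Sum>m<n. f m) = (\<Sum>m\<in>{i, l}. f m)"
    by (rule sum.mono_neutral_right) (use assms in auto)
  then show ?thesis using assms(3) by simp
qed

locale cavity =
  fixes n :: nat and z \<eta> :: complex and w :: "nat \<Rightarrow> nat \<Rightarrow> complex" and i :: nat
  assumes i: "i < n" and \<eta>: "Im \<eta> > 0"
begin

definition A where "A = markov_matrix n z w"
definition A0 where "A0 = cavity_matrix n z i w"
definition R where "R = block_resolvent n A \<eta>"
definition R0 where "R0 = block_resolvent n A0 \<eta>"
definition J where "J = {..<n} - {i}"
definition v where "v = Im \<eta>"
definition g where "g = (\<Sum>k<n. w i k) + z"
definition r where "r l = R (l, False) (i, False)"
definition r' where "r' l = R (l, True) (i, False)"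

lemma v: "v > 0" using \<eta> by (simp add: v_def)

lemma J: "l \<in> J \<Longrightarrow> l < n" "l \<in> J \<Longrightarrow> l \<noteq> i"
  by (auto simp: J_def)

lemma sum_split: "(\<Sum>k<n. f k) = f i + (\<Sum>k\<in>J. f k)" for f :: "nat \<Rightarrow> 'b :: comm_monoid_add"
  unfolding J_def using i by (intro sum.remove) auto

lemmas R = resolvent_of_block_resolvent[OF \<eta>, of n A, folded R_def]
lemmas R0 = resolvent_of_block_resolvent[OF \<eta>, of n A0, folded R0_def]

lemma fin: "finite (block_index n)" by simp

lemma A_row: "A i j = w i j - (if j = i then g else 0)"
  by (auto simp: A_def markov_matrix_def g_def)

lemma A_column: "k \<noteq> i \<Longrightarrow> A k i = w k i"
  by (auto simp: A_def markov_matrix_def)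

text \<open>The price of independence for a generator: away from \<open>i\<close> the matrices
  differ by a diagonal of removed column entries, typically small one by one but possibly of large
  rank.\<close>

lemma A_minus_A0:
  assumes "l \<in> J" "m \<in> J"
  shows "A l m - A0 l m = (if l = m then - w l i else 0)"
proof -
  have "(\<Sum>k<n. w l k) = w l i + (\<Sum>k\<in>{..<n} - {i}. w l k)"
    using sum_split[of "w l"] unfolding J_def .
  then show ?thesis using assms J(2) by (auto simp: A_def A0_def markov_matrix_def cavity_matrix_def)
qed

lemma A0_zero: "A0 i j = 0" "A0 k i = 0"
  by (simp_all add: A0_def cavity_matrix_def)

lemma hermitization_A0_zero: "hermitization A0 q (i, b) = 0"
  by (auto simp: hermitization_def A0_zero)

lemma decoupled:
  assumes "j \<in> J"
  shows "R0 (j, c) (i, b) = 0"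
proof -
  have "(\<Sum>k\<in>block_index n. R0 (j, c) k * hermitization A0 k (i, b)) = \<eta> * R0 (j, c) (i, b) + of_bool ((j, c) = (i, b))"
    by (rule resolvent_of_right[OF R0]) (use i J[OF assms] in auto)
  then have "\<eta> * R0 (j, c) (i, b) = 0" using J(2)[OF assms] by (simp add: hermitization_A0_zero)
  then show ?thesis using \<eta> by auto
qed

text \<open>The resolvent identity against the cavity resolvent, which has no entries joining
  \<open>j\<close> and \<open>i\<close>. In each row of the difference of the hermitizations only
  position \<open>i\<close> and the diagonal survive, hence two terms for every \<open>l\<close> and
  flag.\<close>

lemma expansion:
  assumes j: "j \<in> J"
  shows "R (j, c) (i, False) =
    - (\<Sum>l\<in>J. R0 (j, c) (l, False) * (w l i * (r' i - r' l)) + R0 (j, c) (l, True) * (cnj (w i l) * r i - cnj (w l i) * r l))"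
proof -
  define D where "D q = (\<Sum>p\<in>block_index n. (hermitization A q p - hermitization A0 q p) * R p (i, False))" for q
  have DF: "D (l, False) = w l i * (r' i - r' l)" if l: "l \<in> J" for l
  proof -
    have "D (l, False) = (\<Sum>m<n. (A l m - A0 l m) * r' m)"
      unfolding D_def by (simp add: sum_block_index hermitization_def r'_def)
    also have "\<dots> = (A l i - A0 l i) * r' i + (A l l - A0 l l) * r' l"
      by (rule sum_two_indices) (use i J[OF l] A_minus_A0[OF l] in \<open>auto simp: J_def\<close>)
    also have "\<dots> = w l i * (r' i - r' l)"
      unfolding A_minus_A0[OF l l] A_column[OF J(2)[OF l]] A0_zero by (simp add: algebra_simps)
    finally show ?thesis .
  qed
  have DT: "D (l, True) = cnj (w i l) * r i - cnj (w l i) * r l" if l: "l \<in> J" for l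
  proof -
    have "D (l, True) = (\<Sum>m<n. cnj (A m l - A0 m l) * r m)"
      unfolding D_def by (simp add: sum_block_index hermitization_def r_def)
    also have "\<dots> = cnj (A i l - A0 i l) * r i + cnj (A l l - A0 l l) * r l"
      by (rule sum_two_indices) (use i J[OF l] A_minus_A0[OF _ l] in \<open>auto simp: J_def\<close>)
    also have "\<dots> = cnj (w i l) * r i - cnj (w l i) * r l"
      unfolding A_minus_A0[OF l l] A_row A0_zero using J(2)[OF l] by (simp add: algebra_simps)
    finally show ?thesis .
  qed
  have "R (j, c) (i, False) = R0 (j, c) (i, False) - (\<Sum>q\<in>block_index n. R0 (j, c) q * D q)"
    unfolding D_def by (rule resolvent_identity[OF fin R R0]) (use i J[OF j] in auto)
  also have "\<dots> = - (\<Sum>q\<in>block_index n. R0 (j, c) q * D q)" by (simp add: decoupled[OF j])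
  also have "(\<Sum>q\<in>block_index n. R0 (j, c) q * D q) =
      (\<Sum>l<n. R0 (j, c) (l, False) * D (l, False) + R0 (j, c) (l, True) * D (l, True))"
    unfolding sum_block_index sum.distrib ..
  also have "\<dots> = (\<Sum>l\<in>J. R0 (j, c) (l, False) * D (l, False) + R0 (j, c) (l, True) * D (l, True))"
    unfolding sum_split by (simp add: decoupled[OF j])
  also have "\<dots> = (\<Sum>l\<in>J. R0 (j, c) (l, False) * (w l i * (r' i - r' l)) + R0 (j, c) (l, True) * (cnj (w i l) * r i - cnj (w l i) * r l))"
    by (intro sum.cong refl) (simp add: DF DT)
  finally show ?thesis .
qed

text \<open>A two by two linear system for \<open>r i\<close> and \<open>r' i\<close>. The entry
  \<open>w i i\<close> is kept apart because it also occurs inside the row sum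
  \<open>g\<close>.\<close>

lemma row_equations:
  "w i i * r' i - g * r' i + (\<Sum>j\<in>J. w i j * r' j) = \<eta> * r i + 1"
  "cnj (w i i) * r i - cnj g * r i + (\<Sum>j\<in>J. cnj (w j i) * r j) = \<eta> * r' i"
proof -
  have "(\<Sum>m<n. A i m * r' m) = \<eta> * r i + 1"
    using resolvent_of_left[OF R, of "(i, False)" "(i, False)"] i
    unfolding sum_hermitization_False r_def r'_def by simp
  then have "A i i * r' i + (\<Sum>m\<in>J. A i m * r' m) = \<eta> * r i + 1" unfolding sum_split .
  moreover have "(\<Sum>m\<in>J. A i m * r' m) = (\<Sum>m\<in>J. w i m * r' m)"
    by (intro sum.cong refl) (simp add: A_row J(2))
  ultimately show "w i i * r' i - g * r' i + (\<Sum>j\<in>J. w i j * r' j) = \<eta> * r i + 1"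
    by (simp add: A_row left_diff_distrib)
  have "(\<Sum>m<n. cnj (A m i) * r m) = \<eta> * r' i"
    using resolvent_of_left[OF R, of "(i, True)" "(i, False)"] i
    unfolding sum_hermitization_True r_def r'_def by simp
  then have "cnj (A i i) * r i + (\<Sum>m\<in>J. cnj (A m i) * r m) = \<eta> * r' i" unfolding sum_split .
  moreover have "(\<Sum>m\<in>J. cnj (A m i) * r m) = (\<Sum>m\<in>J. cnj (w m i) * r m)"
    by (intro sum.cong refl) (simp add: A_column J(2))
  ultimately show "cnj (w i i) * r i - cnj g * r i + (\<Sum>j\<in>J. cnj (w j i) * r j) = \<eta> * r' i"
    by (simp add: A_row left_diff_distrib)
qed

text \<open>Expanding the sums in \<open>row_equations\<close> yields four quadratic forms in the
  removed entries with cavity resolvents as coefficients. \<open>q1\<close> and \<open>q3\<close>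
  are close to \<open>s\<close>; \<open>q2\<close> and \<open>q4\<close> pair row entries with
  column entries and are small.\<close>

definition q1 where "q1 = (\<Sum>j\<in>J. \<Sum>l\<in>J. R0 (j, True) (l, True) * w i j * cnj (w i l))"
definition q2 where "q2 = (\<Sum>j\<in>J. \<Sum>l\<in>J. R0 (j, True) (l, False) * w i j * w l i)"
definition q3 where "q3 = (\<Sum>j\<in>J. \<Sum>l\<in>J. R0 (j, False) (l, False) * cnj (w j i) * w l i)"
definition q4 where "q4 = (\<Sum>j\<in>J. \<Sum>l\<in>J. R0 (j, False) (l, True) * cnj (w j i) * cnj (w i l))"
text \<open>Up to sign, what the diagonal perturbation makes of column \<open>(i, False)\<close> of
  \<open>R\<close>. As \<open>R\<close> itself depends on the removed entries, \<open>x1\<close> and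
  \<open>x2\<close> are estimated by norms and not by independence.\<close>

definition y where "y p = (if fst p = i then 0 else if snd p then cnj (w (fst p) i) * r (fst p) else w (fst p) i * r' (fst p))"
definition x1 where "x1 = (\<Sum>j\<in>J. w i j * (\<Sum>p\<in>block_index n. R0 (j, True) p * y p))"
definition x2 where "x2 = (\<Sum>j\<in>J. cnj (w j i) * (\<Sum>p\<in>block_index n. R0 (j, False) p * y p))"

lemma y_sum: "(\<Sum>p\<in>block_index n. f p * y p) =
    (\<Sum>l\<in>J. f (l, False) * (w l i * r' l) + f (l, True) * (cnj (w l i) * r l))"
proof -
  have "(\<Sum>p\<in>block_index n. f p * y p) = (\<Sum>l<n. f (l, False) * y (l, False) + f (l, True) * y (l, True))"
    unfolding sum_block_index sum.distrib ..
  also have "\<dots> = (\<Sum>l\<in>J. f (l, False) * y (l, False) + f (l, True) * y (l, True))"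
    unfolding sum_split by (simp add: y_def)
  also have "\<dots> = (\<Sum>l\<in>J. f (l, False) * (w l i * r' l) + f (l, True) * (cnj (w l i) * r l))"
    by (intro sum.cong refl) (simp add: y_def J(2))
  finally show ?thesis .
qed

lemma expansion_y:
  assumes j: "j \<in> J"
  shows "R (j, c) (i, False) = - r' i * (\<Sum>l\<in>J. R0 (j, c) (l, False) * w l i)
    - r i * (\<Sum>l\<in>J. R0 (j, c) (l, True) * cnj (w i l)) + (\<Sum>p\<in>block_index n. R0 (j, c) p * y p)"
proof -
  have "R (j, c) (i, False) = (\<Sum>l\<in>J. - (R0 (j, c) (l, False) * (w l i * (r' i - r' l)) +
      R0 (j, c) (l, True) * (cnj (w i l) * r i - cnj (w l i) * r l)))"
    unfolding expansion[OF j] by (rule sum_negf[symmetric])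
  also have "\<dots> = (\<Sum>l\<in>J. - r' i * (R0 (j, c) (l, False) * w l i) - r i * (R0 (j, c) (l, True) * cnj (w i l))
      + (R0 (j, c) (l, False) * (w l i * r' l) + R0 (j, c) (l, True) * (cnj (w l i) * r l)))"
    by (rule sum.cong[OF refl]) (simp add: algebra_simps)
  also have "\<dots> = (\<Sum>l\<in>J. - r' i * (R0 (j, c) (l, False) * w l i)) - (\<Sum>l\<in>J. r i * (R0 (j, c) (l, True) * cnj (w i l)))
      + (\<Sum>l\<in>J. R0 (j, c) (l, False) * (w l i * r' l) + R0 (j, c) (l, True) * (cnj (w l i) * r l))"
    by (simp only: sum.distrib[of "\<lambda>l. - r' i * (R0 (j, c) (l, False) * w l i) - r i * (R0 (j, c) (l, True) * cnj (w i l))"] sum_subtractf)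
  finally show ?thesis unfolding y_sum sum_distrib_left .
qed

lemma quadratic_sums:
  "(\<Sum>j\<in>J. w i j * r' j) = - r' i * q2 - r i * q1 + x1"
  "(\<Sum>j\<in>J. cnj (w j i) * r j) = - r' i * q3 - r i * q4 + x2"
proof -
  have gen: "(\<Sum>j\<in>J. a j * R (j, c) (i, False)) =
    - r' i * (\<Sum>j\<in>J. \<Sum>l\<in>J. R0 (j, c) (l, False) * a j * w l i) - r i * (\<Sum>j\<in>J. \<Sum>l\<in>J. R0 (j, c) (l, True) * a j * cnj (w i l))
    + (\<Sum>j\<in>J. a j * (\<Sum>p\<in>block_index n. R0 (j, c) p * y p))" for a c
  proof -
    have "(\<Sum>j\<in>J. a j * R (j, c) (i, False)) = (\<Sum>j\<in>J. a j * (- r' i * (\<Sum>l\<in>J. R0 (j, c) (l, False) * w l i)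
      - r i * (\<Sum>l\<in>J. R0 (j, c) (l, True) * cnj (w i l)) + (\<Sum>p\<in>block_index n. R0 (j, c) p * y p)))"
      by (intro sum.cong refl) (simp only: expansion_y)
    also have "\<dots> = (\<Sum>j\<in>J. - r' i * (a j * (\<Sum>l\<in>J. R0 (j, c) (l, False) * w l i))
      - r i * (a j * (\<Sum>l\<in>J. R0 (j, c) (l, True) * cnj (w i l))) + a j * (\<Sum>p\<in>block_index n. R0 (j, c) p * y p))"
      by (intro sum.cong refl) (simp add: algebra_simps)
    also have "\<dots> = - r' i * (\<Sum>j\<in>J. a j * (\<Sum>l\<in>J. R0 (j, c) (l, False) * w l i))
      - r i * (\<Sum>j\<in>J. a j * (\<Sum>l\<in>J. R0 (j, c) (l, True) * cnj (w i l)))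
      + (\<Sum>j\<in>J. a j * (\<Sum>p\<in>block_index n. R0 (j, c) p * y p))"
      unfolding sum.distrib sum_subtractf sum_distrib_left[symmetric] ..
    also have "(\<Sum>j\<in>J. a j * (\<Sum>l\<in>J. R0 (j, c) (l, False) * w l i)) = (\<Sum>j\<in>J. \<Sum>l\<in>J. R0 (j, c) (l, False) * a j * w l i)"
      unfolding sum_distrib_left by (intro sum.cong refl) (simp add: mult_ac)
    also have "(\<Sum>j\<in>J. a j * (\<Sum>l\<in>J. R0 (j, c) (l, True) * cnj (w i l))) = (\<Sum>j\<in>J. \<Sum>l\<in>J. R0 (j, c) (l, True) * a j * cnj (w i l))"
      unfolding sum_distrib_left by (intro sum.cong refl) (simp add: mult_ac)
    finally show ?thesis .
  qed
  have "(\<Sum>j\<in>J. w i j * r' j) = (\<Sum>j\<in>J. w i j * R (j, True) (i, False))" unfolding r'_def ..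
  also have "\<dots> = - r' i * q2 - r i * q1 + x1" unfolding q1_def q2_def x1_def by (rule gen)
  finally show "(\<Sum>j\<in>J. w i j * r' j) = - r' i * q2 - r i * q1 + x1" .
  have "(\<Sum>j\<in>J. cnj (w j i) * r j) = (\<Sum>j\<in>J. cnj (w j i) * R (j, False) (i, False))" unfolding r_def ..
  also have "\<dots> = - r' i * q3 - r i * q4 + x2" unfolding q3_def q4_def x2_def by (rule gen)
  finally show "(\<Sum>j\<in>J. cnj (w j i) * r j) = - r' i * q3 - r i * q4 + x2" .
qed

lemma r_bounds: "cmod (r i) \<le> 1 / v" "cmod (r' i) \<le> 1 / v"
  unfolding r_def r'_def v_def
  by (rule resolvent_entry_bound[OF fin hermitian_hermitization R \<eta>]; use i in simp)+

text \<open>The two equations for the diagonal block of the resolvent determine its corner up to the errors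
  on the right.\<close>
lemma resolvent_corner:
  assumes s: "Im s \<ge> 0"
  shows "cmod (r i - pastur_kernel (\<eta> + s) (cmod g)) \<le>
    1 / v * (1 / v * (cmod (q1 - s) + cmod q2 + cmod (q3 - s) + cmod q4 + 2 * cmod (w i i)) + cmod x1 + cmod x2)"
proof -
  define W where "W = \<eta> + s"
  have W: "Im W \<ge> v" "Im W > 0" using s \<eta> by (simp_all add: W_def v_def)
  define E1 where "E1 = (q1 - s) * r i + q2 * r' i - x1 - w i i * r' i"
  define E2 where "E2 = (q3 - s) * r' i + q4 * r i - x2 - cnj (w i i) * r i"
  have e1: "- W * r i - g * r' i = 1 + E1"
    using row_equations(1) unfolding quadratic_sums W_def E1_def by (simp add: algebra_simps)
  have e2: "- cnj g * r i - W * r' i = E2"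
    using row_equations(2) unfolding quadratic_sums W_def E2_def by (simp add: algebra_simps)
  define Q where "Q = complex_of_real ((cmod g)\<^sup>2) - W\<^sup>2"
  note q = square_diff_nonzero[OF W(2), of "cmod g", folded Q_def]
  have bounds: "cmod W / cmod Q \<le> 1 / v" "cmod g / cmod Q \<le> 1 / v"
  proof -
    have 1: "1 / Im W \<le> 1 / v" using W v by (simp add: frac_le)
    have "cmod W / cmod Q = cmod (pastur_kernel W (cmod g))"
      by (simp add: pastur_kernel_def Q_def norm_divide)
    then show "cmod W / cmod Q \<le> 1 / v" using cmod_pastur_kernel_le[OF W(2), of "cmod g"] 1 by linarith
    define t where "t = cmod g"
    have Qf: "Q = (complex_of_real t - W) * (complex_of_real t + W)"
      unfolding Q_def t_def square_diff_factor ..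
    have nz: "complex_of_real t - W \<noteq> 0" "complex_of_real t + W \<noteq> 0" using q Qf by auto
    have b: "cmod (1 / (complex_of_real t - W)) \<le> 1 / v" "cmod (1 / (complex_of_real t + W)) \<le> 1 / v"
    proof -
      show "cmod (1 / (complex_of_real t - W)) \<le> 1 / v" using cmod_inverse_diff_le[OF W(2), of t] 1 by linarith
      have "complex_of_real (- t) - W = - (complex_of_real t + W)" by simp
      then have "cmod (1 / (complex_of_real (- t) - W)) = cmod (1 / (complex_of_real t + W))"
        by (simp only: norm_divide norm_minus_cancel)
      then show "cmod (1 / (complex_of_real t + W)) \<le> 1 / v" using cmod_inverse_diff_le[OF W(2), of "- t"] 1 by linarith
    qed
    have tQ: "complex_of_real t / Q = (1 / (complex_of_real t - W) + 1 / (complex_of_real t + W)) / 2"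
      unfolding Qf using nz by (simp add: add_frac_eq)
    have "cmod (complex_of_real t / Q) \<le> (1 / v + 1 / v) / 2"
      unfolding tQ norm_divide[of _ 2] using norm_triangle_mono[OF b] by simp
    then show "cmod g / cmod Q \<le> 1 / v" by (simp add: norm_divide t_def)
  qed
  have gg: "g * cnj g = complex_of_real ((cmod g)\<^sup>2)" by (rule complex_norm_square[symmetric])
  \<comment> \<open>Cramer's rule: the system has determinant
    \<open>W^2 - |g|^2 = - Q\<close>.\<close>
  have "- W * (- W * r i - g * r' i) + g * (- cnj g * r i - W * r' i) = - (Q * r i)"
    unfolding Q_def gg[symmetric] by (simp add: algebra_simps power2_eq_square)
  then have "Q * r i = W * (1 + E1) - g * E2" unfolding e1 e2 by (simp add: algebra_simps)
  then have "r i = (W * (1 + E1) - g * E2) / Q" using q by (simp add: field_simps)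
  also have "\<dots> = pastur_kernel W (cmod g) + (W / Q) * E1 - (g / Q) * E2"
    unfolding pastur_kernel_def Q_def[symmetric] by (simp add: diff_divide_distrib add_divide_distrib distrib_left)
  finally have "r i - pastur_kernel W (cmod g) = (W / Q) * E1 - (g / Q) * E2" by simp
  then have "cmod (r i - pastur_kernel W (cmod g)) \<le> cmod ((W / Q) * E1) + cmod ((g / Q) * E2)"
    by (simp only: norm_triangle_ineq4)
  also have "\<dots> = (cmod W / cmod Q) * cmod E1 + (cmod g / cmod Q) * cmod E2"
    by (simp only: norm_mult norm_divide)
  also have "\<dots> \<le> 1 / v * cmod E1 + 1 / v * cmod E2"
    using bounds by (intro add_mono mult_right_mono) auto
  also have "\<dots> = 1 / v * (cmod E1 + cmod E2)" by (simp add: distrib_left)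
  also have "\<dots> \<le> 1 / v * (1 / v * (cmod (q1 - s) + cmod q2 + cmod (q3 - s) + cmod q4 + 2 * cmod (w i i)) + cmod x1 + cmod x2)"
  proof (rule mult_left_mono)
    have four: "cmod (a + b - c - d) \<le> cmod a + cmod b + cmod c + cmod d" for a b c d :: complex
      using norm_triangle_ineq4[of "a + b - c" d] norm_triangle_ineq4[of "a + b" c] norm_triangle_ineq[of a b] by linarith
    have m: "cmod (a * b) \<le> 1 / v * cmod a" if "cmod b \<le> 1 / v" for a b
      using mult_left_mono[OF that, of "cmod a"] by (simp add: norm_mult mult.commute)
    have "cmod E1 \<le> 1 / v * cmod (q1 - s) + 1 / v * cmod q2 + cmod x1 + 1 / v * cmod (w i i)"
      unfolding E1_def by (rule order_trans[OF four]) (intro add_mono m r_bounds order_refl)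
    moreover have "cmod E2 \<le> 1 / v * cmod (q3 - s) + 1 / v * cmod q4 + cmod x2 + 1 / v * cmod (cnj (w i i))"
      unfolding E2_def by (rule order_trans[OF four]) (intro add_mono m r_bounds order_refl)
    ultimately show "cmod E1 + cmod E2 \<le> 1 / v * (cmod (q1 - s) + cmod q2 + cmod (q3 - s) + cmod q4 + 2 * cmod (w i i)) + cmod x1 + cmod x2"
      by (simp add: distrib_left add_divide_distrib)
  qed (use v in simp)
  finally show ?thesis unfolding W_def .
qed

text \<open>Column \<open>(i, False)\<close> of \<open>R\<close> has squared norm at most
  \<open>1 / v^2\<close>. Entries of modulus at most \<open>\<epsilon>\<close> scale this by
  \<open>\<epsilon>^2\<close>; for the larger ones the local mass of the column is bounded by the
  total \<open>1 / v^2\<close>.\<close>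

lemma y_norm_bound:
  assumes \<epsilon>: "\<epsilon> \<ge> 0"
  shows "(\<Sum>p\<in>block_index n. (cmod (y p))\<^sup>2) \<le>
    (\<epsilon>\<^sup>2 + (\<Sum>l\<in>J. (cmod (w l i))\<^sup>2 * indicator {x. cmod x > \<epsilon>} (w l i))) / v\<^sup>2"
proof -
  define c where "c l = (cmod (r l))\<^sup>2 + (cmod (r' l))\<^sup>2" for l
  define t where "t l = (cmod (w l i))\<^sup>2 * indicator {x. cmod x > \<epsilon>} (w l i)" for l
  have c0: "c l \<ge> 0" "t l \<ge> 0" for l by (simp_all add: c_def t_def)
  have total: "(\<Sum>l<n. c l) \<le> 1 / v\<^sup>2"
    using resolvent_column_bound[OF fin hermitian_hermitization R \<eta>, of "(i, False)"] i
    unfolding sum_block_index c_def r_def r'_def v_def sum.distrib by simp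
  have each: "c l \<le> 1 / v\<^sup>2" if "l \<in> J" for l
    by (rule order_trans[OF member_le_sum[of l "{..<n}" c] total]) (use J[OF that] c0 in auto)
  have sumJ: "(\<Sum>l\<in>J. c l) \<le> 1 / v\<^sup>2"
    by (rule order_trans[OF sum_mono2 total]) (auto simp: J_def c0)
  have "(\<Sum>p\<in>block_index n. (cmod (y p))\<^sup>2) = (\<Sum>l\<in>J. (cmod (y (l, False)))\<^sup>2 + (cmod (y (l, True)))\<^sup>2)"
    unfolding sum_block_index sum.distrib[symmetric] sum_split by (simp add: y_def)
  also have "\<dots> = (\<Sum>l\<in>J. (cmod (w l i))\<^sup>2 * c l)"
    by (intro sum.cong refl) (simp add: y_def J(2) norm_mult power_mult_distrib c_def distrib_left)
  also have "\<dots> \<le> (\<Sum>l\<in>J. \<epsilon>\<^sup>2 * c l + t l * (1 / v\<^sup>2))"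
  proof (rule sum_mono)
    fix l assume l: "l \<in> J"
    show "(cmod (w l i))\<^sup>2 * c l \<le> \<epsilon>\<^sup>2 * c l + t l * (1 / v\<^sup>2)"
    proof (cases "cmod (w l i) > \<epsilon>")
      case True
      then have "(cmod (w l i))\<^sup>2 * c l = t l * c l" by (simp add: t_def)
      also have "\<dots> \<le> t l * (1 / v\<^sup>2)" by (intro mult_left_mono each l c0)
      finally show ?thesis using mult_nonneg_nonneg[OF zero_le_power2[of \<epsilon>] c0(1)[of l]] by linarith
    next
      case False
      then have "(cmod (w l i))\<^sup>2 * c l \<le> \<epsilon>\<^sup>2 * c l" by (intro mult_right_mono power_mono c0) auto
      then show ?thesis using mult_nonneg_nonneg[OF c0(2)[of l], of "1 / v\<^sup>2"] by simp
    qed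
  qed
  also have "\<dots> = \<epsilon>\<^sup>2 * (\<Sum>l\<in>J. c l) + (\<Sum>l\<in>J. t l) * (1 / v\<^sup>2)"
    unfolding sum.distrib sum_distrib_left sum_distrib_right ..
  also have "\<dots> \<le> \<epsilon>\<^sup>2 * (1 / v\<^sup>2) + (\<Sum>l\<in>J. t l) * (1 / v\<^sup>2)"
    by (intro add_right_mono mult_left_mono sumJ) simp
  also have "\<dots> = (\<epsilon>\<^sup>2 + (\<Sum>l\<in>J. t l)) / v\<^sup>2" by (simp add: add_divide_distrib)
  finally show ?thesis unfolding t_def .
qed

lemma R0_apply_bound:
  "cmod (\<Sum>j\<in>J. a j * (\<Sum>p\<in>block_index n. R0 (j, c) p * y p)) \<le>
     sqrt (\<Sum>j\<in>J. (cmod (a j))\<^sup>2) * (sqrt (\<Sum>p\<in>block_index n. (cmod (y p))\<^sup>2) / v)"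
proof -
  define u where "u p = (\<Sum>q\<in>block_index n. R0 p q * y q)" for p
  have "cmod (\<Sum>j\<in>J. a j * u (j, c)) \<le> sqrt (\<Sum>j\<in>J. (cmod (a j))\<^sup>2) * sqrt (\<Sum>j\<in>J. (cmod (u (j, c)))\<^sup>2)"
    by (rule cmod_sum_mult_le)
  also have "\<dots> \<le> sqrt (\<Sum>j\<in>J. (cmod (a j))\<^sup>2) * (sqrt (\<Sum>p\<in>block_index n. (cmod (y p))\<^sup>2) / v)"
  proof (rule mult_left_mono)
    have "(\<Sum>j\<in>J. (cmod (u (j, c)))\<^sup>2) = (\<Sum>p\<in>(\<lambda>j. (j, c)) ` J. (cmod (u p))\<^sup>2)"
      by (subst sum.reindex) (auto simp: inj_on_def)
    also have "\<dots> \<le> (\<Sum>p\<in>block_index n. (cmod (u p))\<^sup>2)"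
      by (rule sum_mono2) (auto simp: J_def)
    finally have "sqrt (\<Sum>j\<in>J. (cmod (u (j, c)))\<^sup>2) \<le> sqrt (\<Sum>p\<in>block_index n. (cmod (u p))\<^sup>2)" by simp
    also have "\<dots> \<le> sqrt (\<Sum>p\<in>block_index n. (cmod (y p))\<^sup>2) / v"
      unfolding u_def v_def by (rule resolvent_apply_bound[OF fin hermitian_hermitization R0 \<eta>])
    finally show "sqrt (\<Sum>j\<in>J. (cmod (u (j, c)))\<^sup>2) \<le> sqrt (\<Sum>p\<in>block_index n. (cmod (y p))\<^sup>2) / v" .
  qed (simp add: sum_nonneg)
  finally show ?thesis unfolding u_def .
qed

text \<open>Uses \<open>sqrt a * sqrt b <= \<epsilon> a + b / \<epsilon>\<close> with
  \<open>a\<close> the squared norm of the removed row or column. The \<open>\<epsilon>^2\<close>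
  inside \<open>b\<close> leaves \<open>\<epsilon>\<close>, and for fixed \<open>\<epsilon>\<close>
  the remaining \<open>\<Lambda> / \<epsilon>\<close> will vanish in mean by the Lindeberg
  condition.\<close>

lemma x_bounds:
  assumes \<epsilon>: "\<epsilon> > 0"
  defines "\<Lambda> \<equiv> (\<Sum>l\<in>J. (cmod (w l i))\<^sup>2 * indicator {x. cmod x > \<epsilon>} (w l i))"
  shows "cmod x1 \<le> 1 / v * (\<epsilon> * (\<Sum>j\<in>J. (cmod (w i j))\<^sup>2) + (\<epsilon> + \<Lambda> / \<epsilon>) / v\<^sup>2)"
    "cmod x2 \<le> 1 / v * (\<epsilon> * (\<Sum>j\<in>J. (cmod (w j i))\<^sup>2) + (\<epsilon> + \<Lambda> / \<epsilon>) / v\<^sup>2)"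
proof -
  have gen: "sqrt a * (sqrt b / v) \<le> 1 / v * (\<epsilon> * a + (\<epsilon> + \<Lambda> / \<epsilon>) / v\<^sup>2)"
    if a: "a \<ge> 0" and b: "0 \<le> b" "b \<le> (\<epsilon>\<^sup>2 + \<Lambda>) / v\<^sup>2" for a b
  proof -
    have "sqrt a * sqrt b = sqrt (\<epsilon> * a) * sqrt (b / \<epsilon>)"
      using \<epsilon> by (simp add: real_sqrt_mult real_sqrt_divide)
    also have "\<dots> \<le> \<epsilon> * a + b / \<epsilon>"
    proof -
      have "0 \<le> (sqrt (\<epsilon> * a) - sqrt (b / \<epsilon>))\<^sup>2" by simp
      also have "\<dots> = \<epsilon> * a + b / \<epsilon> - 2 * (sqrt (\<epsilon> * a) * sqrt (b / \<epsilon>))"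
        using \<epsilon> a b by (simp add: power2_diff)
      finally have "2 * (sqrt (\<epsilon> * a) * sqrt (b / \<epsilon>)) \<le> \<epsilon> * a + b / \<epsilon>" by simp
      moreover have "0 \<le> sqrt (\<epsilon> * a) * sqrt (b / \<epsilon>)" using \<epsilon> a b by simp
      ultimately show ?thesis by linarith
    qed
    also have "b / \<epsilon> \<le> ((\<epsilon>\<^sup>2 + \<Lambda>) / v\<^sup>2) / \<epsilon>" using b \<epsilon> by (intro divide_right_mono) auto
    also have "((\<epsilon>\<^sup>2 + \<Lambda>) / v\<^sup>2) / \<epsilon> = (\<epsilon> + \<Lambda> / \<epsilon>) / v\<^sup>2"
      using \<epsilon> by (simp add: add_divide_distrib power2_eq_square)
    finally show ?thesis using v by (simp add: divide_right_mono)
  qed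
  have yb: "0 \<le> (\<Sum>p\<in>block_index n. (cmod (y p))\<^sup>2)" "(\<Sum>p\<in>block_index n. (cmod (y p))\<^sup>2) \<le> (\<epsilon>\<^sup>2 + \<Lambda>) / v\<^sup>2"
    using y_norm_bound[of \<epsilon>] \<epsilon> by (simp_all add: sum_nonneg \<Lambda>_def)
  show "cmod x1 \<le> 1 / v * (\<epsilon> * (\<Sum>j\<in>J. (cmod (w i j))\<^sup>2) + (\<epsilon> + \<Lambda> / \<epsilon>) / v\<^sup>2)"
    unfolding x1_def by (rule order_trans[OF R0_apply_bound gen[OF _ yb]]) (simp add: sum_nonneg)
  have "cmod x2 \<le> sqrt (\<Sum>j\<in>J. (cmod (cnj (w j i)))\<^sup>2) * (sqrt (\<Sum>p\<in>block_index n. (cmod (y p))\<^sup>2) / v)"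
    unfolding x2_def by (rule R0_apply_bound)
  also have "\<dots> = sqrt (\<Sum>j\<in>J. (cmod (w j i))\<^sup>2) * (sqrt (\<Sum>p\<in>block_index n. (cmod (y p))\<^sup>2) / v)" by simp
  finally show "cmod x2 \<le> 1 / v * (\<epsilon> * (\<Sum>j\<in>J. (cmod (w j i))\<^sup>2) + (\<epsilon> + \<Lambda> / \<epsilon>) / v\<^sup>2)"
    by (rule order_trans[OF _ gen[OF _ yb]]) (simp add: sum_nonneg)
qed

text \<open>Zeroing the row and then the column costs \<open>2 / v\<close> each, by rank one. The
  diagonal perturbation need not have low rank; the resolvent identity charges
  \<open>2 |w l i| / v^2\<close> for each entry, in total of order \<open>sqrt n\<close> in mean and
  negligible after division by \<open>n\<close>.\<close>

lemma trace_difference: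
  "cmod ((\<Sum>p\<in>block_index n. R0 p p) - (\<Sum>p\<in>block_index n. R p p)) \<le> 4 / v + 2 * (\<Sum>l\<in>J. cmod (w l i)) / v\<^sup>2"
proof -
  define A1 where "A1 k j = (if k = i then 0 else A k j)" for k j
  define A2 where "A2 k j = (if j = i then 0 else A1 k j)" for k j
  define R1 where "R1 = block_resolvent n A1 \<eta>"
  define R2 where "R2 = block_resolvent n A2 \<eta>"
  note r1 = resolvent_of_block_resolvent[OF \<eta>, of n A1, folded R1_def]
  note r2 = resolvent_of_block_resolvent[OF \<eta>, of n A2, folded R2_def]
  have t1: "cmod ((\<Sum>p\<in>block_index n. R1 p p) - (\<Sum>p\<in>block_index n. R p p)) \<le> 2 / v"
    unfolding v_def
    by (rule trace_resolvent_rank_one[OF R r1, where p = "\<lambda>k. if k = i then - 1 else 0" and q = "\<lambda>j. cnj (A i j)"])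
       (use \<eta> in \<open>auto simp: A1_def\<close>)
  have t2: "cmod ((\<Sum>p\<in>block_index n. R2 p p) - (\<Sum>p\<in>block_index n. R1 p p)) \<le> 2 / v"
    unfolding v_def
    by (rule trace_resolvent_rank_one[OF r1 r2, where p = "\<lambda>k. - A1 k i" and q = "\<lambda>j. if j = i then 1 else 0"])
       (use \<eta> in \<open>auto simp: A2_def\<close>)
  define D where "D q p = (\<Sum>m\<in>block_index n. (hermitization A0 q m - hermitization A2 q m) * R0 m p)" for q p
  have zero: "A0 k m - A2 k m = (if k = m \<and> k \<noteq> i then w k i else 0)" if km: "k < n" "m < n" for k m
  proof (cases "k = i \<or> m = i")
    case True
    then show ?thesis by (auto simp: A0_zero A2_def A1_def)
  next
    case False
    then have J': "k \<in> J" "m \<in> J" using km by (auto simp: J_def)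
    have "A k m - A0 k m = (if k = m then - w k i else 0)" by (rule A_minus_A0[OF J'])
    then have "A0 k m = A k m + (if k = m then w k i else 0)" by (auto simp: algebra_simps split: if_splits)
    then show ?thesis using False by (auto simp: A2_def A1_def)
  qed
  have one: "(\<Sum>m<n. (if l = m \<and> l \<noteq> i then c else 0) * f m) = (if l \<noteq> i then c * f l else 0)" if "l < n" for l c and f :: "nat \<Rightarrow> complex"
  proof -
    have "(\<Sum>m<n. (if l = m \<and> l \<noteq> i then c else 0) * f m) = (\<Sum>m<n. if l = m then (if l \<noteq> i then c * f l else 0) else 0)"
      by (intro sum.cong refl) auto
    then show ?thesis using that by (simp add: sum.delta)
  qed
  have DF: "D (l, False) p = (if l \<noteq> i then w l i * R0 (l, True) p else 0)" if l: "l < n" for l p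
  proof -
    have "D (l, False) p = (\<Sum>m<n. (A0 l m - A2 l m) * R0 (m, True) p)"
      unfolding D_def by (simp add: sum_block_index hermitization_def)
    also have "\<dots> = (\<Sum>m<n. (if l = m \<and> l \<noteq> i then w l i else 0) * R0 (m, True) p)"
      by (intro sum.cong refl) (simp only: zero[OF l] lessThan_iff)
    finally show ?thesis using one[OF l] by simp
  qed
  have DT: "D (l, True) p = (if l \<noteq> i then cnj (w l i) * R0 (l, False) p else 0)" if l: "l < n" for l p
  proof -
    have "D (l, True) p = (\<Sum>m<n. cnj (A0 m l - A2 m l) * R0 (m, False) p)"
      unfolding D_def by (simp add: sum_block_index hermitization_def)
    also have "\<dots> = (\<Sum>m<n. (if l = m \<and> l \<noteq> i then cnj (w l i) else 0) * R0 (m, False) p)"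
    proof (intro sum.cong refl)
      fix m assume "m \<in> {..<n}"
      then have "A0 m l - A2 m l = (if m = l \<and> m \<noteq> i then w m i else 0)" using l by (intro zero) auto
      then show "cnj (A0 m l - A2 m l) * R0 (m, False) p = (if l = m \<and> l \<noteq> i then cnj (w l i) else 0) * R0 (m, False) p"
        by auto
    qed
    finally show ?thesis using one[OF l] by simp
  qed
  \<comment> \<open>By cyclicity of the trace, each entry of the perturbation is multiplied by an
    entry of the product of the two resolvents.\<close>
  have RR: "cmod (\<Sum>p\<in>block_index n. R2 p a * R0 b p) \<le> 1 / v\<^sup>2" if ab: "a \<in> block_index n" "b \<in> block_index n" for a b
  proof -
    have "cmod (\<Sum>p\<in>block_index n. R2 p a * R0 b p) \<le> sqrt (\<Sum>p\<in>block_index n. (cmod (R2 p a))\<^sup>2) * sqrt (\<Sum>p\<in>block_index n. (cmod (R0 b p))\<^sup>2)"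
      by (rule cmod_sum_mult_le)
    also have "\<dots> \<le> sqrt (1 / v\<^sup>2) * sqrt (1 / v\<^sup>2)"
      unfolding v_def
      by (intro mult_mono real_sqrt_le_mono resolvent_column_bound[OF fin hermitian_hermitization r2 \<eta> ab(1)]
          resolvent_row_bound[OF fin hermitian_hermitization R0 \<eta> ab(2)]) (auto simp: sum_nonneg)
    finally show ?thesis by simp
  qed
  have "(\<Sum>p\<in>block_index n. R0 p p) - (\<Sum>p\<in>block_index n. R2 p p) = (\<Sum>p\<in>block_index n. R0 p p - R2 p p)"
    by (rule sum_subtractf[symmetric])
  also have "\<dots> = (\<Sum>p\<in>block_index n. - (\<Sum>q\<in>block_index n. R2 p q * D q p))"
  proof (intro sum.cong refl)
    fix p assume "p \<in> block_index n"
    then show "R0 p p - R2 p p = - (\<Sum>q\<in>block_index n. R2 p q * D q p)"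
      using resolvent_identity[OF fin R0 r2, of p p] by (simp add: D_def)
  qed
  also have "\<dots> = - (\<Sum>q\<in>block_index n. \<Sum>p\<in>block_index n. R2 p q * D q p)"
    unfolding sum_negf by (subst sum.swap) (rule refl)
  also have "(\<Sum>q\<in>block_index n. \<Sum>p\<in>block_index n. R2 p q * D q p) =
      (\<Sum>l<n. (\<Sum>p\<in>block_index n. R2 p (l, False) * D (l, False) p) + (\<Sum>p\<in>block_index n. R2 p (l, True) * D (l, True) p))"
    unfolding sum_block_index[of "\<lambda>q. \<Sum>p\<in>block_index n. R2 p q * D q p"] sum.distrib ..
  also have "\<dots> = (\<Sum>l\<in>J. w l i * (\<Sum>p\<in>block_index n. R2 p (l, False) * R0 (l, True) p) +
      cnj (w l i) * (\<Sum>p\<in>block_index n. R2 p (l, True) * R0 (l, False) p))"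
  proof -
    have zi: "(\<Sum>p\<in>block_index n. R2 p (i, False) * D (i, False) p) + (\<Sum>p\<in>block_index n. R2 p (i, True) * D (i, True) p) = 0"
      by (simp only: DF[OF i] DT[OF i]) simp
    show ?thesis
      unfolding sum_split zi add_0
    proof (intro sum.cong refl)
      fix l assume l: "l \<in> J"
      show "(\<Sum>p\<in>block_index n. R2 p (l, False) * D (l, False) p) + (\<Sum>p\<in>block_index n. R2 p (l, True) * D (l, True) p) =
        w l i * (\<Sum>p\<in>block_index n. R2 p (l, False) * R0 (l, True) p) + cnj (w l i) * (\<Sum>p\<in>block_index n. R2 p (l, True) * R0 (l, False) p)"
        unfolding DF[OF J(1)[OF l]] DT[OF J(1)[OF l]] sum_distrib_left using J(2)[OF l]
        by (simp add: mult.left_commute)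
    qed
  qed
  finally have "cmod ((\<Sum>p\<in>block_index n. R0 p p) - (\<Sum>p\<in>block_index n. R2 p p)) =
     cmod (\<Sum>l\<in>J. w l i * (\<Sum>p\<in>block_index n. R2 p (l, False) * R0 (l, True) p) +
      cnj (w l i) * (\<Sum>p\<in>block_index n. R2 p (l, True) * R0 (l, False) p))"
    by (simp only: norm_minus_cancel)
  also have "\<dots> \<le> (\<Sum>l\<in>J. cmod (w l i) * (1 / v\<^sup>2) + cmod (w l i) * (1 / v\<^sup>2))"
  proof (rule order_trans[OF norm_sum], rule sum_mono)
    fix l assume l: "l \<in> J"
    then have lV: "(l, b) \<in> block_index n" for b using J(1) by simp
    show "cmod (w l i * (\<Sum>p\<in>block_index n. R2 p (l, False) * R0 (l, True) p) +
      cnj (w l i) * (\<Sum>p\<in>block_index n. R2 p (l, True) * R0 (l, False) p)) \<le> cmod (w l i) * (1 / v\<^sup>2) + cmod (w l i) * (1 / v\<^sup>2)"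
      by (rule order_trans[OF norm_triangle_ineq])
         (unfold norm_mult complex_mod_cnj, intro add_mono mult_left_mono RR lV norm_ge_zero)
  qed
  also have "\<dots> = 2 * (\<Sum>l\<in>J. cmod (w l i)) / v\<^sup>2"
    unfolding sum_distrib_left sum_divide_distrib by (intro sum.cong refl) simp
  finally have t3: "cmod ((\<Sum>p\<in>block_index n. R0 p p) - (\<Sum>p\<in>block_index n. R2 p p)) \<le> 2 * (\<Sum>l\<in>J. cmod (w l i)) / v\<^sup>2" .
  have "cmod (a - d) \<le> cmod (a - b) + cmod (b - c) + cmod (c - d)" for a b c d :: complex
    using norm_triangle_ineq[of "a - b" "b - c"] norm_triangle_ineq[of "a - c" "c - d"] by simp
  from this[of "\<Sum>p\<in>block_index n. R0 p p" "\<Sum>p\<in>block_index n. R p p" "\<Sum>p\<in>block_index n. R2 p p" "\<Sum>p\<in>block_index n. R1 p p"]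
  show ?thesis using t1 t2 t3 by simp
qed

text \<open>Half of the bound in \<open>trace_difference\<close>, plus \<open>1 / v\<close> for the
  index \<open>i\<close> missing from \<open>J\<close>:
  \<open>4 / (2 v) + 1 / v = 3 / v\<close>.\<close>

lemma partial_trace:
  assumes n: "n > 0"
  defines "S \<equiv> (\<Sum>p\<in>block_index n. R p p) / (2 * of_nat n)"
  shows "cmod ((1 / of_nat n) * (\<Sum>j\<in>J. R0 (j, c) (j, c)) - s) \<le>
    cmod (S - s) + (3 / v + (\<Sum>l\<in>J. cmod (w l i)) / v\<^sup>2) / n"
proof -
  have \<eta>0: "\<eta> \<noteq> 0" using \<eta> by auto
  have "(\<Sum>k<n. R0 (k, c) (k, c)) = (\<Sum>p\<in>block_index n. R0 p p) / 2"
    using trace_resolvent_blocks[OF R0 \<eta>0] unfolding sum_block_index by (cases c) simp_all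
  then have eq: "(\<Sum>j\<in>J. R0 (j, c) (j, c)) = (\<Sum>p\<in>block_index n. R0 p p) / 2 - R0 (i, c) (i, c)"
    unfolding sum_split by (simp add: algebra_simps)
  define x where "x = (\<Sum>p\<in>block_index n. R0 p p) - (\<Sum>p\<in>block_index n. R p p)"
  have "(1 / of_nat n) * (\<Sum>j\<in>J. R0 (j, c) (j, c)) - s = (S - s) + (x / 2 - R0 (i, c) (i, c)) / of_nat n"
    unfolding eq S_def x_def by (simp add: diff_divide_distrib)
  then have "cmod ((1 / of_nat n) * (\<Sum>j\<in>J. R0 (j, c) (j, c)) - s) \<le> cmod (S - s) + cmod ((x / 2 - R0 (i, c) (i, c)) / of_nat n)"
    by (simp only: norm_triangle_ineq)
  also have "cmod ((x / 2 - R0 (i, c) (i, c)) / of_nat n) \<le> (3 / v + (\<Sum>l\<in>J. cmod (w l i)) / v\<^sup>2) / n"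
  proof -
    have "cmod (x / 2 - R0 (i, c) (i, c)) \<le> cmod x / 2 + cmod (R0 (i, c) (i, c))"
      using norm_triangle_ineq4[of "x / 2" "R0 (i, c) (i, c)"] by (simp add: norm_divide)
    also have "\<dots> \<le> (4 / v + 2 * (\<Sum>l\<in>J. cmod (w l i)) / v\<^sup>2) / 2 + 1 / v"
      using trace_difference resolvent_entry_bound[OF fin hermitian_hermitization R0 \<eta>, of "(i, c)" "(i, c)"] i
      unfolding x_def v_def by (intro add_mono divide_right_mono) auto
    also have "\<dots> = 3 / v + (\<Sum>l\<in>J. cmod (w l i)) / v\<^sup>2" by (simp add: add_divide_distrib)
    finally show ?thesis by (simp add: norm_divide divide_right_mono)
  qed
  finally show ?thesis by simp
qed

end

section \<open>The approximate fixed point equation\<close>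

lemma integral_of_nn_bound:
  fixes X :: "'a \<Rightarrow> real"
  assumes "X \<in> borel_measurable M" "\<And>x. X x \<ge> 0" "(\<integral>\<^sup>+x. ennreal (X x) \<partial>M) \<le> ennreal c" "c \<ge> 0"
  shows "integrable M X" "(\<integral>x. X x \<partial>M) \<le> c"
proof -
  show i: "integrable M X"
    by (rule integrableI_nonneg) (use assms in \<open>auto intro: le_less_trans\<close>)
  have "ennreal (\<integral>x. X x \<partial>M) \<le> ennreal c"
    using nn_integral_eq_integral[OF i] assms by simp
  then show "(\<integral>x. X x \<partial>M) \<le> c" using assms(4) by simp
qed

lemma sum_over_images:
  fixes h :: "'u \<Rightarrow> 'u \<Rightarrow> 'b :: comm_monoid_add"
  assumes U: "finite U" and \<alpha>: "inj_on \<alpha> J" "\<alpha> ` J \<subseteq> U" and \<beta>: "inj_on \<beta> J" "\<beta> ` J \<subseteq> U"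
    and z: "\<And>u v. u \<notin> \<alpha> ` J \<or> v \<notin> \<beta> ` J \<Longrightarrow> h u v = 0"
  shows "(\<Sum>u\<in>U. \<Sum>v\<in>U. h u v) = (\<Sum>j\<in>J. \<Sum>l\<in>J. h (\<alpha> j) (\<beta> l))"
proof -
  have inner: "(\<Sum>v\<in>U. h u v) = (\<Sum>l\<in>J. h u (\<beta> l))" for u
  proof -
    have "(\<Sum>v\<in>U. h u v) = (\<Sum>v\<in>\<beta> ` J. h u v)"
      by (rule sum.mono_neutral_right) (use U \<beta> z in auto)
    then show ?thesis by (simp add: sum.reindex[OF \<beta>(1)])
  qed
  have "(\<Sum>u\<in>U. \<Sum>l\<in>J. h u (\<beta> l)) = (\<Sum>u\<in>\<alpha> ` J. \<Sum>l\<in>J. h u (\<beta> l))"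
    by (rule sum.mono_neutral_right) (use U \<alpha> z in \<open>auto intro!: sum.neutral\<close>)
  then show ?thesis unfolding inner by (simp add: sum.reindex[OF \<alpha>(1)])
qed

text \<open>Removed row and column entries are two injective images of the same index set. Extending
  the coefficients by zero makes pure and mixed forms alike into one form on
  \<open>U\<close>.\<close>

lemma (in entry_pair) quadratic_form_injections:
  assumes U: "finite U" and \<alpha>: "inj_on \<alpha> J" "\<alpha> ` J \<subseteq> U" and \<beta>: "inj_on \<beta> J" "\<beta> ` J \<subseteq> U"
    and b: "(\<Sum>j\<in>J. \<Sum>l\<in>J. (cmod (M j l))\<^sup>2) \<le> b"
  shows "(\<integral>\<^sup>+\<omega>. ennreal (cmod (\<Sum>j\<in>J. \<Sum>l\<in>J. if \<alpha> j = \<beta> l then 0 else M j l * f (\<omega> (\<alpha> j)) * g (\<omega> (\<beta> l)))) \<partial>PiM U (\<lambda>_. N))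
    \<le> ennreal (sqrt (2 * b) * \<tau>)"
proof -
  define B where "B u v = (if u \<in> \<alpha> ` J \<and> v \<in> \<beta> ` J then M (inv_into J \<alpha> u) (inv_into J \<beta> v) else 0)" for u v
  have B: "B (\<alpha> j) (\<beta> l) = M j l" if "j \<in> J" "l \<in> J" for j l
    using that \<alpha>(1) \<beta>(1) by (simp add: B_def)
  have B0: "B u v = 0" if "u \<notin> \<alpha> ` J \<or> v \<notin> \<beta> ` J" for u v
    using that by (auto simp: B_def)
  have eq: "(\<Sum>u\<in>U. \<Sum>v\<in>U. if u = v then 0 else B u v * f (\<omega> u) * g (\<omega> v)) =
    (\<Sum>j\<in>J. \<Sum>l\<in>J. if \<alpha> j = \<beta> l then 0 else M j l * f (\<omega> (\<alpha> j)) * g (\<omega> (\<beta> l)))" (is "?l = ?r") for \<omega>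
  proof -
    have "?l = (\<Sum>j\<in>J. \<Sum>l\<in>J. if \<alpha> j = \<beta> l then 0 else B (\<alpha> j) (\<beta> l) * f (\<omega> (\<alpha> j)) * g (\<omega> (\<beta> l)))"
      by (rule sum_over_images[OF U \<alpha> \<beta>]) (simp add: B0)
    also have "\<dots> = ?r" by (intro sum.cong refl) (simp add: B)
    finally show ?thesis .
  qed
  have "(\<Sum>u\<in>U. \<Sum>v\<in>U. (cmod (B u v))\<^sup>2) = (\<Sum>j\<in>J. \<Sum>l\<in>J. (cmod (B (\<alpha> j) (\<beta> l)))\<^sup>2)"
    by (rule sum_over_images[OF U \<alpha> \<beta>]) (simp add: B0)
  also have "\<dots> = (\<Sum>j\<in>J. \<Sum>l\<in>J. (cmod (M j l))\<^sup>2)" by (intro sum.cong refl) (simp add: B)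
  finally have "(\<Sum>u\<in>U. \<Sum>v\<in>U. (cmod (B u v))\<^sup>2) = (\<Sum>j\<in>J. \<Sum>l\<in>J. (cmod (M j l))\<^sup>2)" .
  then show ?thesis
    using quadratic_form_off_diagonal[OF U, of B b] b unfolding eq by simp
qed

lemma (in entry_law) diagonal_form_injection:
  assumes U: "finite U" and \<alpha>: "inj_on \<alpha> J" "\<alpha> ` J \<subseteq> U"
    and b: "\<And>j. j \<in> J \<Longrightarrow> cmod (m j) \<le> \<beta>" and \<beta>: "\<beta> \<ge> 0" and \<epsilon>: "\<epsilon> \<ge> 0"
  shows "(\<integral>\<^sup>+\<omega>. ennreal (cmod (\<Sum>j\<in>J. m j * complex_of_real ((cmod (\<omega> (\<alpha> j)))\<^sup>2 - \<tau>))) \<partial>PiM U (\<lambda>_. N))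
    \<le> ennreal (\<beta> * (\<epsilon> * sqrt (card U * \<tau>) + 2 * card U * tail_moment \<epsilon>))"
proof -
  define c where "c u = (if u \<in> \<alpha> ` J then m (inv_into J \<alpha> u) else 0)" for u
  have "(\<Sum>u\<in>U. c u * complex_of_real ((cmod (\<omega> u))\<^sup>2 - \<tau>)) = (\<Sum>u\<in>\<alpha> ` J. c u * complex_of_real ((cmod (\<omega> u))\<^sup>2 - \<tau>))" for \<omega>
    by (rule sum.mono_neutral_right) (use U \<alpha> in \<open>auto simp: c_def\<close>)
  also have "\<dots> \<omega> = (\<Sum>j\<in>J. m j * complex_of_real ((cmod (\<omega> (\<alpha> j)))\<^sup>2 - \<tau>))" for \<omega>
    unfolding sum.reindex[OF \<alpha>(1)] by (intro sum.cong) (use \<alpha>(1) in \<open>auto simp: c_def\<close>)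
  finally have eq: "(\<Sum>u\<in>U. c u * complex_of_real ((cmod (\<omega> u))\<^sup>2 - \<tau>)) = (\<Sum>j\<in>J. m j * complex_of_real ((cmod (\<omega> (\<alpha> j)))\<^sup>2 - \<tau>))" for \<omega> .
  have "cmod (c u) \<le> \<beta>" if "u \<in> U" for u
    using b \<beta> \<alpha>(1) by (auto simp: c_def)
  then show ?thesis using quadratic_form_diagonal[OF U, of c \<beta> \<epsilon>] \<beta> \<epsilon> unfolding eq by blast
qed

lemma (in entry_law) entry_pairs:
  "entry_pair N \<tau> (\<lambda>x. x) cnj" "entry_pair N \<tau> (\<lambda>x. x) (\<lambda>x. x)" "entry_pair N \<tau> cnj (\<lambda>x. x)" "entry_pair N \<tau> cnj cnj"
proof -
  have c: "cnj \<in> borel_measurable borel" by (intro borel_measurable_continuous_onI continuous_intros)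
  have "(\<integral>x. cnj x \<partial>N) = cnj (\<integral>x. x \<partial>N)" by (rule Bochner_Integration.integral_cnj)
  then have m: "(\<integral>x. cnj x \<partial>N) = 0" using mean_zero by simp
  show "entry_pair N \<tau> (\<lambda>x. x) cnj" "entry_pair N \<tau> (\<lambda>x. x) (\<lambda>x. x)" "entry_pair N \<tau> cnj (\<lambda>x. x)" "entry_pair N \<tau> cnj cnj"
    by (unfold_locales; use c m mean_zero in simp)+
qed

text \<open>A single size \<open>n\<close> on the canonical product space of the entries, where
  independence is Fubini's theorem. The normalized trace \<open>S\<close> will be compared with its
  expectation \<open>s\<close>.\<close>

locale markov_model = entry_law N "1 / real n" for N :: "complex measure" and n :: nat +
  fixes z \<eta> :: complex
  assumes n: "n \<ge> 1" and \<eta>: "Im \<eta> > 0"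
begin

definition v where "v = Im \<eta>"
definition I :: "(nat \<times> nat) set" where "I = {..<n} \<times> {..<n}"
definition P :: "(nat \<times> nat \<Rightarrow> complex) measure" where "P = PiM I (\<lambda>_. N)"
definition W :: "(nat \<times> nat \<Rightarrow> complex) \<Rightarrow> nat \<Rightarrow> nat \<Rightarrow> complex" where "W \<omega> i j = \<omega> (i, j)"
definition R where "R \<omega> = block_resolvent n (markov_matrix n z (W \<omega>)) \<eta>"
definition S where "S \<omega> = (\<Sum>p\<in>block_index n. R \<omega> p p) / (2 * of_nat n)"
definition s where "s = (\<integral>\<omega>. S \<omega> \<partial>P)"

lemma v: "v > 0" using \<eta> by (simp add: v_def)

sublocale P: prob_space P unfolding P_def by (rule prob_space_product)

lemma fin: "finite I" "finite (block_index n)" by (simp_all add: I_def)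

lemma n0: "n > 0" "real n > 0" using n by simp_all

lemma W_measurable: "i < n \<Longrightarrow> j < n \<Longrightarrow> (\<lambda>\<omega>. W \<omega> i j) \<in> borel_measurable P"
  unfolding W_def P_def by (rule measurable_coordinate) (simp add: I_def)

lemma R_measurable:
  assumes "p \<in> block_index n" "q \<in> block_index n"
  shows "(\<lambda>\<omega>. R \<omega> p q) \<in> borel_measurable P"
  unfolding R_def
proof (rule borel_measurable_block_resolvent[OF _ assms])
  fix i j assume "i < n" "j < n"
  then show "(\<lambda>\<omega>. markov_matrix n z (W \<omega>) i j) \<in> borel_measurable P"
    unfolding markov_matrix_def
    by (cases "i = j") (auto intro!: borel_measurable_diff borel_measurable_add borel_measurable_sum W_measurable)
qed

lemma resolvent_R: "resolvent_of (block_index n) (hermitization (markov_matrix n z (W \<omega>))) \<eta> (R \<omega>)"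
  unfolding R_def by (rule resolvent_of_block_resolvent[OF \<eta>])

lemma R_bound: "p \<in> block_index n \<Longrightarrow> q \<in> block_index n \<Longrightarrow> cmod (R \<omega> p q) \<le> 1 / v"
  unfolding v_def by (rule resolvent_entry_bound[OF fin(2) hermitian_hermitization resolvent_R \<eta>])

lemma S_eq: "S \<omega> = (\<Sum>k<n. R \<omega> (k, False) (k, False)) / of_nat n"
proof -
  have "\<eta> \<noteq> 0" using \<eta> by auto
  from trace_resolvent_blocks[OF resolvent_R this, of \<omega>] show ?thesis
    unfolding S_def sum_block_index by simp
qed

lemma S_measurable: "S \<in> borel_measurable P"
  unfolding S_def[abs_def] by (intro borel_measurable_divide borel_measurable_sum borel_measurable_const R_measurable) auto

lemma S_bound: "cmod (S \<omega>) \<le> 1 / v"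
proof -
  have "cmod (\<Sum>k<n. R \<omega> (k, False) (k, False)) \<le> (\<Sum>k<n. 1 / v)"
    by (rule order_trans[OF norm_sum]) (intro sum_mono R_bound, auto)
  then show ?thesis unfolding S_eq norm_divide using n0 by (simp add: divide_le_eq mult.commute)
qed

lemma S_integrable: "integrable P S"
  by (rule P.integrable_const_bound[OF _ S_measurable]) (use S_bound in auto)

lemma S_Im_nonneg: "Im (S \<omega>) \<ge> 0"
proof -
  have "Im (R \<omega> p p) \<ge> 0" if "p \<in> block_index n" for p
  proof -
    have "Im \<eta> * (\<Sum>k\<in>block_index n. (cmod (R \<omega> k p))\<^sup>2) = Im (R \<omega> p p)"
      by (rule resolvent_ward[OF fin(2) hermitian_hermitization resolvent_R that])
    then show ?thesis using \<eta> by (metis mult_nonneg_nonneg less_imp_le sum_nonneg zero_le_power2)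
  qed
  then have "Im (\<Sum>k<n. R \<omega> (k, False) (k, False)) \<ge> 0" unfolding Im_sum by (intro sum_nonneg) auto
  then show ?thesis unfolding S_eq by (simp add: Im_divide_of_nat)
qed

lemma s_bounds: "cmod s \<le> 1 / v" "Im s \<ge> 0"
proof -
  show "cmod s \<le> 1 / v" unfolding s_def by (rule P.norm_expectation_le[OF S_integrable S_bound])
  have "Im s = (\<integral>\<omega>. Im (S \<omega>) \<partial>P)" unfolding s_def by (rule integral_Im[OF S_integrable, symmetric])
  then show "Im s \<ge> 0" using S_Im_nonneg by (simp add: integral_nonneg_AE)
qed

subsection \<open>Concentration\<close>

text \<open>The row sum sits in the same row as its entries, so changing a row is a rank one change
  whatever its size; the trace bound \<open>2 / v\<close> is divided by \<open>2 n\<close>.\<close>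

lemma S_row_change:
  assumes t: "t < n" and eq: "\<And>p. p \<in> I \<Longrightarrow> fst p \<noteq> t \<Longrightarrow> x p = y p"
  shows "cmod (S x - S y) \<le> 1 / (real n * v)"
proof -
  let ?d = "\<lambda>j. markov_matrix n z (W x) t j - markov_matrix n z (W y) t j"
  have "cmod ((\<Sum>p\<in>block_index n. R x p p) - (\<Sum>p\<in>block_index n. R y p p)) \<le> 2 / Im \<eta>"
  proof (rule trace_resolvent_rank_one[OF resolvent_R resolvent_R _ \<eta>,
        where p = "\<lambda>k. if k = t then 1 else 0" and q = "\<lambda>j. cnj (?d j)"])
    fix i j assume ij: "i < n" "j < n"
    show "markov_matrix n z (W x) i j = markov_matrix n z (W y) i j + (if i = t then 1 else 0) * cnj (cnj (?d j))"
    proof (cases "i = t")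
      case False
      then have "W x i k = W y i k" if "k < n" for k
        using eq[of "(i, k)"] ij that by (simp add: W_def I_def)
      moreover from this have "sum (W x i) {..<n} = sum (W y i) {..<n}" by (intro sum.cong) auto
      ultimately show ?thesis using False ij by (cases "i = j") (simp_all add: markov_matrix_def)
    qed simp
  qed
  then have "cmod ((\<Sum>p\<in>block_index n. R x p p) - (\<Sum>p\<in>block_index n. R y p p)) / (2 * real n) \<le> (2 / v) / (2 * real n)"
    unfolding v_def by (rule divide_right_mono) simp
  moreover have "cmod (S x - S y) = cmod ((\<Sum>p\<in>block_index n. R x p p) - (\<Sum>p\<in>block_index n. R y p p)) / (2 * real n)"
    unfolding S_def diff_divide_distrib[symmetric] norm_divide by (simp add: norm_mult)
  ultimately show ?thesis by (simp add: mult.commute)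
qed

text \<open>Bounded differences over \<open>n\<close> rows with \<open>c = 1 / (n v)\<close>, so
  that the exponent \<open>a^2 / (2 n c^2)\<close> is \<open>a^2 v^2 n / 2\<close>. Real and
  imaginary parts are separate because the inequality concerns real functions.\<close>

lemma concentration:
  assumes a: "a > 0" and f: "f = Re \<or> f = Im"
  shows "measure P {\<omega> \<in> space P. \<bar>f (S \<omega>) - f s\<bar> \<ge> a} \<le> 2 * exp (- (a\<^sup>2 * v\<^sup>2 * real n / 2))"
proof -
  have fl: "\<bar>f x\<bar> \<le> cmod x" "f x - f y = f (x - y)" for x y
    using f abs_Re_le_cmod abs_Im_le_cmod by auto
  have fm: "(\<lambda>\<omega>. f (S \<omega>)) \<in> borel_measurable P"
    using f S_measurable by auto
  have fs: "f s = (\<integral>\<omega>. f (S \<omega>) \<partial>P)"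
    using f integral_Re[OF S_integrable] integral_Im[OF S_integrable] by (auto simp: s_def)
  have "measure P {\<omega> \<in> space P. \<bar>f (S \<omega>) - (\<integral>\<omega>. f (S \<omega>) \<partial>P)\<bar> \<ge> a}
      \<le> 2 * exp (- (a\<^sup>2 / (2 * real (card {..<n}) * (1 / (real n * v))\<^sup>2)))"
    unfolding P_def I_def
  proof (rule bounded_differences_inequality[OF prob_space_axioms _ _ _ _ a])
    show "(\<lambda>\<omega>. f (S \<omega>)) \<in> borel_measurable (PiM ({..<n} \<times> {..<n}) (\<lambda>_. N))"
      using fm by (simp add: P_def I_def)
    show "\<bar>f (S x)\<bar> \<le> 1 / v" for x using fl(1)[of "S x"] S_bound[of x] by linarith
    show "\<bar>f (S x) - f (S y)\<bar> \<le> 1 / (real n * v)"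
      if "t \<in> {..<n}" "\<And>p. p \<in> {..<n} \<times> {..<n} \<Longrightarrow> fst p \<noteq> t \<Longrightarrow> x p = y p" for t x y
      unfolding fl(2) by (rule order_trans[OF fl(1) S_row_change[of t]]) (use that in \<open>auto simp: I_def\<close>)
  qed (use n0 v in \<open>auto simp: lessThan_empty_iff\<close>)
  moreover have "a\<^sup>2 / (2 * real (card {..<n}) * (1 / (real n * v))\<^sup>2) = a\<^sup>2 * v\<^sup>2 * real n / 2"
    using n0 v by (simp add: power_divide power_mult_distrib field_simps power2_eq_square)
  ultimately show ?thesis unfolding fs by metis
qed

definition deviation where "deviation = (\<integral>\<omega>. cmod (S \<omega> - s) \<partial>P)"

lemma deviation_integrable: "integrable P (\<lambda>\<omega>. cmod (S \<omega> - s))"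
  by (intro integrable_norm Bochner_Integration.integrable_diff S_integrable) simp

text \<open>On the exceptional event of \<open>concentration\<close> each part deviates by at most
  \<open>2 / v\<close>; the outer factor 2 adds the real and imaginary parts. The level
  \<open>a\<close> is chosen later.\<close>

lemma deviation_le:
  assumes a: "a > 0"
  shows "deviation \<le> 2 * (a + 4 / v * exp (- (a\<^sup>2 * v\<^sup>2 * real n / 2)))"
proof -
  have part: "integrable P (\<lambda>\<omega>. \<bar>f (S \<omega>) - f s\<bar>)" "(\<integral>\<omega>. \<bar>f (S \<omega>) - f s\<bar> \<partial>P) \<le> a + 4 / v * exp (- (a\<^sup>2 * v\<^sup>2 * real n / 2))"
    if f: "f = Re \<or> f = Im" for f
  proof -
    let ?B = "{\<omega> \<in> space P. \<bar>f (S \<omega>) - f s\<bar> \<ge> a}"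
    have fm: "(\<lambda>\<omega>. f (S \<omega>)) \<in> borel_measurable P" using f S_measurable by auto
    then have Bm: "?B \<in> sets P" by measurable
    have fl: "\<bar>f x\<bar> \<le> cmod x" for x using f abs_Re_le_cmod abs_Im_le_cmod by auto
    have b: "\<bar>f (S \<omega>) - f s\<bar> \<le> 2 / v" for \<omega>
      using fl[of "S \<omega>"] fl[of s] S_bound[of \<omega>] s_bounds(1) by (simp add: abs_le_iff)
    show i: "integrable P (\<lambda>\<omega>. \<bar>f (S \<omega>) - f s\<bar>)"
      by (rule P.integrable_const_bound[where B = "2 / v"]) (use b fm in auto)
    have "(\<integral>\<omega>. \<bar>f (S \<omega>) - f s\<bar> \<partial>P) \<le> (\<integral>\<omega>. a + 2 / v * indicator ?B \<omega> \<partial>P)"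
    proof (rule integral_mono[OF i])
      show "integrable P (\<lambda>\<omega>. a + 2 / v * indicator ?B \<omega>)"
        using Bm by (intro Bochner_Integration.integrable_add integrable_mult_right integrable_real_indicator) (auto simp: P.emeasure_eq_measure)
      show "\<bar>f (S \<omega>) - f s\<bar> \<le> a + 2 / v * indicator ?B \<omega>" if "\<omega> \<in> space P" for \<omega>
        using b[of \<omega>] a v that by (cases "\<omega> \<in> ?B") (auto simp: not_le)
    qed
    also have "\<dots> = a + 2 / v * measure P ?B"
    proof -
      have "integrable P (indicator ?B :: _ \<Rightarrow> real)" using Bm by (intro integrable_real_indicator) (auto simp: P.emeasure_eq_measure)
      then show ?thesis using Bm P.prob_space by (simp add: Int_absorb1 subset_iff)
    qed
    also have "\<dots> \<le> a + 2 / v * (2 * exp (- (a\<^sup>2 * v\<^sup>2 * real n / 2)))"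
      using v by (intro add_left_mono mult_left_mono concentration a f) auto
    finally show "(\<integral>\<omega>. \<bar>f (S \<omega>) - f s\<bar> \<partial>P) \<le> a + 4 / v * exp (- (a\<^sup>2 * v\<^sup>2 * real n / 2))" by simp
  qed
  have "deviation \<le> (\<integral>\<omega>. \<bar>Re (S \<omega>) - Re s\<bar> + \<bar>Im (S \<omega>) - Im s\<bar> \<partial>P)"
    unfolding deviation_def
  proof (rule integral_mono[OF deviation_integrable])
    show "integrable P (\<lambda>\<omega>. \<bar>Re (S \<omega>) - Re s\<bar> + \<bar>Im (S \<omega>) - Im s\<bar>)"
      using part(1)[of Re] part(1)[of Im] by (intro Bochner_Integration.integrable_add) auto
    show "cmod (S \<omega> - s) \<le> \<bar>Re (S \<omega>) - Re s\<bar> + \<bar>Im (S \<omega>) - Im s\<bar>" for \<omega>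
      using cmod_le[of "S \<omega> - s"] by simp
  qed
  also have "\<dots> = (\<integral>\<omega>. \<bar>Re (S \<omega>) - Re s\<bar> \<partial>P) + (\<integral>\<omega>. \<bar>Im (S \<omega>) - Im s\<bar> \<partial>P)"
    using part(1)[of Re] part(1)[of Im] by (intro Bochner_Integration.integral_add) auto
  also have "\<dots> \<le> 2 * (a + 4 / v * exp (- (a\<^sup>2 * v\<^sup>2 * real n / 2)))"
    using part(2)[of Re] part(2)[of Im] by simp
  finally show ?thesis .
qed

subsection \<open>Expectations of the error terms\<close>

definition cross where "cross i = {p \<in> I. fst p = i \<or> snd p = i}"
definition R0 where "R0 i \<omega> = block_resolvent n (cavity_matrix n z i (W \<omega>)) \<eta>"

lemma cross: "finite (cross i)" "cross i \<union> (I - cross i) = I" "card (cross i) \<le> 2 * n"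
proof -
  show "finite (cross i)" using fin(1) by (simp add: cross_def)
  show "cross i \<union> (I - cross i) = I" by (auto simp: cross_def)
  have "cross i \<subseteq> (\<lambda>j. (i, j)) ` {..<n} \<union> (\<lambda>j. (j, i)) ` {..<n}" by (auto simp: cross_def I_def)
  then have "card (cross i) \<le> card ((\<lambda>j. (i, j)) ` {..<n} \<union> (\<lambda>j. (j, i)) ` {..<n})" by (intro card_mono) auto
  also have "\<dots> \<le> card ((\<lambda>j. (i, j)) ` {..<n}) + card ((\<lambda>j. (j, i)) ` {..<n})" by (rule card_Un_le)
  also have "\<dots> \<le> 2 * n" using card_image_le[of "{..<n}" "\<lambda>j. (i, j)"] card_image_le[of "{..<n}" "\<lambda>j. (j, i)"] by simp
  finally show "card (cross i) \<le> 2 * n" .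
qed

lemma resolvent_R0: "resolvent_of (block_index n) (hermitization (cavity_matrix n z i (W \<omega>))) \<eta> (R0 i \<omega>)"
  unfolding R0_def by (rule resolvent_of_block_resolvent[OF \<eta>])

lemma R0_measurable:
  assumes i: "i < n" and "p \<in> block_index n" "q \<in> block_index n"
  shows "(\<lambda>\<omega>. R0 i \<omega> p q) \<in> borel_measurable P"
  unfolding R0_def
proof (rule borel_measurable_block_resolvent[OF _ assms(2,3)])
  fix k j assume kj: "k < n" "j < n"
  have "(\<lambda>\<omega>. (\<Sum>l\<in>{..<n} - {i}. W \<omega> k l) + z) \<in> borel_measurable P"
    by (intro borel_measurable_add borel_measurable_sum W_measurable kj) auto
  then show "(\<lambda>\<omega>. cavity_matrix n z i (W \<omega>) k j) \<in> borel_measurable P"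
    unfolding cavity_matrix_def using W_measurable[OF kj]
    by (cases "k = i \<or> j = i"; cases "k = j") (simp_all add: borel_measurable_diff)
qed

lemma R0_merge:
  assumes y: "y \<in> space (PiM (I - cross i) (\<lambda>_. N))"
  shows "R0 i (merge (I - cross i) (cross i) (y, x)) = R0 i y"
proof -
  have eq: "W (merge (I - cross i) (cross i) (y, x)) k j = W y k j" if "k \<noteq> i" "j \<noteq> i" for k j
    using y that by (auto simp: W_def merge_def cross_def space_PiM PiE_def extensional_def)
  have "cavity_matrix n z i (W (merge (I - cross i) (cross i) (y, x))) = cavity_matrix n z i (W y)"
  proof (intro ext)
    fix k j
    show "cavity_matrix n z i (W (merge (I - cross i) (cross i) (y, x))) k j = cavity_matrix n z i (W y) k j"
    proof (cases "k = i \<or> j = i")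
      case False
      have "(\<Sum>l\<in>{..<n} - {i}. W (merge (I - cross i) (cross i) (y, x)) k l) = (\<Sum>l\<in>{..<n} - {i}. W y k l)"
        using False by (intro sum.cong refl eq) auto
      then show ?thesis using False eq by (simp add: cavity_matrix_def)
    qed (simp add: cavity_matrix_def)
  qed
  then show ?thesis unfolding R0_def by simp
qed

lemma nn_integral_cross_le:
  assumes f: "f \<in> borel_measurable P"
    and le: "\<And>y. y \<in> space (PiM (I - cross i) (\<lambda>_. N)) \<Longrightarrow>
      (\<integral>\<^sup>+x. f (merge (I - cross i) (cross i) (y, x)) \<partial>PiM (cross i) (\<lambda>_. N)) \<le> c"
  shows "(\<integral>\<^sup>+\<omega>. f \<omega> \<partial>P) \<le> c"
proof -
  interpret PP: product_sigma_finite "\<lambda>_::nat \<times> nat. N"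
    by (simp add: product_sigma_finite_def prob_space_imp_sigma_finite prob_space_axioms)
  interpret D: prob_space "PiM (I - cross i) (\<lambda>_. N)" by (rule prob_space_product)
  have un: "(I - cross i) \<union> cross i = I" by (auto simp: cross_def)
  have "(\<integral>\<^sup>+\<omega>. f \<omega> \<partial>P) = (\<integral>\<^sup>+y. (\<integral>\<^sup>+x. f (merge (I - cross i) (cross i) (y, x)) \<partial>PiM (cross i) (\<lambda>_. N)) \<partial>PiM (I - cross i) (\<lambda>_. N))"
    using PP.product_nn_integral_fold[of "I - cross i" "cross i" f] f fin(1) cross(1)
    unfolding P_def un by auto
  also have "\<dots> \<le> (\<integral>\<^sup>+y. c \<partial>PiM (I - cross i) (\<lambda>_. N))"
    by (rule nn_integral_mono) (rule le)
  finally show ?thesis by (simp add: D.emeasure_space_1)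
qed

text \<open>Each resolvent row has squared norm at most \<open>1 / v^2\<close>. With entries of
  variance \<open>1 / n\<close>, the off-diagonal forms then have second moment of order
  \<open>1 / n\<close>.\<close>

lemma R0_square_sum:
  assumes J: "J \<subseteq> {..<n}"
  shows "(\<Sum>j\<in>J. \<Sum>l\<in>J. (cmod (R0 i \<omega> (j, b) (l, c)))\<^sup>2) \<le> real n / v\<^sup>2"
proof -
  have row: "(\<Sum>l\<in>J. (cmod (R0 i \<omega> (j, b) (l, c)))\<^sup>2) \<le> 1 / v\<^sup>2" if "j \<in> J" for j
  proof -
    have "(\<Sum>l\<in>J. (cmod (R0 i \<omega> (j, b) (l, c)))\<^sup>2) = (\<Sum>q\<in>(\<lambda>l. (l, c)) ` J. (cmod (R0 i \<omega> (j, b) q))\<^sup>2)"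
      by (subst sum.reindex) (auto simp: inj_on_def)
    also have "\<dots> \<le> (\<Sum>q\<in>block_index n. (cmod (R0 i \<omega> (j, b) q))\<^sup>2)"
      by (rule sum_mono2) (use J in auto)
    also have "\<dots> \<le> 1 / (Im \<eta>)\<^sup>2"
      by (rule resolvent_row_bound[OF fin(2) hermitian_hermitization resolvent_R0 \<eta>]) (use J that in auto)
    finally show ?thesis by (simp add: v_def)
  qed
  have "(\<Sum>j\<in>J. \<Sum>l\<in>J. (cmod (R0 i \<omega> (j, b) (l, c)))\<^sup>2) \<le> (\<Sum>j\<in>J. 1 / v\<^sup>2)" by (rule sum_mono) (rule row)
  also have "\<dots> \<le> real n * (1 / v\<^sup>2)"
    using card_mono[OF _ J] by (simp add: divide_right_mono)
  finally show ?thesis by simp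
qed

definition off_bound where "off_bound = sqrt (2 * (real n / v\<^sup>2)) * (1 / real n)"
text \<open>The bound for diagonal forms with \<open>\<beta> = 1 / v\<close>,
  \<open>\<tau> = 1 / n\<close> and at most \<open>2 n\<close> coordinates in
  \<open>cross i\<close>, whence \<open>sqrt 2\<close> and 4.\<close>

definition diag_bound where "diag_bound \<epsilon> = 1 / v * (\<epsilon> * sqrt 2 + 4 * (real n * tail_moment \<epsilon>))"

lemma off_diagonal_expectation:
  assumes fg: "entry_pair N (1 / real n) f g" and i: "i < n" and J: "J \<subseteq> {..<n}"
    and \<alpha>: "inj_on \<alpha> J" "\<alpha> ` J \<subseteq> cross i" and \<beta>: "inj_on \<beta> J" "\<beta> ` J \<subseteq> cross i"
  shows "integrable P (\<lambda>\<omega>. cmod (\<Sum>j\<in>J. \<Sum>l\<in>J. if \<alpha> j = \<beta> l then 0 else R0 i \<omega> (j, b) (l, c) * f (\<omega> (\<alpha> j)) * g (\<omega> (\<beta> l))))"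
    "(\<integral>\<omega>. cmod (\<Sum>j\<in>J. \<Sum>l\<in>J. if \<alpha> j = \<beta> l then 0 else R0 i \<omega> (j, b) (l, c) * f (\<omega> (\<alpha> j)) * g (\<omega> (\<beta> l))) \<partial>P) \<le> off_bound"
proof -
  interpret E: entry_pair N "1 / real n" f g by (rule fg)
  let ?X = "\<lambda>\<omega>. \<Sum>j\<in>J. \<Sum>l\<in>J. if \<alpha> j = \<beta> l then 0 else R0 i \<omega> (j, b) (l, c) * f (\<omega> (\<alpha> j)) * g (\<omega> (\<beta> l))"
  have coord: "(\<lambda>\<omega>. h (\<omega> u)) \<in> borel_measurable P" if "h \<in> borel_measurable borel" "u \<in> cross i" for h :: "complex \<Rightarrow> complex" and u
    unfolding P_def by (rule measurable_compose[OF measurable_coordinate that(1)]) (use that(2) in \<open>auto simp: cross_def\<close>)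
  have "(\<lambda>\<omega>. if \<alpha> j = \<beta> l then 0 else R0 i \<omega> (j, b) (l, c) * f (\<omega> (\<alpha> j)) * g (\<omega> (\<beta> l))) \<in> borel_measurable P"
    if jl: "j \<in> J" "l \<in> J" for j l
  proof (cases "\<alpha> j = \<beta> l")
    case False
    have u: "\<alpha> j \<in> cross i" "\<beta> l \<in> cross i" "j < n" "l < n" using jl \<alpha>(2) \<beta>(2) J by auto
    have "(\<lambda>\<omega>. R0 i \<omega> (j, b) (l, c) * f (\<omega> (\<alpha> j)) * g (\<omega> (\<beta> l))) \<in> borel_measurable P"
      by (intro borel_measurable_times R0_measurable[OF i] coord E.f_measurable E.g_measurable u) (use u in auto)
    then show ?thesis using False by simp
  qed simp
  then have Xm: "?X \<in> borel_measurable P" by (intro borel_measurable_sum)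
  have "(\<integral>\<^sup>+\<omega>. ennreal (cmod (?X \<omega>)) \<partial>P) \<le> ennreal off_bound"
  proof (rule nn_integral_cross_le[where i = i])
    show "(\<lambda>\<omega>. ennreal (cmod (?X \<omega>))) \<in> borel_measurable P"
      by (rule measurable_compose[OF measurable_compose[OF Xm borel_measurable_norm] measurable_ennreal])
    fix y assume y: "y \<in> space (PiM (I - cross i) (\<lambda>_. N))"
    have m: "merge (I - cross i) (cross i) (y, x) u = x u" if "u \<in> cross i" for x u using that by (simp add: merge_def)
    have "?X (merge (I - cross i) (cross i) (y, x)) =
        (\<Sum>j\<in>J. \<Sum>l\<in>J. if \<alpha> j = \<beta> l then 0 else R0 i y (j, b) (l, c) * f (x (\<alpha> j)) * g (x (\<beta> l)))" for x
      unfolding R0_merge[OF y] using \<alpha>(2) \<beta>(2) by (intro sum.cong refl) (simp add: m image_subset_iff)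
    then show "(\<integral>\<^sup>+x. ennreal (cmod (?X (merge (I - cross i) (cross i) (y, x)))) \<partial>PiM (cross i) (\<lambda>_. N)) \<le> ennreal off_bound"
      unfolding off_bound_def
      using E.quadratic_form_injections[OF cross(1) \<alpha> \<beta> R0_square_sum[OF J, of i y b c]] by simp
  qed
  then show "integrable P (\<lambda>\<omega>. cmod (?X \<omega>))" "(\<integral>\<omega>. cmod (?X \<omega>) \<partial>P) \<le> off_bound"
    by (rule integral_of_nn_bound[OF measurable_compose[OF Xm borel_measurable_norm] norm_ge_zero]; simp add: off_bound_def)+
qed

lemma diagonal_expectation:
  assumes i: "i < n" and J: "J \<subseteq> {..<n}" and \<alpha>: "inj_on \<alpha> J" "\<alpha> ` J \<subseteq> cross i" and \<epsilon>: "\<epsilon> \<ge> 0"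
  shows "integrable P (\<lambda>\<omega>. cmod (\<Sum>j\<in>J. R0 i \<omega> (j, b) (j, b) * complex_of_real ((cmod (\<omega> (\<alpha> j)))\<^sup>2 - 1 / real n)))"
    "(\<integral>\<omega>. cmod (\<Sum>j\<in>J. R0 i \<omega> (j, b) (j, b) * complex_of_real ((cmod (\<omega> (\<alpha> j)))\<^sup>2 - 1 / real n)) \<partial>P) \<le> diag_bound \<epsilon>"
proof -
  let ?X = "\<lambda>\<omega>. \<Sum>j\<in>J. R0 i \<omega> (j, b) (j, b) * complex_of_real ((cmod (\<omega> (\<alpha> j)))\<^sup>2 - 1 / real n)"
  have d0: "diag_bound \<epsilon> \<ge> 0" using v \<epsilon> tail_moment_nonneg by (simp add: diag_bound_def)
  have "(\<lambda>\<omega>. complex_of_real ((cmod (\<omega> (\<alpha> j)))\<^sup>2 - 1 / real n)) \<in> borel_measurable P" if "j \<in> J" for j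
  proof -
    have "(\<lambda>x::complex. complex_of_real ((cmod x)\<^sup>2 - 1 / real n)) \<in> borel_measurable borel" by measurable
    moreover have "\<alpha> j \<in> I" using that \<alpha>(2) by (auto simp: cross_def)
    ultimately show ?thesis unfolding P_def
      by (intro measurable_compose[OF measurable_coordinate])
  qed
  then have Xm: "?X \<in> borel_measurable P"
    using J by (intro borel_measurable_sum borel_measurable_times R0_measurable[OF i]) auto
  have "(\<integral>\<^sup>+\<omega>. ennreal (cmod (?X \<omega>)) \<partial>P) \<le> ennreal (diag_bound \<epsilon>)"
  proof (rule nn_integral_cross_le[where i = i])
    show "(\<lambda>\<omega>. ennreal (cmod (?X \<omega>))) \<in> borel_measurable P"
      by (rule measurable_compose[OF measurable_compose[OF Xm borel_measurable_norm] measurable_ennreal])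
    fix y assume y: "y \<in> space (PiM (I - cross i) (\<lambda>_. N))"
    have m: "merge (I - cross i) (cross i) (y, x) u = x u" if "u \<in> cross i" for x u using that by (simp add: merge_def)
    have eq: "?X (merge (I - cross i) (cross i) (y, x)) =
        (\<Sum>j\<in>J. R0 i y (j, b) (j, b) * complex_of_real ((cmod (x (\<alpha> j)))\<^sup>2 - 1 / real n))" for x
      unfolding R0_merge[OF y] using \<alpha>(2) by (intro sum.cong refl) (simp add: m image_subset_iff)
    have "cmod (R0 i y (j, b) (j, b)) \<le> 1 / v" if "j \<in> J" for j
      unfolding v_def by (rule resolvent_entry_bound[OF fin(2) hermitian_hermitization resolvent_R0 \<eta>]) (use that J in auto)
    then have "(\<integral>\<^sup>+x. ennreal (cmod (\<Sum>j\<in>J. R0 i y (j, b) (j, b) * complex_of_real ((cmod (x (\<alpha> j)))\<^sup>2 - 1 / real n))) \<partial>PiM (cross i) (\<lambda>_. N))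
      \<le> ennreal (1 / v * (\<epsilon> * sqrt (card (cross i) * (1 / real n)) + 2 * card (cross i) * tail_moment \<epsilon>))"
      by (intro diagonal_form_injection[OF cross(1) \<alpha>]) (use v \<epsilon> in auto)
    also have "\<dots> \<le> ennreal (diag_bound \<epsilon>)"
    proof (rule ennreal_leI)
      have c: "real (card (cross i)) \<le> 2 * real n" using cross(3)[of i] by linarith
      have "sqrt (card (cross i) * (1 / real n)) \<le> sqrt 2" using c n0 by (simp add: divide_le_eq)
      moreover have "2 * real (card (cross i)) * tail_moment \<epsilon> \<le> 4 * real n * tail_moment \<epsilon>"
        using c tail_moment_nonneg[of \<epsilon>] by (intro mult_right_mono) auto
      ultimately show "1 / v * (\<epsilon> * sqrt (card (cross i) * (1 / real n)) + 2 * card (cross i) * tail_moment \<epsilon>) \<le> diag_bound \<epsilon>"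
        unfolding diag_bound_def using v \<epsilon> by (intro mult_left_mono add_mono) auto
    qed
    finally show "(\<integral>\<^sup>+x. ennreal (cmod (?X (merge (I - cross i) (cross i) (y, x)))) \<partial>PiM (cross i) (\<lambda>_. N)) \<le> ennreal (diag_bound \<epsilon>)"
      unfolding eq .
  qed
  then show "integrable P (\<lambda>\<omega>. cmod (?X \<omega>))" "(\<integral>\<omega>. cmod (?X \<omega>) \<partial>P) \<le> diag_bound \<epsilon>"
    by (rule integral_of_nn_bound[OF measurable_compose[OF Xm borel_measurable_norm] norm_ge_zero]; use d0 in simp)+
qed

lemma entry_expectations:
  assumes u: "u \<in> I"
  shows "integrable P (\<lambda>\<omega>. (cmod (\<omega> u))\<^sup>2)" "(\<integral>\<omega>. (cmod (\<omega> u))\<^sup>2 \<partial>P) = 1 / real n"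
    "integrable P (\<lambda>\<omega>. cmod (\<omega> u))" "(\<integral>\<omega>. cmod (\<omega> u) \<partial>P) \<le> 1 / sqrt (real n)"
    "integrable P (\<lambda>\<omega>. (cmod (\<omega> u))\<^sup>2 * indicator {x. cmod x > \<epsilon>} (\<omega> u))"
    "(\<integral>\<omega>. (cmod (\<omega> u))\<^sup>2 * indicator {x. cmod x > \<epsilon>} (\<omega> u) \<partial>P) = tail_moment \<epsilon>"
proof -
  show i2: "integrable P (\<lambda>\<omega>. (cmod (\<omega> u))\<^sup>2)" and e2: "(\<integral>\<omega>. (cmod (\<omega> u))\<^sup>2 \<partial>P) = 1 / real n"
    unfolding P_def using integral_one_factor[OF fin(1) u square_integrable] second_moment by simp_all
  show "integrable P (\<lambda>\<omega>. (cmod (\<omega> u))\<^sup>2 * indicator {x. cmod x > \<epsilon>} (\<omega> u))"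
    "(\<integral>\<omega>. (cmod (\<omega> u))\<^sup>2 * indicator {x. cmod x > \<epsilon>} (\<omega> u) \<partial>P) = tail_moment \<epsilon>"
    unfolding P_def tail_moment_def using integral_one_factor[OF fin(1) u integrable_tail[of \<epsilon>]] by simp_all
  have m: "(\<lambda>\<omega>. \<omega> u) \<in> borel_measurable P" unfolding P_def by (rule measurable_coordinate[OF u])
  have "(\<integral>\<^sup>+\<omega>. ennreal (cmod (\<omega> u)) \<partial>P) \<le> ennreal (1 / sqrt (real n))"
    by (rule P.nn_integral_norm_le_sqrt[OF m i2]) (simp_all add: e2 power_divide)
  then show "integrable P (\<lambda>\<omega>. cmod (\<omega> u))" "(\<integral>\<omega>. cmod (\<omega> u) \<partial>P) \<le> 1 / sqrt (real n)"
    by (rule integral_of_nn_bound[OF measurable_compose[OF m borel_measurable_norm] norm_ge_zero]; simp)+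
qed

end

text \<open>Off-diagonal part, centred diagonal and trace. With \<open>t = 1 / n\<close> and cavity
  coefficients the first two are small in mean, and the trace term is the one close to
  \<open>s\<close>.\<close>

lemma quadratic_form_split:
  fixes M :: "'u \<Rightarrow> 'u \<Rightarrow> complex"
  assumes J: "finite J"
  shows "(\<Sum>j\<in>J. \<Sum>l\<in>J. M j l * x j * cnj (x l)) =
      (\<Sum>j\<in>J. \<Sum>l\<in>J. if j = l then 0 else M j l * x j * cnj (x l)) +
      (\<Sum>j\<in>J. M j j * complex_of_real ((cmod (x j))\<^sup>2 - t)) + complex_of_real t * (\<Sum>j\<in>J. M j j)" (is "?l = ?o + ?d + ?t")
    and "(\<Sum>j\<in>J. \<Sum>l\<in>J. M j l * cnj (x j) * x l) =
      (\<Sum>j\<in>J. \<Sum>l\<in>J. if j = l then 0 else M j l * cnj (x j) * x l) +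
      (\<Sum>j\<in>J. M j j * complex_of_real ((cmod (x j))\<^sup>2 - t)) + complex_of_real t * (\<Sum>j\<in>J. M j j)" (is "?l' = ?o' + ?d + ?t")
proof -
  have *: "(\<Sum>l\<in>J. h l) = (\<Sum>l\<in>J. if j = l then 0 else h l) + h j" if "j \<in> J" for j and h :: "'u \<Rightarrow> complex"
  proof -
    have "(\<Sum>l\<in>J - {j}. if j = l then 0 else h l) = (\<Sum>l\<in>J - {j}. h l)" by (rule sum.cong) auto
    then show ?thesis
      using sum.remove[OF J that, of h] sum.remove[OF J that, of "\<lambda>l. if j = l then 0 else h l"] by simp
  qed
  have sq: "x j * cnj (x j) = complex_of_real ((cmod (x j))\<^sup>2)" for j by (metis complex_norm_square of_real_power)
  have d: "?d + ?t = (\<Sum>j\<in>J. M j j * complex_of_real ((cmod (x j))\<^sup>2))"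
    unfolding sum_distrib_left sum.distrib[symmetric] by (rule sum.cong) (simp_all add: algebra_simps)
  have "?l = (\<Sum>j\<in>J. (\<Sum>l\<in>J. if j = l then 0 else M j l * x j * cnj (x l)) + M j j * complex_of_real ((cmod (x j))\<^sup>2))"
  proof (rule sum.cong[OF refl])
    fix j assume j: "j \<in> J"
    show "(\<Sum>l\<in>J. M j l * x j * cnj (x l)) = (\<Sum>l\<in>J. if j = l then 0 else M j l * x j * cnj (x l)) + M j j * complex_of_real ((cmod (x j))\<^sup>2)"
      unfolding sq[symmetric] mult.assoc[symmetric] by (rule *[OF j])
  qed
  then show "?l = ?o + ?d + ?t" unfolding sum.distrib add.assoc d .
  have "?l' = (\<Sum>j\<in>J. (\<Sum>l\<in>J. if j = l then 0 else M j l * cnj (x j) * x l) + M j j * complex_of_real ((cmod (x j))\<^sup>2))"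
  proof (rule sum.cong[OF refl])
    fix j assume j: "j \<in> J"
    have "M j j * cnj (x j) * x j = M j j * complex_of_real ((cmod (x j))\<^sup>2)" unfolding sq[symmetric] by simp
    then show "(\<Sum>l\<in>J. M j l * cnj (x j) * x l) = (\<Sum>l\<in>J. if j = l then 0 else M j l * cnj (x j) * x l) + M j j * complex_of_real ((cmod (x j))\<^sup>2)"
      using *[OF j, of "\<lambda>l. M j l * cnj (x j) * x l"] by simp
  qed
  then show "?l' = ?o' + ?d + ?t" unfolding sum.distrib add.assoc d .
qed

section \<open>Assembling the error terms of the fixed point equation\<close>

context markov_model
begin

definition J :: "nat \<Rightarrow> nat set" where "J i = {..<n} - {i}"

definition off where
  "off i \<alpha> \<beta> f g b c \<omega> = cmod (\<Sum>j\<in>J i. \<Sum>l\<in>J i.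
     if \<alpha> j = \<beta> l then 0 else R0 i \<omega> (j, b) (l, c) * f (\<omega> (\<alpha> j)) * g (\<omega> (\<beta> l)))"

definition diag where
  "diag i \<alpha> b \<omega> = cmod (\<Sum>j\<in>J i. R0 i \<omega> (j, b) (j, b) * complex_of_real ((cmod (\<omega> (\<alpha> j)))\<^sup>2 - 1 / real n))"

definition "along_row i = (\<lambda>j::nat. (i::nat, j))"
definition "along_column i = (\<lambda>j::nat. (j, i::nat))"

definition dev where
  "dev i \<omega> = cmod (S \<omega> - s) + (3 / v + (1 / v\<^sup>2) * (\<Sum>l\<in>J i. cmod (\<omega> (along_column i l)))) * (1 / real n)"

definition ext where
  "ext i \<alpha> \<epsilon> \<omega> = 1 / v * (\<epsilon> * (\<Sum>j\<in>J i. (cmod (\<omega> (\<alpha> j)))\<^sup>2) +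
     1 / v\<^sup>2 * (\<epsilon> + 1 / \<epsilon> * (\<Sum>l\<in>J i. (cmod (\<omega> (along_column i l)))\<^sup>2 * indicator {x. cmod x > \<epsilon>} (\<omega> (along_column i l)))))"

text \<open>The right side of \<open>resolvent_corner\<close> term by term: \<open>q1 - s\<close>
  and \<open>q3 - s\<close> are split into off-diagonal, diagonal and trace parts
  (\<open>dev\<close> for the latter), and \<open>ext\<close> bounds \<open>x1\<close> and
  \<open>x2\<close>.\<close>

definition error where
  "error i \<epsilon> \<omega> = 1 / v * (1 / v * ((off i (along_row i) (along_row i) (\<lambda>x. x) cnj True True \<omega> + diag i (along_row i) True \<omega> + dev i \<omega>) +
       off i (along_row i) (along_column i) (\<lambda>x. x) (\<lambda>x. x) True False \<omega> +
       (off i (along_column i) (along_column i) cnj (\<lambda>x. x) False False \<omega> + diag i (along_column i) False \<omega> + dev i \<omega>) +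
       off i (along_column i) (along_row i) cnj cnj False True \<omega> + 2 * cmod (\<omega> (i, i))) +
     ext i (along_row i) \<epsilon> \<omega> + ext i (along_column i) \<epsilon> \<omega>)"

lemma corner_error:
  assumes i: "i < n" and \<epsilon>: "\<epsilon> > 0"
  shows "cmod (R \<omega> (i, False) (i, False) - pastur_kernel (\<eta> + s) (cmod ((\<Sum>k<n. \<omega> (i, k)) + z))) \<le> error i \<epsilon> \<omega>"
proof -
  interpret C: cavity n z \<eta> "W \<omega>" i by unfold_locales (use i \<eta> in auto)
  have R: "C.R = R \<omega>" and R0: "C.R0 = R0 i \<omega>" and J: "C.J = J i" and v: "C.v = v"
    by (simp_all add: C.R_def C.A_def R_def C.R0_def C.A0_def R0_def C.J_def J_def C.v_def v_def)
  have fJ: "finite (J i)" by (simp add: J_def)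
  have row_ne: "along_row i j \<noteq> along_column i l" "along_column i j \<noteq> along_row i l" if "j \<in> J i" for j l
    using that by (auto simp: along_row_def along_column_def J_def)
  have row_ne': "along_row i j \<noteq> along_column i l" "along_column i j \<noteq> along_row i l" if "l \<in> J i" for j l
    using that by (auto simp: along_row_def along_column_def J_def)
  have pt: "cmod (complex_of_real (1 / real n) * (\<Sum>j\<in>J i. R0 i \<omega> (j, c) (j, c)) - s) \<le> dev i \<omega>" for c
    using C.partial_trace[OF n0(1), of c s] unfolding R R0 J v S_def[symmetric] dev_def W_def along_column_def
    by (simp add: divide_inverse mult_ac)
  have tri: "cmod (a + b + c - d) \<le> cmod a + cmod b + cmod (c - d)" for a b c d :: complex
    using norm_triangle_ineq[of "a + b" "c - d"] norm_triangle_ineq[of a b] by (simp add: algebra_simps)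
  have q1: "cmod (C.q1 - s) \<le> off i (along_row i) (along_row i) (\<lambda>x. x) cnj True True \<omega> + diag i (along_row i) True \<omega> + dev i \<omega>"
    unfolding C.q1_def R0 J W_def quadratic_form_split(1)[OF fJ, of "\<lambda>j l. R0 i \<omega> (j, True) (l, True)" "\<lambda>j. \<omega> (i, j)" "1 / real n"]
    by (rule order_trans[OF tri]) (use pt[of True] in \<open>simp add: off_def diag_def along_row_def\<close>)
  have q3: "cmod (C.q3 - s) \<le> off i (along_column i) (along_column i) cnj (\<lambda>x. x) False False \<omega> + diag i (along_column i) False \<omega> + dev i \<omega>"
    unfolding C.q3_def R0 J W_def quadratic_form_split(2)[OF fJ, of "\<lambda>j l. R0 i \<omega> (j, False) (l, False)" "\<lambda>j. \<omega> (j, i)" "1 / real n"]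
    by (rule order_trans[OF tri]) (use pt[of False] in \<open>simp add: off_def diag_def along_column_def\<close>)
  have q2: "cmod C.q2 = off i (along_row i) (along_column i) (\<lambda>x. x) (\<lambda>x. x) True False \<omega>"
    unfolding C.q2_def R0 J W_def off_def
    by (intro arg_cong[where f = cmod] sum.cong refl) (simp only: row_ne if_False along_row_def[symmetric] along_column_def[symmetric], simp add: along_row_def along_column_def)
  have q4: "cmod C.q4 = off i (along_column i) (along_row i) cnj cnj False True \<omega>"
    unfolding C.q4_def R0 J W_def off_def
    by (intro arg_cong[where f = cmod] sum.cong refl) (simp only: row_ne if_False along_row_def[symmetric] along_column_def[symmetric], simp add: along_row_def along_column_def)
  have x: "cmod C.x1 \<le> ext i (along_row i) \<epsilon> \<omega>" "cmod C.x2 \<le> ext i (along_column i) \<epsilon> \<omega>"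
    using C.x_bounds[OF \<epsilon>] unfolding J v W_def ext_def along_row_def along_column_def by (simp_all add: divide_inverse mult_ac)
  have "cmod (C.r i - pastur_kernel (\<eta> + s) (cmod C.g)) \<le>
    1 / v * (1 / v * (cmod (C.q1 - s) + cmod C.q2 + cmod (C.q3 - s) + cmod C.q4 + 2 * cmod (W \<omega> i i)) + cmod C.x1 + cmod C.x2)"
    using C.resolvent_corner[OF s_bounds(2)] unfolding v .
  also have "\<dots> \<le> error i \<epsilon> \<omega>"
    unfolding error_def W_def[of \<omega> i i] q2 q4 using markov_model.v[OF markov_model_axioms]
    by (intro mult_left_mono add_mono q1 q3 x order_refl) auto
  finally show ?thesis unfolding C.r_def R C.g_def W_def .
qed

text \<open>Closed under sums and nonnegative scaling, so that the nested expression
  \<open>error\<close> is integrated by following its structure, integrability included.\<close>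

definition mean_le where
  "mean_le X c \<longleftrightarrow> integrable P X \<and> (\<integral>\<omega>. X \<omega> \<partial>P) \<le> (c :: real)"

lemma mean_le_const: "mean_le (\<lambda>_. c) c"
  by (simp add: mean_le_def P.prob_space)

lemma mean_le_add: "mean_le X c \<Longrightarrow> mean_le Y d \<Longrightarrow> mean_le (\<lambda>\<omega>. X \<omega> + Y \<omega>) (c + d)"
  unfolding mean_le_def by simp

lemma mean_le_scale: "k \<ge> 0 \<Longrightarrow> mean_le X c \<Longrightarrow> mean_le (\<lambda>\<omega>. k * X \<omega>) (k * c)"
  unfolding mean_le_def by (auto intro: mult_left_mono)

lemma mean_le_scale_right: "k \<ge> 0 \<Longrightarrow> mean_le X c \<Longrightarrow> mean_le (\<lambda>\<omega>. X \<omega> * k) (c * k)"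
  using mean_le_scale[of k X c] by (simp add: mult.commute)

lemma mean_le_sum:
  assumes "\<And>j. j \<in> J i \<Longrightarrow> mean_le (X j) c" "c \<ge> 0"
  shows "mean_le (\<lambda>\<omega>. \<Sum>j\<in>J i. X j \<omega>) (real n * c)"
  unfolding mean_le_def
proof
  show i: "integrable P (\<lambda>\<omega>. \<Sum>j\<in>J i. X j \<omega>)" using assms by (auto simp: mean_le_def)
  have "(\<integral>\<omega>. (\<Sum>j\<in>J i. X j \<omega>) \<partial>P) = (\<Sum>j\<in>J i. \<integral>\<omega>. X j \<omega> \<partial>P)"
    by (rule Bochner_Integration.integral_sum) (use assms in \<open>auto simp: mean_le_def\<close>)
  also have "\<dots> \<le> (\<Sum>j\<in>J i. c)" by (rule sum_mono) (use assms in \<open>auto simp: mean_le_def\<close>)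
  also have "\<dots> \<le> real n * c"
    using card_mono[of "{..<n}" "J i"] assms(2) by (auto simp: J_def intro!: mult_right_mono)
  finally show "(\<integral>\<omega>. (\<Sum>j\<in>J i. X j \<omega>) \<partial>P) \<le> real n * c" .
qed

definition bound where
  "bound \<epsilon> = (let d = deviation + (3 / v + 1 / v\<^sup>2 * (real n * (1 / sqrt (real n)))) * (1 / real n);
     x = 1 / v * (\<epsilon> * (real n * (1 / real n)) + 1 / v\<^sup>2 * (\<epsilon> + 1 / \<epsilon> * (real n * tail_moment \<epsilon>)))
   in 1 / v * (1 / v * ((off_bound + diag_bound \<epsilon> + d) + off_bound + (off_bound + diag_bound \<epsilon> + d) + off_bound
     + 2 * (1 / sqrt (real n))) + x + x))"

lemma mean_error:
  assumes i: "i < n" and \<epsilon>: "\<epsilon> > 0"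
  shows "mean_le (error i \<epsilon>) (bound \<epsilon>)"
proof -
  have J: "J i \<subseteq> {..<n}" by (auto simp: J_def)
  have inj: "inj_on (along_row i) (J i)" "inj_on (along_column i) (J i)" by (auto simp: along_row_def along_column_def inj_on_def)
  have im: "along_row i ` J i \<subseteq> cross i" "along_column i ` J i \<subseteq> cross i"
    using i by (auto simp: along_row_def along_column_def J_def cross_def I_def)
  have mI: "along_row i j \<in> I" "along_column i j \<in> I" if "j \<in> J i" for j
    using that i by (auto simp: along_row_def along_column_def J_def I_def)
  have ii: "(i, i) \<in> I" using i by (simp add: I_def)
  have off: "mean_le (off i \<alpha> \<beta> f g b c) off_bound"
    if "entry_pair N (1 / real n) f g" "inj_on \<alpha> (J i)" "\<alpha> ` J i \<subseteq> cross i" "inj_on \<beta> (J i)" "\<beta> ` J i \<subseteq> cross i" for \<alpha> \<beta> f g b c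
    unfolding mean_le_def off_def[abs_def] using off_diagonal_expectation[OF that(1) i J that(2-5)] by blast
  have diag: "mean_le (diag i \<alpha> b) (diag_bound \<epsilon>)" if "inj_on \<alpha> (J i)" "\<alpha> ` J i \<subseteq> cross i" for \<alpha> b
    unfolding mean_le_def diag_def[abs_def] using diagonal_expectation[OF i J that less_imp_le[OF \<epsilon>]] by blast
  have dv: "mean_le (\<lambda>\<omega>. cmod (S \<omega> - s)) deviation"
    unfolding mean_le_def using deviation_integrable by (simp add: deviation_def)
  have en: "mean_le (\<lambda>\<omega>. cmod (\<omega> u)) (1 / sqrt (real n))" "mean_le (\<lambda>\<omega>. (cmod (\<omega> u))\<^sup>2) (1 / real n)"
    "mean_le (\<lambda>\<omega>. (cmod (\<omega> u))\<^sup>2 * indicator {x. cmod x > \<epsilon>} (\<omega> u)) (tail_moment \<epsilon>)" if "u \<in> I" for u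
    unfolding mean_le_def using entry_expectations[OF that] by simp_all
  note rules = mean_le_add mean_le_scale mean_le_scale_right mean_le_const mean_le_sum en mI
  have dev: "mean_le (dev i) (deviation + (3 / v + 1 / v\<^sup>2 * (real n * (1 / sqrt (real n)))) * (1 / real n))"
    unfolding dev_def[abs_def] by (intro rules dv) (use v in auto)
  have ext: "mean_le (ext i \<alpha> \<epsilon>) (1 / v * (\<epsilon> * (real n * (1 / real n)) + 1 / v\<^sup>2 * (\<epsilon> + 1 / \<epsilon> * (real n * tail_moment \<epsilon>))))"
    if "\<And>j. j \<in> J i \<Longrightarrow> \<alpha> j \<in> I" for \<alpha>
    unfolding ext_def[abs_def] by (intro rules that tail_moment_nonneg) (use v \<epsilon> in auto)
  show ?thesis
    unfolding error_def[abs_def] bound_def Let_def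
    by (intro mean_le_add mean_le_scale off diag dev ext entry_pairs inj im mI en ii) (use v in auto)
qed

text \<open>Average the corner estimate over \<open>i\<close>. The diagonal entries of the resolvent
  average to \<open>s\<close> in mean, and the kernel at a row sum has for every \<open>i\<close>
  the same mean, an \<open>n\<close>-fold convolution at \<open>z\<close>. This last step requires
  the deterministic parameter \<open>\<eta> + s\<close> in the kernel.\<close>

theorem approximate_fixed_point:
  assumes \<epsilon>: "\<epsilon> > 0"
  shows "cmod (s - (smear N ^^ n) (\<lambda>g. pastur_kernel (\<eta> + s) (cmod g)) z) \<le> bound \<epsilon>"
proof -
  define \<phi> where "\<phi> = (\<lambda>g. pastur_kernel (\<eta> + s) (cmod g))"
  define F where "F i \<omega> = \<phi> ((\<Sum>k<n. \<omega> (i, k)) + z)" for i and \<omega> :: "nat \<times> nat \<Rightarrow> complex"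
  have w: "Im (\<eta> + s) > 0" using \<eta> s_bounds(2) by simp
  have bb: "bounded_borel \<phi>" unfolding \<phi>_def by (rule bounded_borel_kernel[OF w])
  have [measurable]: "\<phi> \<in> borel_measurable borel" using bb by (simp add: bounded_borel_def)
  have F: "(\<integral>\<omega>. F i \<omega> \<partial>P) = (smear N ^^ n) \<phi> z" if i: "i < n" for i
  proof -
    have eq: "I \<inter> ({i} \<times> UNIV) = (\<lambda>k. (i, k)) ` {..<n}" using i by (auto simp: I_def)
    have inj: "inj_on (\<lambda>k. (i, k)) {..<n}" by (auto simp: inj_on_def)
    have "(\<integral>\<omega>. \<phi> (z + (\<Sum>u\<in>I \<inter> ({i} \<times> UNIV). \<omega> u)) \<partial>PiM I (\<lambda>_. N)) = (smear N ^^ card (I \<inter> ({i} \<times> UNIV))) \<phi> z"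
      by (rule integral_sum_coordinates[OF complex_law fin(1) bb])
    then show ?thesis unfolding eq card_image[OF inj] sum.reindex[OF inj] P_def F_def
      by (simp add: o_def add.commute)
  qed
  have Fm: "F i \<in> borel_measurable P" if "i < n" for i
  proof -
    have "(\<lambda>\<omega>. (\<Sum>k<n. W \<omega> i k) + z) \<in> borel_measurable P"
      by (intro borel_measurable_add borel_measurable_sum W_measurable that) auto
    then show ?thesis unfolding F_def[abs_def] W_def by measurable
  qed
  have Fi: "integrable P (F i)" if "i < n" for i
    using cmod_pastur_kernel_le[OF w] by (intro P.integrable_const_bound[OF _ Fm[OF that], of "1 / Im (\<eta> + s)"]) (auto simp: F_def \<phi>_def)
  have Ri: "integrable P (\<lambda>\<omega>. R \<omega> (i, False) (i, False))" if "i < n" for i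
    by (rule P.integrable_const_bound[OF _ R_measurable, of _ _ "1 / v"]) (use R_bound that in auto)
  have "of_nat n * s = (\<integral>\<omega>. (\<Sum>i<n. R \<omega> (i, False) (i, False)) \<partial>P)"
    unfolding s_def S_eq[abs_def] using n0 by simp
  also have "\<dots> = (\<Sum>i<n. \<integral>\<omega>. R \<omega> (i, False) (i, False) \<partial>P)"
    by (rule Bochner_Integration.integral_sum) (use Ri in auto)
  finally have ns: "of_nat n * s = (\<Sum>i<n. \<integral>\<omega>. R \<omega> (i, False) (i, False) \<partial>P)" .
  have "of_nat n * (s - (smear N ^^ n) \<phi> z) = (\<Sum>i<n. (\<integral>\<omega>. R \<omega> (i, False) (i, False) \<partial>P) - (smear N ^^ n) \<phi> z)"
    unfolding right_diff_distrib ns by (simp add: sum_subtractf)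
  also have "\<dots> = (\<Sum>i<n. \<integral>\<omega>. R \<omega> (i, False) (i, False) - F i \<omega> \<partial>P)"
    by (rule sum.cong[OF refl]) (simp add: Ri Fi F)
  also have "cmod \<dots> \<le> (\<Sum>i<n. bound \<epsilon>)"
  proof (rule order_trans[OF norm_sum], rule sum_mono)
    fix i assume "i \<in> {..<n}"
    then have i: "i < n" by simp
    note E = mean_error[OF i \<epsilon>, unfolded mean_le_def]
    have "cmod (\<integral>\<omega>. R \<omega> (i, False) (i, False) - F i \<omega> \<partial>P) \<le> (\<integral>\<omega>. error i \<epsilon> \<omega> \<partial>P)"
      using Bochner_Integration.integrable_diff[OF Ri[OF i] Fi[OF i]] corner_error[OF i \<epsilon>] E
      unfolding F_def \<phi>_def by (intro norm_integral_le) blast+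
    then show "cmod (\<integral>\<omega>. R \<omega> (i, False) (i, False) - F i \<omega> \<partial>P) \<le> bound \<epsilon>" using E by linarith
  qed
  finally have "real n * cmod (s - (smear N ^^ n) \<phi> z) \<le> real n * bound \<epsilon>" by (simp add: norm_mult)
  then show ?thesis using n0 by (simp add: \<phi>_def)
qed

end

section \<open>Passage to the limit\<close>

text \<open>For fixed \<open>\<epsilon>\<close> all terms vanish as \<open>n\<close> grows except
  those proportional to \<open>\<epsilon>\<close>; these persist and are made small afterwards by
  the choice of \<open>\<epsilon>\<close>.\<close>

lemma bound_tendsto:
  assumes N: "\<And>n. n \<ge> 1 \<Longrightarrow> entry_law (N n) (1 / real n)"
    and tail: "(\<lambda>n. real n * entry_law.tail_moment (N n) \<epsilon>) \<longlonglongrightarrow> 0"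
    and \<eta>: "Im \<eta> > 0" and \<epsilon>: "\<epsilon> > 0" and \<delta>: "\<delta> > 0"
  defines "v \<equiv> Im \<eta>"
  shows "\<forall>\<^sub>F n in sequentially. markov_model.bound (N n) n z \<eta> \<epsilon> \<le>
    \<epsilon> * (1 / v * (1 / v * (2 * (1 / v * sqrt 2)) + 2 * (1 / v * (1 + 1 / v\<^sup>2)))) + \<delta>"
proof -
  have v: "v > 0" using \<eta> by (simp add: v_def)
  define T where "T n = real n * entry_law.tail_moment (N n) \<epsilon>" for n
  define f where "f n = sqrt (2 * (real n / v\<^sup>2)) * (1 / real n)" for n
  \<comment> \<open>The deviation bound at level \<open>a = n powr (-1/4)\<close>: it tends to 0
    while \<open>a^2 n = sqrt n\<close> still tends to infinity.\<close>
  define h where "h n = 2 * (real n powr (-1/4) + 4 / v * exp (- ((real n powr (-1/4))\<^sup>2 * v\<^sup>2 * real n / 2)))" for n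
  define l where "l n = (3 / v + 1 / v\<^sup>2 * (real n * (1 / sqrt (real n)))) * (1 / real n)" for n
  define u where "u n = 1 / sqrt (real n)" for n
  define E where "E n = (let d = h n + l n;
      x = 1 / v * (\<epsilon> + 1 / v\<^sup>2 * (\<epsilon> + 1 / \<epsilon> * T n)); q = 1 / v * (\<epsilon> * sqrt 2 + 4 * T n)
    in 1 / v * (1 / v * ((f n + q + d) + f n + (f n + q + d) + f n + 2 * u n) + x + x))" for n
  have "f \<longlonglongrightarrow> 0" unfolding f_def using v by real_asymp
  moreover have "h \<longlonglongrightarrow> 0" unfolding h_def using v by real_asymp
  moreover have "l \<longlonglongrightarrow> 0" unfolding l_def using v by real_asymp
  moreover have "u \<longlonglongrightarrow> 0" unfolding u_def by real_asymp
  ultimately have lims: "f \<longlonglongrightarrow> 0" "h \<longlonglongrightarrow> 0" "l \<longlonglongrightarrow> 0" "u \<longlonglongrightarrow> 0" by blast+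
  have T: "T \<longlonglongrightarrow> 0" using tail unfolding T_def .
  have "E \<longlonglongrightarrow> (let d = 0 + 0;
      x = 1 / v * (\<epsilon> + 1 / v\<^sup>2 * (\<epsilon> + 1 / \<epsilon> * 0)); q = 1 / v * (\<epsilon> * sqrt 2 + 4 * 0)
    in 1 / v * (1 / v * ((0 + q + d) + 0 + (0 + q + d) + 0 + 2 * 0) + x + x))"
    unfolding E_def[abs_def] Let_def by (intro tendsto_intros lims T)
  also have "(let d = 0 + 0;
      x = 1 / v * (\<epsilon> + 1 / v\<^sup>2 * (\<epsilon> + 1 / \<epsilon> * 0)); q = 1 / v * (\<epsilon> * sqrt 2 + 4 * 0)
    in 1 / v * (1 / v * ((0 + q + d) + 0 + (0 + q + d) + 0 + 2 * 0) + x + x))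
    = \<epsilon> * (1 / v * (1 / v * (2 * (1 / v * sqrt 2)) + 2 * (1 / v * (1 + 1 / v\<^sup>2))))" (is "_ = ?c")
    by (simp add: Let_def algebra_simps add_divide_distrib)
  finally have "\<forall>\<^sub>F n in sequentially. E n < ?c + \<delta>"
    by (rule order_tendstoD) (use \<delta> in simp)
  then show ?thesis
    using eventually_ge_at_top[of 1]
  proof eventually_elim
    case (elim n)
    interpret entry_law "N n" "1 / real n" by (rule N) (rule elim)
    interpret M: markov_model "N n" n z \<eta> by unfold_locales (use elim \<eta> in auto)
    have vv: "M.v = v" by (simp add: M.v_def v_def)
    have n: "real n > 0" using elim by simp
    have "real n powr (-1/4) > 0" using n by simp
    then have d: "M.deviation \<le> h n" unfolding h_def vv[symmetric] by (rule M.deviation_le)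
    define Q where "Q d = 1 / v * (1 / v * ((f n + 1 / v * (\<epsilon> * sqrt 2 + 4 * T n) + d) + f n
        + (f n + 1 / v * (\<epsilon> * sqrt 2 + 4 * T n) + d) + f n + 2 * u n)
      + 1 / v * (\<epsilon> + 1 / v\<^sup>2 * (\<epsilon> + 1 / \<epsilon> * T n)) + 1 / v * (\<epsilon> + 1 / v\<^sup>2 * (\<epsilon> + 1 / \<epsilon> * T n)))" for d
    have "\<epsilon> * (real n * (1 / real n)) = \<epsilon>" using n by simp
    then have "M.bound \<epsilon> = Q (M.deviation + l n)"
      unfolding M.bound_def Let_def Q_def M.off_bound_def M.diag_bound_def vv f_def T_def l_def u_def by (simp only:)
    also have "\<dots> \<le> Q (h n + l n)"
    proof -
      have "(f n + 1 / v * (\<epsilon> * sqrt 2 + 4 * T n) + (M.deviation + l n)) \<le> (f n + 1 / v * (\<epsilon> * sqrt 2 + 4 * T n) + (h n + l n))"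
        using d by simp
      moreover have "1 / v \<ge> 0" using v by simp
      ultimately show ?thesis unfolding Q_def
        by (intro mult_left_mono[of _ _ "1 / v"] add_right_mono add_mono) simp_all
    qed
    also have "Q (h n + l n) = E n" unfolding Q_def E_def Let_def ..
    finally have "M.bound \<epsilon> \<le> E n" .
    then show ?case using elim by simp
  qed
qed

theorem expected_transform_limit:
  fixes z \<eta> a b :: complex
  assumes N: "\<And>n. n \<ge> 1 \<Longrightarrow> entry_law (N n) (1 / real n)"
    and tail: "\<And>\<epsilon>. \<epsilon> > 0 \<Longrightarrow> (\<lambda>n. real n * entry_law.tail_moment (N n) \<epsilon>) \<longlonglongrightarrow> 0"
    and m11: "(\<lambda>n. real n * mom11 (N n)) \<longlonglongrightarrow> (Re a)\<^sup>2 + (Re b)\<^sup>2"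
    and m12: "(\<lambda>n. real n * mom12 (N n)) \<longlonglongrightarrow> Re a * Im a + Re b * Im b"
    and m22: "(\<lambda>n. real n * mom22 (N n)) \<longlonglongrightarrow> (Im a)\<^sup>2 + (Im b)\<^sup>2"
    and \<eta>: "Im \<eta> > 0"
  defines "s \<equiv> \<lambda>n. markov_model.s (N n) n z \<eta>"
  shows "(\<lambda>n. s n - (\<integral>g. pastur_kernel (\<eta> + s n) (cmod (g - z)) \<partial>planar_normal a b)) \<longlonglongrightarrow> 0"
proof (rule tendstoI)
  fix e :: real assume e: "e > 0"
  define v where "v = Im \<eta>"
  have v: "v > 0" using \<eta> by (simp add: v_def)
  define c where "c = 1 / v * (1 / v * (2 * (1 / v * sqrt 2)) + 2 * (1 / v * (1 + 1 / v\<^sup>2)))"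
  have c: "c > 0" unfolding c_def using v by (intro mult_pos_pos add_pos_pos) auto
  \<comment> \<open>Leaves \<open>e / 4\<close> for the terms proportional to
    \<open>\<epsilon>\<close>, \<open>e / 4\<close> for the vanishing ones and \<open>e / 4\<close>
    for the Gaussian replacement.\<close>
  define \<epsilon> where "\<epsilon> = e / (4 * c)"
  have \<epsilon>: "\<epsilon> > 0" "\<epsilon> * c = e / 4" using c e by (simp_all add: \<epsilon>_def)
  have e4: "e / 4 > 0" using e by simp
  have "\<forall>\<^sub>F n in sequentially. markov_model.bound (N n) n z \<eta> \<epsilon> \<le> \<epsilon> * c + e / 4"
    unfolding c_def v_def by (rule bound_tendsto[OF N tail[OF \<epsilon>(1)] \<eta> \<epsilon>(1) e4])
  moreover have "\<forall>\<^sub>F n in sequentially. \<forall>w z. Im w \<ge> v \<longrightarrow>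
    cmod ((smear (N n) ^^ n) (\<lambda>g. pastur_kernel w (cmod g)) z - (\<integral>g. pastur_kernel w (cmod (g - z)) \<partial>planar_normal a b)) \<le> e / 4"
    by (rule replacement_clt[OF N tail m11 m12 m22 v e4])
  ultimately show "\<forall>\<^sub>F n in sequentially.
      dist (s n - (\<integral>g. pastur_kernel (\<eta> + s n) (cmod (g - z)) \<partial>planar_normal a b)) 0 < e"
    using eventually_ge_at_top[of 1]
  proof eventually_elim
    case (elim n)
    interpret entry_law "N n" "1 / real n" by (rule N) (rule elim)
    interpret M: markov_model "N n" n z \<eta> by unfold_locales (use elim \<eta> in auto)
    have s: "s n = M.s" by (simp add: s_def)
    have "v \<le> Im (\<eta> + s n)" using M.s_bounds(2) by (simp add: s v_def)
    then have 1: "cmod ((smear (N n) ^^ n) (\<lambda>g. pastur_kernel (\<eta> + s n) (cmod g)) z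
        - (\<integral>g. pastur_kernel (\<eta> + s n) (cmod (g - z)) \<partial>planar_normal a b)) \<le> e / 4"
      using elim(2) by blast
    have 2: "cmod (s n - (smear (N n) ^^ n) (\<lambda>g. pastur_kernel (\<eta> + s n) (cmod g)) z) \<le> e / 4 + e / 4"
      using M.approximate_fixed_point[OF \<epsilon>(1)] elim(1) \<epsilon>(2) unfolding s by linarith
    have "cmod (s n - (\<integral>g. pastur_kernel (\<eta> + s n) (cmod (g - z)) \<partial>planar_normal a b)) \<le> (e / 4 + e / 4) + e / 4"
      by (rule norm_diff_triangle_le[OF 2 1])
    then show ?case using e by simp
  qed
qed

section \<open>Symmetrized laws and the passage back to the half line\<close>

definition signed_law :: "(nat \<Rightarrow> real) \<Rightarrow> nat \<Rightarrow> real measure" where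
  "signed_law x n = distr (uniform_count_measure ({..<n} \<times> (UNIV :: bool set))) borel (\<lambda>(k, b). if b then x k else - x k)"

lemma measurable_uniform_count: "f \<in> uniform_count_measure A \<rightarrow>\<^sub>M M \<longleftrightarrow> f \<in> A \<rightarrow> space M"
  unfolding uniform_count_measure_def measurable_point_measure_eq1 by simp

lemma integral_signed_law:
  fixes f :: "real \<Rightarrow> 'b :: {banach, second_countable_topology}"
  assumes f: "f \<in> borel_measurable borel"
  shows "(\<integral>t. f t \<partial>signed_law x n) = (1 / (2 * real n)) *\<^sub>R (\<Sum>k<n. f (x k) + f (- x k))"
proof -
  have "(\<integral>t. f t \<partial>signed_law x n) = (\<integral>p. f (case p of (k, b) \<Rightarrow> if b then x k else - x k) \<partial>uniform_count_measure ({..<n} \<times> (UNIV :: bool set)))"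
    unfolding signed_law_def by (rule integral_distr[OF _ f]) (simp add: measurable_uniform_count)
  also have "\<dots> = (\<Sum>p\<in>{..<n} \<times> (UNIV :: bool set). (1 / (2 * real n)) *\<^sub>R f (case p of (k, b) \<Rightarrow> if b then x k else - x k))"
    unfolding uniform_count_measure_def
    by (subst lebesgue_integral_point_measure_finite) (simp_all add: card_cartesian_product mult.commute)
  also have "\<dots> = (\<Sum>k<n. \<Sum>b\<in>(UNIV :: bool set). (1 / (2 * real n)) *\<^sub>R f (if b then x k else - x k))"
    unfolding sum.cartesian_product by (intro sum.cong) auto
  also have "\<dots> = (1 / (2 * real n)) *\<^sub>R (\<Sum>k<n. f (x k) + f (- x k))"
    unfolding scaleR_sum_right by (intro sum.cong) (simp_all add: UNIV_bool scaleR_add_right add.commute)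
  finally show ?thesis .
qed

lemma real_distribution_signed_law:
  assumes "n \<ge> 1"
  shows "real_distribution (signed_law x n)"
proof -
  have "prob_space (uniform_count_measure ({..<n} \<times> (UNIV :: bool set)))"
    using assms by (intro prob_space_uniform_count_measure) (auto simp: lessThan_empty_iff)
  then have "prob_space (signed_law x n)"
    unfolding signed_law_def by (rule prob_space.prob_space_distr) (simp add: measurable_uniform_count)
  then show ?thesis
    by (simp add: real_distribution_def real_distribution_axioms_def signed_law_def)
qed

text \<open>The kernel at \<open>x k\<close> is the average of the contributions of the two atoms
  \<open>x k\<close> and \<open>- x k\<close>.\<close>

lemma stieltjes_signed_law:
  assumes "Im \<eta> > 0"
  shows "stieltjes (signed_law x n) \<eta> = (\<Sum>k<n. pastur_kernel \<eta> (x k)) / of_nat n"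
proof -
  have "stieltjes (signed_law x n) \<eta> = (1 / (2 * real n)) *\<^sub>R
      (\<Sum>k<n. 1 / (complex_of_real (x k) - \<eta>) + 1 / (complex_of_real (- x k) - \<eta>))"
    unfolding stieltjes_def by (rule integral_signed_law) measurable
  also have "\<dots> = (1 / (2 * real n)) *\<^sub>R (\<Sum>k<n. 2 * pastur_kernel \<eta> (x k))"
  proof -
    have "1 / (complex_of_real t - \<eta>) + 1 / (complex_of_real (- t) - \<eta>) = 2 * pastur_kernel \<eta> t" for t
      unfolding pastur_kernel_split[OF assms] by simp
    then show ?thesis by (simp only:)
  qed
  also have "\<dots> = (\<Sum>k<n. pastur_kernel \<eta> (x k)) / of_nat n"
    unfolding sum_distrib_left[symmetric] by (simp add: scaleR_conv_of_real)
  finally show ?thesis .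
qed

lemma borel_prob_real_distribution: "borel_prob \<nu> \<longleftrightarrow> real_distribution \<nu>"
  by (auto simp: borel_prob_def real_distribution_def real_distribution_axioms_def)

lemma ennreal_two_mult_half: "2 * x / 2 = (x :: ennreal)"
  unfolding mult.commute[of 2 x] by (rule ennreal_mult_divide_eq) auto

text \<open>The identity of indicators \<open>1\<^sub>A(|t|) + 1\<^sub>A(-|t|) = 1\<^sub>A(t) + 1\<^sub>A(-t)\<close>, integrated.\<close>
lemma symmetrization_distr_abs:
  assumes \<nu>: "symmetric_prob \<nu>"
  shows "symmetrization (distr \<nu> borel abs) = \<nu>"
proof -
  have s: "sets \<nu> = sets borel" and sy: "\<And>A. A \<in> sets borel \<Longrightarrow> emeasure \<nu> (uminus ` A) = emeasure \<nu> A"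
    using \<nu> by (auto simp: symmetric_prob_def borel_prob_def)
  have [measurable_cong]: "sets \<nu> = sets borel" by (rule s)
  have sp: "space \<nu> = UNIV" using sets_eq_imp_space_eq[OF s] by simp
  have sets: "sets (symmetrization (distr \<nu> borel abs)) = sets borel"
    using sets.sigma_sets_eq[of "borel :: real measure"] by (simp add: symmetrization_def)
  show ?thesis
  proof (rule measure_eqI)
    show "sets (symmetrization (distr \<nu> borel abs)) = sets \<nu>" by (simp add: sets s)
    fix A assume "A \<in> sets (symmetrization (distr \<nu> borel abs))"
    then have A[measurable]: "A \<in> sets borel" by (simp add: sets)
    have mA[measurable]: "uminus ` A \<in> sets borel" by (rule uminus_image_borel[OF A])
    have em: "emeasure (distr \<nu> borel abs) B = (\<integral>\<^sup>+t. indicator B \<bar>t\<bar> \<partial>\<nu>)" if [measurable]: "B \<in> sets borel" for B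
      proof -
      have "emeasure (distr \<nu> borel abs) B = (\<integral>\<^sup>+t. indicator B t \<partial>distr \<nu> borel abs)" by simp
      also have "\<dots> = (\<integral>\<^sup>+t. indicator B \<bar>t\<bar> \<partial>\<nu>)" by (rule nn_integral_distr) measurable
      finally show ?thesis .
    qed
    have ind: "indicator A \<bar>t\<bar> + indicator (uminus ` A) \<bar>t\<bar> = indicator A t + (indicator (uminus ` A) t :: ennreal)" for t :: real
    proof -
      have "t \<in> uminus ` A \<longleftrightarrow> - t \<in> A" for t :: real by (metis image_eqI imageE minus_minus)
      then show ?thesis by (cases "t \<ge> 0") (auto simp: indicator_def add.commute)
    qed
    have "emeasure (distr \<nu> borel abs) A + emeasure (distr \<nu> borel abs) (uminus ` A)
        = (\<integral>\<^sup>+t. indicator A \<bar>t\<bar> + indicator (uminus ` A) \<bar>t\<bar> \<partial>\<nu>)"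
      unfolding em[OF A] em[OF mA] by (rule nn_integral_add[symmetric]) measurable
    also have "\<dots> = emeasure \<nu> A + emeasure \<nu> (uminus ` A)"
      unfolding ind by (subst nn_integral_add) (simp_all add: s mA)
    also have "\<dots> = 2 * emeasure \<nu> A" by (simp add: sy[OF A] mult_2)
    finally show "emeasure (symmetrization (distr \<nu> borel abs)) A = emeasure \<nu> A"
      by (subst emeasure_symmetrization) (simp_all add: ennreal_two_mult_half)
  qed
qed

text \<open>The preimage \<open>B\<close> of \<open>A\<close> under \<open>abs\<close> is a
  symmetric set, so the symmetrization gives it the original mass of \<open>B\<close>; for a law on
  the half line this is the mass of \<open>A\<close>.\<close>

lemma symmetrization_inject:
  assumes \<nu>: "borel_prob \<nu>" "emeasure \<nu> {..<0} = 0" and \<nu>': "borel_prob \<nu>'" "emeasure \<nu>' {..<0} = 0"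
    and eq: "symmetrization \<nu> = symmetrization \<nu>'"
  shows "\<nu> = \<nu>'"
proof (rule measure_eqI)
  show "sets \<nu> = sets \<nu>'" using \<nu> \<nu>' by (simp add: borel_prob_def)
  fix A assume "A \<in> sets \<nu>"
  then have A: "A \<in> sets borel" using \<nu> by (simp add: borel_prob_def)
  define B where "B = abs -` A"
  have "(abs :: real \<Rightarrow> real) \<in> borel_measurable borel" by simp
  then have B: "B \<in> sets borel" using A measurable_sets[of abs borel borel A] by (simp add: B_def)
  have mB: "uminus ` B = B"
  proof (intro equalityI subsetI)
    fix t assume "t \<in> B"
    then have "- t \<in> B" by (simp add: B_def)
    from imageI[OF this, of uminus] show "t \<in> uminus ` B" by simp
  qed (auto simp: B_def)
  have val: "emeasure (symmetrization \<mu>) B = emeasure \<mu> A" if \<mu>: "borel_prob \<mu>" "emeasure \<mu> {..<0} = 0" for \<mu>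
  proof -
    have s: "sets \<mu> = sets borel" using \<mu> by (simp add: borel_prob_def)
    have "AE t in \<mu>. t \<notin> {..<0}" by (rule AE_not_in) (use \<mu> s in \<open>auto simp: null_sets_def\<close>)
    then have "AE t in \<mu>. t \<in> B \<longleftrightarrow> t \<in> A" by eventually_elim (auto simp: B_def)
    then have "emeasure \<mu> B = emeasure \<mu> A" by (rule emeasure_eq_AE) (use A B s in auto)
    then show ?thesis
      by (simp add: emeasure_symmetrization[OF s B] mB mult_2[symmetric] ennreal_two_mult_half)
  qed
  show "emeasure \<nu> A = emeasure \<nu>' A" using val[OF \<nu>] val[OF \<nu>'] eq by simp
qed

text \<open>Abstract convergence applies to the laws of plus or minus the singular values.
  Reflection leaves their transforms unchanged, so the limit is symmetric; folding it by
  \<open>abs\<close> gives the limit on the half line, whose symmetrization is the limit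
  again.\<close>

theorem (in prob_space) singular_law_limit:
  assumes r: "r \<in> borel_measurable M"
    and B: "\<And>n. B n \<in> carrier_mat n n"
    and conv: "\<And>\<eta>. \<eta> \<in> rational_upper \<Longrightarrow>
      (\<lambda>n. S n \<eta> - (\<integral>g. pastur_kernel (\<eta> + S n \<eta>) (r g) \<partial>M)) \<longlonglongrightarrow> 0"
    and S: "\<And>n \<eta>. n \<ge> 1 \<Longrightarrow> Im \<eta> > 0 \<Longrightarrow> S n \<eta> = (\<Sum>k<n. pastur_kernel \<eta> (singular_values (B n) ! k)) / of_nat n"
  shows "\<exists>\<nu>. borel_prob \<nu> \<and> emeasure \<nu> {..<0} = 0 \<and> converges_weakly (\<lambda>n. singular_law (B n)) \<nu> \<and>
    symmetric_prob (symmetrization \<nu>) \<and>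
    (\<forall>\<eta>. Im \<eta> > 0 \<longrightarrow> stieltjes (symmetrization \<nu>) \<eta> =
      (\<integral>g. pastur_kernel (\<eta> + stieltjes (symmetrization \<nu>) \<eta>) (r g) \<partial>M))"
proof -
  define x where "x n k = singular_values (B n) ! k" for n k
  \<comment> \<open>Shifted by one, since for size 0 there are no atoms and hence no probability
    measure.\<close>
  define \<mu> where "\<mu> n = signed_law (x (Suc n)) (Suc n)" for n
  have \<mu>: "real_distribution (\<mu> n)" for n unfolding \<mu>_def by (rule real_distribution_signed_law) simp
  have st: "stieltjes (\<mu> n) \<eta> = S (Suc n) \<eta>" if "Im \<eta> > 0" for n \<eta>
    using S[of "Suc n" \<eta>] that by (simp add: \<mu>_def stieltjes_signed_law x_def)
  have "\<exists>\<nu>. real_distribution \<nu> \<and> weak_conv_m \<mu> \<nu> \<and>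
    (\<forall>\<eta>. Im \<eta> > 0 \<longrightarrow> stieltjes \<nu> \<eta> = (\<integral>g. pastur_kernel (\<eta> + stieltjes \<nu> \<eta>) (r g) \<partial>M))"
  proof (rule approx_pastur_weak_limit[OF r \<mu>])
    fix \<eta> assume \<eta>: "\<eta> \<in> rational_upper"
    then have "Im \<eta> > 0" by (simp add: rational_upper_def)
    then show "(\<lambda>n. stieltjes (\<mu> n) \<eta> - (\<integral>g. pastur_kernel (\<eta> + stieltjes (\<mu> n) \<eta>) (r g) \<partial>M)) \<longlonglongrightarrow> 0"
      using LIMSEQ_Suc[OF conv[OF \<eta>]] by (simp add: st)
  qed
  then obtain \<nu> where \<nu>: "real_distribution \<nu>" and w: "weak_conv_m \<mu> \<nu>"
    and fp: "\<And>\<eta>. Im \<eta> > 0 \<Longrightarrow> stieltjes \<nu> \<eta> = (\<integral>g. pastur_kernel (\<eta> + stieltjes \<nu> \<eta>) (r g) \<partial>M)"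
    by blast
  interpret \<nu>: real_distribution \<nu> by (rule \<nu>)
  note [measurable_cong] = \<nu>.events_eq_borel
  have reflect: "real_distribution (distr \<nu> borel uminus)"
    using \<nu>.prob_space_distr[of uminus borel] by (simp add: real_distribution_def real_distribution_axioms_def)
  have "stieltjes (distr \<nu> borel uminus) \<eta> = stieltjes \<nu> \<eta>" if \<eta>: "Im \<eta> > 0" for \<eta>
  proof -
    have "stieltjes (distr \<nu> borel uminus) \<eta> = (\<integral>t. 1 / (complex_of_real (- t) - \<eta>) \<partial>\<nu>)"
      unfolding stieltjes_def by (rule integral_distr) measurable
    moreover have "(\<lambda>n. \<integral>t. 1 / (complex_of_real (- t) - \<eta>) \<partial>\<mu> n) \<longlonglongrightarrow> (\<integral>t. 1 / (complex_of_real (- t) - \<eta>) \<partial>\<nu>)"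
    proof (rule weak_conv_imp_integral_bdd_continuous_conv[OF \<mu> \<nu> w])
      show "isCont (\<lambda>t. 1 / (complex_of_real (- t) - \<eta>)) t" for t
        using of_real_diff_nonzero(1)[OF \<eta>, of "- t"] by (intro continuous_intros) auto
      show "cmod (1 / (complex_of_real (- t) - \<eta>)) \<le> 1 / Im \<eta>" for t by (rule cmod_inverse_diff_le[OF \<eta>])
    qed
    moreover have "(\<integral>t. 1 / (complex_of_real (- t) - \<eta>) \<partial>\<mu> n) = stieltjes (\<mu> n) \<eta>" for n
      unfolding \<mu>_def stieltjes_def by (subst (1 2) integral_signed_law) (simp_all add: add.commute)
    ultimately show ?thesis
      using weak_conv_stieltjes[OF \<mu> \<nu> w \<eta>] by (simp add: LIMSEQ_unique)
  qed
  then have reflected: "distr \<nu> borel uminus = \<nu>" by (rule stieltjes_unique[OF reflect \<nu>])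
  have sym: "symmetric_prob \<nu>"
    unfolding symmetric_prob_def borel_prob_real_distribution
  proof (intro conjI ballI \<nu>)
    fix A :: "real set" assume A: "A \<in> sets borel"
    have "emeasure (distr \<nu> borel uminus) A = emeasure \<nu> (uminus -` A \<inter> space \<nu>)"
      by (rule emeasure_distr) (use A in auto)
    also have "uminus -` A \<inter> space \<nu> = uminus ` A" by (auto simp: image_iff) (metis minus_minus)
    finally show "emeasure \<nu> (uminus ` A) = emeasure \<nu> A" by (simp add: reflected)
  qed
  define \<nu>' where "\<nu>' = distr \<nu> borel abs"
  have s\<nu>: "symmetrization \<nu>' = \<nu>" unfolding \<nu>'_def by (rule symmetrization_distr_abs[OF sym])
  have bp: "borel_prob \<nu>'"
    unfolding borel_prob_def \<nu>'_def using \<nu>.prob_space_distr[of abs borel] by simp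
  have "abs -` {..<0 :: real} \<inter> space \<nu> = {}" by auto
  then have neg: "emeasure \<nu>' {..<0} = 0" unfolding \<nu>'_def by (subst emeasure_distr) auto
  have "converges_weakly (\<lambda>n. singular_law (B n)) \<nu>'"
    unfolding converges_weakly_def
  proof (intro allI impI, elim conjE)
    fix f :: "real \<Rightarrow> real" assume c: "continuous_on UNIV f" and b: "bounded (range f)"
    obtain C where C: "\<bar>f t\<bar> \<le> C" for t using b by (auto simp: bounded_iff)
    have fm[measurable]: "f \<in> borel_measurable borel" by (rule borel_measurable_continuous_onI[OF c])
    have "(\<lambda>n. \<integral>t. f \<bar>t\<bar> \<partial>\<mu> n) \<longlonglongrightarrow> (\<integral>t. f \<bar>t\<bar> \<partial>\<nu>)"
    proof (rule weak_conv_imp_integral_bdd_continuous_conv[OF \<mu> \<nu> w])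
      show "isCont (\<lambda>t. f \<bar>t\<bar>) t" for t
        using c by (intro isCont_o2[of t abs f]) (auto simp: continuous_on_eq_continuous_at intro!: continuous_intros)
    qed (use C in simp)
    also have "(\<integral>t. f \<bar>t\<bar> \<partial>\<nu>) = (\<integral>t. f t \<partial>\<nu>')" unfolding \<nu>'_def by (rule integral_distr[symmetric]) measurable
    also have "(\<lambda>n. \<integral>t. f \<bar>t\<bar> \<partial>\<mu> n) = (\<lambda>n. \<integral>t. f t \<partial>singular_law (B (Suc n)))"
    proof
      fix n
      have nn: "x (Suc n) k \<ge> 0" if "k < Suc n" for k
        unfolding x_def by (rule singular_values_nonneg[OF B nth_mem]) (simp add: length_singular_values[OF B] that)
      have d: "dim_row (B (Suc n)) = Suc n" using B by blast
      have "(\<integral>t. f \<bar>t\<bar> \<partial>\<mu> n) = (1 / (2 * real (Suc n))) *\<^sub>R (\<Sum>k<Suc n. f \<bar>x (Suc n) k\<bar> + f \<bar>- x (Suc n) k\<bar>)"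
        unfolding \<mu>_def by (rule integral_signed_law) measurable
      also have "(\<Sum>k<Suc n. f \<bar>x (Suc n) k\<bar> + f \<bar>- x (Suc n) k\<bar>) = (\<Sum>k<Suc n. 2 * f (x (Suc n) k))"
        by (rule sum.cong[OF refl]) (use nn in auto)
      also have "(1 / (2 * real (Suc n))) *\<^sub>R \<dots> = (\<Sum>k<Suc n. (1 / real (Suc n)) *\<^sub>R f (x (Suc n) k))"
        unfolding scaleR_sum_right by (rule sum.cong) (simp_all add: divide_simps)
      also have "\<dots> = (\<integral>k. f (x (Suc n) k) \<partial>uniform_count_measure {..<Suc n})"
        unfolding uniform_count_measure_def
        by (subst lebesgue_integral_point_measure_finite) simp_all
      also have "\<dots> = (\<integral>t. f t \<partial>singular_law (B (Suc n)))"
        unfolding singular_law_def d x_def by (rule integral_distr[symmetric]) (simp_all add: measurable_uniform_count)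
      finally show "(\<integral>t. f \<bar>t\<bar> \<partial>\<mu> n) = (\<integral>t. f t \<partial>singular_law (B (Suc n)))" .
    qed
    finally show "(\<lambda>n. \<integral>t. f t \<partial>singular_law (B n)) \<longlonglongrightarrow> (\<integral>t. f t \<partial>\<nu>')"
      by (rule LIMSEQ_imp_Suc)
  qed
  then show ?thesis using bp neg sym fp by (intro exI[of _ \<nu>']) (simp add: s\<nu>)
qed

section \<open>Random Markov generators\<close>

text \<open>What determines the limit law for \<open>K\<close> and \<open>z\<close>, without
  reference to the matrices; at most one law qualifies, so it can be chosen from \<open>K\<close>
  and \<open>z\<close> alone.\<close>

definition generator_limit :: "real^2^2 \<Rightarrow> complex \<Rightarrow> real measure \<Rightarrow> bool" where
  "generator_limit K z \<nu> \<longleftrightarrow> borel_prob \<nu> \<and> emeasure \<nu> {..<0} = 0 \<and>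
     symmetric_prob (symmetrization \<nu>) \<and> stieltjes_equation K z (symmetrization \<nu>)"

context random_generator
begin

definition scaling :: "nat \<Rightarrow> real" where
  "scaling n = 1 / (sqrt (law_var (L n)) * sqrt (real n))"

definition normalize :: "nat \<Rightarrow> complex \<Rightarrow> complex" where
  "normalize n x = complex_of_real (scaling n) * (x - law_mean (L n))"

definition entry :: "nat \<Rightarrow> complex measure" where
  "entry n = distr (L n) borel (normalize n)"

definition indices :: "nat \<Rightarrow> (nat \<times> nat) set" where
  "indices n = {..<n} \<times> {..<n}"

text \<open>Restricted to the index set, as points of the product space are extensional
  functions.\<close>

definition entries :: "nat \<Rightarrow> 'a \<Rightarrow> nat \<times> nat \<Rightarrow> complex" where
  "entries n \<omega> = (\<lambda>p\<in>indices n. normalize n (X n (fst p) (snd p) \<omega>))"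

lemma normalize_measurable[measurable]: "normalize n \<in> borel_measurable borel"
  unfolding normalize_def[abs_def] by measurable

lemma X_measurable: "n \<ge> 1 \<Longrightarrow> i < n \<Longrightarrow> j < n \<Longrightarrow> X n i j \<in> borel_measurable P"
  using indep[of n] by (auto simp: indep_vars_def)

lemma L_law:
  assumes "n \<ge> 1"
  shows "prob_space (L n)" "sets (L n) = sets borel"
proof -
  have "L n = distr P borel (X n 0 0)" using law[of 0 n 0] assms by simp
  then show "prob_space (L n)" "sets (L n) = sets borel"
    using prob_space_distr[OF X_measurable[OF assms, of 0 0]] assms by simp_all
qed

lemma scaling_square:
  assumes "n \<ge> 1"
  shows "(scaling n)\<^sup>2 = 1 / (law_var (L n) * real n)"
  using var_pos[OF assms] by (simp add: scaling_def power_divide power_mult_distrib)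

lemma n_scaling_square:
  assumes "n \<ge> 1"
  shows "real n * (scaling n)\<^sup>2 = 1 / law_var (L n)"
  using var_pos[OF assms] assms by (simp add: scaling_square)

lemma normalize_measurable_L: "n \<ge> 1 \<Longrightarrow> normalize n \<in> borel_measurable (L n)"
  using normalize_measurable[of n] L_law(2)[of n] measurable_cong_sets[of "L n" borel borel "borel :: complex measure"] by simp

lemma integral_entry:
  fixes f :: "complex \<Rightarrow> 'b :: {banach, second_countable_topology}"
  assumes "n \<ge> 1" "f \<in> borel_measurable borel"
  shows "(\<integral>x. f x \<partial>entry n) = (\<integral>x. f (normalize n x) \<partial>L n)"
  unfolding entry_def by (rule integral_distr[OF normalize_measurable_L[OF assms(1)] assms(2)])

lemma cmod_normalize: "(cmod (normalize n x))\<^sup>2 = (scaling n)\<^sup>2 * (cmod (x - law_mean (L n)))\<^sup>2"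
  by (simp add: normalize_def norm_mult power_mult_distrib)

lemma entry_law_entry:
  assumes n: "n \<ge> 1"
  shows "entry_law (entry n) (1 / real n)"
proof -
  interpret Ln: prob_space "L n" by (rule L_law(1)[OF n])
  note [measurable] = normalize_measurable_L[OF n]
  show ?thesis
  proof (intro entry_law.intro entry_law_axioms.intro)
    show "prob_space (entry n)" unfolding entry_def by (rule Ln.prob_space_distr) measurable
    show "sets (entry n) = sets borel" by (simp add: entry_def)
    have "(\<integral>x. x \<partial>entry n) = (\<integral>x. complex_of_real (scaling n) * (x - law_mean (L n)) \<partial>L n)"
      using integral_entry[OF n, of "\<lambda>x. x"] by (simp add: normalize_def)
    also have "\<dots> = complex_of_real (scaling n) * ((\<integral>x. x \<partial>L n) - law_mean (L n))"
      using mean_finite[OF n] by (simp add: Ln.prob_space)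
    finally show "(\<integral>x. x \<partial>entry n) = 0" by (simp add: law_mean_def)
    have "integrable (L n) (\<lambda>x. (cmod (normalize n x))\<^sup>2)"
      unfolding cmod_normalize using var_finite[OF n] by simp
    then show "integrable (entry n) (\<lambda>x. (cmod x)\<^sup>2)"
      unfolding entry_def by (subst integrable_distr_eq) simp_all
    have "(\<integral>x. (cmod x)\<^sup>2 \<partial>entry n) = (scaling n)\<^sup>2 * law_var (L n)"
      using integral_entry[OF n, of "\<lambda>x. (cmod x)\<^sup>2"] by (simp add: cmod_normalize law_var_def)
    then show "(\<integral>x. (cmod x)\<^sup>2 \<partial>entry n) = 1 / real n"
      using var_pos[OF n] by (simp add: scaling_square[OF n])
  qed
qed

text \<open>A normalized entry above \<open>\<epsilon>\<close> means that \<open>|x - m|^2\<close>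
  exceeds \<open>\<epsilon>^2 n\<close> times the variance, so \<open>n\<close> times the tail is at
  most the Lindeberg quotient at \<open>\<epsilon>^2\<close>.\<close>

lemma entry_tail:
  assumes \<epsilon>: "\<epsilon> > 0"
  shows "(\<lambda>n. real n * entry_law.tail_moment (entry n) \<epsilon>) \<longlonglongrightarrow> 0"
proof (rule tendsto_sandwich[OF _ _ tendsto_const])
  let ?u = "\<lambda>n. (\<integral>x. (cmod (x - law_mean (L n)))\<^sup>2 *
     indicator {x. (cmod (x - law_mean (L n)))\<^sup>2 \<ge> \<epsilon>\<^sup>2 * real n * law_var (L n)} x \<partial>L n) / law_var (L n)"
  show "?u \<longlonglongrightarrow> 0" by (rule lindeberg) (use \<epsilon> in simp)
  show "\<forall>\<^sub>F n in sequentially. 0 \<le> real n * entry_law.tail_moment (entry n) \<epsilon>"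
    using eventually_ge_at_top[of 1]
  proof eventually_elim
    case (elim n)
    interpret E: entry_law "entry n" "1 / real n" by (rule entry_law_entry[OF elim])
    show ?case using E.tail_moment_nonneg by simp
  qed
  show "\<forall>\<^sub>F n in sequentially. real n * entry_law.tail_moment (entry n) \<epsilon> \<le> ?u n"
    using eventually_ge_at_top[of 1]
  proof eventually_elim
    case (elim n)
    interpret Ln: prob_space "L n" by (rule L_law(1)[OF elim])
    interpret E: entry_law "entry n" "1 / real n" by (rule entry_law_entry[OF elim])
    define m where "m = law_mean (L n)"
    define V where "V = law_var (L n)"
    have V: "V > 0" using var_pos[OF elim] by (simp add: V_def)
    define B where "B = {x. (cmod (x - m))\<^sup>2 \<ge> \<epsilon>\<^sup>2 * real n * V}"
    have sL: "sets (L n) = sets borel" by (rule L_law(2)[OF elim])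
    have "B \<in> sets borel" unfolding B_def by measurable
    then have BL: "B \<in> sets (L n)" using sL by simp
    have vi: "integrable (L n) (\<lambda>x. (cmod (x - m))\<^sup>2)" using var_finite[OF elim] by (simp add: m_def)
    have int: "integrable (L n) (\<lambda>x. (cmod (x - m))\<^sup>2 * indicator B x)"
      by (rule Bochner_Integration.integrable_bound[OF vi])
         (use BL borel_measurable_integrable[OF vi] in \<open>auto simp: indicator_def intro!: borel_measurable_times borel_measurable_indicator\<close>)
    have tm: "E.tail_moment \<epsilon> = (\<integral>x. (cmod (normalize n x))\<^sup>2 * indicator {x. cmod x > \<epsilon>} (normalize n x) \<partial>L n)"
      unfolding E.tail_moment_def by (rule integral_entry[OF elim]) measurable
    also have "\<dots> \<le> (\<integral>x. (scaling n)\<^sup>2 * ((cmod (x - m))\<^sup>2 * indicator B x) \<partial>L n)"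
    proof (rule integral_mono)
      have "integrable (entry n) (\<lambda>x. (cmod x)\<^sup>2 * indicator {x. cmod x > \<epsilon>} x)" by (rule E.integrable_tail)
      then show "integrable (L n) (\<lambda>x. (cmod (normalize n x))\<^sup>2 * indicator {x. cmod x > \<epsilon>} (normalize n x))"
        unfolding entry_def by (subst (asm) integrable_distr_eq) (use normalize_measurable_L[OF elim] in auto)
      show "integrable (L n) (\<lambda>x. (scaling n)\<^sup>2 * ((cmod (x - m))\<^sup>2 * indicator B x))" using int by simp
      fix x
      have "x \<in> B" if "cmod (normalize n x) > \<epsilon>"
      proof -
        have "\<epsilon>\<^sup>2 \<le> (cmod (normalize n x))\<^sup>2" using that \<epsilon> by (intro power_mono) auto
        then have "\<epsilon>\<^sup>2 \<le> (cmod (x - m))\<^sup>2 / (V * real n)"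
          unfolding cmod_normalize scaling_square[OF elim] by (simp add: V_def m_def)
        then show ?thesis using V elim by (simp add: B_def pos_le_divide_eq mult_ac)
      qed
      then show "(cmod (normalize n x))\<^sup>2 * indicator {x. cmod x > \<epsilon>} (normalize n x) \<le> (scaling n)\<^sup>2 * ((cmod (x - m))\<^sup>2 * indicator B x)"
        by (auto simp: cmod_normalize m_def indicator_def)
    qed
    also have "\<dots> = (scaling n)\<^sup>2 * (\<integral>x. (cmod (x - m))\<^sup>2 * indicator B x \<partial>L n)" by simp
    finally have "real n * E.tail_moment \<epsilon> \<le> real n * ((scaling n)\<^sup>2 * (\<integral>x. (cmod (x - m))\<^sup>2 * indicator B x \<partial>L n))"
      by (intro mult_left_mono) auto
    also have "\<dots> = (real n * (scaling n)\<^sup>2) * (\<integral>x. (cmod (x - m))\<^sup>2 * indicator B x \<partial>L n)" by simp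
    finally show ?case unfolding n_scaling_square[OF elim] by (simp add: m_def V_def B_def)
  qed
qed

lemma entry_moments:
  "(\<lambda>n. real n * mom11 (entry n)) \<longlonglongrightarrow> K $ 1 $ 1" "(\<lambda>n. real n * mom12 (entry n)) \<longlonglongrightarrow> K $ 1 $ 2"
  "(\<lambda>n. real n * mom12 (entry n)) \<longlonglongrightarrow> K $ 2 $ 1" "(\<lambda>n. real n * mom22 (entry n)) \<longlonglongrightarrow> K $ 2 $ 2"
proof -
  define C where "C n = (1 / law_var (L n)) *\<^sub>R law_cov (L n)" for n
  have lim: "(\<lambda>n. C n $ i $ j) \<longlonglongrightarrow> K $ i $ j" for i j
    unfolding C_def by (intro tendsto_vec_nth cov_limit)
  have prod: "real n * (\<integral>x. p x * q x \<partial>entry n) = 1 / law_var (L n) * (\<integral>x. p (x - law_mean (L n)) * q (x - law_mean (L n)) \<partial>L n)"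
    if n: "n \<ge> 1" and pq: "p = Re \<or> p = Im" "q = Re \<or> q = Im" for n and p q :: "complex \<Rightarrow> real"
  proof -
    have "(\<lambda>x. p x * q x) \<in> borel_measurable borel" using pq by auto
    then have "(\<integral>x. p x * q x \<partial>entry n) = (\<integral>x. p (normalize n x) * q (normalize n x) \<partial>L n)"
      by (rule integral_entry[OF n])
    also have "\<dots> = (\<integral>x. (scaling n)\<^sup>2 * (p (x - law_mean (L n)) * q (x - law_mean (L n))) \<partial>L n)"
      using pq by (intro Bochner_Integration.integral_cong refl) (auto simp: normalize_def power2_eq_square)
    finally show ?thesis unfolding n_scaling_square[OF n, symmetric] by simp
  qed
  have ev: "(\<lambda>n. real n * (\<integral>x. p x * q x \<partial>entry n)) \<longlonglongrightarrow> K $ i $ j"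
    if pq: "p = Re \<or> p = Im" "q = Re \<or> q = Im" and ij: "\<And>w. vec_of_complex w $ i = p w" "\<And>w. vec_of_complex w $ j = q w" for p q i j
  proof (rule Lim_transform_eventually[OF lim])
    show "\<forall>\<^sub>F n in sequentially. C n $ i $ j = real n * (\<integral>x. p x * q x \<partial>entry n)"
      using eventually_ge_at_top[of 1] by eventually_elim (simp add: prod[OF _ pq] C_def law_cov_def ij)
  qed
  have vec: "vec_of_complex w $ 1 = Re w" "vec_of_complex w $ 2 = Im w" for w
    by (simp_all add: vec_of_complex_def)
  show "(\<lambda>n. real n * mom11 (entry n)) \<longlonglongrightarrow> K $ 1 $ 1"
    using ev[of Re Re 1 1] vec by (simp add: second_moments_def power2_eq_square)
  show "(\<lambda>n. real n * mom12 (entry n)) \<longlonglongrightarrow> K $ 1 $ 2"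
    using ev[of Re Im 1 2] vec by (simp add: second_moments_def)
  show "(\<lambda>n. real n * mom12 (entry n)) \<longlonglongrightarrow> K $ 2 $ 1"
    using ev[of Im Re 2 1] vec by (simp add: second_moments_def mult.commute)
  show "(\<lambda>n. real n * mom22 (entry n)) \<longlonglongrightarrow> K $ 2 $ 2"
    using ev[of Im Im 2 2] vec by (simp add: second_moments_def power2_eq_square)
qed

text \<open>Both properties pass to the limit from covariance matrices; they are what a factor of
  \<open>K\<close>, and with it \<open>gaussian_law K\<close>, requires.\<close>

lemma K_psd: "transpose K = K" "0 \<le> t \<bullet> (K *v t)"
proof -
  have k21: "K $ 2 $ 1 = K $ 1 $ 2" by (rule LIMSEQ_unique[OF entry_moments(3,2)])
  then show "transpose K = K"
    by (simp add: transpose_def Finite_Cartesian_Product.vec_eq_iff forall_2)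
  have quad: "t \<bullet> (K *v t) = (t $ 1)\<^sup>2 * K $ 1 $ 1 + 2 * (t $ 1 * t $ 2) * K $ 1 $ 2 + (t $ 2)\<^sup>2 * K $ 2 $ 2"
    using k21 by (simp add: inner_vec_def matrix_vector_mult_def sum_2 power2_eq_square algebra_simps)
  have lim: "(\<lambda>n. (t $ 1)\<^sup>2 * (real n * mom11 (entry n)) + 2 * (t $ 1 * t $ 2) * (real n * mom12 (entry n)) + (t $ 2)\<^sup>2 * (real n * mom22 (entry n)))
    \<longlonglongrightarrow> (t $ 1)\<^sup>2 * K $ 1 $ 1 + 2 * (t $ 1 * t $ 2) * K $ 1 $ 2 + (t $ 2)\<^sup>2 * K $ 2 $ 2"
    by (intro tendsto_intros entry_moments)
  have nonneg: "\<forall>\<^sub>F n in sequentially. 0 \<le> (t $ 1)\<^sup>2 * (real n * mom11 (entry n)) + 2 * (t $ 1 * t $ 2) * (real n * mom12 (entry n)) + (t $ 2)\<^sup>2 * (real n * mom22 (entry n))"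
    using eventually_ge_at_top[of 1]
  proof eventually_elim
    case (elim n)
    interpret E: entry_law "entry n" "1 / real n" by (rule entry_law_entry[OF elim])
    have "0 \<le> (\<integral>x. (t $ 1 * Re x + t $ 2 * Im x)\<^sup>2 \<partial>entry n)" by simp
    also have "\<dots> = (\<integral>x. (t $ 1)\<^sup>2 * (Re x)\<^sup>2 + 2 * (t $ 1 * t $ 2) * (Re x * Im x) + (t $ 2)\<^sup>2 * (Im x)\<^sup>2 \<partial>entry n)"
      by (intro Bochner_Integration.integral_cong refl) (simp add: power2_eq_square algebra_simps)
    also have "\<dots> = (t $ 1)\<^sup>2 * mom11 (entry n) + 2 * (t $ 1 * t $ 2) * mom12 (entry n) + (t $ 2)\<^sup>2 * mom22 (entry n)"
      using E.integrable_moments by (simp add: second_moments_def)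
    finally have "0 \<le> real n * \<dots>" by simp
    then show ?case by (simp add: algebra_simps)
  qed
  show "0 \<le> t \<bullet> (K *v t)"
    unfolding quad by (rule tendsto_lowerbound[OF lim nonneg sequentially_bot])
qed

text \<open>Transfers every estimate on the canonical product space to \<open>P\<close>, one size
  \<open>n\<close> at a time.\<close>

lemma distr_entries:
  assumes n: "n \<ge> 1"
  shows "entries n \<in> P \<rightarrow>\<^sub>M PiM (indices n) (\<lambda>_. entry n)"
    and "distr P (PiM (indices n) (\<lambda>_. entry n)) (entries n) = PiM (indices n) (\<lambda>_. entry n)"
proof -
  define Y where "Y p \<omega> = normalize n (X n (fst p) (snd p) \<omega>)" for p \<omega>
  have Xm: "X n (fst p) (snd p) \<in> borel_measurable P" if "p \<in> indices n" for p
    using that X_measurable[OF n] by (auto simp: indices_def)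
  have Ym: "Y p \<in> borel_measurable P" if "p \<in> indices n" for p
    unfolding Y_def[abs_def] by (rule measurable_compose[OF Xm[OF that] normalize_measurable])
  have ne: "indices n \<noteq> {}" using n by (auto simp: indices_def lessThan_empty_iff)
  have "indep_vars (\<lambda>_. borel) (\<lambda>p. X n (fst p) (snd p)) (indices n)"
    using indep[OF n] by (simp add: indices_def case_prod_beta')
  then have "indep_vars (\<lambda>_. borel) (\<lambda>p \<omega>. normalize n (X n (fst p) (snd p) \<omega>)) (indices n)"
    by (rule indep_vars_compose2) simp
  then have "indep_vars (\<lambda>_. borel) Y (indices n)" unfolding Y_def[abs_def] .
  then have "distr P (PiM (indices n) (\<lambda>_. borel)) (\<lambda>\<omega>. \<lambda>p\<in>indices n. Y p \<omega>) = PiM (indices n) (\<lambda>p. distr P borel (Y p))"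
    using indep_vars_iff_distr_eq_PiM'[OF ne, where X = Y and M' = "\<lambda>_. borel"] Ym by blast
  also have "PiM (indices n) (\<lambda>p. distr P borel (Y p)) = PiM (indices n) (\<lambda>_. entry n)"
  proof (rule PiM_cong[OF refl])
    fix p assume p: "p \<in> indices n"
    have "entry n = distr (distr P borel (X n (fst p) (snd p))) borel (normalize n)"
      using law[of "fst p" n "snd p"] p by (auto simp: entry_def indices_def)
    also have "\<dots> = distr P borel (normalize n \<circ> X n (fst p) (snd p))"
      by (rule distr_distr[OF normalize_measurable Xm[OF p]])
    finally show "distr P borel (Y p) = entry n" by (simp add: Y_def[abs_def] o_def)
  qed
  finally have d: "distr P (PiM (indices n) (\<lambda>_. borel)) (entries n) = PiM (indices n) (\<lambda>_. entry n)"
    by (simp add: entries_def[abs_def] Y_def)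
  have sets: "sets (PiM (indices n) (\<lambda>_. entry n)) = sets (PiM (indices n) (\<lambda>_. borel))"
    by (rule sets_PiM_cong) (simp_all add: entry_def)
  have "entries n \<in> P \<rightarrow>\<^sub>M PiM (indices n) (\<lambda>_. borel)"
    unfolding entries_def[abs_def] using Ym[unfolded Y_def[abs_def]] by (rule measurable_restrict)
  then show "entries n \<in> P \<rightarrow>\<^sub>M PiM (indices n) (\<lambda>_. entry n)"
    using measurable_cong_sets[OF refl sets] by blast
  show "distr P (PiM (indices n) (\<lambda>_. entry n)) (entries n) = PiM (indices n) (\<lambda>_. entry n)"
    using distr_cong[OF refl sets, of P "entries n" "entries n"] d by simp
qed

lemma markov_model_entry:
  assumes "n \<ge> 1" "Im \<eta> > 0"
  shows "markov_model (entry n) n \<eta>"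
  using assms entry_law_entry by (simp add: markov_model_def markov_model_axioms_def)

text \<open>Borel-Cantelli: the exponential bounds are summable in \<open>n\<close>, which works for
  any coupling of the different sizes.\<close>

lemma transform_concentration:
  assumes \<eta>: "Im \<eta> > 0"
  shows "AE \<omega> in P. (\<lambda>n. markov_model.S n z \<eta> (entries n \<omega>) - markov_model.s (entry n) n z \<eta>) \<longlonglongrightarrow> 0"
proof -
  define S where "S n \<omega> = markov_model.S n z \<eta> (entries n \<omega>)" for n \<omega>
  define s where "s n = markov_model.s (entry n) n z \<eta>" for n
  define v where "v = Im \<eta>"
  have v: "v > 0" using \<eta> by (simp add: v_def)
  have part: "AE \<omega> in P. (\<lambda>n. f (S n \<omega>) - f (s n)) \<longlonglongrightarrow> 0" if f: "f = Re \<or> f = Im" for f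
  proof -
    have small: "AE \<omega> in P. \<forall>\<^sub>F n in sequentially. \<bar>f (S n \<omega>) - f (s n)\<bar> < a" if a: "a > 0" for a
    proof -
      \<comment> \<open>Indexed by \<open>Suc n\<close>, so that every matrix is nonempty; the
        exponential bound is then below a geometric term with exponent \<open>n\<close>.\<close>
      define A where "A n = {\<omega> \<in> space P. \<bar>f (S (Suc n) \<omega>) - f (s (Suc n))\<bar> \<ge> a}" for n
      have A: "A n \<in> sets P \<and> measure P (A n) \<le> 2 * exp (- (a\<^sup>2 * v\<^sup>2 / 2)) ^ n" for n
      proof -
        interpret M: markov_model "entry (Suc n)" "Suc n" z \<eta> by (rule markov_model_entry) (use \<eta> in auto)
        have I: "M.I = indices (Suc n)" by (simp add: M.I_def indices_def)
        have MP: "M.P = PiM (indices (Suc n)) (\<lambda>_. entry (Suc n))" by (simp add: M.P_def I)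
        have E: "entries (Suc n) \<in> P \<rightarrow>\<^sub>M M.P" "distr P M.P (entries (Suc n)) = M.P"
          using distr_entries[of "Suc n"] unfolding MP by simp_all
        let ?B = "{\<omega> \<in> space M.P. \<bar>f (M.S \<omega>) - f M.s\<bar> \<ge> a}"
        have "(\<lambda>\<omega>. f (M.S \<omega>)) \<in> borel_measurable M.P" using f M.S_measurable by auto
        then have B: "?B \<in> sets M.P" by measurable
        have "A n = entries (Suc n) -` ?B \<inter> space P"
          using measurable_space[OF E(1)] by (auto simp: A_def S_def s_def)
        then have "A n \<in> sets P" "measure P (A n) = measure M.P ?B"
          using measurable_sets[OF E(1) B] measure_distr[OF E(1) B] E(2) by simp_all
        moreover have "measure M.P ?B \<le> 2 * exp (- (a\<^sup>2 * v\<^sup>2 * real (Suc n) / 2))"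
          using M.concentration[OF a f] by (simp add: M.v_def v_def)
        moreover have "exp (- (a\<^sup>2 * v\<^sup>2 * real (Suc n) / 2)) \<le> exp (- (a\<^sup>2 * v\<^sup>2 / 2)) ^ n"
          unfolding exp_of_nat_mult[symmetric] by (simp add: algebra_simps)
        ultimately show ?thesis by auto
      qed
      have "exp (- (a\<^sup>2 * v\<^sup>2 / 2)) < 1" using a v by simp
      then have "summable (\<lambda>n. 2 * exp (- (a\<^sup>2 * v\<^sup>2 / 2)) ^ n)"
        by (intro summable_mult summable_geometric) simp
      then have "summable (\<lambda>n. measure P (A n))"
        by (rule summable_comparison_test_ev[rotated]) (use A in simp)
      then have "AE \<omega> in P. \<forall>\<^sub>F n in sequentially. \<omega> \<in> space P - A n"
        by (intro borel_cantelli_AE1) (use A in \<open>auto simp: emeasure_eq_measure\<close>)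
      then show ?thesis
      proof eventually_elim
        case (elim \<omega>)
        then have "\<forall>\<^sub>F n in sequentially. \<bar>f (S (Suc n) \<omega>) - f (s (Suc n))\<bar> < a"
          by eventually_elim (auto simp: A_def)
        then show ?case by (rule eventually_sequentially_Suc[THEN iffD1])
      qed
    qed
    \<comment> \<open>Countably many levels \<open>a = 1 / (k + 1)\<close> give a single exceptional
      null set.\<close>
    have "AE \<omega> in P. \<forall>k::nat. \<forall>\<^sub>F n in sequentially. \<bar>f (S n \<omega>) - f (s n)\<bar> < 1 / real (Suc k)"
      unfolding AE_all_countable by (intro allI small) simp
    then show ?thesis
    proof eventually_elim
      case (elim \<omega>)
      show ?case
      proof (rule tendstoI)
        fix e :: real assume "e > 0"
        then obtain k where "1 / real (Suc k) < e" using nat_approx_posE by blast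
        moreover have "\<forall>\<^sub>F n in sequentially. \<bar>f (S n \<omega>) - f (s n)\<bar> < 1 / real (Suc k)" using elim by blast
        ultimately show "\<forall>\<^sub>F n in sequentially. dist (f (S n \<omega>) - f (s n)) 0 < e"
          by (auto elim: eventually_mono)
      qed
    qed
  qed
  have "AE \<omega> in P. (\<lambda>n. S n \<omega> - s n) \<longlonglongrightarrow> 0"
    using part[of Re] part[of Im] by (auto simp: tendsto_complex_iff)
  then show ?thesis unfolding S_def s_def .
qed

section \<open>From the centred matrix back to the generator itself\<close>

definition shifted :: "complex \<Rightarrow> nat \<Rightarrow> 'a \<Rightarrow> complex mat" where
  "shifted z n \<omega> = normalized_generator (L n) n (\<lambda>i j. X n i j \<omega>) - z \<cdot>\<^sub>m 1\<^sub>m n"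

lemma shifted_carrier: "shifted z n \<omega> \<in> carrier_mat n n"
  unfolding shifted_def by (rule minus_carrier_mat) simp

text \<open>Centring the entries changes the matrix by a multiple of the all-ones matrix.\<close>
lemma shifted_entry:
  assumes ij: "i < n" "j < n"
  shows "shifted z n \<omega> $$ (i, j) =
    markov_matrix n z (\<lambda>i j. entries n \<omega> (i, j)) i j + complex_of_real (scaling n) * law_mean (L n)"
proof -
  define c where "c = complex_of_real (scaling n)"
  have e: "entries n \<omega> (i, k) = c * X n i k \<omega> - c * law_mean (L n)" if "k < n" for k
    using ij that by (simp add: entries_def indices_def normalize_def c_def right_diff_distrib)
  have "(\<Sum>k<n. entries n \<omega> (i, k)) = (\<Sum>k<n. c * X n i k \<omega> - c * law_mean (L n))"
    by (rule sum.cong[OF refl]) (simp add: e)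
  also have "\<dots> = c * (\<Sum>k<n. X n i k \<omega>) - of_nat n * (c * law_mean (L n))"
    by (simp add: sum_subtractf sum_distrib_left)
  finally have sum: "(\<Sum>k<n. entries n \<omega> (i, k)) = c * (\<Sum>k<n. X n i k \<omega>) - of_nat n * (c * law_mean (L n))" .
  have "shifted z n \<omega> $$ (i, j) = c * (X n i j \<omega> - (if i = j then (\<Sum>k<n. X n i k \<omega>) else 0)
      + of_nat n * law_mean (L n) * (if i = j then 1 else 0)) - z * (if i = j then 1 else 0)"
    using ij by (auto simp: shifted_def normalized_generator_def markov_generator_def mat_diag_def c_def scaling_def)
  then show ?thesis
    unfolding markov_matrix_def sum e[OF ij(2)] c_def[symmetric] by (auto simp: algebra_simps)
qed

definition transform :: "complex \<Rightarrow> nat \<Rightarrow> complex \<Rightarrow> 'a \<Rightarrow> complex" where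
  "transform z n \<eta> \<omega> = (\<Sum>k<n. pastur_kernel \<eta> (singular_values (shifted z n \<omega>) ! k)) / of_nat n"

text \<open>Undoing the centring is a rank one change, so the normalized traces differ by at most
  \<open>(2 / Im \<eta>) / (2 n)\<close>.\<close>

lemma transform_diff:
  assumes n: "n \<ge> 1" and \<eta>: "Im \<eta> > 0"
  shows "cmod (transform z n \<eta> \<omega> - markov_model.S n z \<eta> (entries n \<omega>)) \<le> 1 / Im \<eta> * (1 / real n)"
proof -
  interpret M: markov_model "entry n" n z \<eta> by (rule markov_model_entry[OF n \<eta>])
  let ?B = "\<lambda>i j. shifted z n \<omega> $$ (i, j)"
  have "transform z n \<eta> \<omega> = (2 * (\<Sum>k<n. pastur_kernel \<eta> (singular_values (shifted z n \<omega>) ! k))) / (2 * of_nat n)"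
    by (simp add: transform_def)
  also have "\<dots> = (\<Sum>p\<in>block_index n. block_resolvent n ?B \<eta> p p) / (2 * of_nat n)"
    unfolding trace_block_resolvent[OF shifted_carrier \<eta>] ..
  finally have "transform z n \<eta> \<omega> - M.S (entries n \<omega>) =
      ((\<Sum>p\<in>block_index n. block_resolvent n ?B \<eta> p p) - (\<Sum>p\<in>block_index n. M.R (entries n \<omega>) p p)) / (2 * of_nat n)"
    by (simp add: M.S_def diff_divide_distrib)
  then have "cmod (transform z n \<eta> \<omega> - M.S (entries n \<omega>)) =
      cmod ((\<Sum>p\<in>block_index n. block_resolvent n ?B \<eta> p p) - (\<Sum>p\<in>block_index n. M.R (entries n \<omega>) p p)) / (2 * real n)"
    by (simp add: norm_divide norm_mult)
  also have "\<dots> \<le> (2 / Im \<eta>) / (2 * real n)"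
  proof (rule divide_right_mono)
    show "cmod ((\<Sum>p\<in>block_index n. block_resolvent n ?B \<eta> p p) - (\<Sum>p\<in>block_index n. M.R (entries n \<omega>) p p)) \<le> 2 / Im \<eta>"
      by (rule trace_resolvent_rank_one[OF M.resolvent_R resolvent_of_block_resolvent[OF \<eta>] _ \<eta>,
            where p = "\<lambda>_. complex_of_real (scaling n) * law_mean (L n)" and q = "\<lambda>_. 1"])
         (simp add: shifted_entry M.W_def[abs_def])
  qed simp
  finally show ?thesis by simp
qed

lemma Im_transform_nonneg:
  assumes n: "n \<ge> 1" and \<eta>: "Im \<eta> > 0"
  shows "Im (transform z n \<eta> \<omega>) \<ge> 0"
  unfolding transform_def stieltjes_signed_law[OF \<eta>, symmetric]
  by (rule real_distribution.Im_stieltjes_nonneg[OF real_distribution_signed_law[OF n] \<eta>])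

lemma gaussian_law_properties:
  "prob_space (gaussian_law K)" "(\<lambda>g. cmod (g - z)) \<in> borel_measurable (gaussian_law K)"
proof -
  obtain a b where "gaussian_law K = planar_normal a b" using gaussian_law_planar[OF K_psd] by metis
  then have c: "complex_law (gaussian_law K)" using complex_law_normal by simp
  then show "prob_space (gaussian_law K)" by (simp add: complex_law_def)
  have "sets (gaussian_law K) = sets borel" using c by (simp add: complex_law_def)
  then have "borel_measurable (gaussian_law K) = (borel_measurable borel :: (complex \<Rightarrow> real) set)"
    by (rule measurable_cong_sets) simp
  then show "(\<lambda>g. cmod (g - z)) \<in> borel_measurable (gaussian_law K)" by simp
qed

lemma expected_limit:
  fixes z \<eta> :: complex
  assumes \<eta>: "Im \<eta> > 0"
  defines "s \<equiv> \<lambda>n. markov_model.s (entry n) n z \<eta>"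
  shows "(\<lambda>n. s n - (\<integral>g. pastur_kernel (\<eta> + s n) (cmod (g - z)) \<partial>gaussian_law K)) \<longlonglongrightarrow> 0"
proof -
  obtain a b where ab: "gaussian_law K = planar_normal a b" "K $ 1 $ 1 = (Re a)\<^sup>2 + (Re b)\<^sup>2"
    "K $ 1 $ 2 = Re a * Im a + Re b * Im b" "K $ 2 $ 2 = (Im a)\<^sup>2 + (Im b)\<^sup>2"
    using gaussian_law_planar[OF K_psd] by metis
  show ?thesis unfolding s_def ab(1)
    by (rule expected_transform_limit[OF entry_law_entry entry_tail
          entry_moments(1)[unfolded ab] entry_moments(2)[unfolded ab] entry_moments(4)[unfolded ab] \<eta>])
qed

lemma stieltjes_equation_pastur:
  "stieltjes_equation K z \<nu> \<longleftrightarrow> (\<forall>\<eta>. Im \<eta> > 0 \<longrightarrow>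
     stieltjes \<nu> \<eta> = (\<integral>g. pastur_kernel (\<eta> + stieltjes \<nu> \<eta>) (cmod (g - z)) \<partial>gaussian_law K))"
  by (simp add: stieltjes_equation_def pastur_kernel_def add.commute)

text \<open>The transform of the generator, its centred version and the expectation \<open>s\<close>
  agree in the limit, and the integrated kernel is Lipschitz above height \<open>Im \<eta>\<close>.
  So the approximate equation passes from \<open>s\<close> to the random transform, at all rational
  points outside one null set.\<close>

theorem singular_law_converges:
  "AE \<omega> in P. \<exists>\<nu>. generator_limit K z \<nu> \<and> converges_weakly (\<lambda>n. singular_law (shifted z n \<omega>)) \<nu>"
proof -
  interpret G: prob_space "gaussian_law K" by (rule gaussian_law_properties)
  note r = gaussian_law_properties(2)[of z]
  define \<Phi> where "\<Phi> w = (\<integral>g. pastur_kernel w (cmod (g - z)) \<partial>gaussian_law K)" for w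
  have "AE \<omega> in P. \<forall>\<eta>\<in>rational_upper.
      (\<lambda>n. markov_model.S n z \<eta> (entries n \<omega>) - markov_model.s (entry n) n z \<eta>) \<longlonglongrightarrow> 0"
    unfolding AE_ball_countable[OF countable_rational_upper]
    by (intro ballI transform_concentration) (simp add: rational_upper_def)
  then show ?thesis
  proof eventually_elim
    case (elim \<omega>)
    have conv: "(\<lambda>n. transform z n \<eta> \<omega> - \<Phi> (\<eta> + transform z n \<eta> \<omega>)) \<longlonglongrightarrow> 0" if e: "\<eta> \<in> rational_upper" for \<eta>
    proof -
      have \<eta>: "Im \<eta> > 0" using e by (simp add: rational_upper_def)
      define S where "S n = markov_model.S n z \<eta> (entries n \<omega>)" for n
      define s where "s n = markov_model.s (entry n) n z \<eta>" for n
      define T where "T n = transform z n \<eta> \<omega>" for n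
      have "(\<lambda>n. 1 / Im \<eta> * (1 / real n)) \<longlonglongrightarrow> 0" by (intro tendsto_mult_right_zero lim_1_over_n)
      then have "(\<lambda>n. T n - S n) \<longlonglongrightarrow> 0"
      proof (rule Lim_null_comparison[rotated])
        show "\<forall>\<^sub>F n in sequentially. cmod (T n - S n) \<le> 1 / Im \<eta> * (1 / real n)"
          using eventually_ge_at_top[of 1] unfolding T_def S_def by eventually_elim (rule transform_diff[OF _ \<eta>])
      qed
      moreover have "(\<lambda>n. S n - s n) \<longlonglongrightarrow> 0" using elim e unfolding S_def s_def by blast
      ultimately have "(\<lambda>n. (T n - S n) + (S n - s n)) \<longlonglongrightarrow> 0 + 0" by (rule tendsto_add)
      then have Ts: "(\<lambda>n. T n - s n) \<longlonglongrightarrow> 0" by simp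
      have "(\<lambda>n. cmod (T n - s n) / (Im \<eta>)\<^sup>2) \<longlonglongrightarrow> 0"
        using tendsto_divide_zero[OF tendsto_norm_zero[OF Ts]] .
      then have "(\<lambda>n. \<Phi> (\<eta> + s n) - \<Phi> (\<eta> + T n)) \<longlonglongrightarrow> 0"
      proof (rule Lim_null_comparison[rotated])
        show "\<forall>\<^sub>F n in sequentially. cmod (\<Phi> (\<eta> + s n) - \<Phi> (\<eta> + T n)) \<le> cmod (T n - s n) / (Im \<eta>)\<^sup>2"
          using eventually_ge_at_top[of 1]
        proof eventually_elim
          case (elim n)
          interpret M: markov_model "entry n" n z \<eta> by (rule markov_model_entry[OF elim \<eta>])
          have "Im (s n) \<ge> 0" "Im (T n) \<ge> 0"
            using M.s_bounds(2) Im_transform_nonneg[OF elim \<eta>] by (simp_all add: s_def T_def)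
          then have "cmod (\<Phi> (\<eta> + s n) - \<Phi> (\<eta> + T n)) \<le> cmod ((\<eta> + s n) - (\<eta> + T n)) / (Im \<eta>)\<^sup>2"
            unfolding \<Phi>_def by (intro G.pastur_lipschitz[OF r]) (use \<eta> in auto)
          then show ?case by (simp add: norm_minus_commute)
        qed
      qed
      moreover have "(\<lambda>n. s n - \<Phi> (\<eta> + s n)) \<longlonglongrightarrow> 0"
        unfolding \<Phi>_def s_def by (rule expected_limit[OF \<eta>])
      ultimately have "(\<lambda>n. (T n - s n) + (s n - \<Phi> (\<eta> + s n)) + (\<Phi> (\<eta> + s n) - \<Phi> (\<eta> + T n))) \<longlonglongrightarrow> 0 + 0 + 0"
        using Ts by (intro tendsto_add)
      then show ?thesis by (simp add: T_def)
    qed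
    have "\<exists>\<nu>. borel_prob \<nu> \<and> emeasure \<nu> {..<0} = 0 \<and> converges_weakly (\<lambda>n. singular_law (shifted z n \<omega>)) \<nu> \<and>
      symmetric_prob (symmetrization \<nu>) \<and>
      (\<forall>\<eta>. Im \<eta> > 0 \<longrightarrow> stieltjes (symmetrization \<nu>) \<eta> =
        (\<integral>g. pastur_kernel (\<eta> + stieltjes (symmetrization \<nu>) \<eta>) (cmod (g - z)) \<partial>gaussian_law K))"
      by (rule G.singular_law_limit[OF r shifted_carrier, where S = "\<lambda>n \<eta>. transform z n \<eta> \<omega>"])
         (use conv in \<open>simp_all add: \<Phi>_def transform_def\<close>)
    then show ?case unfolding generator_limit_def stieltjes_equation_pastur by blast
  qed
qed

text \<open>Transforms of probability laws have nonnegative imaginary part, so uniqueness of fixed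
  points determines the transform at each \<open>\<eta>\<close>, and the transform determines the
  law.\<close>

lemma stieltjes_equation_unique:
  assumes "symmetric_prob \<mu>" "stieltjes_equation K z \<mu>" "symmetric_prob \<mu>'" "stieltjes_equation K z \<mu>'"
  shows "\<mu> = \<mu>'"
proof (rule stieltjes_unique)
  interpret G: prob_space "gaussian_law K" by (rule gaussian_law_properties)
  show \<mu>: "real_distribution \<mu>" "real_distribution \<mu>'"
    using assms by (simp_all add: symmetric_prob_def borel_prob_real_distribution)
  fix \<eta> assume \<eta>: "Im \<eta> > 0"
  note eq = assms(2,4)[unfolded stieltjes_equation_pastur, rule_format, OF \<eta>]
  show "stieltjes \<mu> \<eta> = stieltjes \<mu>' \<eta>"
    by (rule G.pastur_fixed_point_unique[OF gaussian_law_properties(2)[of z] \<eta>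
          real_distribution.Im_stieltjes_nonneg[OF \<mu>(1) \<eta>] eq(1)
          real_distribution.Im_stieltjes_nonneg[OF \<mu>(2) \<eta>] eq(2)])
qed

lemma generator_limit_unique:
  assumes "generator_limit K z \<nu>" "generator_limit K z \<nu>'"
  shows "\<nu> = \<nu>'"
  by (rule symmetrization_inject)
     (use assms stieltjes_equation_unique[of "symmetrization \<nu>" z "symmetrization \<nu>'"] in \<open>auto simp: generator_limit_def\<close>)

end

theorem theorem1p1:
  shows "\<exists>\<nu> :: real^2^2 \<Rightarrow> complex \<Rightarrow> real measure.
    \<forall>(P :: 'a measure) L X K. random_generator P L X K \<longrightarrow>
      (\<forall>z.
         borel_prob (\<nu> K z) \<and> emeasure (\<nu> K z) {..<0} = 0 \<and>
         (AE \<omega> in P. converges_weakly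
            (\<lambda>n. singular_law
                   (normalized_generator (L n) n (\<lambda>i j. X n i j \<omega>) - z \<cdot>\<^sub>m 1\<^sub>m n))
            (\<nu> K z)) \<and>
         symmetric_prob (symmetrization (\<nu> K z)) \<and>
         stieltjes_equation K z (symmetrization (\<nu> K z)) \<and>
         (\<forall>\<mu>. symmetric_prob \<mu> \<and> stieltjes_equation K z \<mu> \<longrightarrow> \<mu> = symmetrization (\<nu> K z)))"
proof (intro exI[of _ "\<lambda>K z. SOME \<nu>. generator_limit K z \<nu>"] allI impI)
  fix P :: "'a measure" and L X K z
  assume "random_generator P L X K"
  then interpret random_generator P L X K .
  let ?\<nu> = "SOME \<nu>. generator_limit K z \<nu>"
  note conv = singular_law_converges[of z]
  \<comment> \<open>Existence of the deterministic law is read off one good realization: a property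
    that holds almost surely on a probability space holds somewhere.\<close>
  have "\<exists>\<nu>. generator_limit K z \<nu>"
  proof (rule ccontr)
    assume "\<nexists>\<nu>. generator_limit K z \<nu>"
    with conv have "AE \<omega> in P. False" by (auto elim: eventually_mono)
    then show False by simp
  qed
  then have lim: "generator_limit K z ?\<nu>" by (rule someI_ex)
  have "AE \<omega> in P. converges_weakly (\<lambda>n. singular_law (shifted z n \<omega>)) ?\<nu>"
    using conv
  proof eventually_elim
    case (elim \<omega>)
    then obtain \<nu> where \<nu>: "generator_limit K z \<nu>" "converges_weakly (\<lambda>n. singular_law (shifted z n \<omega>)) \<nu>" by blast
    \<comment> \<open>A priori the law found for a realization depends on it; uniqueness identifies
      it with the chosen one.\<close>
    from generator_limit_unique[OF \<nu>(1) lim] \<nu>(2) show ?case by simp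
  qed
  then have ae: "AE \<omega> in P. converges_weakly
      (\<lambda>n. singular_law (normalized_generator (L n) n (\<lambda>i j. X n i j \<omega>) - z \<cdot>\<^sub>m 1\<^sub>m n)) ?\<nu>"
    unfolding shifted_def .
  have uniq: "\<mu> = symmetrization ?\<nu>" if "symmetric_prob \<mu>" "stieltjes_equation K z \<mu>" for \<mu>
    using stieltjes_equation_unique[OF that] lim generator_limit_def[of K z ?\<nu>] by metis
  show "borel_prob ?\<nu> \<and> emeasure ?\<nu> {..<0} = 0 \<and>
         (AE \<omega> in P. converges_weakly
            (\<lambda>n. singular_law
                   (normalized_generator (L n) n (\<lambda>i j. X n i j \<omega>) - z \<cdot>\<^sub>m 1\<^sub>m n))
            ?\<nu>) \<and>
         symmetric_prob (symmetrization ?\<nu>) \<and>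
         stieltjes_equation K z (symmetrization ?\<nu>) \<and>
         (\<forall>\<mu>. symmetric_prob \<mu> \<and> stieltjes_equation K z \<mu> \<longrightarrow> \<mu> = symmetrization ?\<nu>)"
  proof (intro conjI allI impI)
    show "borel_prob ?\<nu>" "emeasure ?\<nu> {..<0} = 0" "symmetric_prob (symmetrization ?\<nu>)"
      "stieltjes_equation K z (symmetrization ?\<nu>)"
      using lim generator_limit_def[of K z ?\<nu>] by simp_all
  qed (rule ae, elim conjE, rule uniq)
qed

end
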